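(* Let $1<p<\infty$ and let $X$ be one of the following glued metric measure spaces: (a) for an integer $n\ge2$, $X=[0,1]^n\cup[-1,0]^n\subset\mathbb{R}^n$ with the Euclidean metric and the $n$-dimensional Lebesgue measure, for which $d_{\mathrm f}:=n$ and $d_{\mathrm w,p}:=p$; (b) $X=K^+\cup K^-\subset\mathbb{R}^2$, the union of two copies of the planar Sierpiński carpet glued at the vertex $o=(0,0)$, with the Euclidean metric and the $d_{\mathrm f}$-dimensional Hausdorff measure, where $d_{\mathrm f}:=\log 8/\log3$ and $d_{\mathrm w,p}:=\log(8\rho_p)/\log3$ is the $p$-walk dimension of the carpet. Then $$\theta_p(X)=\frac1p\max\{d_{\mathrm f},d_{\mathrm w,p}\}\qquad\text{and}\qquad\theta_p^*(X)=\frac{d_{\mathrm w,p}}{p}.$$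
   Context: For a metric measure space $(X,d,\mu)$, $B(x,r)=\{y\in X:d(x,y)<r\}$, and for $\theta>0$, $B^\theta_{p,p}(X)$ is the vector space of $u\in L^p(X)$ (functions identified $\mu$-a.e.) with $$\|u\|_{B^\theta_{p,p}(X)}^p:=\int_X\int_X\frac{|u(y)-u(x)|^p}{d(x,y)^{\theta p}\,\mu(B(x,d(x,y)))}\,d\mu(y)\,d\mu(x)<\infty$$ (the integrand is taken to be $0$ when $x=y$). The critical exponents are $$\theta_p(X):=\sup\{\theta>0: B^\theta_{p,p}(X)\text{ contains non-constant functions}\},$$ $$\theta_p^*(X):=\sup\{\theta>0: B^\theta_{p,p}(X)\text{ is dense in }L^p(X)\}.$$ Sierpiński carpet: let $S=\{0,1,2\}^2\setminus\{(1,1)\}$ and $F_i(x)=(x+i)/3$ for $i\in S$, $x\in\mathbb{R}^2$. The standard Sierpiński carpet $K_0$ is the unique non-empty compact set with $K_0=\bigcup_{i\in S}F_i(K_0)$; it lies in $[0,1]^2$. The set $K^+$ is the copy of the carpet in the quadrant $\{x\le0,y\le0\}$ with a vertex at $o$, i.e. $K^+=K_0-(1,1)\subset[-1,0]^2$, and $K^-$ is the reflection of $K^+$ in the line $\{y=-x\}$, i.e. $K^-=K_0$. The $p$-scaling factor $\rho_p$ of the carpet: for $m\ge1$ and $w=w_1\cdots w_m\in S^m$ let $K_w=F_{w_1}\circ\cdots\circ F_{w_m}(K_0)$, and let $G_m$ be the graph with vertex set $S^m$ in which $v\ne w$ are joined by an edge iff $K_v\cap K_w\ne\emptyset$. Let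 $\mathcal{C}_p^{(m)}$ be the minimum of $\sum_{\{v,w\}}|f(v)-f(w)|^p$ (sum over edges of $G_m$) over all $f:S^m\to\mathbb{R}$ with $f(w)=0$ whenever $K_w$ meets $\{0\}\times[0,1]$ and $f(w)=1$ whenever $K_w$ meets $\{1\}\times[0,1]$. Then $\rho_p:=\lim_{m\to\infty}\left(\mathcal{C}_p^{(m)}\right)^{-1/m}\in(0,\infty)$. *)

theory Defs
  imports "HOL-Analysis.Analysis"
begin

section \<open>Besov spaces and critical exponents of a metric measure space\<close>

text \<open>
  A metric measure space is a measure \<open>M\<close> over a metric space type: the space \<open>X\<close> is
  \<^term>\<open>space M\<close>, its metric is the restriction of \<^const>\<open>dist\<close>.  Elements of \<open>L\<^sup>p(X)\<close> are
  represented by measurable functions, with equality read almost everywhere.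
\<close>

definition Lp_space :: "real \<Rightarrow> 'a measure \<Rightarrow> ('a \<Rightarrow> real) set" where
  "Lp_space p M = {u \<in> borel_measurable M. integrable M (\<lambda>x. \<bar>u x\<bar> powr p)}"

definition Lp_norm :: "real \<Rightarrow> 'a measure \<Rightarrow> ('a \<Rightarrow> real) \<Rightarrow> real" where
  "Lp_norm p M u = (\<integral>x. \<bar>u x\<bar> powr p \<partial>M) powr (1 / p)"

definition mball_of :: "'a::metric_space measure \<Rightarrow> 'a \<Rightarrow> real \<Rightarrow> 'a set" where
  "mball_of M x r = {y \<in> space M. dist x y < r}"

text \<open>The \<open>p\<close>-th power of the seminorm, with values in \<open>[0, \<infinity>]\<close>.\<close>

definition besov_energy ::
  "real \<Rightarrow> real \<Rightarrow> 'a::metric_space measure \<Rightarrow> ('a \<Rightarrow> real) \<Rightarrow> ennreal" where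
  "besov_energy p \<theta> M u =
     (\<integral>\<^sup>+x. (\<integral>\<^sup>+y. (if x = y then 0
        else ennreal (\<bar>u y - u x\<bar> powr p)
               / (ennreal (dist x y powr (\<theta> * p)) * emeasure M (mball_of M x (dist x y)))) \<partial>M) \<partial>M)"

definition besov_space ::
  "real \<Rightarrow> real \<Rightarrow> 'a::metric_space measure \<Rightarrow> ('a \<Rightarrow> real) set" where
  "besov_space p \<theta> M = {u \<in> Lp_space p M. besov_energy p \<theta> M u < \<infinity>}"

definition contains_nonconstant :: "'a measure \<Rightarrow> ('a \<Rightarrow> real) set \<Rightarrow> bool" where
  "contains_nonconstant M B \<longleftrightarrow> (\<exists>u\<in>B. \<not> (\<exists>c. AE x in M. u x = c))"

definition dense_in_Lp :: "real \<Rightarrow> 'a measure \<Rightarrow> ('a \<Rightarrow> real) set \<Rightarrow> bool" where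
  "dense_in_Lp p M B \<longleftrightarrow>
     (\<forall>f\<in>Lp_space p M. \<forall>\<epsilon>>0. \<exists>u\<in>B. Lp_norm p M (\<lambda>x. f x - u x) < \<epsilon>)"

text \<open>Suprema are taken in the extended reals, so that nothing is presupposed about
  boundedness or non-emptiness.\<close>

definition critical_exponent :: "real \<Rightarrow> 'a::metric_space measure \<Rightarrow> ereal" where
  "critical_exponent p M =
     Sup (ereal ` {\<theta>. \<theta> > 0 \<and> contains_nonconstant M (besov_space p \<theta> M)})"

definition dense_critical_exponent :: "real \<Rightarrow> 'a::metric_space measure \<Rightarrow> ereal" where
  "dense_critical_exponent p M =
     Sup (ereal ` {\<theta>. \<theta> > 0 \<and> dense_in_Lp p M (besov_space p \<theta> M)})"


section \<open>Hausdorff measure\<close>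

text \<open>No normalising constant is used; a constant factor in the measure cancels in
  \<^const>\<open>besov_energy\<close> up to a constant factor and so affects neither exponent.  Covering
  sets must be bounded because \<^const>\<open>diameter\<close> is unspecified on unbounded sets.\<close>

definition hausdorff_content :: "real \<Rightarrow> real \<Rightarrow> 'a::metric_space set \<Rightarrow> ennreal" where
  "hausdorff_content s \<delta> A =
     Inf {(\<Sum>i. ennreal (diameter (E i) powr s)) | E :: nat \<Rightarrow> 'a set.
            A \<subseteq> (\<Union>i. E i) \<and> (\<forall>i. bounded (E i) \<and> diameter (E i) \<le> \<delta>)}"

definition hausdorff_outer :: "real \<Rightarrow> 'a::metric_space set \<Rightarrow> ennreal" where
  "hausdorff_outer s A = (SUP \<delta>\<in>{0<..}. hausdorff_content s \<delta> A)"

definition hausdorff_measure :: "real \<Rightarrow> 'a::metric_space measure" where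
  "hausdorff_measure s = measure_of UNIV (sets borel) (hausdorff_outer s)"

text \<open>The outer measure is a metric outer measure, so \<^const>\<open>hausdorff_measure\<close> really is its
  restriction to the Borel sets (and not the null measure that \<^const>\<open>measure_of\<close> returns on
  set functions that are not measures).\<close>

lemma hausdorff_content_le:
  assumes "A \<subseteq> (\<Union>i. E i)" "\<And>i. bounded (E i)" "\<And>i. diameter (E i) \<le> \<delta>"
  shows "hausdorff_content s \<delta> A \<le> (\<Sum>i. ennreal (diameter (E i) powr s))"
  unfolding hausdorff_content_def by (rule Inf_lower) (use assms in blast)

lemma hausdorff_content_less:
  fixes A :: "'a::metric_space set"
  assumes "hausdorff_content s \<delta> A < c"
  obtains E :: "nat \<Rightarrow> 'a set" where "A \<subseteq> (\<Union>i. E i)" "\<And>i. bounded (E i)"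
    "\<And>i. diameter (E i) \<le> \<delta>" "(\<Sum>i. ennreal (diameter (E i) powr s)) < c"
  using assms unfolding hausdorff_content_def Inf_less_iff by blast

lemma hausdorff_content_mono: "A \<subseteq> B \<Longrightarrow> hausdorff_content s \<delta> A \<le> hausdorff_content s \<delta> B"
  unfolding hausdorff_content_def by (rule Inf_superset_mono) blast

lemma hausdorff_content_antimono:
  fixes A :: "'a::metric_space set"
  assumes "\<delta> \<le> \<delta>'"
  shows "hausdorff_content s \<delta>' A \<le> hausdorff_content s \<delta> A"
proof -
  have "diameter E \<le> \<delta> \<Longrightarrow> diameter E \<le> \<delta>'" for E :: "'a set"
    using assms by simp
  then show ?thesis
    unfolding hausdorff_content_def by (intro Inf_superset_mono) blast
qed

lemma hausdorff_content_countable: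
  fixes A :: "nat \<Rightarrow> 'a::metric_space set"
  shows "hausdorff_content s \<delta> (\<Union>n. A n) \<le> (\<Sum>n. hausdorff_content s \<delta> (A n))"
proof (cases "\<exists>n. hausdorff_content s \<delta> (A n) = \<infinity>")
  case True
  then obtain n where n: "hausdorff_content s \<delta> (A n) = top" by auto
  have "hausdorff_content s \<delta> (A n) \<le> (\<Sum>n. hausdorff_content s \<delta> (A n))"
    using sum_le_suminf[of "\<lambda>n. hausdorff_content s \<delta> (A n)" "{n}"] by simp
  then show ?thesis using n by (simp add: top_unique)
next
  case False
  let ?h = "\<lambda>n. hausdorff_content s \<delta> (A n)"
  show ?thesis
  proof (rule ennreal_le_epsilon)
    fix e :: real assume e: "0 < e"
    let ?e = "\<lambda>n. ennreal (e * (1/2)^Suc n)"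
    have "\<exists>E. A n \<subseteq> (\<Union>i. E i) \<and> (\<forall>i. bounded (E i)) \<and> (\<forall>i. diameter (E i) \<le> \<delta>) \<and>
       (\<Sum>i. ennreal (diameter (E i) powr s)) < ?h n + ?e n" for n
    proof -
      have "?h n < ?h n + ?e n" using False e
        by (metis ennreal_add_left_cancel_less ennreal_less_zero_iff add.right_neutral
            half_gt_zero_iff infinity_ennreal_def mult_pos_pos zero_less_power zero_less_one)
      then show ?thesis by (rule hausdorff_content_less) blast
    qed
    then obtain E where E: "\<And>n. A n \<subseteq> (\<Union>i. E n i)" "\<And>n i. bounded (E n i)"
       "\<And>n i. diameter (E n i) \<le> \<delta>"
       "\<And>n. (\<Sum>i. ennreal (diameter (E n i) powr s)) < ?h n + ?e n" by metis
    define G where "G k = (case prod_decode k of (n, i) \<Rightarrow> E n i)" for k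
    have G: "G (prod_encode (n, i)) = E n i" for n i by (simp add: G_def)
    have cov: "(\<Union>n. A n) \<subseteq> (\<Union>k. G k)"
    proof
      fix x assume "x \<in> (\<Union>n. A n)"
      then obtain n i where "x \<in> E n i" using E(1) by blast
      then show "x \<in> (\<Union>k. G k)" using G by blast
    qed
    have "hausdorff_content s \<delta> (\<Union>n. A n) \<le> (\<Sum>k. ennreal (diameter (G k) powr s))"
      by (rule hausdorff_content_le[OF cov]) (auto simp: G_def E split: prod.split)
    also have "\<dots> = (\<Sum>n. \<Sum>i. ennreal (diameter (E n i) powr s))"
    proof -
      let ?f = "\<lambda>z. ennreal (diameter (E (fst z) (snd z)) powr s)"
      have "ennreal (diameter (G k) powr s) = ?f (prod_decode k)" for k
        by (simp add: G_def split_beta)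
      moreover have "(\<Sum>k. ?f (prod_decode k)) = (\<Sum>n. \<Sum>i. ennreal (diameter (E n i) powr s))"
        by (rule suminf_ennreal_2dimen) simp
      ultimately show ?thesis by simp
    qed
    also have "\<dots> \<le> (\<Sum>n. ?h n + ?e n)"
      by (intro suminf_le) (use E(4) less_imp_le in auto)
    also have "\<dots> = (\<Sum>n. ?h n) + (\<Sum>n. ?e n)"
      by (rule suminf_add[symmetric]) auto
    also have "(\<Sum>n. ?e n) = ennreal e"
    proof -
      have "(\<lambda>n. e * (1/2)^Suc n) sums (e * 1)"
        by (intro sums_mult power_half_series)
      then show ?thesis using e by (intro suminf_ennreal_eq) auto
    qed
    finally show "hausdorff_content s \<delta> (\<Union>n. A n) \<le> (\<Sum>n. ?h n) + ennreal e" .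
  qed
qed

lemma hausdorff_outer_mono: "A \<subseteq> B \<Longrightarrow> hausdorff_outer s A \<le> hausdorff_outer s B"
  unfolding hausdorff_outer_def by (intro SUP_mono') (rule hausdorff_content_mono)

lemma hausdorff_outer_upper: "0 < \<delta> \<Longrightarrow> hausdorff_content s \<delta> A \<le> hausdorff_outer s A"
  unfolding hausdorff_outer_def by (rule SUP_upper) simp

lemma hausdorff_outer_empty: "hausdorff_outer s {} = 0"
proof -
  have "hausdorff_content s \<delta> {} \<le> 0" if "\<delta> > 0" for \<delta>
    using hausdorff_content_le[of "{}" "\<lambda>_. {}" \<delta> s] that by simp
  then have "hausdorff_outer s {} \<le> 0"
    unfolding hausdorff_outer_def by (intro SUP_least) auto
  then show ?thesis by simp
qed

lemma hausdorff_outer_countable: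
  "hausdorff_outer s (\<Union>n. A n) \<le> (\<Sum>n. hausdorff_outer s (A n))"
  unfolding hausdorff_outer_def[of s "\<Union>n. A n"]
proof (rule SUP_least)
  fix \<delta> :: real assume "\<delta> \<in> {0<..}"
  then show "hausdorff_content s \<delta> (\<Union>n. A n) \<le> (\<Sum>n. hausdorff_outer s (A n))"
    by (intro order_trans[OF hausdorff_content_countable] suminf_le hausdorff_outer_upper) auto
qed

lemma outer_measure_space_hausdorff: "outer_measure_space UNIV (hausdorff_outer s)"
  unfolding outer_measure_space_def positive_def increasing_def countably_subadditive_def
  by (simp add: hausdorff_outer_empty hausdorff_outer_mono hausdorff_outer_countable)

lemma hausdorff_outer_Un:
  fixes A B :: "'a::metric_space set"
  shows "hausdorff_outer s (A \<union> B) \<le> hausdorff_outer s A + hausdorff_outer s B"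
proof -
  have "subadditive UNIV (hausdorff_outer s :: 'a set \<Rightarrow> ennreal)"
    using ring_of_sets.countably_subadditive_subadditive[OF ring_of_sets_Pow[of UNIV], where f = "hausdorff_outer s :: 'a set \<Rightarrow> ennreal"]
      outer_measure_space_hausdorff[of s, where 'a='a] by (simp add: outer_measure_space_def)
  then have *: "A \<inter> (B - A) = {} \<Longrightarrow> hausdorff_outer s (A \<union> (B - A)) \<le> hausdorff_outer s A + hausdorff_outer s (B - A)"
    by (rule subadditiveD) auto
  have "hausdorff_outer s (B - A) \<le> hausdorff_outer s B" by (intro hausdorff_outer_mono) auto
  then have "hausdorff_outer s A + hausdorff_outer s (B - A) \<le> hausdorff_outer s A + hausdorff_outer s B"
    by (rule add_left_mono)
  with * show ?thesis by (metis Diff_disjoint Un_Diff_cancel order_trans)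
qed

text \<open>The outer measure is additive on positively separated sets.\<close>

lemma hausdorff_outer_separated:
  fixes A B :: "'a::metric_space set"
  assumes e: "0 < e" and sep: "\<And>x y. x \<in> A \<Longrightarrow> y \<in> B \<Longrightarrow> e \<le> dist x y"
  shows "hausdorff_outer s A + hausdorff_outer s B \<le> hausdorff_outer s (A \<union> B)"
proof -
  have *: "hausdorff_content s \<delta> A + hausdorff_content s \<delta> B \<le> hausdorff_content s \<delta> (A \<union> B)"
    if d: "0 < \<delta>" "\<delta> < e" for \<delta>
    unfolding hausdorff_content_def[of s \<delta> "A \<union> B"]
  proof (rule Inf_greatest, clarify)
    fix E :: "nat \<Rightarrow> 'a set"
    assume cov: "A \<union> B \<subseteq> (\<Union>i. E i)" and E: "\<forall>i. bounded (E i) \<and> diameter (E i) \<le> \<delta>"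
    define P where "P i \<longleftrightarrow> E i \<inter> A \<noteq> {}" for i
    have disj: "E i \<inter> B = {}" if Pi: "P i" for i
    proof (rule ccontr)
      assume "E i \<inter> B \<noteq> {}"
      then obtain x y where "x \<in> E i" "x \<in> A" "y \<in> E i" "y \<in> B"
        using Pi unfolding P_def by blast
      then show False
        using sep[of x y] diameter_bounded_bound[of "E i" x y] E d by (meson le_less_trans less_le_not_le order_trans)
    qed
    define F where "F i = (if P i then E i else {})" for i
    define G where "G i = (if P i then {} else E i)" for i
    have 1: "hausdorff_content s \<delta> A \<le> (\<Sum>i. ennreal (diameter (F i) powr s))"
      by (rule hausdorff_content_le) (use cov E d in \<open>auto simp: F_def P_def, blast\<close>)
    have 2: "hausdorff_content s \<delta> B \<le> (\<Sum>i. ennreal (diameter (G i) powr s))"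
      by (rule hausdorff_content_le) (use cov E d disj in \<open>auto simp: G_def, blast\<close>)
    have "hausdorff_content s \<delta> A + hausdorff_content s \<delta> B \<le>
        (\<Sum>i. ennreal (diameter (F i) powr s) + ennreal (diameter (G i) powr s))"
      using 1 2 by (subst suminf_add[symmetric]) (auto intro: add_mono)
    also have "\<dots> = (\<Sum>i. ennreal (diameter (E i) powr s))"
      by (intro suminf_cong) (auto simp: F_def G_def)
    finally show "hausdorff_content s \<delta> A + hausdorff_content s \<delta> B \<le> (\<Sum>i. ennreal (diameter (E i) powr s))" .
  qed
  have "hausdorff_outer s A + hausdorff_outer s B
      = (SUP \<delta>\<in>{0<..}. hausdorff_content s \<delta> A + hausdorff_content s \<delta> B)"
    unfolding hausdorff_outer_def
  proof (rule SUP_add_directed_ennreal[symmetric])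
    fix i j :: real assume "i \<in> {0<..}" "j \<in> {0<..}"
    then show "\<exists>k\<in>{0<..}. hausdorff_content s i A + hausdorff_content s j B \<le> hausdorff_content s k A + hausdorff_content s k B"
      by (intro bexI[of _ "min i j"]) (auto intro!: add_mono hausdorff_content_antimono)
  qed
  also have "\<dots> \<le> hausdorff_outer s (A \<union> B)"
  proof (rule SUP_least)
    fix \<delta> :: real assume d: "\<delta> \<in> {0<..}"
    have "hausdorff_content s \<delta> A + hausdorff_content s \<delta> B
       \<le> hausdorff_content s (min \<delta> (e/2)) A + hausdorff_content s (min \<delta> (e/2)) B"
      by (intro add_mono hausdorff_content_antimono) auto
    also have "\<dots> \<le> hausdorff_content s (min \<delta> (e/2)) (A \<union> B)" using e d by (intro *) auto
    also have "\<dots> \<le> hausdorff_outer s (A \<union> B)" using e d by (intro hausdorff_outer_upper) auto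
    finally show "hausdorff_content s \<delta> A + hausdorff_content s \<delta> B \<le> hausdorff_outer s (A \<union> B)" .
  qed
  finally show ?thesis .
qed

lemma hausdorff_outer_separated_sum:
  fixes R :: "nat \<Rightarrow> 'a::metric_space set"
  assumes "\<And>i j x y. i < j \<Longrightarrow> x \<in> R i \<Longrightarrow> y \<in> R j \<Longrightarrow> e j \<le> dist x y" "\<And>j. 0 < e j"
  shows "(\<Sum>i<n. hausdorff_outer s (R i)) \<le> hausdorff_outer s (\<Union>i<n. R i)"
proof (induction n)
  case (Suc n)
  have "(\<Sum>i<Suc n. hausdorff_outer s (R i)) \<le> hausdorff_outer s (\<Union>i<n. R i) + hausdorff_outer s (R n)"
    using Suc by (simp add: add_mono)
  also have "\<dots> \<le> hausdorff_outer s ((\<Union>i<n. R i) \<union> R n)"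
    by (rule hausdorff_outer_separated[of "e n"]) (use assms in auto)
  also have "(\<Union>i<n. R i) \<union> R n = (\<Union>i<Suc n. R i)" by (auto simp: less_Suc_eq)
  finally show ?case .
qed simp

lemma hausdorff_outer_closed:
  fixes F T :: "'a::metric_space set"
  assumes F: "closed F"
  shows "hausdorff_outer s (T \<inter> F) + hausdorff_outer s (T - F) \<le> hausdorff_outer s T"
proof (cases "F = {} \<or> hausdorff_outer s T = top")
  case True
  then show ?thesis by (auto simp: hausdorff_outer_empty)
next
  case False
  let ?H = "hausdorff_outer s"
  let ?d = "\<lambda>x. infdist x F"
  have ne: "F \<noteq> {}" and fin: "?H T < top" using False by (auto simp: top.not_eq_extremum)
  define b :: "nat \<Rightarrow> real" where "b k = 1 / (real k + 1)" for k
  have bpos: "0 < b k" for k by (simp add: b_def)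
  have bdec: "b (Suc k) < b k" for k by (simp add: b_def field_simps)
  have banti: "i \<le> j \<Longrightarrow> b j \<le> b i" for i j by (simp add: b_def frac_le)
  define U where "U k = {x \<in> T. b k \<le> ?d x}" for k
  define R where "R k = {x \<in> T. b (Suc k) \<le> ?d x \<and> ?d x < b k}" for k
  have lip: "?d x \<le> ?d y + dist x y" for x y by (rule infdist_triangle)
  have main: "?H (T \<inter> F) + ?H (U k) \<le> ?H T" for k
  proof -
    have "?H (T \<inter> F) + ?H (U k) \<le> ?H (T \<inter> F \<union> U k)"
    proof (rule hausdorff_outer_separated[OF bpos[of k]])
      fix x y assume x: "x \<in> T \<inter> F" and y: "y \<in> U k"
      have "?d y \<le> dist y x" by (rule infdist_le) (use x in auto)
      with y show "b k \<le> dist x y" by (simp add: U_def dist_commute)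
    qed
    also have "\<dots> \<le> ?H T" by (rule hausdorff_outer_mono) (auto simp: U_def)
    finally show ?thesis .
  qed
  have sep: "b (Suc i) - b j \<le> dist x y" if "x \<in> R i" "y \<in> R j" for i j x y
    using that lip[of x y] by (auto simp: R_def)
  have bnd: "(\<Sum>i<n. ?H (R (2 * i + c))) \<le> ?H T" for n c
  proof -
    have "(\<Sum>i<n. ?H (R (2 * i + c))) \<le> ?H (\<Union>i<n. R (2 * i + c))"
    proof (rule hausdorff_outer_separated_sum[where e = "\<lambda>j. b (2*j + c - 1) - b (2*j + c) + (if 2*j+c = 0 then 1 else 0)"])
      fix j
      show "0 < b (2*j + c - 1) - b (2*j + c) + (if 2*j+c = 0 then 1 else 0)"
        by (cases "2*j+c") (use bdec in auto)
      fix i x y assume ij: "i < j" "x \<in> R (2*i+c)" "y \<in> R (2*j+c)"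
      have "b (2*j+c-1) \<le> b (Suc (2*i+c))" by (rule banti) (use ij in auto)
      then show "b (2*j + c - 1) - b (2*j + c) + (if 2*j+c = 0 then 1 else 0) \<le> dist x y"
        using sep[OF ij(2,3)] ij by auto
    qed
    also have "\<dots> \<le> ?H T" by (rule hausdorff_outer_mono) (auto simp: R_def)
    finally show ?thesis .
  qed
  have sumR: "(\<Sum>i<n. ?H (R i)) \<le> ?H T + ?H T" for n
  proof -
    have "(\<Sum>i<n. ?H (R i)) \<le> (\<Sum>i<2*n. ?H (R i))" by (rule sum_mono2) auto
    also have "\<dots> = (\<Sum>i<n. ?H (R (2*i+0))) + (\<Sum>i<n. ?H (R (2*i+1)))"
      by (induction n) (auto simp: algebra_simps)
    also have "\<dots> \<le> ?H T + ?H T" by (intro add_mono bnd)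
    finally show ?thesis .
  qed
  have sumR_fin: "(\<Sum>i. ?H (R i)) \<noteq> top"
  proof -
    have "(\<Sum>i. ?H (R i)) \<le> ?H T + ?H T" by (intro suminf_le_const sumR) simp
    then show ?thesis using fin by (auto simp: top_unique)
  qed
  have tail: "(\<lambda>k. \<Sum>i. ?H (R (i + k))) \<longlonglongrightarrow> 0"
  proof -
    define r where "r i = enn2real (?H (R i))" for i
    have Rr: "?H (R i) = ennreal (r i)" for i
    proof -
      have "?H (R i) \<le> ?H T" by (rule hausdorff_outer_mono) (auto simp: R_def)
      then show ?thesis using fin by (auto simp: r_def ennreal_enn2real_if top_unique)
    qed
    have rpos: "0 \<le> r i" for i by (simp add: r_def)
    have "summable r" using sumR_fin rpos unfolding Rr
      by (metis summable_suminf_not_top)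
    then have sk: "summable (\<lambda>i. r (i + k))" for k by (simp add: summable_iff_shift)
    have "(\<lambda>k. \<Sum>i. r (i + k)) \<longlonglongrightarrow> 0" by (rule suminf_exist_split2[OF \<open>summable r\<close>])
    then have "(\<lambda>k. ennreal (\<Sum>i. r (i + k))) \<longlonglongrightarrow> ennreal 0" by (rule tendsto_ennrealI)
    moreover have "ennreal (\<Sum>i. r (i + k)) = (\<Sum>i. ?H (R (i + k)))" for k
      unfolding Rr by (rule suminf_ennreal2[symmetric]) (use rpos sk in auto)
    ultimately show ?thesis by simp
  qed
  have step: "?H (T \<inter> F) + ?H (T - F) \<le> ?H T + (\<Sum>i. ?H (R (i + k)))" for k
  proof -
    have "T - F \<subseteq> U k \<union> (\<Union>i. R (i + k))"
    proof
      fix x assume x: "x \<in> T - F"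
      have pos: "0 < ?d x" using x in_closed_iff_infdist_zero[OF F ne, of x] infdist_nonneg[of x F] by auto
      obtain m where m: "b m \<le> ?d x"
      proof -
        obtain m where "1 / ?d x < real m" using reals_Archimedean2 by blast
        then have "b m \<le> ?d x" using pos by (simp add: b_def field_simps)
        then show thesis by (rule that)
      qed
      define l where "l = (LEAST m. b m \<le> ?d x)"
      have l: "b l \<le> ?d x" unfolding l_def by (rule LeastI[of _ m]) (rule m)
      show "x \<in> U k \<union> (\<Union>i. R (i + k))"
      proof (cases "l \<le> k")
        case True
        then show ?thesis using l banti[OF True] x by (auto simp: U_def)
      next
        case False
        then obtain j where j: "l = Suc j" "k \<le> j" by (cases l) auto
        have "\<not> b j \<le> ?d x" using not_less_Least[of j "\<lambda>m. b m \<le> ?d x"] j l_def by auto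
        then have "x \<in> R ((j - k) + k)" using j l x by (auto simp: R_def)
        then show ?thesis by blast
      qed
    qed
    then have "?H (T - F) \<le> ?H (U k \<union> (\<Union>i. R (i + k)))" by (rule hausdorff_outer_mono)
    also have "\<dots> \<le> ?H (U k) + (\<Sum>i. ?H (R (i + k)))"
      by (rule order_trans[OF hausdorff_outer_Un]) (intro add_left_mono hausdorff_outer_countable)
    finally have "?H (T \<inter> F) + ?H (T - F) \<le> (?H (T \<inter> F) + ?H (U k)) + (\<Sum>i. ?H (R (i + k)))"
      by (simp add: add.assoc add_left_mono)
    also have "\<dots> \<le> ?H T + (\<Sum>i. ?H (R (i + k)))" by (intro add_right_mono main)
    finally show ?thesis .
  qed
  have "(\<lambda>k. ?H T + (\<Sum>i. ?H (R (i + k)))) \<longlonglongrightarrow> ?H T + 0" by (intro tendsto_add tendsto_const tail)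
  then have "?H (T \<inter> F) + ?H (T - F) \<le> ?H T + 0"
    by (rule LIMSEQ_le_const) (use step in auto)
  then show ?thesis by simp
qed

lemma measure_space_hausdorff: "measure_space UNIV (sets borel) (hausdorff_outer s)"
proof -
  interpret P: sigma_algebra UNIV "UNIV :: 'a set set" using sigma_algebra_Pow[of UNIV] by simp
  let ?L = "lambda_system UNIV UNIV (hausdorff_outer s :: 'a set \<Rightarrow> ennreal)"
  have L: "measure_space UNIV ?L (hausdorff_outer s)"
    by (rule P.caratheodory_lemma[OF outer_measure_space_hausdorff])
  then interpret L: sigma_algebra UNIV ?L by (simp add: measure_space_def)
  have "F \<in> ?L" if "closed F" for F :: "'a set"
  proof -
    have "hausdorff_outer s (T \<inter> F) + hausdorff_outer s (T - F) = hausdorff_outer s T" for T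
      using hausdorff_outer_closed[OF that, of s T] hausdorff_outer_Un[of s "T \<inter> F" "T - F"]
      by (simp add: antisym Int_Diff_Un)
    then show ?thesis by (simp add: P.lambda_system_eq)
  qed
  then have "sigma_sets UNIV {F. closed F} \<subseteq> ?L" by (intro L.sigma_sets_subset) auto
  then have sub: "sets borel \<subseteq> ?L" by (simp add: borel_eq_closed)
  have "sigma_algebra UNIV (sets (borel :: 'a measure))" using sets.sigma_algebra_axioms[of borel] by simp
  then show ?thesis using L sub
    unfolding measure_space_def by (auto simp: positive_def countably_additive_def)
qed

lemma sets_hausdorff_measure [simp, measurable_cong]: "sets (hausdorff_measure s) = sets borel"
  unfolding hausdorff_measure_def by (metis sets.sets_measure_of_eq space_borel)

lemma space_hausdorff_measure [simp]: "space (hausdorff_measure s) = UNIV"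
  unfolding hausdorff_measure_def by (simp add: space_measure_of_conv)

lemma emeasure_hausdorff_measure:
  "A \<in> sets borel \<Longrightarrow> emeasure (hausdorff_measure s) A = hausdorff_outer s A"
  unfolding hausdorff_measure_def
  using measure_space_hausdorff[of s] unfolding measure_space_def
  by (elim conjE) (rule emeasure_measure_of_sigma)


section \<open>The glued cubes\<close>

definition glued_cubes :: "(real ^ 'n::finite) measure" where
  "glued_cubes = restrict_space lborel
     ({x. \<forall>i. 0 \<le> x $ i \<and> x $ i \<le> 1} \<union> {x. \<forall>i. -1 \<le> x $ i \<and> x $ i \<le> 0})"


section \<open>The Sierpinski carpet and its scaling factor\<close>

definition carpet_index :: "(real \<times> real) set" where
  "carpet_index = {0, 1, 2} \<times> {0, 1, 2} - {(1, 1)}"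

definition carpet_map :: "real \<times> real \<Rightarrow> real \<times> real \<Rightarrow> real \<times> real" where
  "carpet_map i x = (x + i) /\<^sub>R 3"

definition is_carpet :: "(real \<times> real) set \<Rightarrow> bool" where
  "is_carpet K \<longleftrightarrow> K \<noteq> {} \<and> compact K \<and> K = (\<Union>i\<in>carpet_index. carpet_map i ` K)"

definition carpet :: "(real \<times> real) set" where
  "carpet = (THE K. is_carpet K)"

text \<open>Existence and uniqueness of the carpet justify the definite description.\<close>

lemma finite_carpet_index: "finite carpet_index"
  by (simp add: carpet_index_def)

lemma dist_carpet_map: "dist (carpet_map i x) (carpet_map i y) = dist x y / 3"
  by (simp add: carpet_map_def dist_norm flip: scaleR_diff_right)

lemma inj_carpet_map: "inj (carpet_map i)"
  by (rule injI) (simp add: carpet_map_def)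

lemma continuous_on_carpet_map: "continuous_on A (carpet_map i)"
  unfolding carpet_map_def by (intro continuous_intros)

lemma is_carpet_subset:
  assumes "is_carpet K" "is_carpet L"
  shows "K \<subseteq> L"
proof -
  have K: "K \<noteq> {}" "compact K" "K = (\<Union>i\<in>carpet_index. carpet_map i ` K)"
   and L: "L \<noteq> {}" "compact L" "L = (\<Union>i\<in>carpet_index. carpet_map i ` L)"
    using assms by (auto simp: is_carpet_def)
  obtain x where x: "x \<in> K" "\<And>y. y \<in> K \<Longrightarrow> infdist y L \<le> infdist x L"
    using continuous_attains_sup[OF K(2,1), of "\<lambda>x. infdist x L"]
    using continuous_on_infdist[OF continuous_on_id, of K L] by blast
  obtain i y where iy: "i \<in> carpet_index" "y \<in> K" "x = carpet_map i y" using x(1) K(3) by blast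
  obtain z where z: "z \<in> L" "infdist y L = dist y z"
    using infdist_attains_inf[OF compact_imp_closed[OF L(2)] L(1)] by blast
  have "carpet_map i z \<in> L" using L(3) iy(1) z(1) by blast
  then have "infdist x L \<le> dist x (carpet_map i z)" by (rule infdist_le)
  also have "\<dots> = infdist y L / 3" using iy z by (simp add: dist_carpet_map)
  also have "\<dots> \<le> infdist x L / 3" using x(2)[OF iy(2)] by simp
  finally have "infdist x L \<le> 0" by simp
  then have "infdist y L = 0" if "y \<in> K" for y
    using x(2)[OF that] infdist_nonneg[of y L] by linarith
  then show ?thesis
    using in_closed_iff_infdist_zero[OF compact_imp_closed[OF L(2)] L(1)] by auto
qed

lemma is_carpet_exists: "\<exists>K. is_carpet K \<and> K \<subseteq> {0..1} \<times> {0..1}"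
proof -
  define \<Phi> where "\<Phi> A = (\<Union>i\<in>carpet_index. carpet_map i ` A)" for A
  define Q where "Q n = (\<Phi> ^^ n) ({0..1} \<times> {0..1})" for n
  have Q0: "Q 0 = {0..1} \<times> {0..1}" and QS: "Q (Suc n) = \<Phi> (Q n)" for n by (simp_all add: Q_def)
  have mono: "A \<subseteq> B \<Longrightarrow> \<Phi> A \<subseteq> \<Phi> B" for A B by (auto simp: \<Phi>_def)
  have "Q (Suc n) \<subseteq> Q n" for n
  proof (induction n)
    case 0
    show ?case by (auto simp: QS Q0 \<Phi>_def carpet_index_def carpet_map_def)
  next
    case (Suc n)
    then show ?case by (simp add: QS mono)
  qed
  then have dec: "m \<le> n \<Longrightarrow> Q n \<subseteq> Q m" for m n by (rule lift_Suc_antimono_le)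
  have comp: "compact (Q n)" for n
  proof (induction n)
    case 0 show ?case by (simp add: Q0 compact_Times)
  next
    case (Suc n)
    then show ?case unfolding QS \<Phi>_def
      by (intro compact_UN finite_carpet_index compact_continuous_image continuous_on_carpet_map)
  qed
  have ne: "Q n \<noteq> {}" for n
  proof (induction n)
    case (Suc n)
    have "(0, 0) \<in> carpet_index" by (simp add: carpet_index_def)
    with Suc show ?case by (auto simp: QS \<Phi>_def)
  qed (auto simp: Q0)
  define K where "K = (\<Inter>n. Q n)"
  have Kne: "K \<noteq> {}" unfolding K_def by (rule compact_nest[OF comp ne dec])
  have Kc: "compact K" unfolding K_def
    using comp by (intro compact_Inter) auto
  have "K \<subseteq> \<Phi> K"
  proof
    fix x assume x: "x \<in> K"
    have "\<exists>i\<in>carpet_index. x \<in> carpet_map i ` Q n" for n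
    proof -
      have "x \<in> Q (Suc n)" using x by (simp add: K_def)
      then show ?thesis unfolding QS \<Phi>_def by blast
    qed
    then obtain c where c: "\<And>n. c n \<in> carpet_index" "\<And>n. x \<in> carpet_map (c n) ` Q n" by metis
    have "\<exists>i\<in>carpet_index. infinite {n \<in> UNIV. c n = i}"
      by (rule pigeonhole_infinite_rel) (use finite_carpet_index c in auto)
    then obtain i where i: "i \<in> carpet_index" "infinite {n. c n = i}" by auto
    have "x \<in> carpet_map i ` Q n" for n
    proof -
      obtain m where "n \<le> m" "c m = i" using i(2) unfolding infinite_nat_iff_unbounded_le by auto
      then show ?thesis using c(2)[of m] dec by blast
    qed
    then have "x \<in> (\<Inter>n. carpet_map i ` Q n)" by blast
    also have "\<dots> = carpet_map i ` K" unfolding K_def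
      by (rule image_INT[OF inj_carpet_map, symmetric]) auto
    finally show "x \<in> \<Phi> K" using i by (auto simp: \<Phi>_def)
  qed
  moreover have "\<Phi> K \<subseteq> K"
  proof -
    have "\<Phi> K \<subseteq> Q (Suc n)" for n unfolding QS by (rule mono) (auto simp: K_def)
    then have "\<Phi> K \<subseteq> Q n" for n using dec[of n "Suc n"] by (meson le_SucI order_refl order_trans)
    then show ?thesis by (auto simp: K_def)
  qed
  ultimately have "is_carpet K" using Kne Kc by (auto simp: is_carpet_def \<Phi>_def)
  moreover have "K \<subseteq> {0..1} \<times> {0..1}" using Q0 by (auto simp: K_def)
  ultimately show ?thesis by blast
qed

lemma ex1_carpet: "\<exists>!K. is_carpet K"
  using is_carpet_exists is_carpet_subset by (meson subset_antisym)

lemma is_carpet_carpet: "is_carpet carpet"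
  unfolding carpet_def by (rule theI'[OF ex1_carpet])

lemma carpet_subset: "carpet \<subseteq> {0..1} \<times> {0..1}"
  using is_carpet_exists is_carpet_carpet ex1_carpet by metis

definition words :: "nat \<Rightarrow> (real \<times> real) list set" where
  "words m = {w. length w = m \<and> set w \<subseteq> carpet_index}"

definition cell :: "(real \<times> real) list \<Rightarrow> (real \<times> real) set" where
  "cell w = foldr carpet_map w ` carpet"

definition carpet_edges :: "nat \<Rightarrow> ((real \<times> real) list \<times> (real \<times> real) list) set" where
  "carpet_edges m = {(v, w). v \<in> words m \<and> w \<in> words m \<and> v \<noteq> w \<and> cell v \<inter> cell w \<noteq> {}}"

text \<open>\<^const>\<open>carpet_edges\<close> lists every undirected edge in both orientations, hence the factor
  \<open>1/2\<close>.\<close>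

definition graph_energy :: "real \<Rightarrow> nat \<Rightarrow> ((real \<times> real) list \<Rightarrow> real) \<Rightarrow> real" where
  "graph_energy p m f = (\<Sum>(v, w)\<in>carpet_edges m. \<bar>f v - f w\<bar> powr p) / 2"

definition crossing_function :: "nat \<Rightarrow> ((real \<times> real) list \<Rightarrow> real) \<Rightarrow> bool" where
  "crossing_function m f \<longleftrightarrow>
     (\<forall>w\<in>words m. (cell w \<inter> ({0} \<times> {0..1}) \<noteq> {} \<longrightarrow> f w = 0) \<and>
                  (cell w \<inter> ({1} \<times> {0..1}) \<noteq> {} \<longrightarrow> f w = 1))"

text \<open>The infimum is a minimum for \<open>m \<ge> 1\<close>: the energy depends only on finitely many values of
  \<open>f\<close>, and truncating these to \<open>[0, 1]\<close> does not increase it.\<close>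

definition carpet_conductance :: "real \<Rightarrow> nat \<Rightarrow> real" where
  "carpet_conductance p m = Inf {graph_energy p m f | f. crossing_function m f}"

definition carpet_scaling :: "real \<Rightarrow> real" where
  "carpet_scaling p = lim (\<lambda>m. carpet_conductance p m powr (- 1 / real m))"

definition carpet_dim :: real where
  "carpet_dim = ln 8 / ln 3"

definition carpet_walk_dim :: "real \<Rightarrow> real" where
  "carpet_walk_dim p = ln (8 * carpet_scaling p) / ln 3"

definition carpet_plus :: "(real \<times> real) set" where
  "carpet_plus = (\<lambda>x. x - (1, 1)) ` carpet"

text \<open>The map below is the reflection in the line \<open>{y = -x}\<close>.\<close>

definition carpet_minus :: "(real \<times> real) set" where
  "carpet_minus = (\<lambda>(x, y). (- y, - x)) ` carpet_plus"

definition glued_carpets :: "(real \<times> real) measure" where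
  "glued_carpets = restrict_space (hausdorff_measure carpet_dim) (carpet_plus \<union> carpet_minus)"

end

theory Submission
  imports Defs
begin

text \<open>
  A function on \<open>X\<close> has finite Besov energy iff its restrictions to the two copies have finite
  Riesz energy with kernel \<open>d(x, y)\<^bsup>-(\<theta>p + d\<^sub>f)\<^esup>\<close> and the cross energy between the copies is finite.
  When \<open>\<theta>p > d\<^sub>w\<close>, finite Riesz energy forces a function to be constant on each copy, so the
  Besov space is not dense, and a non-constant function in it exists iff the cross energy of two
  different constants is finite; as points of different copies have a distance comparable to the sum
  of their distances to \<open>o\<close>, this holds for \<open>\<theta>p < d\<^sub>f\<close> and fails for \<open>\<theta>p > d\<^sub>f\<close>.  When \<open>\<theta>p < d\<^sub>w\<close>, each Lipschitz
  function that vanishes near \<open>o\<close> is approximated on each copy by functions of finite Riesz energy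
  that vanish near \<open>o\<close>, which gives density.

  On the cube, \<open>d\<^sub>w = p\<close> because Lipschitz functions have finite energy below and the midpoint trick
  excludes non-constant functions above.  On the carpet, one iterates: replacing every cell of
  a coarse grid by a nearly optimal crossing function of the level-\<open>m\<close> graph multiplies the energy by
  a constant times the conductance \<open>C\<^sub>m\<close>.  This shows that the conductances are submultiplicative up
  to a constant, hence that \<open>\<rho>\<^sub>p\<close> exists, and yields the approximating functions.  Conversely, by
  Hahn-Banach there are weights on the sides of the level-\<open>m\<close> graph whose averages are controlled by the
  energy divided by \<open>C\<^sub>m\<close>.  Hence functions on the level-\<open>n\<close> graph whose energies are
  exponentially smaller than \<open>C\<^sub>n\<close>, such as the cell averages of a function of finite Riesz
  energy above the critical exponent, are constant.
\<close>

section \<open>Inequalities for powers\<close>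

text \<open>The obstacle is the constant lost at each change of scale: refining by \<open>m\<close>
  levels, or averaging over \<open>m\<close> levels, costs a factor that depends on \<open>p\<close>
  alone, besides the conductance. A supremum of exponents asks only about exponents away from the
  critical one, so strict inequalities leave room: \<open>m\<close> is fixed so large that the
  exponential gap beats the constant, and the step of \<open>m\<close> levels is then iterated.
  Refinement needs values that agree where cells touch. It therefore works with functions on the
  corners of cells, and with crossing functions symmetrised to agree on the bottom and the top side.
  In the other direction, comparing means of adjacent cells directly would need a Poincare
  inequality with the right constant. Weighted averages over one side avoid this: the weights are
  dual to the conductance, and folding along the diagonal carries the estimate from opposite sides
  to adjacent ones. Means and side averages differ by a constant that does depend on
  \<open>m\<close>, but it enters each of the \<open>K\<close> terms of a telescoping sum only once,
  so the geometric decay in \<open>K\<close> wins.\<close>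

lemma powr_mono_abs:
  fixes x y p :: real
  assumes "\<bar>x\<bar> \<le> y" "0 \<le> p"
  shows "\<bar>x\<bar> powr p \<le> y powr p"
  using assms by (intro powr_mono2) auto

lemma powr_add_le:
  fixes a b p :: real
  assumes "0 \<le> a" "0 \<le> b" "0 \<le> p"
  shows "(a + b) powr p \<le> 2 powr p * (a powr p + b powr p)"
proof -
  have "(a + b) powr p \<le> (2 * max a b) powr p"
    using assms by (intro powr_mono2) auto
  also have "\<dots> = 2 powr p * max a b powr p" using assms by (simp add: powr_mult)
  also have "max a b powr p \<le> a powr p + b powr p" by (simp add: max_def)
  finally show ?thesis by simp
qed

lemma powr_sum_le:
  fixes f :: "'a \<Rightarrow> real"
  assumes "finite F" "\<And>i. i \<in> F \<Longrightarrow> 0 \<le> f i" "0 \<le> p"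
  shows "(\<Sum>i\<in>F. f i) powr p \<le> real (card F) powr p * (\<Sum>i\<in>F. f i powr p)"
proof (cases "F = {}")
  case False
  define m where "m = Max (f ` F)"
  have mem: "m \<in> f ` F" unfolding m_def using assms False by (intro Max_in) auto
  then obtain j where j: "j \<in> F" "m = f j" by auto
  have le: "f i \<le> m" if "i \<in> F" for i unfolding m_def using assms that by (intro Max_ge) auto
  have "(\<Sum>i\<in>F. f i) \<le> real (card F) * m"
    using sum_bounded_above[of F f m] le by auto
  then have "(\<Sum>i\<in>F. f i) powr p \<le> (real (card F) * m) powr p"
    using assms by (intro powr_mono2 sum_nonneg) auto
  also have "\<dots> = real (card F) powr p * f j powr p" using j assms by (simp add: powr_mult)
  also have "f j powr p \<le> (\<Sum>i\<in>F. f i powr p)" using j assms by (intro member_le_sum) auto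
  finally show ?thesis by (simp add: mult_left_mono)
qed simp

lemma abs_powr_add_le:
  fixes a b p :: real
  assumes "0 \<le> p"
  shows "\<bar>a + b\<bar> powr p \<le> 2 powr p * (\<bar>a\<bar> powr p + \<bar>b\<bar> powr p)"
  using order_trans[OF powr_mono_abs[OF abs_triangle_ineq] powr_add_le[of "\<bar>a\<bar>" "\<bar>b\<bar>" p]] assms by simp

lemma abs_powr_diff_le:
  fixes a b p :: real
  assumes "0 \<le> p"
  shows "\<bar>a - b\<bar> powr p \<le> 2 powr p * (\<bar>a\<bar> powr p + \<bar>b\<bar> powr p)"
  using abs_powr_add_le[of p a "- b"] assms by auto

text \<open>\<open>powr_convex\<close> gives this on the open half-line. A combination with the
  endpoint 0 reduces to \<open>s powr p \<le> s\<close> for \<open>0 < s < 1\<close>, which uses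
  \<open>1 \<le> p\<close> once more.\<close>

lemma convex_on_powr:
  assumes "1 \<le> (p::real)"
  shows "convex_on {0..} (\<lambda>x::real. x powr p)"
proof -
  have "convex_on {0..} (\<lambda>x::real. x powr p)"
  proof (rule convex_onI)
    fix t x y :: real assume t: "0 < t" "t < 1" and xy: "x \<in> {0..}" "y \<in> {0..}"
    have c: "convex_on {0<..} (\<lambda>x::real. x powr p)" by (rule powr_convex) (use assms in auto)
    show "((1 - t) *\<^sub>R x + t *\<^sub>R y) powr p \<le> (1 - t) * x powr p + t * y powr p"
    proof (cases "x = 0 \<or> y = 0")
      case False
      then show ?thesis using convex_onD[OF c, of t x y] t xy by auto
    next
      case True
      have *: "(s * z) powr p \<le> s * z powr p" if "0 < s" "s < 1" "0 \<le> z" for s z :: real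
      proof -
        have "s powr p \<le> s powr 1" using that assms by (intro powr_mono') auto
        then show ?thesis using that by (auto simp: powr_mult intro!: mult_right_mono)
      qed
      show ?thesis using True *[of t y] *[of "1 - t" x] t xy assms by auto
    qed
  qed (simp)
  then show ?thesis .
qed

text \<open>Convexity for \<open>a + b\<close> written as a combination of
  \<open>a / (1 - \<eta>)\<close> and \<open>b / \<eta>\<close>. The parameter distributes the loss:
  as \<open>\<eta>\<close> tends to 1 the factor of \<open>b\<close> tends to 1, at the price of a
  large factor for \<open>a\<close>.\<close>

lemma powr_convex_add_le:
  fixes a b \<eta> p :: real
  assumes "0 \<le> a" "0 \<le> b" "0 < \<eta>" "\<eta> < 1" "1 \<le> p"
  shows "(a + b) powr p \<le> (1 - \<eta>) powr (1 - p) * a powr p + \<eta> powr (1 - p) * b powr p"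
proof -
  have "(a + b) powr p = ((1 - \<eta>) *\<^sub>R (a / (1 - \<eta>)) + \<eta> *\<^sub>R (b / \<eta>)) powr p"
    using assms by simp
  also have "\<dots> \<le> (1 - \<eta>) * (a / (1 - \<eta>)) powr p + \<eta> * (b / \<eta>) powr p"
    using convex_onD[OF convex_on_powr[OF assms(5)], of \<eta> "a / (1 - \<eta>)" "b / \<eta>"] assms by simp
  also have "\<dots> = (1 - \<eta>) powr (1 - p) * a powr p + \<eta> powr (1 - p) * b powr p"
    using assms by (simp add: powr_divide powr_diff)
  finally show ?thesis .
qed

text \<open>Terms are peeled off one at a time with \<open>powr_convex_add_le\<close>. Each term
  pays \<open>(1 - \<eta>) powr (1 - p)\<close> once and a factor \<open>\<eta> powr (1 - p)\<close>
  for every earlier term. That ratio can be brought as close to 1 as desired, so any geometric decay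
  of the p-th powers absorbs it.\<close>

lemma powr_sum_geometric_le:
  fixes v :: "nat \<Rightarrow> real"
  assumes "\<And>j. 0 \<le> v j" "0 < \<eta>" "\<eta> < 1" "1 \<le> p"
  shows "(\<Sum>j<N. v j) powr p
    \<le> (1 - \<eta>) powr (1 - p) * (\<Sum>j<N. (\<eta> powr (1 - p)) ^ j * v j powr p)"
  using assms(1)
proof (induction N arbitrary: v)
  case (Suc N)
  let ?c = "(1 - \<eta>) powr (1 - p)" and ?d = "\<eta> powr (1 - p)"
  have "(\<Sum>j<Suc N. v j) powr p = (v 0 + (\<Sum>j<N. v (Suc j))) powr p"
    by (rule arg_cong[OF sum.lessThan_Suc_shift])
  also have "\<dots> \<le> ?c * v 0 powr p + ?d * (\<Sum>j<N. v (Suc j)) powr p"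
    using assms Suc.prems by (intro powr_convex_add_le sum_nonneg) auto
  also have "\<dots> \<le> ?c * v 0 powr p + ?d * (?c * (\<Sum>j<N. ?d ^ j * v (Suc j) powr p))"
    using Suc.IH[of "\<lambda>j. v (Suc j)"] Suc.prems by (intro add_left_mono mult_left_mono) auto
  also have "\<dots> = ?c * (\<Sum>j<Suc N. ?d ^ j * v j powr p)"
    by (simp add: sum.lessThan_Suc_shift sum_distrib_left algebra_simps del: sum.lessThan_Suc)
  finally show ?case .
qed simp

lemma powr_mean_le:
  fixes f :: "'a \<Rightarrow> real"
  assumes "finite F" "F \<noteq> {}" "1 \<le> p"
  shows "\<bar>(\<Sum>i\<in>F. f i) / card F\<bar> powr p \<le> (\<Sum>i\<in>F. \<bar>f i\<bar> powr p) / card F"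
proof -
  have c: "0 < card F" using assms by (simp add: card_gt_0_iff)
  have "\<bar>(\<Sum>i\<in>F. f i) / card F\<bar> \<le> (\<Sum>i\<in>F. (1 / card F) *\<^sub>R \<bar>f i\<bar>)"
    using sum_abs[of f F] c by (simp add: divide_right_mono flip: sum_divide_distrib)
  then have "\<bar>(\<Sum>i\<in>F. f i) / card F\<bar> powr p \<le> (\<Sum>i\<in>F. (1 / card F) *\<^sub>R \<bar>f i\<bar>) powr p"
    using assms by (intro powr_mono_abs) auto
  also have "\<dots> \<le> (\<Sum>i\<in>F. (1 / card F) * \<bar>f i\<bar> powr p)"
    using assms c by (intro convex_on_sum[OF _ _ convex_on_powr]) auto
  finally show ?thesis by (simp add: sum_divide_distrib)
qed

text \<open>Minkowski's inequality follows from convexity and homogeneity.\<close>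

lemma Minkowski_sum:
  fixes f g :: "'a \<Rightarrow> real"
  assumes fin: "finite F" and p: "1 \<le> p"
  shows "(\<Sum>i\<in>F. \<bar>f i + g i\<bar> powr p) powr (1 / p)
    \<le> (\<Sum>i\<in>F. \<bar>f i\<bar> powr p) powr (1 / p) + (\<Sum>i\<in>F. \<bar>g i\<bar> powr p) powr (1 / p)"
proof -
  define N where "N f = (\<Sum>i\<in>F. \<bar>f i\<bar> powr p) powr (1 / p)" for f :: "'a \<Rightarrow> real"
  have N0: "0 \<le> N f" for f by (simp add: N_def)
  have Np: "N f powr p = (\<Sum>i\<in>F. \<bar>f i\<bar> powr p)" for f
    using p by (simp add: N_def powr_powr sum_nonneg)
  have zero: "f i = 0" if "N f = 0" "i \<in> F" for f i
  proof -
    have "(\<Sum>i\<in>F. \<bar>f i\<bar> powr p) = 0" using that p Np[of f] by simp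
    then show ?thesis using that fin by (simp add: sum_nonneg_eq_0_iff)
  qed
  show ?thesis
  proof (cases "N f = 0 \<or> N g = 0")
    case True
    then have "N (\<lambda>i. f i + g i) \<le> N f + N g"
    proof
      assume a: "N f = 0"
      then have "N (\<lambda>i. f i + g i) = N g" unfolding N_def using zero[OF a] by (intro arg_cong2[where f="(powr)"] sum.cong) auto
      then show ?thesis using N0 by auto
    next
      assume a: "N g = 0"
      then have "N (\<lambda>i. f i + g i) = N f" unfolding N_def using zero[OF a] by (intro arg_cong2[where f="(powr)"] sum.cong) auto
      then show ?thesis using N0 by auto
    qed
    then show ?thesis by (simp add: N_def)
  next
    case False
    define a b where "a = N f" and "b = N g"
    have ab: "0 < a" "0 < b" using False N0[of f] N0[of g] by (auto simp: a_def b_def)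
    \<comment> \<open>With this weight \<open>\<bar>f i\<bar> + \<bar>g i\<bar>\<close> is
      \<open>a + b\<close> times a convex combination of the normalised values
      \<open>\<bar>f i\<bar> / a\<close> and \<open>\<bar>g i\<bar> / b\<close>, whose p-th powers
      each sum to 1.\<close>
    define t where "t = b / (a + b)"
    have t: "0 < t" "t < 1" "1 - t = a / (a + b)" using ab by (auto simp: t_def field_simps)
    have "\<bar>f i + g i\<bar> powr p \<le> (a + b) powr p * ((1 - t) * (\<bar>f i\<bar> powr p / a powr p) + t * (\<bar>g i\<bar> powr p / b powr p))" for i
    proof -
      have e1: "(a+b) * ((1 - t) * (\<bar>f i\<bar> / a)) = \<bar>f i\<bar>" using ab t(3) by simp
      have e2: "(a+b) * (t * (\<bar>g i\<bar> / b)) = \<bar>g i\<bar>" using ab by (simp add: t_def)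
      have eq: "(a + b) * ((1 - t) *\<^sub>R (\<bar>f i\<bar> / a) + t *\<^sub>R (\<bar>g i\<bar> / b)) = \<bar>f i\<bar> + \<bar>g i\<bar>"
        using e1 e2 by (simp add: distrib_left)
      have "\<bar>f i + g i\<bar> powr p \<le> ((a + b) * ((1 - t) *\<^sub>R (\<bar>f i\<bar> / a) + t *\<^sub>R (\<bar>g i\<bar> / b))) powr p"
        unfolding eq using p by (intro powr_mono_abs) auto
      also have "\<dots> = (a + b) powr p * ((1 - t) *\<^sub>R (\<bar>f i\<bar> / a) + t *\<^sub>R (\<bar>g i\<bar> / b)) powr p"
        by (rule powr_mult)
      also have "\<dots> \<le> (a + b) powr p * ((1 - t) * (\<bar>f i\<bar> / a) powr p + t * (\<bar>g i\<bar> / b) powr p)"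
        using convex_onD[OF convex_on_powr[OF p], of t "\<bar>f i\<bar> / a" "\<bar>g i\<bar> / b"] ab t by (intro mult_left_mono) auto
      finally show ?thesis using ab by (simp add: powr_divide)
    qed
    then have "(\<Sum>i\<in>F. \<bar>f i + g i\<bar> powr p) \<le> (\<Sum>i\<in>F. (a + b) powr p * ((1 - t) * (\<bar>f i\<bar> powr p / a powr p) + t * (\<bar>g i\<bar> powr p / b powr p)))"
      by (rule sum_mono)
    also have "\<dots> = (a + b) powr p * ((1 - t) * ((\<Sum>i\<in>F. \<bar>f i\<bar> powr p) / a powr p) + t * ((\<Sum>i\<in>F. \<bar>g i\<bar> powr p) / b powr p))"
      by (simp add: sum.distrib flip: sum_distrib_left sum_divide_distrib)
    also have "\<dots> = (a + b) powr p"
      using ab by (simp add: a_def b_def flip: Np)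
    finally have "(\<Sum>i\<in>F. \<bar>f i + g i\<bar> powr p) powr (1 / p) \<le> ((a + b) powr p) powr (1 / p)"
      using p by (intro powr_mono2 sum_nonneg) auto
    then show ?thesis using ab p by (simp add: powr_powr a_def b_def N_def)
  qed
qed

section \<open>A finite Hahn-Banach theorem\<close>

definition sublinear :: "(('a \<Rightarrow> real) \<Rightarrow> real) \<Rightarrow> bool" where
  "sublinear N \<longleftrightarrow> (\<forall>f g. N (\<lambda>x. f x + g x) \<le> N f + N g) \<and> (\<forall>c f. 0 \<le> c \<longrightarrow> N (\<lambda>x. c * f x) = c * N f)"

lemma sublinear_add: "sublinear N \<Longrightarrow> N (\<lambda>x. f x + g x) \<le> N f + N g"
  by (simp add: sublinear_def)

lemma sublinear_scale: "sublinear N \<Longrightarrow> 0 \<le> c \<Longrightarrow> N (\<lambda>x. c * f x) = c * N f"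
  by (simp add: sublinear_def)

lemma sublinear_zero: "sublinear N \<Longrightarrow> N (\<lambda>x. 0) = 0"
  using sublinear_scale[of N 0 "\<lambda>x. 0"] by simp

lemma sublinear_neg: "sublinear N \<Longrightarrow> 0 \<le> N f + N (\<lambda>x. - f x)"
  using sublinear_add[of N f "\<lambda>x. - f x"] sublinear_zero[of N] by simp

text \<open>The minorant \<open>q f\<close> is the infimum of \<open>N (f + g) - l g\<close> over
  \<open>g\<close> in \<open>S\<close>. Besides containing 0, \<open>S\<close> need only be a convex
  cone. So the lemma serves both for a single ray, where it makes \<open>N\<close> odd in one
  direction, and for the subspace of the extension theorem.\<close>

lemma sublinear_inf_convolution:
  assumes N: "sublinear N" and S0: "(\<lambda>x. 0) \<in> S" "l (\<lambda>x. 0) = 0"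
    and Sadd: "\<And>f g. f \<in> S \<Longrightarrow> g \<in> S \<Longrightarrow> (\<lambda>x. f x + g x) \<in> S \<and> l (\<lambda>x. f x + g x) = l f + l g"
    and Sscale: "\<And>c f. f \<in> S \<Longrightarrow> 0 < c \<Longrightarrow> (\<lambda>x. c * f x) \<in> S \<and> l (\<lambda>x. c * f x) = c * l f"
    and le: "\<And>f. f \<in> S \<Longrightarrow> l f \<le> N f"
  obtains q where "sublinear q" "\<And>f. q f \<le> N f" "\<And>f g. g \<in> S \<Longrightarrow> q f \<le> N (\<lambda>x. f x + g x) - l g"
proof -
  define T where "T f = {N (\<lambda>x. f x + g x) - l g | g. g \<in> S}" for f
  define q where "q f = Inf (T f)" for f
  have ne: "T f \<noteq> {}" for f using S0 by (auto simp: T_def)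
  \<comment> \<open>The infimum is finite because \<open>l g \<le> N g\<close> and \<open>g\<close>
    is the sum of \<open>f + g\<close> and \<open>- f\<close>.\<close>
  have low: "- N (\<lambda>x. - f x) \<le> y" if y: "y \<in> T f" for f y
  proof -
    obtain g where g: "g \<in> S" "y = N (\<lambda>x. f x + g x) - l g" using y by (auto simp: T_def)
    have "l g \<le> N (\<lambda>x. (f x + g x) + - f x)" using le[OF g(1)] by simp
    also have "\<dots> \<le> N (\<lambda>x. f x + g x) + N (\<lambda>x. - f x)" by (rule sublinear_add[OF N])
    finally show ?thesis using g by simp
  qed
  have bdd: "bdd_below (T f)" for f using low by (auto intro!: bdd_belowI)
  have qle: "q f \<le> N (\<lambda>x. f x + g x) - l g" if "g \<in> S" for f g
    unfolding q_def by (rule cInf_lower[OF _ bdd]) (use that in \<open>auto simp: T_def\<close>)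
  have qN: "q f \<le> N f" for f using qle[OF S0(1), of f] S0 by simp
  have add: "q (\<lambda>x. f x + g x) \<le> q f + q g" for f g
  proof -
    have "q (\<lambda>x. f x + g x) \<le> a + b" if ab: "a \<in> T f" "b \<in> T g" for a b
    proof -
      obtain f' where f': "f' \<in> S" "a = N (\<lambda>x. f x + f' x) - l f'" using ab by (auto simp: T_def)
      obtain g' where g': "g' \<in> S" "b = N (\<lambda>x. g x + g' x) - l g'" using ab by (auto simp: T_def)
      have "q (\<lambda>x. f x + g x) \<le> N (\<lambda>x. (f x + g x) + (f' x + g' x)) - (l f' + l g')"
        using qle[of "\<lambda>x. f' x + g' x" "\<lambda>x. f x + g x"] Sadd[OF f'(1) g'(1)] by simp
      moreover have "N (\<lambda>x. (f x + g x) + (f' x + g' x)) \<le> N (\<lambda>x. f x + f' x) + N (\<lambda>x. g x + g' x)"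
        using sublinear_add[OF N, of "\<lambda>x. f x + f' x" "\<lambda>x. g x + g' x"] by (simp add: algebra_simps)
      ultimately show ?thesis using f' g' by simp
    qed
    then have "q (\<lambda>x. f x + g x) - b \<le> q f" if "b \<in> T g" for b
      unfolding q_def[of f] using that by (intro cInf_greatest ne) (auto simp: algebra_simps)
    then have "q (\<lambda>x. f x + g x) - q f \<le> q g"
      unfolding q_def[of g] by (intro cInf_greatest ne) (auto simp: algebra_simps)
    then show ?thesis by simp
  qed
  have z: "q (\<lambda>x. 0) = 0"
  proof (rule antisym)
    show "q (\<lambda>x. 0) \<le> 0" using qN[of "\<lambda>x. 0"] sublinear_zero[OF N] by simp
    show "0 \<le> q (\<lambda>x. 0)" unfolding q_def
      by (rule cInf_greatest[OF ne]) (use low[of _ "\<lambda>x. 0"] sublinear_zero[OF N] in auto)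
  qed
  have scale1: "q (\<lambda>x. c * f x) \<le> c * q f" if c: "0 < c" for c f
  proof -
    have "q (\<lambda>x. c * f x) / c \<le> q f"
      unfolding q_def[of f]
    proof (rule cInf_greatest[OF ne])
      fix y assume "y \<in> T f"
      then obtain g where g: "g \<in> S" "y = N (\<lambda>x. f x + g x) - l g" by (auto simp: T_def)
      have "q (\<lambda>x. c * f x) \<le> N (\<lambda>x. c * f x + c * g x) - c * l g"
        using qle[of "\<lambda>x. c * g x" "\<lambda>x. c * f x"] Sscale[OF g(1) c] by simp
      also have "N (\<lambda>x. c * f x + c * g x) = c * N (\<lambda>x. f x + g x)"
        using sublinear_scale[OF N, of c "\<lambda>x. f x + g x"] c by (simp add: algebra_simps)
      finally show "q (\<lambda>x. c * f x) / c \<le> y" using c unfolding g(2) by (simp add: field_simps)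
    qed
    then show ?thesis using c by (simp add: field_simps)
  qed
  have scale: "q (\<lambda>x. c * f x) = c * q f" if "0 \<le> c" for c f
  proof (cases "c = 0")
    case False
    then have c: "0 < c" using that by simp
    have "q f \<le> (1 / c) * q (\<lambda>x. c * f x)" using scale1[of "1 / c" "\<lambda>x. c * f x"] c by simp
    then have "c * q f \<le> q (\<lambda>x. c * f x)" using c by (simp add: field_simps)
    then show ?thesis using scale1[OF c, of f] by simp
  qed (simp add: z)
  have qsub: "sublinear q" unfolding sublinear_def using add scale by auto
  show thesis by (rule that[OF qsub qN qle])
qed

text \<open>Uses the ray of nonnegative multiples of \<open>v\<close> with \<open>l = N\<close> on
  it: then \<open>N' (- v)\<close> is at most \<open>N 0 - N v\<close>, which is the inequality
  opposite to the one that sublinearity gives.\<close>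

lemma sublinear_linearize:
  fixes N :: "('a \<Rightarrow> real) \<Rightarrow> real"
  assumes N: "sublinear N"
  obtains N' where "sublinear N'" "\<And>f. N' f \<le> N f" "N' (\<lambda>x. - v x) = - N' v"
proof -
  let ?S = "{\<lambda>x. c * v x | c. 0 \<le> c}"
  have sc: "N (\<lambda>x. c * v x) = c * N v" if "0 \<le> c" for c by (rule sublinear_scale[OF N that])
  obtain N' where N': "sublinear N'" "\<And>f. N' f \<le> N f" "\<And>f g. g \<in> ?S \<Longrightarrow> N' f \<le> N (\<lambda>x. f x + g x) - N g"
  proof (rule sublinear_inf_convolution[OF N, of ?S N])
    show "(\<lambda>x. 0) \<in> ?S" by (auto intro!: exI[of _ 0])
    show "N (\<lambda>x. 0) = 0" by (rule sublinear_zero[OF N])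
    show "(\<lambda>x. f x + g x) \<in> ?S \<and> N (\<lambda>x. f x + g x) = N f + N g" if fg: "f \<in> ?S" "g \<in> ?S" for f g
    proof -
      obtain c d where cd: "0 \<le> c" "f = (\<lambda>x. c * v x)" "0 \<le> d" "g = (\<lambda>x. d * v x)" using fg by auto
      then have "(\<lambda>x. f x + g x) = (\<lambda>x. (c + d) * v x)" by (simp add: distrib_right)
      with cd sc[of "c + d"] show ?thesis by (auto simp: sc distrib_right intro: exI[of _ "c + d"])
    qed
    show "(\<lambda>x. c * f x) \<in> ?S \<and> N (\<lambda>x. c * f x) = c * N f" if f: "f \<in> ?S" "0 < c" for c f
    proof -
      obtain d where "0 \<le> d" "f = (\<lambda>x. d * v x)" using f by auto
      then show ?thesis using f(2) sublinear_scale[OF N, of c f] by (auto intro!: exI[of _ "c * d"])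
    qed
  qed auto
  have "v \<in> ?S" by (auto intro!: exI[of _ 1])
  from N'(3)[OF this, of "\<lambda>x. - v x"] have "N' (\<lambda>x. - v x) \<le> - N v" using sublinear_zero[OF N] by simp
  then have "N' (\<lambda>x. - v x) = - N' v" using sublinear_neg[OF N'(1), of v] N'(2)[of v] by simp
  then show thesis by (rule that[OF N'(1,2)])
qed

text \<open>One vector at a time. Oddness at earlier vectors survives, since a sublinear minorant of
  a functional that is odd at \<open>v\<close> agrees with it at \<open>v\<close> and at
  \<open>- v\<close>.\<close>

lemma sublinear_linearize_finite:
  assumes "finite B" "sublinear N"
  obtains N' where "sublinear N'" "\<And>f. N' f \<le> N f" "\<And>v. v \<in> B \<Longrightarrow> N' (\<lambda>x. - v x) = - N' v"
proof -
  have "\<exists>N'. sublinear N' \<and> (\<forall>f. N' f \<le> N f) \<and> (\<forall>v\<in>B. N' (\<lambda>x. - v x) = - N' v)"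
    using assms(1)
  proof (induction B)
    case empty
    then show ?case using assms(2) by auto
  next
    case (insert w B)
    then obtain N1 where N1: "sublinear N1" "\<forall>f. N1 f \<le> N f" "\<forall>v\<in>B. N1 (\<lambda>x. - v x) = - N1 v" by blast
    obtain N2 where N2: "sublinear N2" "\<And>f. N2 f \<le> N1 f" "N2 (\<lambda>x. - w x) = - N2 w"
    proof -
      fix thesis
      assume *: "\<And>N2. sublinear N2 \<Longrightarrow> (\<And>f. N2 f \<le> N1 f) \<Longrightarrow> N2 (\<lambda>x. - w x) = - N2 w \<Longrightarrow> thesis"
      show thesis by (rule sublinear_linearize[OF N1(1), of w thesis]) (rule *)
    qed
    have "N2 (\<lambda>x. - v x) = - N2 v" if "v \<in> B" for v
      using N1(3) that N2(2)[of v] N2(2)[of "\<lambda>x. - v x"] sublinear_neg[OF N2(1), of v] by fastforce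
    then show ?case using N1 N2 by (intro exI[of _ N2]) (auto intro!: order_trans[OF N2(2)])
  qed
  then show thesis using that by blast
qed

text \<open>A sublinear functional that is odd at every unit vector of \<open>V\<close> and sees
  only the values on \<open>V\<close> is linear. \<open>sublinear_linearize_finite\<close> supplies
  the first property and \<open>loc\<close> the second; the infimal convolution made beforehand
  forces agreement with \<open>l\<close> on \<open>S\<close>.\<close>

lemma Hahn_Banach_finite:
  fixes N :: "('a \<Rightarrow> real) \<Rightarrow> real"
  assumes fin: "finite V" and N: "sublinear N"
    and loc: "\<And>f g. (\<And>x. x \<in> V \<Longrightarrow> f x = g x) \<Longrightarrow> N f = N g"
    and S0: "(\<lambda>x. 0) \<in> S" "l (\<lambda>x. 0) = 0"
    and Sadd: "\<And>f g. f \<in> S \<Longrightarrow> g \<in> S \<Longrightarrow> (\<lambda>x. f x + g x) \<in> S \<and> l (\<lambda>x. f x + g x) = l f + l g"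
    and Sscale: "\<And>c f. f \<in> S \<Longrightarrow> (\<lambda>x. c * f x) \<in> S \<and> l (\<lambda>x. c * f x) = c * l f"
    and le: "\<And>f. f \<in> S \<Longrightarrow> l f \<le> N f"
  obtains c where "\<And>f. (\<Sum>x\<in>V. c x * f x) \<le> N f" "\<And>f. f \<in> S \<Longrightarrow> (\<Sum>x\<in>V. c x * f x) = l f"
proof -
  have neg: "l (\<lambda>x. - g x) = - l g" "(\<lambda>x. - g x) \<in> S" if "g \<in> S" for g
    using Sscale[OF that, of "-1"] by auto
  obtain q where q: "sublinear q" "\<And>f. q f \<le> N f" "\<And>f g. g \<in> S \<Longrightarrow> q f \<le> N (\<lambda>x. f x + g x) - l g"
    by (rule sublinear_inf_convolution[OF N, of S l]) (use S0 Sadd Sscale le in blast)+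
  note qN = q(2) and qle = q(3)
  have qS: "q f \<le> l f" if "f \<in> S" for f
    using qle[of "\<lambda>x. - f x" f] neg[OF that] sublinear_zero[OF N] by simp
  define e where "e x = (\<lambda>y. if y = x then 1 else 0 :: real)" for x :: 'a
  obtain r where r: "sublinear r" "\<And>f. r f \<le> q f" "\<And>v. v \<in> e ` V \<Longrightarrow> r (\<lambda>x. - v x) = - r v"
    using sublinear_linearize_finite[of "e ` V" q] fin q(1) by blast
  define c where "c x = r (e x)" for x
  have rloc: "r f = r g" if "\<And>x. x \<in> V \<Longrightarrow> f x = g x" for f g
  proof -
    have 0: "r (\<lambda>x. f x - g x) \<le> 0" if "\<And>x. x \<in> V \<Longrightarrow> f x = g x" for f g
    proof -
      have "N (\<lambda>x. f x - g x) = N (\<lambda>x. 0)" by (rule loc) (use that in auto)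
      then show ?thesis using r(2)[of "\<lambda>x. f x - g x"] qN[of "\<lambda>x. f x - g x"] sublinear_zero[OF N] by simp
    qed
    have "r f \<le> r g" if "\<And>x. x \<in> V \<Longrightarrow> f x = g x" for f g
      using sublinear_add[OF r(1), of "\<lambda>x. f x - g x" g] 0[of f g] that by simp
    from this[of f g] this[of g f] that show ?thesis by auto
  qed
  have up: "r f \<le> (\<Sum>x\<in>V. c x * f x)" for f
  proof -
    have one: "r (\<lambda>y. f x * e x y) \<le> c x * f x" if x: "x \<in> V" for x f
    proof (cases "0 \<le> f x")
      case True
      then show ?thesis using sublinear_scale[OF r(1) True, of "e x"] by (simp add: c_def)
    next
      case False
      have "r (\<lambda>y. f x * e x y) = r (\<lambda>y. (- f x) * (- e x y))" by simp
      also have "\<dots> = (- f x) * r (\<lambda>y. - e x y)"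
        by (rule sublinear_scale[OF r(1)]) (use False in auto)
      finally show ?thesis using r(3)[of "e x"] x by (simp add: c_def)
    qed
    have "r (\<lambda>y. \<Sum>x\<in>W. f x * e x y) \<le> (\<Sum>x\<in>W. c x * f x)" if "W \<subseteq> V" for W
      using finite_subset[OF that fin] that
    proof (induction W)
      case empty
      then show ?case using sublinear_zero[OF r(1)] by simp
    next
      case (insert w W)
      have "r (\<lambda>y. \<Sum>x\<in>insert w W. f x * e x y) \<le> r (\<lambda>y. f w * e w y) + r (\<lambda>y. \<Sum>x\<in>W. f x * e x y)"
        using sublinear_add[OF r(1), of "\<lambda>y. f w * e w y" "\<lambda>y. \<Sum>x\<in>W. f x * e x y"] insert by simp
      also have "\<dots> \<le> c w * f w + (\<Sum>x\<in>W. c x * f x)" using one insert by (intro add_mono) auto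
      finally show ?case using insert by simp
    qed
    moreover have "r f = r (\<lambda>y. \<Sum>x\<in>V. f x * e x y)"
      by (rule rloc) (use fin in \<open>simp add: e_def if_distrib cong: if_cong\<close>)
    ultimately show ?thesis by auto
  qed
  have down: "(\<Sum>x\<in>V. c x * f x) \<le> r f" for f
    using up[of "\<lambda>x. - f x"] sublinear_neg[OF r(1), of f] by (simp add: sum_negf)
  have lin: "(\<Sum>x\<in>V. c x * f x) = r f" for f using up down by (simp add: antisym)
  show thesis
  proof (rule that[of c])
    show "(\<Sum>x\<in>V. c x * f x) \<le> N f" for f using lin r(2)[of f] qN[of f] by simp
    show "(\<Sum>x\<in>V. c x * f x) = l f" if "f \<in> S" for f
    proof -
      have a: "r f \<le> l f" using r(2)[of f] qS[OF that] by simp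
      have b: "r (\<lambda>x. - f x) \<le> - l f" using r(2)[of "\<lambda>x. - f x"] qS[of "\<lambda>x. - f x"] neg[OF that] by simp
      have c: "r (\<lambda>x. - f x) = - r f" by (simp add: sum_negf flip: lin)
      show ?thesis using a b lin c by simp
    qed
  qed
qed

section \<open>Fekete's lemma\<close>

lemma Fekete:
  fixes x :: "nat \<Rightarrow> real"
  assumes sub: "\<And>m n. 0 < m \<Longrightarrow> 0 < n \<Longrightarrow> x (m + n) \<le> x m + x n"
    and low: "\<And>n. 0 < n \<Longrightarrow> c * real n \<le> x n"
  obtains l where "(\<lambda>n. x n / real n) \<longlonglongrightarrow> l"
proof -
  define l where "l = Inf ((\<lambda>n. x n / real n) ` {0<..})"
  have bdd: "bdd_below ((\<lambda>n. x n / real n) ` {0<..})"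
    using low by (auto intro!: bdd_belowI[of _ c] simp: field_simps)
  have ge: "l \<le> x n / real n" if "0 < n" for n
    unfolding l_def by (rule cInf_lower[OF _ bdd]) (use that in auto)
  have mult: "x (q * m) \<le> real q * x m" if "0 < q" "0 < m" for q m
    using that(1)
  proof (induction q rule: nat_induct_non_zero)
    case (Suc n)
    then show ?case using sub[of m "n * m"] that by (simp add: algebra_simps)
  qed simp
  have "(\<lambda>n. x n / real n) \<longlonglongrightarrow> l"
  proof (rule LIMSEQ_I)
    fix e :: real assume e: "0 < e"
    have "\<exists>m>0. x m / real m < l + e / 2"
    proof (rule ccontr)
      assume "\<not> ?thesis"
      then have "l + e / 2 \<le> x n / real n" if "0 < n" for n using that \<open>\<not> (\<exists>m>0. x m / real m < l + e / 2)\<close> not_less by blast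
      then have "l + e / 2 \<le> l" by (subst (2) l_def, intro cInf_greatest) auto
      then show False using e by simp
    qed
    then obtain m where m: "0 < m" "x m / real m < l + e / 2" by auto
    \<comment> \<open>Bounds the remainder term \<open>x r - r * (x m / m)\<close> for every
      \<open>r\<close> with \<open>0 < r \<le> 2 * m\<close>, independently of
      \<open>n\<close>.\<close>
    define B where "B = (\<Sum>r\<le>2 * m. \<bar>x r\<bar>) + real (2 * m) * \<bar>x m / real m\<bar>"
    obtain n0 where n0: "2 * B / e < real n0" using reals_Archimedean2 by blast
    show "\<exists>no. \<forall>n\<ge>no. norm (x n / real n - l) < e"
    proof (intro exI allI impI)
      fix n assume n: "n \<ge> max (Suc n0) (2 * m)"
      \<comment> \<open>One block fewer than \<open>n div m\<close>: the remainder \<open>r\<close>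
        is then at least \<open>m\<close>, hence positive, as subadditivity is assumed for positive
        arguments only.\<close>
      define q where "q = n div m - 1"
      define r where "r = n - q * m"
      have "2 \<le> n div m" using n m by (simp add: less_eq_div_iff_mult_less_eq)
      then have q: "0 < q" "n div m = q + 1" by (auto simp: q_def)
      have "n = (n div m) * m + n mod m" by simp
      then have nn: "n = q * m + (m + n mod m)" using q by (simp add: algebra_simps)
      then have r: "r = m + n mod m" by (simp add: r_def)
      have rb: "0 < r" "r \<le> 2 * m" using r m by (auto simp: less_imp_le add_mono mult_2)
      have n': "n = q * m + r" using nn r by simp
      have "x n \<le> x (q * m) + x r" unfolding n' using q m rb by (intro sub) auto
      also have "x (q * m) \<le> real q * x m" using q m by (intro mult)
      also have "real q * x m = real (q * m) * (x m / real m)" using m by simp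
      also have "\<dots> = real n * (x m / real m) - real r * (x m / real m)"
        using n' by (simp add: algebra_simps)
      finally have "x n \<le> real n * (x m / real m) + (x r - real r * (x m / real m))" by simp
      also have "x r - real r * (x m / real m) \<le> B"
      proof -
        have "x r \<le> (\<Sum>r\<le>2 * m. \<bar>x r\<bar>)"
          using member_le_sum[of r "{..2 * m}" "\<lambda>r. \<bar>x r\<bar>"] rb by auto
        moreover have 2: "- (real r * (x m / real m)) \<le> real r * \<bar>x m / real m\<bar>"
          using abs_ge_minus_self[of "real r * (x m / real m)"] by (simp add: abs_mult)
        moreover have "real r * \<bar>x m / real m\<bar> \<le> real (2 * m) * \<bar>x m / real m\<bar>"
          using rb by (intro mult_right_mono) linarith+
        ultimately show ?thesis
          unfolding B_def diff_conv_add_uminus[of "x r"] by (intro add_mono order_trans[OF 2])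
      qed
      finally have "x n / real n \<le> x m / real m + B / real n"
        using n m by (simp add: field_simps)
      moreover have "B / real n < e / 2"
      proof -
        have "2 * B / e < real n" using n0 n by linarith
        then show ?thesis using e n m by (simp add: field_simps)
      qed
      ultimately have "x n / real n < l + e" using m by linarith
      moreover have "l \<le> x n / real n" using n m by (intro ge) auto
      ultimately show "norm (x n / real n - l) < e" by simp
    qed
  qed
  then show thesis by (rule that)
qed

section \<open>Combinatorics of the carpet cells\<close>

definition digits :: "(int \<times> int) set" where
  "digits = {0, 1, 2} \<times> {0, 1, 2} - {(1, 1)}"

text \<open>In ternary notation, the digits of \<open>q\<close> followed by the \<open>m\<close>
  digits of \<open>r\<close>: the cell at relative position \<open>r\<close> inside the cell
  \<open>q\<close>.\<close>

definition blk :: "nat \<Rightarrow> int \<times> int \<Rightarrow> int \<times> int \<Rightarrow> int \<times> int" where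
  "blk m q r = (3 ^ m * fst q + fst r, 3 ^ m * snd q + snd r)"

text \<open>The cell \<open>(i, j)\<close> of level \<open>n\<close> is the copy of the carpet in the square with lower left corner
  \<open>(i, j) / 3\<^sup>n\<close>.\<close>

primrec cells :: "nat \<Rightarrow> (int \<times> int) set" where
  "cells 0 = {(0, 0)}"
| "cells (Suc n) = case_prod (blk n) ` (digits \<times> cells n)"

declare cells.simps(2) [simp del]

lemma fst_blk [simp]: "fst (blk m q r) = 3 ^ m * fst q + fst r"
  and snd_blk [simp]: "snd (blk m q r) = 3 ^ m * snd q + snd r"
  by (simp_all add: blk_def)

lemma blk_assoc: "blk m (blk n d q) r = blk (n + m) d (blk m q r)"
  by (simp add: blk_def power_add algebra_simps)

lemma cells_add: "cells (n + m) = case_prod (blk m) ` (cells n \<times> cells m)"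
proof (induction n)
  case 0
  have "blk m (0, 0) x = x" for x by (simp add: blk_def)
  then have "case_prod (blk m) ` ({(0, 0)} \<times> cells m) = cells m" by (simp add: image_def)
  then show ?case by simp
next
  case (Suc n)
  have "cells (Suc n + m) = case_prod (blk (n + m)) ` (digits \<times> (case_prod (blk m) ` (cells n \<times> cells m)))"
    using Suc by (simp add: cells.simps(2))
  also have "\<dots> = case_prod (blk m) ` (cells (Suc n) \<times> cells m)"
  proof (intro set_eqI iffI)
    fix x assume "x \<in> case_prod (blk (n + m)) ` (digits \<times> (case_prod (blk m) ` (cells n \<times> cells m)))"
    then obtain d q r where "d \<in> digits" "q \<in> cells n" "r \<in> cells m" "x = blk (n + m) d (blk m q r)" by auto
    then show "x \<in> case_prod (blk m) ` (cells (Suc n) \<times> cells m)"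
      by (intro image_eqI[of _ _ "(blk n d q, r)"]) (auto simp: blk_assoc cells.simps(2))
  next
    fix x assume "x \<in> case_prod (blk m) ` (cells (Suc n) \<times> cells m)"
    then obtain d q r where "d \<in> digits" "q \<in> cells n" "r \<in> cells m" "x = blk m (blk n d q) r" by (auto simp: cells.simps(2))
    then show "x \<in> case_prod (blk (n + m)) ` (digits \<times> (case_prod (blk m) ` (cells n \<times> cells m)))"
      by (intro image_eqI[of _ _ "(d, blk m q r)"]) (auto simp: blk_assoc)
  qed
  finally show ?case .
qed

lemma cells_range:
  "q \<in> cells n \<Longrightarrow> 0 \<le> fst q \<and> fst q < 3 ^ n \<and> 0 \<le> snd q \<and> snd q < 3 ^ n"
proof (induction n arbitrary: q)
  case (Suc n)
  then obtain d r where dr: "d \<in> digits" "r \<in> cells n" "q = blk n d r" by (auto simp: cells.simps(2))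
  have "d \<in> {0,1,2} \<times> {0,1,2}" using dr by (auto simp: digits_def)
  then show ?case using Suc.IH[OF dr(2)] by (auto simp: dr(3))
qed auto

lemma blk_div_mod:
  assumes "0 \<le> fst r" "fst r < 3 ^ m" "0 \<le> snd r" "snd r < 3 ^ m"
  shows "fst (blk m q r) div 3 ^ m = fst q" "fst (blk m q r) mod 3 ^ m = fst r"
    "snd (blk m q r) div 3 ^ m = snd q" "snd (blk m q r) mod 3 ^ m = snd r"
  using assms by auto

lemma blk_inj:
  assumes "r \<in> cells m" "r' \<in> cells m" "blk m q r = blk m q' r'"
  shows "q = q'" "r = r'"
  using blk_div_mod[of r m q] blk_div_mod[of r' m q'] cells_range[OF assms(1)] cells_range[OF assms(2)] assms(3)
  by (auto simp del: fst_blk snd_blk intro!: prod_eqI)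

lemma bij_blk: "bij_betw (case_prod (blk m)) (cells n \<times> cells m) (cells (n + m))"
proof -
  have "inj_on (case_prod (blk m)) (cells n \<times> cells m)"
  proof (rule inj_onI, clarsimp simp del: fst_blk snd_blk)
    fix a b c d a' b' c' d'
    assume "(c, d) \<in> cells m" "(c', d') \<in> cells m" "blk m (a, b) (c, d) = blk m (a', b') (c', d')"
    from blk_inj[OF this] show "a = a' \<and> b = b' \<and> c = c' \<and> d = d'" by simp
  qed
  then show ?thesis by (simp add: bij_betw_def cells_add)
qed

lemma blk_in_cells: "q \<in> cells n \<Longrightarrow> r \<in> cells m \<Longrightarrow> blk m q r \<in> cells (n + m)"
  unfolding cells_add by auto

lemma cells_blkE:
  assumes "a \<in> cells (n + m)"
  obtains q r where "q \<in> cells n" "r \<in> cells m" "a = blk m q r"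
  using assms unfolding cells_add by auto

lemma finite_cells [simp]: "finite (cells n)"
  by (induction n) (auto simp: digits_def cells.simps(2))

lemma sum_cells_add: "(\<Sum>a\<in>cells (n + m). f a) = (\<Sum>q\<in>cells n. \<Sum>r\<in>cells m. f (blk m q r))"
  using sum.reindex_bij_betw[OF bij_blk, of f m n, symmetric] by (simp add: sum.cartesian_product case_prod_unfold)

lemma cells_1: "cells (Suc 0) = digits"
proof -
  have "case_prod (blk 0) ` (digits \<times> {(0, 0)}) = (\<lambda>d. blk 0 d (0, 0)) ` digits" by force
  also have "\<dots> = digits" by (simp add: blk_def)
  finally show ?thesis by (simp add: cells.simps(2))
qed

lemma card_cells: "card (cells n) = 8 ^ n"
proof (induction n)
  case (Suc n)
  have "card (cells (1 + n)) = card (cells 1 \<times> cells n)"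
    using bij_betw_same_card[OF bij_blk] by metis
  moreover have "card (cells 1) = 8" unfolding One_nat_def cells_1 digits_def by (simp add: card_Diff_subset card_cartesian_product)
  ultimately show ?case using Suc by (simp add: card_cartesian_product)
qed simp

text \<open>The recursion of \<open>cells\<close> splits off the leading ternary digit of both
  coordinates; this form splits off the last one, by \<open>cells_add\<close> with one fine level. A
  cell is thus a pair of digit strings that never carry 1 at the same position, and the symmetries
  below follow digit by digit.\<close>

lemma cells_Suc_iff:
  "(x, y) \<in> cells (Suc n) \<longleftrightarrow> (x div 3, y div 3) \<in> cells n \<and> \<not> (x mod 3 = 1 \<and> y mod 3 = 1)"
proof
  assume "(x, y) \<in> cells (Suc n)"
  then have "(x, y) \<in> cells (n + 1)" by simp
  then obtain q r where q: "q \<in> cells n" and r: "r \<in> cells 1" and xy: "(x, y) = blk 1 q r"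
    by (rule cells_blkE)
  have "r \<in> digits" using r unfolding One_nat_def cells_1 .
  note qr = q this xy
  have r3: "0 \<le> fst r \<and> fst r < 3 \<and> 0 \<le> snd r \<and> snd r < 3 \<and> \<not> (fst r = 1 \<and> snd r = 1)"
    using qr(2) by (cases r) (auto simp: digits_def)
  have e: "x div 3 = fst q" "x mod 3 = fst r" "y div 3 = snd q" "y mod 3 = snd r"
    using blk_div_mod[of r 1 q] r3 unfolding xy[symmetric] fst_conv snd_conv power_one_right by blast+
  show "(x div 3, y div 3) \<in> cells n \<and> \<not> (x mod 3 = 1 \<and> y mod 3 = 1)"
    unfolding e prod.collapse using qr(1) r3 by blast
next
  assume a: "(x div 3, y div 3) \<in> cells n \<and> \<not> (x mod 3 = 1 \<and> y mod 3 = 1)"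
  have d: "(u, v) \<in> digits" if "u \<in> {0,1,2}" "v \<in> {0,1,2}" "\<not> (u = 1 \<and> v = 1)" for u v
    using that by (auto simp: digits_def)
  have "x mod 3 \<in> {0,1,2}" "y mod 3 \<in> {0,1,2}" by auto
  then have "(x mod 3, y mod 3) \<in> cells 1" using a unfolding One_nat_def cells_1 by (intro d) blast+
  then have "blk 1 (x div 3, y div 3) (x mod 3, y mod 3) \<in> cells (n + 1)" using a by (intro blk_in_cells) auto
  then show "(x, y) \<in> cells (Suc n)" by (simp add: blk_def)
qed

lemma cells_swap: "(x, y) \<in> cells n \<Longrightarrow> (y, x) \<in> cells n"
  by (induction n arbitrary: x y) (auto simp: cells_Suc_iff)

lemma cells_swap_iff: "prod.swap q \<in> cells n \<longleftrightarrow> q \<in> cells n"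
  using cells_swap by (cases q) (auto simp: prod.swap_def)

text \<open>Reflection replaces each ternary digit \<open>d\<close> by \<open>2 - d\<close> and so
  fixes the critical digit 1.\<close>

lemma reflect_div_mod_3:
  fixes x :: int
  shows "(3 * N - 1 - x) div 3 = N - 1 - x div 3" "(3 * N - 1 - x) mod 3 = 2 - x mod 3"
proof -
  have *: "3 * N - 1 - x = 3 * (N - 1 - x div 3) + (2 - x mod 3)"
    using mult_div_mod_eq[of 3 x] by (simp add: algebra_simps)
  have "0 \<le> 2 - x mod 3" "2 - x mod 3 < 3" by auto
  then show "(3 * N - 1 - x) div 3 = N - 1 - x div 3" "(3 * N - 1 - x) mod 3 = 2 - x mod 3"
    unfolding * by (simp_all only: div_mult_self4[of 3] mod_mult_self4[of 3]) auto
qed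

lemma cells_reflect_x: "(x, y) \<in> cells n \<Longrightarrow> (3 ^ n - 1 - x, y) \<in> cells n"
proof (induction n arbitrary: x y)
  case (Suc n)
  then show ?case using Suc.IH[of "x div 3" "y div 3"]
    by (auto simp: cells_Suc_iff reflect_div_mod_3)
qed auto

lemma cells_reflect_y: "(x, y) \<in> cells n \<Longrightarrow> (x, 3 ^ n - 1 - y) \<in> cells n"
  using cells_swap cells_reflect_x by blast

lemma cells_left: "0 \<le> y \<Longrightarrow> y < 3 ^ n \<Longrightarrow> (0, y) \<in> cells n"
proof (induction n arbitrary: y)
  case (Suc n)
  then show ?case by (auto simp: cells_Suc_iff)
qed auto

lemma cells_right: "0 \<le> y \<Longrightarrow> y < 3 ^ n \<Longrightarrow> (3 ^ n - 1, y) \<in> cells n"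
  using cells_left[of y n] cells_reflect_x[of 0 y n] by simp

lemma cells_bottom: "0 \<le> x \<Longrightarrow> x < 3 ^ n \<Longrightarrow> (x, 0) \<in> cells n"
  using cells_left cells_swap by blast

lemma cells_top: "0 \<le> x \<Longrightarrow> x < 3 ^ n \<Longrightarrow> (x, 3 ^ n - 1) \<in> cells n"
  using cells_right cells_swap by blast

section \<open>The graph of touching cells, its energy and its conductance\<close>

definition near :: "int \<times> int \<Rightarrow> int \<times> int \<Rightarrow> bool" where
  "near a b \<longleftrightarrow> \<bar>fst a - fst b\<bar> \<le> 1 \<and> \<bar>snd a - snd b\<bar> \<le> 1"

lemma near_refl [simp]: "near a a" by (simp add: near_def)

lemma near_sym: "near a b \<Longrightarrow> near b a" by (auto simp: near_def)

text \<open>Removed squares do not touch each other.\<close>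

lemma cells_corner:
  assumes "(x, y) \<in> cells n" "(x', y') \<in> cells n" "\<bar>x - x'\<bar> = 1" "\<bar>y - y'\<bar> = 1"
  shows "(x, y') \<in> cells n \<or> (x', y) \<in> cells n"
  using assms
proof (induction n arbitrary: x y x' y')
  case (Suc n)
  have p: "(x div 3, y div 3) \<in> cells n" "(x' div 3, y' div 3) \<in> cells n"
    and c: "\<not> (x mod 3 = 1 \<and> y mod 3 = 1)" "\<not> (x' mod 3 = 1 \<and> y' mod 3 = 1)"
    using Suc.prems(1,2) unfolding cells_Suc_iff by auto
  have div: "z div 3 = z' div 3 \<and> z mod 3 \<noteq> z' mod 3 \<or>
     \<bar>z div 3 - z' div 3\<bar> = 1 \<and> z mod 3 \<noteq> 1 \<and> z' mod 3 \<noteq> 1" if "\<bar>z - z'\<bar> = 1" for z z' :: int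
  proof -
    have *: "z div 3 = (z + 1) div 3 \<and> z mod 3 \<noteq> (z + 1) mod 3 \<or>
      \<bar>z div 3 - (z + 1) div 3\<bar> = 1 \<and> z mod 3 \<noteq> 1 \<and> (z + 1) mod 3 \<noteq> 1" for z :: int
    proof -
      define k where "k = z div 3"
      have "z = 3 * k + z mod 3" by (simp add: k_def)
      moreover have "z mod 3 \<in> {0, 1, 2}" by auto
      ultimately consider "z = 3 * k" | "z = 3 * k + 1" | "z = 3 * k + 2" by auto
      then show ?thesis
      proof cases
        case 1 then show ?thesis by simp
      next
        case 2 then show ?thesis by simp
      next
        case 3
        then have "z + 1 = 3 * (k + 1)" by simp
        then have "(z + 1) div 3 = k + 1" "(z + 1) mod 3 = 0" by simp_all
        then show ?thesis using 3 by simp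
      qed
    qed
    have "z' = z + 1 \<or> z = z' + 1" using that by auto
    then show ?thesis
    proof
      assume "z' = z + 1"
      then show ?thesis using *[of z] by blast
    next
      assume "z = z' + 1"
      then show ?thesis using *[of z'] abs_minus_commute[of "z div 3" "z' div 3"] by metis
    qed
  qed
  \<comment> \<open>The induction hypothesis is needed only if both coordinates change block, and
    then no last digit is 1. If a coordinate stays in its block, both candidate corners have parents
    already known to be cells, and the digits rule out that both candidates are removed.\<close>
  show ?case
    using div[OF Suc.prems(3)] div[OF Suc.prems(4)]
  proof (elim disjE)
    assume "\<bar>x div 3 - x' div 3\<bar> = 1 \<and> x mod 3 \<noteq> 1 \<and> x' mod 3 \<noteq> 1"
      "\<bar>y div 3 - y' div 3\<bar> = 1 \<and> y mod 3 \<noteq> 1 \<and> y' mod 3 \<noteq> 1"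
    then show ?thesis using Suc.IH[OF p] by (auto simp: cells_Suc_iff)
  qed (use p c in \<open>auto simp: cells_Suc_iff\<close>)
qed auto

text \<open>Contact at a single corner counts, and every edge occurs in both orientations. By
  \<open>cell_sets_meet\<close> this is the edge relation of the graph G_m.\<close>

definition adj :: "nat \<Rightarrow> ((int \<times> int) \<times> (int \<times> int)) set" where
  "adj n = {(a, b). a \<in> cells n \<and> b \<in> cells n \<and> a \<noteq> b \<and> near a b}"

lemma finite_adj [simp]: "finite (adj n)"
  by (rule finite_subset[of _ "cells n \<times> cells n"]) (auto simp: adj_def)

definition nbrs :: "nat \<Rightarrow> int \<times> int \<Rightarrow> (int \<times> int) set" where
  "nbrs n a = {b \<in> cells n. near a b}"

lemma finite_nbrs [simp]: "finite (nbrs n a)" by (simp add: nbrs_def)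

lemma card_nbrs_le: "card (nbrs n a) \<le> 9"
proof -
  have "nbrs n a \<subseteq> {fst a - 1..fst a + 1} \<times> {snd a - 1..snd a + 1}"
    by (auto simp: nbrs_def near_def)
  from card_mono[OF _ this] show ?thesis by (simp add: card_cartesian_product)
qed

lemma adj_eq: "adj n = Sigma (cells n) (\<lambda>a. nbrs n a - {a})"
  by (auto simp: adj_def nbrs_def)

lemma sum_nbrs_le:
  fixes F :: "int \<times> int \<Rightarrow> real"
  assumes "\<And>a. a \<in> cells n \<Longrightarrow> 0 \<le> F a"
  shows "(\<Sum>a\<in>cells n. \<Sum>b\<in>nbrs n a. F b) \<le> 9 * (\<Sum>a\<in>cells n. F a)"
    "(\<Sum>a\<in>cells n. \<Sum>b\<in>nbrs n a. F a) \<le> 9 * (\<Sum>a\<in>cells n. F a)"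
proof -
  show 1: "(\<Sum>a\<in>cells n. \<Sum>b\<in>nbrs n a. F a) \<le> 9 * (\<Sum>a\<in>cells n. F a)"
    unfolding sum_distrib_left
  proof (intro sum_mono)
    fix a assume "a \<in> cells n"
    then show "(\<Sum>b\<in>nbrs n a. F a) \<le> 9 * F a"
      using assms card_nbrs_le[of n a] by (simp add: mult_right_mono)
  qed
  have "(\<Sum>a\<in>cells n. \<Sum>b\<in>nbrs n a. F b) = (\<Sum>b\<in>cells n. \<Sum>a\<in>nbrs n b. F b)"
    unfolding nbrs_def by (subst sum.swap_restrict) (auto intro!: sum.cong simp: near_def)
  then show "(\<Sum>a\<in>cells n. \<Sum>b\<in>nbrs n a. F b) \<le> 9 * (\<Sum>a\<in>cells n. F a)" using 1 by simp
qed

lemma sum_adj_le: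
  fixes F :: "int \<times> int \<Rightarrow> real"
  assumes "\<And>a. a \<in> cells n \<Longrightarrow> 0 \<le> F a"
  shows "(\<Sum>(a, b)\<in>adj n. F a) \<le> 9 * (\<Sum>a\<in>cells n. F a)"
    "(\<Sum>(a, b)\<in>adj n. F b) \<le> 9 * (\<Sum>a\<in>cells n. F a)"
proof -
  have "(\<Sum>(a, b)\<in>adj n. F a) \<le> (\<Sum>a\<in>cells n. \<Sum>b\<in>nbrs n a. F a)"
    "(\<Sum>(a, b)\<in>adj n. F b) \<le> (\<Sum>a\<in>cells n. \<Sum>b\<in>nbrs n a. F b)"
    unfolding adj_eq
    by (subst sum.Sigma[symmetric], simp, simp, intro sum_mono sum_mono2,
        use assms in \<open>auto simp: nbrs_def\<close>)+
  then show "(\<Sum>(a, b)\<in>adj n. F a) \<le> 9 * (\<Sum>a\<in>cells n. F a)"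
    "(\<Sum>(a, b)\<in>adj n. F b) \<le> 9 * (\<Sum>a\<in>cells n. F a)"
    using sum_nbrs_le[of n F] assms by auto
qed

text \<open>Each undirected edge is counted twice, so this is twice \<open>graph_energy\<close> (see
  \<open>graph_energy_code\<close>); growth rates do not notice the factor.\<close>

definition energy :: "real \<Rightarrow> nat \<Rightarrow> (int \<times> int \<Rightarrow> real) \<Rightarrow> real" where
  "energy p n f = (\<Sum>(a, b)\<in>adj n. \<bar>f a - f b\<bar> powr p)"

lemma energy_nonneg: "0 \<le> energy p n f"
  by (auto simp: energy_def intro!: sum_nonneg)

lemma energy_cong: "(\<And>a. a \<in> cells n \<Longrightarrow> f a = g a) \<Longrightarrow> energy p n f = energy p n g"
  unfolding energy_def by (intro sum.cong) (auto simp: adj_def)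

lemma energy_edge:
  assumes "a \<in> cells n" "b \<in> cells n" "near a b"
  shows "\<bar>f a - f b\<bar> powr p \<le> energy p n f"
proof (cases "a = b")
  case False
  show ?thesis
  proof -
    have "(a, b) \<in> adj n" using False assms by (simp add: adj_def)
    from member_le_sum[OF this, of "\<lambda>(a, b). \<bar>f a - f b\<bar> powr p"] show ?thesis
      by (auto simp: energy_def)
  qed
qed (simp add: energy_nonneg)

lemma energy_eq_nbrs: "energy p n f = (\<Sum>a\<in>cells n. \<Sum>b\<in>nbrs n a. \<bar>f a - f b\<bar> powr p)"
  unfolding energy_def adj_eq
  by (subst sum.Sigma[symmetric], simp, simp, intro sum.cong sum.mono_neutral_left) auto

definition crossing :: "nat \<Rightarrow> (int \<times> int \<Rightarrow> real) \<Rightarrow> bool" where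
  "crossing n f \<longleftrightarrow> (\<forall>y. (0, y) \<in> cells n \<longrightarrow> f (0, y) = 0) \<and> (\<forall>y. (3 ^ n - 1, y) \<in> cells n \<longrightarrow> f (3 ^ n - 1, y) = 1)"

definition conductance :: "real \<Rightarrow> nat \<Rightarrow> real" where
  "conductance p n = Inf {energy p n f | f. crossing n f}"

lemma conductance_le: "crossing n f \<Longrightarrow> conductance p n \<le> energy p n f"
  unfolding conductance_def by (rule cInf_lower) (auto intro!: bdd_belowI[of _ 0] energy_nonneg)

lemma three_power_gt_1: "0 < n \<Longrightarrow> 1 < (3::int) ^ n"
  by (simp add: one_less_power)

lemma crossing_linear:
  assumes "0 < n" shows "crossing n (\<lambda>q. real_of_int (fst q) / (3 ^ n - 1))"
proof -
  have "(1::real) < 3 ^ n" using assms by (simp add: one_less_power)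
  then show ?thesis by (auto simp: crossing_def)
qed

lemma conductance_less:
  assumes "0 < n" "conductance p n < c"
  obtains f where "crossing n f" "energy p n f < c"
proof -
  have "{energy p n f | f. crossing n f} \<noteq> {}" using crossing_linear[OF assms(1)] by auto
  moreover have "bdd_below {energy p n f | f. crossing n f}" by (auto intro!: bdd_belowI[of _ 0] energy_nonneg)
  ultimately show thesis
    using assms(2) that unfolding conductance_def by (auto simp: cInf_less_iff)
qed

text \<open>In the bottom row the values climb from 0 to 1 in \<open>3 ^ n - 1\<close> steps, so
  some edge carries at least the mean increment. This crude bound serves for positivity and for the
  lower bound that \<open>Fekete\<close> asks for.\<close>

lemma conductance_lower:
  assumes "0 < n" "0 < p"
  shows "(1 / 3 ^ n) powr p \<le> conductance p n"
  unfolding conductance_def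
proof (rule cInf_greatest)
  show "{energy p n f | f. crossing n f} \<noteq> {}" using crossing_linear[OF assms(1)] by auto
next
  fix e assume "e \<in> {energy p n f | f. crossing n f}"
  then obtain f where f: "crossing n f" "e = energy p n f" by auto
  define N where "N = (3::nat) ^ n - 1"
  have N: "0 < N" "N < 3 ^ n" "int N = 3 ^ n - 1" "real N = 3 ^ n - 1"
    using assms one_less_power[of "3::nat" n] by (auto simp: N_def of_nat_diff)
  have mem: "(int i, 0) \<in> cells n" if "i \<le> N" for i
    using that N by (intro cells_bottom) auto
  have "f (int N, 0) = 1" "f (0, 0) = 0" using f mem[of 0] mem[of N] N by (auto simp: crossing_def)
  then have "1 = (\<Sum>i<N. f (int (Suc i), 0) - f (int i, 0))" by (subst sum_lessThan_telescope) auto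
  have "\<exists>i<N. 1 / real N \<le> f (int (Suc i), 0) - f (int i, 0)"
  proof (rule ccontr)
    assume "\<not> ?thesis"
    then have "(\<Sum>i<N. f (int (Suc i), 0) - f (int i, 0)) < (\<Sum>i<N. 1 / real N)"
      using N by (intro sum_strict_mono) (auto simp: not_le)
    then show False using N \<open>1 = _\<close> by simp
  qed
  then obtain i where i: "i < N" "1 / real N \<le> f (int (Suc i), 0) - f (int i, 0)" by auto
  have "1 / 3 ^ n \<le> 1 / real N" using N by (intro divide_left_mono) auto
  then have "(1 / 3 ^ n) powr p \<le> \<bar>f (int (Suc i), 0) - f (int i, 0)\<bar> powr p"
    using i assms by (intro powr_mono2) auto
  also have "\<dots> \<le> energy p n f"
    using mem[of i] mem[of "Suc i"] i by (intro energy_edge) (auto simp: near_def)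
  finally show "(1 / 3 ^ n) powr p \<le> e" using f by simp
qed

lemma conductance_pos: "0 < n \<Longrightarrow> 0 < p \<Longrightarrow> 0 < conductance p n"
  using conductance_lower[of n p] by (metis less_le_trans powr_gt_zero divide_pos_pos zero_less_one zero_less_power zero_less_numeral less_irrefl)

text \<open>Tests with the linear function. There are at most \<open>9 * 8 ^ n\<close> oriented
  edges, and \<open>3 ^ n - 1\<close> is at least half of \<open>3 ^ n\<close>.\<close>

lemma conductance_upper:
  assumes "0 < n" "0 < p"
  shows "conductance p n \<le> 9 * 8 ^ n * (2 / 3 ^ n) powr p"
proof -
  let ?f = "\<lambda>q::int \<times> int. real_of_int (fst q) / (3 ^ n - 1)"
  have n3: "(3::real) \<le> 3 ^ n" using assms power_increasing[of 1 n "3::real"] by simp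
  have "energy p n ?f \<le> (\<Sum>(a, b)\<in>adj n. (2 / 3 ^ n) powr p)"
    unfolding energy_def
  proof (intro sum_mono, clarify)
    fix a b c d assume ab: "((a, b), (c, d)) \<in> adj n"
    have "\<bar>real_of_int (a - c)\<bar> \<le> 1" using ab by (auto simp: adj_def near_def simp flip: of_int_abs of_int_diff)
    then have "\<bar>real_of_int a / (3 ^ n - 1) - real_of_int c / (3 ^ n - 1)\<bar> \<le> 1 / (3 ^ n - 1)"
      using n3 by (simp add: divide_right_mono abs_divide flip: diff_divide_distrib)
    also have "\<dots> \<le> 2 / 3 ^ n" using n3 by (simp add: field_simps)
    finally show "\<bar>?f (a, b) - ?f (c, d)\<bar> powr p \<le> (2 / 3 ^ n) powr p"
      using assms by (intro powr_mono_abs) auto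
  qed
  also have "\<dots> \<le> 9 * (\<Sum>a\<in>cells n. (2 / 3 ^ n) powr p)" by (rule sum_adj_le) auto
  also have "\<dots> = 9 * 8 ^ n * (2 / 3 ^ n) powr p" by (simp add: card_cells)
  finally show ?thesis using conductance_le[OF crossing_linear[OF assms(1)], of p] by simp
qed

section \<open>Vertex functions and submultiplicativity\<close>

text \<open>Lattice points in units of \<open>1 / 3 ^ n\<close>. Values at cells offer no compatible
  interpolation where cells touch; values at lattice points do, because touching cells share corners
  (\<open>near_common_corner\<close>).\<close>

definition corners :: "int \<times> int \<Rightarrow> (int \<times> int) set" where
  "corners q = {q, (fst q + 1, snd q), (fst q, snd q + 1), (fst q + 1, snd q + 1)}"

lemma corners_iff: "z \<in> corners q \<longleftrightarrow> fst z \<in> {fst q, fst q + 1} \<and> snd z \<in> {snd q, snd q + 1}"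
  by (cases z; cases q) (auto simp: corners_def)

definition osc :: "(int \<times> int \<Rightarrow> real) \<Rightarrow> int \<times> int \<Rightarrow> real" where
  "osc a q = Max ((\<lambda>(z, z'). \<bar>a z - a z'\<bar>) ` (corners q \<times> corners q))"

lemma finite_corners [simp]: "finite (corners q)" by (simp add: corners_def)

lemma osc_ge: "z \<in> corners q \<Longrightarrow> z' \<in> corners q \<Longrightarrow> \<bar>a z - a z'\<bar> \<le> osc a q"
  unfolding osc_def by (intro Max_ge) auto

lemma osc_le: "(\<And>z z'. z \<in> corners q \<Longrightarrow> z' \<in> corners q \<Longrightarrow> \<bar>a z - a z'\<bar> \<le> c) \<Longrightarrow> osc a q \<le> c"
  unfolding osc_def by (subst Max_le_iff) (auto, auto simp: corners_def)

lemma osc_nonneg: "0 \<le> osc a q"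
  using osc_ge[of q q q a] by (simp add: corners_def)

lemma osc_attained:
  obtains z z' where "z \<in> corners q" "z' \<in> corners q" "osc a q = \<bar>a z - a z'\<bar>"
proof -
  have "osc a q \<in> (\<lambda>(z, z'). \<bar>a z - a z'\<bar>) ` (corners q \<times> corners q)"
    unfolding osc_def by (rule Max_in) (auto simp: corners_def)
  then show thesis using that by auto
qed

lemma osc_powr_le:
  assumes "\<And>z z'. z \<in> corners q \<Longrightarrow> z' \<in> corners q \<Longrightarrow> \<bar>a z - a z'\<bar> powr p \<le> c"
  shows "osc a q powr p \<le> c"
  using osc_attained[of q a] assms by metis

definition vertex_energy :: "real \<Rightarrow> nat \<Rightarrow> (int \<times> int \<Rightarrow> real) \<Rightarrow> real" where
  "vertex_energy p n a = (\<Sum>q\<in>cells n. osc a q powr p)"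

lemma vertex_energy_nonneg: "0 \<le> vertex_energy p n a"
  by (auto simp: vertex_energy_def intro!: sum_nonneg)

definition vertex_crossing :: "nat \<Rightarrow> (int \<times> int \<Rightarrow> real) \<Rightarrow> bool" where
  "vertex_crossing n h \<longleftrightarrow> (\<forall>y. 0 \<le> y \<and> y \<le> 3 ^ n \<longrightarrow> h (0, y) = 0 \<and> h (3 ^ n, y) = 1)"

lemma near_common_corner: "near a b \<Longrightarrow> (max (fst a) (fst b), max (snd a) (snd b)) \<in> corners a \<inter> corners b"
  by (auto simp: near_def corners_iff max_def)

lemma corners_near: "z \<in> corners a \<Longrightarrow> z \<in> corners b \<Longrightarrow> near a b"
  by (auto simp: near_def corners_iff)

text \<open>Each lattice point takes the value of some cell that touches it, truncated to the unit
  interval. Averaging with the mirror image in the horizontal midline then makes the bottom and the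
  top side agree, as \<open>refine_blk\<close> requires.\<close>

lemma crossing_to_vertex:
  assumes f: "crossing m f" and p: "0 < p"
  obtains h where "vertex_crossing m h" "\<And>z. 0 \<le> h z" "\<And>z. h z \<le> 1" "\<And>x. h (x, 0) = h (x, 3 ^ m)"
    "vertex_energy p m h \<le> 8 powr (p + 1) * energy p m f"
proof -
  define g where "g q = max 0 (min 1 (f q))" for q
  \<comment> \<open>Arbitrary at lattice points that touch no cell; \<open>vertex_energy\<close>
    never sees these. On the left and right sides of the square every admissible choice lies in the
    first or the last column, where \<open>f\<close> is prescribed.\<close>
  define c where "c z = (SOME q. q \<in> cells m \<and> z \<in> corners q)" for z
  define v where "v z = g (c z)" for z
  have c: "c z \<in> cells m \<and> z \<in> corners (c z)" if "q \<in> cells m" "z \<in> corners q" for z q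
    unfolding c_def by (rule someI[of _ q]) (use that in auto)
  have left: "v (0, y) = 0" if "0 \<le> y" "y \<le> 3 ^ m" for y
  proof -
    have "\<exists>q\<in>cells m. (0, y) \<in> corners q"
    proof (cases "y = 3 ^ m")
      case True
      then show ?thesis using cells_left[of "y - 1" m] by (intro bexI[of _ "(0, y - 1)"]) (auto simp: corners_iff)
    next
      case False
      then show ?thesis using cells_left[of y m] that by (intro bexI[of _ "(0, y)"]) (auto simp: corners_iff)
    qed
    then have "c (0, y) \<in> cells m" "(0, y) \<in> corners (c (0, y))" using c by blast+
    moreover from this have "fst (c (0, y)) = 0" using cells_range[of "c (0, y)" m] by (auto simp: corners_iff)
    ultimately have "f (c (0, y)) = 0" using f unfolding crossing_def by (metis prod.collapse)
    then show ?thesis by (simp add: v_def g_def)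
  qed
  have right: "v (3 ^ m, y) = 1" if "0 \<le> y" "y \<le> 3 ^ m" for y
  proof -
    have "\<exists>q\<in>cells m. (3 ^ m, y) \<in> corners q"
    proof (cases "y = 3 ^ m")
      case True
      then show ?thesis using cells_right[of "y - 1" m] by (intro bexI[of _ "(3 ^ m - 1, y - 1)"]) (auto simp: corners_iff)
    next
      case False
      then show ?thesis using cells_right[of y m] that by (intro bexI[of _ "(3 ^ m - 1, y)"]) (auto simp: corners_iff)
    qed
    then have "c (3 ^ m, y) \<in> cells m" "(3 ^ m, y) \<in> corners (c (3 ^ m, y))" using c by blast+
    moreover from this have "fst (c (3 ^ m, y)) = 3 ^ m - 1" using cells_range[of "c (3 ^ m, y)" m] by (auto simp: corners_iff)
    ultimately have "f (c (3 ^ m, y)) = 1" using f unfolding crossing_def by (metis prod.collapse)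
    then show ?thesis by (simp add: v_def g_def)
  qed
  define h where "h z = (v z + v (fst z, 3 ^ m - snd z)) / 2" for z
  have v01: "0 \<le> v z" "v z \<le> 1" for z by (auto simp: v_def g_def)
  define loc where "loc q = (\<Sum>b\<in>nbrs m q. \<bar>f q - f b\<bar> powr p)" for q
  have osc_v: "osc v q powr p \<le> 2 powr p * 2 * loc q" if q: "q \<in> cells m" for q
  proof (rule osc_powr_le)
    have *: "\<bar>v z - g q\<bar> powr p \<le> loc q" if "z \<in> corners q" for z
    proof -
      have cz: "c z \<in> nbrs m q" using c[OF q that] corners_near[OF that] by (auto simp: nbrs_def)
      have "\<bar>v z - g q\<bar> \<le> \<bar>f q - f (c z)\<bar>" by (auto simp: v_def g_def)
      then have "\<bar>v z - g q\<bar> powr p \<le> \<bar>f q - f (c z)\<bar> powr p" using p by (intro powr_mono_abs) auto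
      also have "\<dots> \<le> loc q" unfolding loc_def using cz by (intro member_le_sum) auto
      finally show ?thesis .
    qed
    fix z z' assume z: "z \<in> corners q" "z' \<in> corners q"
    have "\<bar>v z - v z'\<bar> powr p = \<bar>(v z - g q) - (v z' - g q)\<bar> powr p" by simp
    also have "\<dots> \<le> 2 powr p * (\<bar>v z - g q\<bar> powr p + \<bar>v z' - g q\<bar> powr p)" using p by (intro abs_powr_diff_le) auto
    also have "\<dots> \<le> 2 powr p * (loc q + loc q)" using * z by (intro mult_left_mono add_mono) auto
    finally show "\<bar>v z - v z'\<bar> powr p \<le> 2 powr p * 2 * loc q" by simp
  qed
  have Dv: "vertex_energy p m v \<le> 2 powr p * 2 * energy p m f"
    unfolding vertex_energy_def energy_eq_nbrs sum_distrib_left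
    using osc_v by (intro sum_mono) (simp add: loc_def sum_distrib_left)
  define rf where "rf q = (fst q, 3 ^ m - 1 - snd q)" for q :: "int \<times> int"
  have rf_cells: "rf q \<in> cells m" if "q \<in> cells m" for q
    using cells_reflect_y[of "fst q" "snd q" m] that by (simp add: rf_def)
  have osc_h: "osc h q powr p \<le> 2 powr p * (osc v q powr p + osc v (rf q) powr p)" for q
  proof (rule osc_powr_le)
    fix z z' assume z: "z \<in> corners q" "z' \<in> corners q"
    have z': "(fst z, 3 ^ m - snd z) \<in> corners (rf q)" "(fst z', 3 ^ m - snd z') \<in> corners (rf q)"
      using z by (auto simp: corners_iff rf_def)
    have "\<bar>h z - h z'\<bar> \<le> osc v q + osc v (rf q)"
      using osc_ge[OF z, of v] osc_ge[OF z', of v] by (simp add: h_def field_simps)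
    then have "\<bar>h z - h z'\<bar> powr p \<le> (osc v q + osc v (rf q)) powr p" using p by (intro powr_mono_abs) auto
    also have "\<dots> \<le> 2 powr p * (osc v q powr p + osc v (rf q) powr p)" using p by (intro powr_add_le osc_nonneg) auto
    finally show "\<bar>h z - h z'\<bar> powr p \<le> 2 powr p * (osc v q powr p + osc v (rf q) powr p)" .
  qed
  have bij: "bij_betw rf (cells m) (cells m)"
    by (rule bij_betwI[of _ _ _ rf]) (auto simp: rf_cells, auto simp: rf_def)
  have "vertex_energy p m h \<le> (\<Sum>q\<in>cells m. 2 powr p * (osc v q powr p + osc v (rf q) powr p))"
    unfolding vertex_energy_def by (intro sum_mono osc_h)
  also have "\<dots> = 2 powr p * (vertex_energy p m v + (\<Sum>q\<in>cells m. osc v (rf q) powr p))"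
    by (simp add: vertex_energy_def sum.distrib sum_distrib_left distrib_left)
  also have "(\<Sum>q\<in>cells m. osc v (rf q) powr p) = vertex_energy p m v"
    unfolding vertex_energy_def by (rule sum.reindex_bij_betw[OF bij])
  also have "2 powr p * (vertex_energy p m v + vertex_energy p m v) \<le> 2 powr p * (2 powr p * 2 * energy p m f + 2 powr p * 2 * energy p m f)"
    using Dv by (intro mult_left_mono add_mono) auto
  also have "\<dots> = 4 * 4 powr p * energy p m f"
    using powr_mult[of 2 2 p] by simp
  also have "\<dots> \<le> 8 powr (p + 1) * energy p m f"
  proof -
    have "4 powr p \<le> 8 powr p" using p by (intro powr_mono2) auto
    then have "4 * 4 powr p \<le> 8 * 8 powr p" by (intro mult_mono) auto
    also have "\<dots> = 8 powr (p + 1)" by (simp add: powr_add)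
    finally have "4 * 4 powr p \<le> 8 powr (p + 1)" .
    then show ?thesis by (intro mult_right_mono energy_nonneg)
  qed
  finally have "vertex_energy p m h \<le> 8 powr (p + 1) * energy p m f" .
  moreover have "0 \<le> h z" "h z \<le> 1" for z
    using v01[of z] v01[of "(fst z, 3 ^ m - snd z)"] by (auto simp: h_def)
  moreover have "vertex_crossing m h" using left right by (simp add: h_def vertex_crossing_def)
  ultimately show thesis by (intro that[of h]) (auto simp: h_def)
qed

lemma vertex_to_crossing:
  assumes g: "vertex_crossing n g" and n: "0 < n" and p: "0 < p"
  obtains f where "crossing n f" "energy p n f \<le> 2 powr p * 18 * vertex_energy p n g"
proof -
  \<comment> \<open>Reads every cell at its lower right corner, but cells of column 0 at their lower
    left one: the first column thus sees the boundary value 0 and the last column the boundary value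
    1.\<close>
  define f where "f q = g (fst q + (if fst q = 0 then 0 else 1), snd q)" for q
  have cr: "crossing n f"
  proof -
    have "f (0, y) = 0" "f (3 ^ n - 1, y) = 1" if "0 \<le> y" "y < 3 ^ n" for y
      using g that three_power_gt_1[OF n] by (auto simp: f_def vertex_crossing_def)
    then show ?thesis unfolding crossing_def by (auto dest: cells_range)
  qed
  have "\<bar>f a - f b\<bar> powr p \<le> 2 powr p * (osc g a powr p + osc g b powr p)" if "(a, b) \<in> adj n" for a b
  proof -
    define z where "z = (max (fst a) (fst b), max (snd a) (snd b))"
    have z: "z \<in> corners a" "z \<in> corners b" using that near_common_corner[of a b] by (auto simp: adj_def z_def)
    have "\<bar>f a - g z\<bar> \<le> osc g a" "\<bar>f b - g z\<bar> \<le> osc g b"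
      unfolding f_def by (rule osc_ge[OF _ z(1)] osc_ge[OF _ z(2)], simp add: corners_iff)+
    then have "\<bar>f a - f b\<bar> \<le> osc g a + osc g b" by linarith
    then have "\<bar>f a - f b\<bar> powr p \<le> (osc g a + osc g b) powr p" using p by (intro powr_mono_abs) auto
    also have "\<dots> \<le> 2 powr p * (osc g a powr p + osc g b powr p)" using p by (intro powr_add_le osc_nonneg) auto
    finally show ?thesis .
  qed
  then have "energy p n f \<le> (\<Sum>(a, b)\<in>adj n. 2 powr p * (osc g a powr p + osc g b powr p))"
    unfolding energy_def by (intro sum_mono) auto
  also have "\<dots> = 2 powr p * ((\<Sum>(a, b)\<in>adj n. osc g a powr p) + (\<Sum>(a, b)\<in>adj n. osc g b powr p))"
    by (simp add: case_prod_unfold sum.distrib sum_distrib_left distrib_left)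
  also have "\<dots> \<le> 2 powr p * (9 * vertex_energy p n g + 9 * vertex_energy p n g)"
    unfolding vertex_energy_def by (intro mult_left_mono add_mono sum_adj_le) auto
  finally show thesis using cr by (intro that) (auto simp: algebra_simps)
qed

definition bilinear_interp :: "(int \<times> int \<Rightarrow> real) \<Rightarrow> int \<times> int \<Rightarrow> real \<Rightarrow> real \<Rightarrow> real" where
  "bilinear_interp a q s t = (1 - s) * (1 - t) * a q + s * (1 - t) * a (fst q + 1, snd q)
     + (1 - s) * t * a (fst q, snd q + 1) + s * t * a (fst q + 1, snd q + 1)"

text \<open>Interpolates the corner values of a coarse cell, with the profile \<open>h\<close> and
  its transpose in place of the two linear coordinates. \<open>div\<close> assigns a lattice point
  to the block on its upper right; \<open>refine_blk\<close> shows that the other blocks touching it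
  yield the same value.\<close>

definition refine :: "nat \<Rightarrow> (int \<times> int \<Rightarrow> real) \<Rightarrow> (int \<times> int \<Rightarrow> real) \<Rightarrow> int \<times> int \<Rightarrow> real" where
  "refine m h a z = bilinear_interp a (fst z div 3 ^ m, snd z div 3 ^ m)
     (h (fst z mod 3 ^ m, snd z mod 3 ^ m)) (h (snd z mod 3 ^ m, fst z mod 3 ^ m))"

lemma bilinear_interp_swap_form:
  "bilinear_interp a q s t = (1 - t) * ((1 - s) * a q + s * a (fst q + 1, snd q))
     + t * ((1 - s) * a (fst q, snd q + 1) + s * a (fst q + 1, snd q + 1))"
  by (simp add: bilinear_interp_def algebra_simps)

lemma convex_comb_diff_le:
  fixes u v w s :: real
  assumes "0 \<le> s" "s \<le> 1" "\<bar>u - w\<bar> \<le> c" "\<bar>v - w\<bar> \<le> c"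
  shows "\<bar>((1 - s) * u + s * v) - w\<bar> \<le> c"
proof -
  have "((1 - s) * u + s * v) - w = (1 - s) * (u - w) + s * (v - w)" by (simp add: algebra_simps)
  also have "\<bar>\<dots>\<bar> \<le> (1 - s) * \<bar>u - w\<bar> + s * \<bar>v - w\<bar>"
    using abs_triangle_ineq[of "(1 - s) * (u - w)" "s * (v - w)"] assms by (simp add: abs_mult)
  also have "\<dots> \<le> (1 - s) * c + s * c" using assms by (intro add_mono mult_left_mono) auto
  finally show ?thesis by (simp add: algebra_simps)
qed

lemma bilinear_interp_diff_le:
  assumes "0 \<le> s" "s \<le> 1" "0 \<le> t" "t \<le> 1" "\<And>z. z \<in> corners q \<Longrightarrow> \<bar>a z - w\<bar> \<le> c"
  shows "\<bar>bilinear_interp a q s t - w\<bar> \<le> c"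
  unfolding bilinear_interp_swap_form
  by (intro convex_comb_diff_le assms) (auto simp: corners_def)

lemma bilinear_interp_osc:
  assumes "0 \<le> s" "s \<le> 1" "0 \<le> t" "t \<le> 1" "0 \<le> s'" "s' \<le> 1" "0 \<le> t'" "t' \<le> 1"
  shows "\<bar>bilinear_interp a q s t - bilinear_interp a q s' t'\<bar> \<le> osc a q"
proof (intro bilinear_interp_diff_le assms)
  fix z assume z: "z \<in> corners q"
  have "\<bar>bilinear_interp a q s' t' - a z\<bar> \<le> osc a q"
    by (intro bilinear_interp_diff_le assms osc_ge z)
  then show "\<bar>a z - bilinear_interp a q s' t'\<bar> \<le> osc a q" by simp
qed

text \<open>Changes the first parameter at fixed \<open>t'\<close> and then the second at fixed
  \<open>s\<close>, which is why the range conditions concern just these two.\<close>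

lemma bilinear_interp_lipschitz:
  assumes "0 \<le> s" "s \<le> 1" "0 \<le> t'" "t' \<le> 1"
  shows "\<bar>bilinear_interp a q s t - bilinear_interp a q s' t'\<bar> \<le> osc a q * (\<bar>s - s'\<bar> + \<bar>t - t'\<bar>)"
proof -
  define A where "A = a (fst q + 1, snd q) - a q"
  define B where "B = a (fst q + 1, snd q + 1) - a (fst q, snd q + 1)"
  define C where "C = a (fst q, snd q + 1) - a q"
  define D where "D = a (fst q + 1, snd q + 1) - a (fst q + 1, snd q)"
  have abcd: "\<bar>A\<bar> \<le> osc a q" "\<bar>B\<bar> \<le> osc a q" "\<bar>C\<bar> \<le> osc a q" "\<bar>D\<bar> \<le> osc a q"
    unfolding A_def B_def C_def D_def by (intro osc_ge; simp add: corners_iff)+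
  have "bilinear_interp a q s t - bilinear_interp a q s' t'
     = (s - s') * ((1 - t') * A + t' * B) + (t - t') * ((1 - s) * C + s * D)"
    by (simp add: bilinear_interp_def A_def B_def C_def D_def algebra_simps)
  also have "\<bar>\<dots>\<bar> \<le> \<bar>s - s'\<bar> * \<bar>(1 - t') * A + t' * B\<bar> + \<bar>t - t'\<bar> * \<bar>(1 - s) * C + s * D\<bar>"
    by (metis abs_mult abs_triangle_ineq)
  also have "\<dots> \<le> \<bar>s - s'\<bar> * osc a q + \<bar>t - t'\<bar> * osc a q"
    using convex_comb_diff_le[of t' A 0 "osc a q" B] convex_comb_diff_le[of s C 0 "osc a q" D] assms abcd
    by (intro add_mono mult_left_mono) auto
  finally show ?thesis by (simp add: algebra_simps)
qed

text \<open>The point is that the formula holds on the closed block. On its right side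
  \<open>h\<close> equals 1 while the next block starts with \<open>h = 0\<close>, and both select
  the same corner values of \<open>a\<close>; the transposed parameter matches because
  \<open>h\<close> agrees on bottom and top. The upper side is symmetric.\<close>

lemma refine_blk:
  assumes h: "vertex_crossing m h" "\<And>x. h (x, 0) = h (x, 3 ^ m)"
    and r: "0 \<le> fst r" "fst r \<le> 3 ^ m" "0 \<le> snd r" "snd r \<le> 3 ^ m"
  shows "refine m h a (blk m q r) = bilinear_interp a q (h (fst r, snd r)) (h (snd r, fst r))"
proof -
  obtain i j where q: "q = (i, j)" by (cases q)
  obtain x y where rr: "r = (x, y)" by (cases r)
  have h0: "h (0, y) = 0" "h (3 ^ m, y) = 1" if "0 \<le> y" "y \<le> 3 ^ m" for y
    using h(1) that by (auto simp: vertex_crossing_def)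
  have full: "(3 ^ m * i + 3 ^ m) div 3 ^ m = i + 1" "(3 ^ m * i + 3 ^ m) mod 3 ^ m = 0" for i :: int
    using div_mult_self2[of "3 ^ m" "3 ^ m" i] by (auto simp: add.commute)
  consider "x < 3 ^ m" "y < 3 ^ m" | "x = 3 ^ m" "y < 3 ^ m" | "x < 3 ^ m" "y = 3 ^ m" | "x = 3 ^ m" "y = 3 ^ m"
    using r rr by force
  then show ?thesis
  proof cases
    case 1
    then show ?thesis using r rr q by (simp add: refine_def blk_def)
  next
    case 2
    then show ?thesis using r rr q h(2)[of y] h0[of y] h0[of 0] h0[of "3 ^ m"]
      by (simp add: refine_def blk_def full bilinear_interp_def)
  next
    case 3
    then show ?thesis using r rr q h(2)[of x] h0[of x] h0[of 0] h0[of "3 ^ m"]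
      by (simp add: refine_def blk_def full bilinear_interp_def)
  next
    case 4
    then show ?thesis using r rr q h(2)[of 0] h(2)[of "3 ^ m"] h0[of 0] h0[of "3 ^ m"]
      by (simp add: refine_def blk_def full bilinear_interp_def)
  qed
qed

locale profile =
  fixes m :: nat and h :: "int \<times> int \<Rightarrow> real"
  assumes crossing: "vertex_crossing m h" and nonneg: "\<And>z. 0 \<le> h z" and le1: "\<And>z. h z \<le> 1"
    and periodic: "\<And>x. h (x, 0) = h (x, 3 ^ m)"
begin

lemma refine_corner:
  assumes r: "r \<in> cells m" and z: "z \<in> corners (blk m q r)"
  obtains z' where "z' \<in> corners r" "refine m h a z = bilinear_interp a q (h z') (h (prod.swap z'))"
    "prod.swap z' \<in> corners (prod.swap r)"
proof -
  define z' where "z' = (fst z - 3 ^ m * fst q, snd z - 3 ^ m * snd q)"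
  have zz: "z = blk m q z'" by (simp add: z'_def blk_def)
  have z': "z' \<in> corners r" using z by (auto simp: corners_iff zz)
  then have "0 \<le> fst z'" "fst z' \<le> 3 ^ m" "0 \<le> snd z'" "snd z' \<le> 3 ^ m"
    using cells_range[OF r] by (auto simp: corners_iff)
  from refine_blk[OF crossing periodic this, of a q] show thesis
    using z' by (intro that[of z']) (auto simp: zz corners_iff prod.swap_def)
qed

lemma refine_osc_le:
  assumes r: "r \<in> cells m"
  shows "osc (refine m h a) (blk m q r) \<le> osc a q"
proof (rule osc_le)
  fix z z' assume "z \<in> corners (blk m q r)" "z' \<in> corners (blk m q r)"
  then show "\<bar>refine m h a z - refine m h a z'\<bar> \<le> osc a q"
    by (elim refine_corner[OF r, where a = a]) (auto intro!: bilinear_interp_osc nonneg le1)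
qed

lemma refine_diff_le:
  assumes r: "r \<in> cells m" and z: "z \<in> corners (blk m q r)" and w: "w \<in> corners q"
  shows "\<bar>refine m h a z - a w\<bar> \<le> osc a q"
  using z by (elim refine_corner[OF r, where a = a]) (auto intro!: bilinear_interp_diff_le osc_ge w nonneg le1)

lemma refine_osc_powr:
  assumes r: "r \<in> cells m" and p: "0 < p"
  shows "osc (refine m h a) (blk m q r) powr p \<le> osc a q powr p * (2 powr p * (osc h r powr p + osc h (prod.swap r) powr p))"
proof (rule osc_powr_le)
  fix z z' assume "z \<in> corners (blk m q r)" "z' \<in> corners (blk m q r)"
  then obtain w w' where w: "w \<in> corners r" "refine m h a z = bilinear_interp a q (h w) (h (prod.swap w))"
    "prod.swap w \<in> corners (prod.swap r)"
    and w': "w' \<in> corners r" "refine m h a z' = bilinear_interp a q (h w') (h (prod.swap w'))"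
    "prod.swap w' \<in> corners (prod.swap r)"
    by (elim refine_corner[OF r, where a = a])
  have "\<bar>refine m h a z - refine m h a z'\<bar> \<le> osc a q * (\<bar>h w - h w'\<bar> + \<bar>h (prod.swap w) - h (prod.swap w')\<bar>)"
    unfolding w w' by (intro bilinear_interp_lipschitz nonneg le1)
  also have "\<dots> \<le> osc a q * (osc h r + osc h (prod.swap r))"
    using w w' by (intro mult_left_mono add_mono osc_ge osc_nonneg)
  finally have "\<bar>refine m h a z - refine m h a z'\<bar> powr p \<le> (osc a q * (osc h r + osc h (prod.swap r))) powr p"
    using p by (intro powr_mono_abs) auto
  also have "\<dots> = osc a q powr p * (osc h r + osc h (prod.swap r)) powr p" by (rule powr_mult)
  also have "\<dots> \<le> osc a q powr p * (2 powr p * (osc h r powr p + osc h (prod.swap r) powr p))"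
    using p by (intro mult_left_mono powr_add_le osc_nonneg) auto
  finally show "\<bar>refine m h a z - refine m h a z'\<bar> powr p \<le> \<dots>" .
qed

text \<open>On a subcell the oscillation is at most that of \<open>a\<close> on the coarse cell
  times the sum of the oscillations of \<open>h\<close> and of its transpose, so the double sum
  factorises. Transposition permutes the cells and yields a second copy of the energy of
  \<open>h\<close>.\<close>

lemma refine_vertex_energy:
  assumes p: "0 < p"
  shows "vertex_energy p (n + m) (refine m h a) \<le> 2 powr (p + 1) * vertex_energy p m h * vertex_energy p n a"
proof -
  have bij: "bij_betw prod.swap (cells m) (cells m)"
    by (rule bij_betwI[of _ _ _ prod.swap]) (auto simp: cells_swap_iff)
  have "vertex_energy p (n + m) (refine m h a)
    \<le> (\<Sum>q\<in>cells n. \<Sum>r\<in>cells m. osc a q powr p * (2 powr p * (osc h r powr p + osc h (prod.swap r) powr p)))"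
    unfolding vertex_energy_def sum_cells_add by (intro sum_mono refine_osc_powr p)
  also have "\<dots> = vertex_energy p n a * (2 powr p * (vertex_energy p m h + (\<Sum>r\<in>cells m. osc h (prod.swap r) powr p)))"
    by (simp add: vertex_energy_def sum.distrib distrib_left flip: sum_distrib_left sum_distrib_right)
  also have "(\<Sum>r\<in>cells m. osc h (prod.swap r) powr p) = vertex_energy p m h"
    unfolding vertex_energy_def by (rule sum.reindex_bij_betw[OF bij])
  finally show ?thesis by (simp add: powr_add algebra_simps)
qed

lemma refine_vertex_crossing:
  assumes "vertex_crossing n a"
  shows "vertex_crossing (n + m) (refine m h a)"
proof -
  have "refine m h a (0, y) = 0 \<and> refine m h a (3 ^ (n + m), y) = 1" if y: "0 \<le> y" "y \<le> 3 ^ (n + m)" for y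
  proof -
    have "\<exists>j z. y = 3 ^ m * j + z \<and> 0 \<le> j \<and> j < 3 ^ n \<and> 0 \<le> z \<and> z \<le> 3 ^ m"
    proof (cases "y = 3 ^ (n + m)")
      \<comment> \<open>The topmost point belongs to no block in the sense of \<open>div\<close>; it
        is the upper end of the last block.\<close>
      case True
      then show ?thesis by (intro exI[of _ "3 ^ n - 1"] exI[of _ "3 ^ m"]) (auto simp: power_add algebra_simps)
    next
      case False
      have "y div 3 ^ m < 3 ^ n" 
      proof (rule ccontr)
        assume "\<not> ?thesis"
        then have "3 ^ n * 3 ^ m \<le> (y div 3 ^ m) * 3 ^ m" by (intro mult_right_mono) auto
        also have "\<dots> \<le> y" using mult_div_mod_eq[of "3 ^ m" y] pos_mod_sign[of "3 ^ m" y] unfolding mult.commute[of "y div _"]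
          by (metis le_add_same_cancel1 zero_less_numeral zero_less_power)
        finally show False using y False by (simp add: power_add)
      qed
      then show ?thesis using y by (intro exI[of _ "y div 3 ^ m"] exI[of _ "y mod 3 ^ m"])
        (auto simp: pos_imp_zdiv_nonneg_iff less_imp_le)
    qed
    then obtain j z where jz: "y = 3 ^ m * j + z" "0 \<le> j" "j < 3 ^ n" "0 \<le> z" "z \<le> 3 ^ m" by blast
    have h: "h (0, z) = 0" "h (3 ^ m, z) = 1" using crossing jz by (auto simp: vertex_crossing_def)
    have a: "a (0, j) = 0" "a (0, j + 1) = 0" "a (3 ^ n, j) = 1" "a (3 ^ n, j + 1) = 1"
      using assms jz by (auto simp: vertex_crossing_def)
    have "refine m h a (0, y) = refine m h a (blk m (0, j) (0, z))" by (simp add: blk_def jz)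
    also have "\<dots> = 0" using jz h a by (subst refine_blk[OF crossing periodic]) (auto simp: bilinear_interp_def)
    finally have 1: "refine m h a (0, y) = 0" .
    have "refine m h a (3 ^ (n + m), y) = refine m h a (blk m (3 ^ n - 1, j) (3 ^ m, z))"
      by (simp add: blk_def jz power_add algebra_simps)
    also have "\<dots> = 1" using jz h a by (subst refine_blk[OF crossing periodic]) (auto simp: bilinear_interp_def algebra_simps)
    finally show ?thesis using 1 by simp
  qed
  then show ?thesis by (simp add: vertex_crossing_def)
qed

end

text \<open>The factor 2 replaces a minimiser: as the conductance is positive, some crossing
  function stays below twice the infimum.\<close>

lemma profile_exists:
  assumes "0 < m" "0 < p"
  obtains h where "profile m h" "vertex_energy p m h \<le> 8 powr (p + 1) * (2 * conductance p m)"
proof -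
  have "conductance p m < 2 * conductance p m" using conductance_pos[OF assms] by simp
  then obtain f where f: "crossing m f" "energy p m f < 2 * conductance p m"
    by (rule conductance_less[OF assms(1)])
  obtain h where h: "vertex_crossing m h" "\<And>z. 0 \<le> h z" "\<And>z. h z \<le> 1" "\<And>x. h (x, 0) = h (x, 3 ^ m)"
    "vertex_energy p m h \<le> 8 powr (p + 1) * energy p m f"
    by (rule crossing_to_vertex[OF f(1) assms(2)]) blast
  have "8 powr (p + 1) * energy p m f \<le> 8 powr (p + 1) * (2 * conductance p m)"
    using f by (intro mult_left_mono) auto
  with h(5) have "vertex_energy p m h \<le> 8 powr (p + 1) * (2 * conductance p m)" by (rule order_trans)
  with h(1-4) show thesis by (intro that[of h]) (auto simp: profile_def)
qed

text \<open>A nearly optimal profile of level \<open>n\<close>, refined by one of level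
  \<open>m\<close>, is a competitor at level \<open>n + m\<close>. What matters about the constant
  is that it depends on \<open>p\<close> alone.\<close>

lemma conductance_submultiplicative:
  assumes "0 < m" "0 < n" "0 < p"
  shows "conductance p (n + m) \<le> 2 powr p * 18 * 2 powr (p + 1) * (8 powr (p + 1) * 2) * (8 powr (p + 1) * 2) * conductance p n * conductance p m"
proof -
  obtain a where a: "profile n a" "vertex_energy p n a \<le> 8 powr (p + 1) * (2 * conductance p n)"
    by (rule profile_exists[OF assms(2,3)])
  obtain h where h: "profile m h" "vertex_energy p m h \<le> 8 powr (p + 1) * (2 * conductance p m)"
    by (rule profile_exists[OF assms(1,3)])
  have "vertex_crossing (n + m) (refine m h a)"
    using profile.refine_vertex_crossing[OF h(1)] profile.crossing[OF a(1)] by blast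
  then obtain f where f: "crossing (n + m) f" "energy p (n + m) f \<le> 2 powr p * 18 * vertex_energy p (n + m) (refine m h a)"
    using vertex_to_crossing[of "n + m" "refine m h a" p] assms by auto
  have "conductance p (n + m) \<le> energy p (n + m) f" by (rule conductance_le[OF f(1)])
  also have "\<dots> \<le> 2 powr p * 18 * vertex_energy p (n + m) (refine m h a)" by (rule f(2))
  also have "\<dots> \<le> 2 powr p * 18 * (2 powr (p + 1) * vertex_energy p m h * vertex_energy p n a)"
    using profile.refine_vertex_energy[OF h(1) assms(3)] by (intro mult_left_mono) auto
  also have "\<dots> \<le> 2 powr p * 18 * (2 powr (p + 1) * (8 powr (p + 1) * (2 * conductance p m)) * (8 powr (p + 1) * (2 * conductance p n)))"
    using a h conductance_pos[OF assms(1,3)] conductance_pos[OF assms(2,3)]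
    by (intro mult_left_mono mult_mono mult_nonneg_nonneg) (auto intro: vertex_energy_nonneg less_imp_le)
  finally show ?thesis by (simp add: mult_ac)
qed

section \<open>Exponential growth of the conductances\<close>

text \<open>The limit \<open>l\<close> equals \<open>- ln (carpet_scaling p)\<close>, as
  \<open>carpet_walk_dim_eq\<close> shows; all exponents of the carpet are expressed by it.\<close>

lemma conductance_growth:
  assumes p: "0 < p"
  obtains l where "(\<lambda>m. ln (conductance p m) / real m) \<longlonglongrightarrow> l"
proof -
  \<comment> \<open>Multiplying the conductances by this constant turns submultiplicativity up to
    the factor \<open>A\<close> into exact submultiplicativity, so that \<open>Fekete\<close>
    applies to the logarithms.\<close>
  define A where "A = 2 powr p * 18 * 2 powr (p + 1) * (8 powr (p + 1) * 2) * (8 powr (p + 1) * 2)"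
  have A: "0 < A" by (simp add: A_def)
  have pos: "0 < conductance p n" if "0 < n" for n using conductance_pos[OF that p] .
  obtain l where l: "(\<lambda>n. ln (A * conductance p n) / real n) \<longlonglongrightarrow> l"
  proof (rule Fekete)
    fix m n :: nat assume mn: "0 < m" "0 < n"
    have "A * conductance p (m + n) \<le> (A * conductance p m) * (A * conductance p n)"
      using conductance_submultiplicative[OF mn(2,1) p] A unfolding A_def[symmetric]
      by (metis (no_types, opaque_lifting) mult.assoc mult.left_commute mult_left_mono less_imp_le)
    then have "ln (A * conductance p (m + n)) \<le> ln ((A * conductance p m) * (A * conductance p n))"
      using A pos mn by (subst ln_le_cancel_iff) auto
    then show "ln (A * conductance p (m + n)) \<le> ln (A * conductance p m) + ln (A * conductance p n)"
      using A pos[OF mn(1)] pos[OF mn(2)] by (subst (asm) ln_mult) auto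
  next
    fix n :: nat assume n: "0 < n"
    have "ln ((1 / 3 ^ n) powr p) \<le> ln (conductance p n)"
      using conductance_lower[OF n p] pos[OF n] by (subst ln_le_cancel_iff) auto
    then have "- (real n * p * ln 3) \<le> ln (conductance p n)"
      by (simp add: ln_powr ln_div ln_realpow mult_ac)
    moreover have "- \<bar>ln A\<bar> * real n \<le> ln A"
    proof -
      have "\<bar>ln A\<bar> * 1 \<le> \<bar>ln A\<bar> * real n" using n by (intro mult_left_mono) auto
      then show ?thesis by (simp add: minus_le_iff abs_le_iff)
    qed
    moreover have "ln (A * conductance p n) = ln A + ln (conductance p n)"
      using A pos[OF n] by (simp add: ln_mult)
    ultimately show "(- \<bar>ln A\<bar> - p * ln 3) * real n \<le> ln (A * conductance p n)"
      by (simp add: algebra_simps)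
  qed
  have eq: "ln (A * conductance p n) / real n - ln A / real n = ln (conductance p n) / real n" if "0 < n" for n
    using A pos[OF that] by (simp add: ln_mult flip: diff_divide_distrib)
  have "(\<lambda>n. ln (A * conductance p n) / real n - ln A / real n) \<longlonglongrightarrow> l - 0"
    by (intro tendsto_diff l lim_const_over_n)
  moreover have "\<forall>\<^sub>F n in sequentially. ln (A * conductance p n) / real n - ln A / real n = ln (conductance p n) / real n"
    using eventually_gt_at_top[of 0] by (rule eventually_mono) (rule eq)
  ultimately have "(\<lambda>n. ln (conductance p n) / real n) \<longlonglongrightarrow> l - 0"
    by (rule Lim_transform_eventually)
  then have "(\<lambda>n. ln (conductance p n) / real n) \<longlonglongrightarrow> l" by simp
  then show thesis by (rule that)
qed

text \<open>In terms of the walk dimension \<open>(ln 8 - l) / ln 3\<close> this says that it is at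
  least \<open>p\<close>, in particular positive.\<close>

lemma conductance_growth_le:
  assumes l: "(\<lambda>m. ln (conductance p m) / real m) \<longlonglongrightarrow> l" and p: "0 < p"
  shows "l \<le> ln 8 - p * ln 3"
proof (rule LIMSEQ_le[OF l])
  show "(\<lambda>n. (ln 9 + p * ln 2) / real n + (ln 8 - p * ln 3)) \<longlonglongrightarrow> ln 8 - p * ln 3"
    using tendsto_add[OF lim_const_over_n tendsto_const] by simp
  show "\<exists>N. \<forall>n\<ge>N. ln (conductance p n) / real n \<le> (ln 9 + p * ln 2) / real n + (ln 8 - p * ln 3)"
  proof (intro exI[of _ 1] allI impI)
    fix n :: nat assume "1 \<le> n"
    then have n: "0 < n" by simp
    have "ln (conductance p n) \<le> ln (9 * 8 ^ n * (2 / 3 ^ n) powr p)"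
      using conductance_upper[OF n p] conductance_pos[OF n p] by (subst ln_le_cancel_iff) auto
    also have "\<dots> = ln 9 + real n * ln 8 + p * (ln 2 - real n * ln 3)"
      by (simp add: ln_mult ln_powr ln_div ln_realpow)
    finally show "ln (conductance p n) / real n \<le> (ln 9 + p * ln 2) / real n + (ln 8 - p * ln 3)"
      using n by (simp add: field_simps)
  qed
qed

section \<open>Side averages\<close>

text \<open>Meant for foldings, which agree at each point with one of two symmetries. A term at
  \<open>a\<close> is below the whole local sum at the image of \<open>a\<close>; there are at most
  9 terms per cell, and summing over both symmetries gives the factor 2 * 9.\<close>

lemma energy_comp_le:
  assumes \<phi>: "\<And>a. a \<in> cells m \<Longrightarrow> \<phi> a \<in> cells m" "\<And>a b. near a b \<Longrightarrow> near (\<phi> a) (\<phi> b)"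
    "\<And>a. \<phi> a = \<sigma> a \<or> \<phi> a = \<tau> a"
    and \<sigma>: "bij_betw \<sigma> (cells m) (cells m)" and \<tau>: "bij_betw \<tau> (cells m) (cells m)"
  shows "energy p m (\<lambda>a. v (\<phi> a)) \<le> 18 * energy p m v"
proof -
  define W where "W a = (\<Sum>b\<in>nbrs m a. \<bar>v a - v b\<bar> powr p)" for a
  have W0: "0 \<le> W a" for a by (auto simp: W_def intro: sum_nonneg)
  have EW: "energy p m v = sum W (cells m)" by (simp add: energy_eq_nbrs W_def)
  have "(\<Sum>b\<in>nbrs m a. \<bar>v (\<phi> a) - v (\<phi> b)\<bar> powr p) \<le> 9 * (W (\<sigma> a) + W (\<tau> a))" if a: "a \<in> cells m" for a
  proof -
    have "\<bar>v (\<phi> a) - v (\<phi> b)\<bar> powr p \<le> W (\<phi> a)" if "b \<in> nbrs m a" for b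
      unfolding W_def using \<phi> that by (intro member_le_sum) (auto simp: nbrs_def)
    then have "(\<Sum>b\<in>nbrs m a. \<bar>v (\<phi> a) - v (\<phi> b)\<bar> powr p) \<le> real (card (nbrs m a)) * W (\<phi> a)"
      by (rule sum_bounded_above)
    also have "\<dots> \<le> 9 * W (\<phi> a)" using card_nbrs_le[of m a] W0 by (intro mult_right_mono) auto
    also have "\<dots> \<le> 9 * (W (\<sigma> a) + W (\<tau> a))" using \<phi>(3)[of a] W0[of "\<sigma> a"] W0[of "\<tau> a"] by auto
    finally show ?thesis .
  qed
  then have "energy p m (\<lambda>a. v (\<phi> a)) \<le> (\<Sum>a\<in>cells m. 9 * (W (\<sigma> a) + W (\<tau> a)))"
    unfolding energy_eq_nbrs by (intro sum_mono) auto
  also have "\<dots> = 9 * ((\<Sum>a\<in>cells m. W (\<sigma> a)) + (\<Sum>a\<in>cells m. W (\<tau> a)))"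
    by (simp add: sum.distrib distrib_left sum_distrib_left)
  also have "\<dots> = 18 * energy p m v"
    by (simp add: EW sum.reindex_bij_betw[OF \<sigma>] sum.reindex_bij_betw[OF \<tau>])
  finally show ?thesis .
qed

lemma bij_swap_cells: "bij_betw prod.swap (cells m) (cells m)"
  by (rule bij_betwI[of _ _ _ prod.swap]) (auto simp: cells_swap_iff)

definition reflect_x :: "nat \<Rightarrow> int \<times> int \<Rightarrow> int \<times> int" where
  "reflect_x m a = (3 ^ m - 1 - fst a, snd a)"

lemma reflect_x_cells: "a \<in> cells m \<Longrightarrow> reflect_x m a \<in> cells m"
  using cells_reflect_x[of "fst a" "snd a" m] by (simp add: reflect_x_def)

lemma energy_reflect_x: "energy p m (\<lambda>a. v (reflect_x m a)) = energy p m v"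
  unfolding energy_def
proof (rule sum.reindex_bij_witness[of _ "map_prod (reflect_x m) (reflect_x m)" "map_prod (reflect_x m) (reflect_x m)"])
  have inv: "reflect_x m (reflect_x m a) = a" for a by (simp add: reflect_x_def)
  have near: "near (reflect_x m a) (reflect_x m b) = near a b" for a b
    by (auto simp: near_def reflect_x_def)
  have adj: "(reflect_x m a, reflect_x m b) \<in> adj m" if "(a, b) \<in> adj m" for a b
    using that reflect_x_cells[of a m] reflect_x_cells[of b m] near[of a b] inv[of a] inv[of b]
    by (auto simp: adj_def simp del: prod.inject dest: arg_cong[of _ _ "reflect_x m"])
  show *: "map_prod (reflect_x m) (reflect_x m) x \<in> adj m" if "x \<in> adj m" for x
    using that adj by (cases x) auto
  show "map_prod (reflect_x m) (reflect_x m) x \<in> adj m" if "x \<in> adj m" for x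
    by (rule *[OF that])
qed (auto simp: reflect_x_def)
lemma energy_scale: "energy p m (\<lambda>a. c * v a) = \<bar>c\<bar> powr p * energy p m v"
  by (simp add: energy_def sum_distrib_left case_prod_unfold abs_mult powr_mult flip: right_diff_distrib)

lemma energy_le_sum:
  assumes "0 \<le> p"
  shows "energy p m f \<le> 2 powr p * 18 * (\<Sum>a\<in>cells m. \<bar>f a\<bar> powr p)"
proof -
  have "energy p m f \<le> (\<Sum>(a, b)\<in>adj m. 2 powr p * (\<bar>f a\<bar> powr p + \<bar>f b\<bar> powr p))"
    unfolding energy_def using assms abs_powr_diff_le by (intro sum_mono) auto
  also have "\<dots> = 2 powr p * ((\<Sum>(a, b)\<in>adj m. \<bar>f a\<bar> powr p) + (\<Sum>(a, b)\<in>adj m. \<bar>f b\<bar> powr p))"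
    by (simp add: case_prod_unfold sum.distrib sum_distrib_left distrib_left)
  also have "\<dots> \<le> 2 powr p * (9 * (\<Sum>a\<in>cells m. \<bar>f a\<bar> powr p) + 9 * (\<Sum>a\<in>cells m. \<bar>f a\<bar> powr p))"
    by (intro mult_left_mono add_mono sum_adj_le) auto
  finally show ?thesis by (simp add: algebra_simps)
qed

text \<open>The dual of a minimiser: weights on the sides whose difference is controlled by the
  conductance.  They come from extending the functional that is \<open>1\<close> on crossing functions.\<close>

lemma side_weights:
  assumes m: "0 < m" and p: "1 \<le> p"
  obtains \<alpha> :: "int \<Rightarrow> real" where "(\<Sum>j\<in>{0..<3 ^ m}. \<alpha> j) = 1"
    "\<And>f. \<bar>\<Sum>j\<in>{0..<3 ^ m}. \<alpha> j * (f (3 ^ m - 1, j) - f (0, j))\<bar> powr p \<le> energy p m f / conductance p m"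
proof -
  have p0: "0 < p" using p by simp
  define c0 where "c0 = conductance p m"
  have c0: "0 < c0" using conductance_pos[OF m p0] by (simp add: c0_def)
  define N where "N f = c0 powr (- (1 / p)) * energy p m f powr (1 / p)" for f
  have N0: "0 \<le> N f" for f by (simp add: N_def)
  have Np: "N f powr p = energy p m f / c0" for f
    using c0 p0 energy_nonneg[of p m f] by (simp add: N_def powr_mult powr_powr powr_minus_divide powr_divide)
  \<comment> \<open>Functions constant on each of the two sides; \<open>l\<close> is the jump
    between them. Rescaled to a crossing function, such a function shows that its jump is at most
    the p-th root of energy over conductance, which is \<open>N\<close>.\<close>
  define S where "S = {f :: int \<times> int \<Rightarrow> real. \<exists>c t. \<forall>y. ((0, y) \<in> cells m \<longrightarrow> f (0, y) = c) \<and> ((3 ^ m - 1, y) \<in> cells m \<longrightarrow> f (3 ^ m - 1, y) = c + t)}"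
  define l where "l f = f (3 ^ m - 1, 0) - f (0, 0)" for f :: "int \<times> int \<Rightarrow> real"
  have in0: "(0, 0) \<in> cells m" "(3 ^ m - 1, 0) \<in> cells m" using cells_left[of 0 m] cells_right[of 0 m] by auto
  have M1: "(3::int) ^ m - 1 \<noteq> 0" using three_power_gt_1[OF m] by linarith
  have sub: "sublinear N"
    unfolding sublinear_def
  proof (intro conjI allI impI)
    fix f g :: "int \<times> int \<Rightarrow> real"
    have "energy p m (\<lambda>x. f x + g x) powr (1 / p) \<le> energy p m f powr (1 / p) + energy p m g powr (1 / p)"
      using Minkowski_sum[OF finite_adj[of m] p, of "\<lambda>(a, b). f a - f b" "\<lambda>(a, b). g a - g b"]
      by (simp add: energy_def case_prod_unfold algebra_simps)
    then show "N (\<lambda>x. f x + g x) \<le> N f + N g"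
      unfolding N_def by (simp add: mult_left_mono flip: distrib_left)
  next
    fix c :: real and f :: "int \<times> int \<Rightarrow> real" assume "0 \<le> c"
    then show "N (\<lambda>x. c * f x) = c * N f"
      using p0 by (simp add: N_def energy_scale powr_mult powr_powr)
  qed
  obtain w where w: "\<And>f. (\<Sum>x\<in>cells m. w x * f x) \<le> N f" "\<And>f. f \<in> S \<Longrightarrow> (\<Sum>x\<in>cells m. w x * f x) = l f"
  proof (rule Hahn_Banach_finite[OF finite_cells sub, where S = S and l = l])
    show "N f = N g" if "\<And>x. x \<in> cells m \<Longrightarrow> f x = g x" for f g
      using energy_cong[of m f g p] that by (simp add: N_def)
    show "(\<lambda>x. 0) \<in> S" by (auto simp: S_def intro!: exI[of _ 0])
    show "l (\<lambda>x. 0) = 0" by (simp add: l_def)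
    show "(\<lambda>x. f x + g x) \<in> S \<and> l (\<lambda>x. f x + g x) = l f + l g" if fg: "f \<in> S" "g \<in> S" for f g
    proof -
      obtain c t where 1: "\<forall>y. ((0, y) \<in> cells m \<longrightarrow> f (0, y) = c) \<and> ((3 ^ m - 1, y) \<in> cells m \<longrightarrow> f (3 ^ m - 1, y) = c + t)"
        using fg by (auto simp: S_def)
      obtain c' t' where 2: "\<forall>y. ((0, y) \<in> cells m \<longrightarrow> g (0, y) = c') \<and> ((3 ^ m - 1, y) \<in> cells m \<longrightarrow> g (3 ^ m - 1, y) = c' + t')"
        using fg by (auto simp: S_def)
      have "(\<lambda>x. f x + g x) \<in> S" unfolding S_def mem_Collect_eq
        by (rule exI[of _ "c + c'"], rule exI[of _ "t + t'"]) (use 1 2 in auto)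
      then show ?thesis by (simp add: l_def)
    qed
    show "(\<lambda>x. c * f x) \<in> S \<and> l (\<lambda>x. c * f x) = c * l f" if f: "f \<in> S" for c f
    proof -
      obtain c' t where 1: "\<forall>y. ((0, y) \<in> cells m \<longrightarrow> f (0, y) = c') \<and> ((3 ^ m - 1, y) \<in> cells m \<longrightarrow> f (3 ^ m - 1, y) = c' + t)"
        using f by (auto simp: S_def)
      have "(\<lambda>x. c * f x) \<in> S" unfolding S_def mem_Collect_eq
        by (rule exI[of _ "c * c'"], rule exI[of _ "c * t"]) (use 1 in \<open>auto simp: distrib_left\<close>)
      then show ?thesis by (simp add: l_def right_diff_distrib)
    qed
    show "l f \<le> N f" if f: "f \<in> S" for f
    proof -
      obtain c t where ct: "\<forall>y. ((0, y) \<in> cells m \<longrightarrow> f (0, y) = c) \<and> ((3 ^ m - 1, y) \<in> cells m \<longrightarrow> f (3 ^ m - 1, y) = c + t)"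
        using f by (auto simp: S_def)
      have lt: "l f = t" using ct in0 by (simp add: l_def)
      show ?thesis
      proof (cases "t = 0")
        case False
        have "crossing m (\<lambda>x. (1 / t) * (f x - c))" using ct False by (auto simp: crossing_def)
        then have "c0 \<le> energy p m (\<lambda>x. (1 / t) * (f x - c))" unfolding c0_def by (rule conductance_le)
        also have "\<dots> = (1 / \<bar>t\<bar> powr p) * energy p m f"
          unfolding energy_scale by (simp add: powr_divide) (simp add: energy_def)
        finally have "\<bar>t\<bar> powr p \<le> N f powr p" unfolding Np using c0 False by (simp add: field_simps)
        then have "\<bar>t\<bar> \<le> N f" using powr_less_mono2[of p "N f" "\<bar>t\<bar>"] p0 N0[of f] by linarith
        then show ?thesis using lt by simp
      qed (use lt N0 in simp)
    qed
  qed blast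
  \<comment> \<open>A unit function off the two sides lies in \<open>S\<close> and has jump 0, so
    the extension vanishes on it: the weights live on the sides.\<close>
  have inter: "w x = 0" if x: "x \<in> cells m" "fst x \<noteq> 0" "fst x \<noteq> 3 ^ m - 1" for x
  proof -
    define e where "e y = (if y = x then 1 else 0 :: real)" for y
    have "e \<in> S" unfolding S_def mem_Collect_eq
      by (rule exI[of _ 0], rule exI[of _ 0]) (use x in \<open>auto simp: e_def\<close>)
    then have "(\<Sum>y\<in>cells m. w y * e y) = l e" by (rule w(2))
    moreover have "l e = 0" using x by (auto simp: l_def e_def)
    moreover have "(\<Sum>y\<in>cells m. w y * e y) = w x" using x by (simp add: e_def if_distrib cong: if_cong)
    ultimately show ?thesis by simp
  qed
  let ?J = "{0..<3 ^ m} :: int set"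
  have split: "(\<Sum>x\<in>cells m. w x * f x) = (\<Sum>j\<in>?J. w (0, j) * f (0, j)) + (\<Sum>j\<in>?J. w (3 ^ m - 1, j) * f (3 ^ m - 1, j))" for f
  proof -
    have "(\<Sum>x\<in>cells m. w x * f x) = (\<Sum>x\<in>Pair 0 ` ?J \<union> Pair (3 ^ m - 1) ` ?J. w x * f x)"
    proof (rule sum.mono_neutral_right)
      show "Pair 0 ` ?J \<union> Pair (3 ^ m - 1) ` ?J \<subseteq> cells m" using cells_left cells_right by auto
      show "\<forall>i\<in>cells m - (Pair 0 ` ?J \<union> Pair (3 ^ m - 1) ` ?J). w i * f i = 0"
      proof
        fix i assume i: "i \<in> cells m - (Pair 0 ` ?J \<union> Pair (3 ^ m - 1) ` ?J)"
        have "snd i \<in> ?J" using cells_range[of i m] i by auto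
        then have "fst i \<noteq> 0" "fst i \<noteq> 3 ^ m - 1" using i by (metis DiffD2 UnI1 UnI2 image_eqI prod.collapse)+
        then show "w i * f i = 0" using inter i by simp
      qed
    qed simp
    also have "\<dots> = (\<Sum>x\<in>Pair 0 ` ?J. w x * f x) + (\<Sum>x\<in>Pair (3 ^ m - 1) ` ?J. w x * f x)"
      using M1 by (intro sum.union_disjoint) auto
    also have "\<dots> = (\<Sum>j\<in>?J. w (0, j) * f (0, j)) + (\<Sum>j\<in>?J. w (3 ^ m - 1, j) * f (3 ^ m - 1, j))"
      by (simp add: sum.reindex inj_on_def)
    finally show ?thesis .
  qed
  have R1: "(\<Sum>j\<in>?J. w (3 ^ m - 1, j)) = 1"
  proof -
    define e where "e y = (if fst y = 3 ^ m - 1 then 1 else 0 :: real)" for y :: "int \<times> int"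
    have "e \<in> S" unfolding S_def mem_Collect_eq
      by (rule exI[of _ 0], rule exI[of _ 1]) (use M1 in \<open>auto simp: e_def\<close>)
    then have "(\<Sum>y\<in>cells m. w y * e y) = l e" by (rule w(2))
    then show ?thesis unfolding split using M1 by (simp add: e_def l_def)
  qed
  have L1: "(\<Sum>j\<in>?J. w (0, j)) = - 1"
  proof -
    have "(\<lambda>x. 1) \<in> S" unfolding S_def mem_Collect_eq
      by (rule exI[of _ 1], rule exI[of _ 0]) auto
    then have "(\<Sum>y\<in>cells m. w y * 1) = l (\<lambda>x. 1)" by (rule w(2))
    then show ?thesis unfolding split[of "\<lambda>x. 1"] using R1 by (simp add: l_def)
  qed
  \<comment> \<open>The extension may weight the two sides differently. Antisymmetrising under
    reflection in the vertical midline, which preserves the energy, gives one weight function that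
    serves both sides with opposite signs.\<close>
  define \<alpha> where "\<alpha> j = (w (3 ^ m - 1, j) - w (0, j)) / 2" for j
  have abs_le: "\<bar>\<Sum>x\<in>cells m. w x * f x\<bar> \<le> N f" for f
  proof -
    have "N (\<lambda>x. - f x) = N f" using energy_scale[of p m "-1" f] by (simp add: N_def)
    then have "- (\<Sum>x\<in>cells m. w x * f x) \<le> N f" using w(1)[of "\<lambda>x. - f x"] by (simp add: sum_negf)
    then show ?thesis using w(1)[of f] by (simp add: abs_le_iff)
  qed
  have half_diff: "\<bar>(a - b) / 2\<bar> \<le> (x + y) / 2" if "\<bar>a\<bar> \<le> x" "\<bar>b\<bar> \<le> y" for a b x y :: real
    using that unfolding abs_le_iff by (simp add: field_simps)
  show thesis
  proof (rule that[of \<alpha>])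
    show "(\<Sum>j\<in>?J. \<alpha> j) = 1" using R1 L1 by (simp add: \<alpha>_def sum_subtractf flip: sum_divide_distrib)
    fix f :: "int \<times> int \<Rightarrow> real"
    define g where "g x = f (reflect_x m x)" for x
    have "(\<Sum>j\<in>?J. \<alpha> j * (f (3 ^ m - 1, j) - f (0, j))) = ((\<Sum>x\<in>cells m. w x * f x) - (\<Sum>x\<in>cells m. w x * g x)) / 2"
      unfolding split g_def reflect_x_def \<alpha>_def sum.distrib[symmetric] sum_subtractf[symmetric] sum_divide_distrib
      by (rule sum.cong) (auto simp: field_simps)
    also have "\<bar>\<dots>\<bar> \<le> (N f + N g) / 2" by (rule half_diff[OF abs_le abs_le])
    also have "N g = N f" unfolding N_def g_def energy_reflect_x ..
    finally have "\<bar>\<Sum>j\<in>?J. \<alpha> j * (f (3 ^ m - 1, j) - f (0, j))\<bar> powr p \<le> N f powr p"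
      using p0 by (intro powr_mono_abs) auto
    then show "\<bar>\<Sum>j\<in>?J. \<alpha> j * (f (3 ^ m - 1, j) - f (0, j))\<bar> powr p \<le> energy p m f / conductance p m"
      by (simp add: Np c0_def)
  qed
qed

text \<open>\<open>R\<close> is instantiated with the reciprocal of the conductance of level
  \<open>m\<close>. It is kept apart from the other constants because the final comparison turns on
  it.\<close>

locale side_average =
  fixes m :: nat and p R :: real and \<alpha> :: "int \<Rightarrow> real"
  assumes m: "0 < m" and p: "1 \<le> p" and R: "0 \<le> R"
    and sum_weights: "(\<Sum>j\<in>{0..<3 ^ m}. \<alpha> j) = 1"
    and weights_bound: "\<And>f. \<bar>\<Sum>j\<in>{0..<3 ^ m}. \<alpha> j * (f (3 ^ m - 1, j) - f (0, j))\<bar> powr p \<le> R * energy p m f"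
begin

abbreviation J :: "int set" where "J \<equiv> {0..<3 ^ m}"

abbreviation last :: int where "last \<equiv> 3 ^ m - 1"

lemma last_nonzero: "last \<noteq> 0" using three_power_gt_1[OF m] by linarith

text \<open>The constant of \<open>energy_le_sum\<close>. It is at least 18, so it also covers the
  folding estimate \<open>energy_comp_le\<close>.\<close>

definition \<kappa> :: real where "\<kappa> = 2 powr p * 18"

lemma \<kappa>_ge: "18 \<le> \<kappa>"
proof -
  have "(1::real) \<le> 2 powr p" using p by (simp add: ge_one_powr_ge_zero)
  then show ?thesis by (simp add: \<kappa>_def)
qed

text \<open>The weights are small in the dual norm: test with functions supported on one column.\<close>

lemma weights_dual_bound: "\<bar>\<Sum>j\<in>J. \<alpha> j * \<beta> j\<bar> powr p \<le> \<kappa> * R * (\<Sum>j\<in>J. \<bar>\<beta> j\<bar> powr p)"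
proof -
  define f where "f a = (if fst a = 0 then - \<beta> (snd a) else 0)" for a :: "int \<times> int"
  have "(\<Sum>j\<in>J. \<alpha> j * \<beta> j) = (\<Sum>j\<in>J. \<alpha> j * (f (last, j) - f (0, j)))"
    using last_nonzero by (simp add: f_def)
  then have 1: "\<bar>\<Sum>j\<in>J. \<alpha> j * \<beta> j\<bar> powr p \<le> R * energy p m f" using weights_bound[of f] by simp
  have "energy p m f \<le> \<kappa> * (\<Sum>a\<in>cells m. \<bar>f a\<bar> powr p)"
    unfolding \<kappa>_def by (rule energy_le_sum) (use p in auto)
  also have "(\<Sum>a\<in>cells m. \<bar>f a\<bar> powr p) = (\<Sum>a\<in>Pair 0 ` J. \<bar>f a\<bar> powr p)"
  proof (rule sum.mono_neutral_right)
    show "Pair 0 ` J \<subseteq> cells m" using cells_left by auto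
    show "\<forall>i\<in>cells m - Pair 0 ` J. \<bar>f i\<bar> powr p = 0"
    proof
      fix i assume i: "i \<in> cells m - Pair 0 ` J"
      have "snd i \<in> J" using cells_range[of i m] i by auto
      then have "fst i \<noteq> 0" using i by (metis DiffD2 image_eqI prod.collapse)
      then show "\<bar>f i\<bar> powr p = 0" by (simp add: f_def)
    qed
  qed simp
  also have "\<dots> = (\<Sum>j\<in>J. \<bar>\<beta> j\<bar> powr p)" by (simp add: sum.reindex inj_on_def f_def)
  finally have "R * energy p m f \<le> R * (\<kappa> * (\<Sum>j\<in>J. \<bar>\<beta> j\<bar> powr p))" using R by (intro mult_left_mono)
  with 1 show ?thesis by (simp add: mult_ac)
qed

lemma scaled_le:
  assumes "x \<le> 18 * e" "0 \<le> e"
  shows "R * x \<le> \<kappa> * R * e"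
proof -
  have "R * x \<le> R * (18 * e)" using assms R by (intro mult_left_mono) auto
  also have "\<dots> \<le> R * (\<kappa> * e)" using assms R \<kappa>_ge by (intro mult_left_mono mult_right_mono) auto
  finally show ?thesis by (simp only: mult_ac)
qed

definition left :: "(int \<times> int \<Rightarrow> real) \<Rightarrow> real" where "left v = (\<Sum>j\<in>J. \<alpha> j * v (0, j))"
definition right :: "(int \<times> int \<Rightarrow> real) \<Rightarrow> real" where "right v = (\<Sum>j\<in>J. \<alpha> j * v (last, j))"
definition bottom :: "(int \<times> int \<Rightarrow> real) \<Rightarrow> real" where "bottom v = (\<Sum>j\<in>J. \<alpha> j * v (j, 0))"
definition top_side :: "(int \<times> int \<Rightarrow> real) \<Rightarrow> real" where "top_side v = (\<Sum>j\<in>J. \<alpha> j * v (j, last))"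

lemma left_right: "\<bar>right v - left v\<bar> powr p \<le> R * energy p m v"
  using weights_bound[of v] by (simp add: left_def right_def sum_subtractf right_diff_distrib)

text \<open>Adjacent sides are compared by folding along the diagonal.\<close>

lemma left_top: "\<bar>top_side v - left v\<bar> powr p \<le> \<kappa> * R * energy p m v"
proof -
  define \<phi> where "\<phi> a = (min (fst a) (snd a), max (fst a) (snd a))" for a :: "int \<times> int"
  have \<phi>: "\<phi> a = id a \<or> \<phi> a = prod.swap a" for a by (cases a) (auto simp: \<phi>_def min_def max_def)
  have "energy p m (\<lambda>a. v (\<phi> a)) \<le> 18 * energy p m v"
  proof (rule energy_comp_le[of m \<phi> id prod.swap])
    show "\<phi> a \<in> cells m" if "a \<in> cells m" for a using \<phi>[of a] that by (metis cells_swap_iff id_apply)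
    show "near (\<phi> a) (\<phi> b)" if "near a b" for a b using that by (auto simp: near_def \<phi>_def)
  qed (use \<phi> in \<open>auto simp: bij_swap_cells\<close>)
  then have *: "R * energy p m (\<lambda>a. v (\<phi> a)) \<le> \<kappa> * R * energy p m v"
    by (rule scaled_le[OF _ energy_nonneg])
  have "top_side v = right (\<lambda>a. v (\<phi> a))" "left v = left (\<lambda>a. v (\<phi> a))"
    unfolding top_side_def right_def left_def \<phi>_def by (auto intro!: sum.cong simp: min.absorb2 max.absorb1)
  then show ?thesis using left_right[of "\<lambda>a. v (\<phi> a)"] * by simp
qed

text \<open>Folds onto the triangle below the diagonal, which keeps the right side and carries the
  left side to the bottom; \<open>left_top\<close> folds onto the triangle above.\<close>

lemma bottom_right: "\<bar>right v - bottom v\<bar> powr p \<le> \<kappa> * R * energy p m v"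
proof -
  define \<phi> where "\<phi> a = (max (fst a) (snd a), min (fst a) (snd a))" for a :: "int \<times> int"
  have \<phi>: "\<phi> a = id a \<or> \<phi> a = prod.swap a" for a by (cases a) (auto simp: \<phi>_def min_def max_def)
  have "energy p m (\<lambda>a. v (\<phi> a)) \<le> 18 * energy p m v"
  proof (rule energy_comp_le[of m \<phi> id prod.swap])
    show "\<phi> a \<in> cells m" if "a \<in> cells m" for a using \<phi>[of a] that by (metis cells_swap_iff id_apply)
    show "near (\<phi> a) (\<phi> b)" if "near a b" for a b using that by (auto simp: near_def \<phi>_def)
  qed (use \<phi> in \<open>auto simp: bij_swap_cells\<close>)
  then have *: "R * energy p m (\<lambda>a. v (\<phi> a)) \<le> \<kappa> * R * energy p m v"
    by (rule scaled_le[OF _ energy_nonneg])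
  have "right v = right (\<lambda>a. v (\<phi> a))" "bottom v = left (\<lambda>a. v (\<phi> a))"
    unfolding bottom_def right_def left_def \<phi>_def by (auto intro!: sum.cong simp: min.absorb2 max.absorb1)
  then show ?thesis using left_right[of "\<lambda>a. v (\<phi> a)"] * by simp
qed

section \<open>Side averages and means over the blocks of a coarser level\<close>

definition trace :: "(int \<times> int \<Rightarrow> real) \<Rightarrow> int \<times> int \<Rightarrow> real" where
  "trace u q = left (\<lambda>r. u (blk m q r))"

definition mean :: "(int \<times> int \<Rightarrow> real) \<Rightarrow> int \<times> int \<Rightarrow> real" where
  "mean u q = (\<Sum>r\<in>cells m. u (blk m q r)) / 8 ^ m"

text \<open>Includes the edges that leave the block \<open>q\<close>, so that it controls both the
  energy inside the block and the differences across its sides.\<close>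

definition local_energy :: "nat \<Rightarrow> (int \<times> int \<Rightarrow> real) \<Rightarrow> int \<times> int \<Rightarrow> real" where
  "local_energy n u q = (\<Sum>r\<in>cells m. \<Sum>z\<in>nbrs (n + m) (blk m q r). \<bar>u (blk m q r) - u z\<bar> powr p)"

lemma local_energy_nonneg: "0 \<le> local_energy n u q"
  by (auto simp: local_energy_def intro!: sum_nonneg)

lemma sum_local_energy: "(\<Sum>q\<in>cells n. local_energy n u q) = energy p (n + m) u"
  unfolding local_energy_def energy_eq_nbrs sum_cells_add ..

lemma block_energy_le:
  assumes q: "q \<in> cells n"
  shows "energy p m (\<lambda>r. u (blk m q r)) \<le> local_energy n u q"
  unfolding energy_eq_nbrs local_energy_def
proof (rule sum_mono)
  fix r assume r: "r \<in> cells m"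
  have inj: "inj_on (blk m q) (nbrs m r)" by (auto intro!: inj_onI dest: blk_inj simp: nbrs_def)
  have "(\<Sum>b\<in>nbrs m r. \<bar>u (blk m q r) - u (blk m q b)\<bar> powr p) = (\<Sum>z\<in>blk m q ` nbrs m r. \<bar>u (blk m q r) - u z\<bar> powr p)"
    by (simp add: sum.reindex[OF inj])
  also have "\<dots> \<le> (\<Sum>z\<in>nbrs (n + m) (blk m q r). \<bar>u (blk m q r) - u z\<bar> powr p)"
  proof (rule sum_mono2)
    show "blk m q ` nbrs m r \<subseteq> nbrs (n + m) (blk m q r)"
      using blk_in_cells[OF q] by (auto simp: nbrs_def near_def)
  qed auto
  finally show "(\<Sum>b\<in>nbrs m r. \<bar>u (blk m q r) - u (blk m q b)\<bar> powr p) \<le> (\<Sum>z\<in>nbrs (n + m) (blk m q r). \<bar>u (blk m q r) - u z\<bar> powr p)" .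
qed

text \<open>Pairing the cells of two touching sides turns the difference of the weighted averages
  into one weighted sum of differences along edges, to which \<open>weights_dual_bound\<close>
  applies. The loss does not grow with the length of the side.\<close>

lemma matching_le:
  assumes q: "q \<in> cells n" "q' \<in> cells n" and inj: "inj_on g J"
    and g: "\<And>j. j \<in> J \<Longrightarrow> g j \<in> cells m" "\<And>j. j \<in> J \<Longrightarrow> g' j \<in> cells m"
    and near: "\<And>j. j \<in> J \<Longrightarrow> near (blk m q (g j)) (blk m q' (g' j))"
  shows "\<bar>(\<Sum>j\<in>J. \<alpha> j * u (blk m q (g j))) - (\<Sum>j\<in>J. \<alpha> j * u (blk m q' (g' j)))\<bar> powr p \<le> \<kappa> * R * local_energy n u q"
proof -
  define W where "W r = (\<Sum>z\<in>nbrs (n + m) (blk m q r). \<bar>u (blk m q r) - u z\<bar> powr p)" for r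
  have "(\<Sum>j\<in>J. \<bar>u (blk m q (g j)) - u (blk m q' (g' j))\<bar> powr p) \<le> (\<Sum>j\<in>J. W (g j))"
  proof (rule sum_mono)
    fix j assume j: "j \<in> J"
    have "blk m q' (g' j) \<in> nbrs (n + m) (blk m q (g j))"
      using near[OF j] blk_in_cells[OF q(2) g(2)[OF j]] by (simp add: nbrs_def)
    then show "\<bar>u (blk m q (g j)) - u (blk m q' (g' j))\<bar> powr p \<le> W (g j)"
      unfolding W_def by (intro member_le_sum) auto
  qed
  also have "\<dots> = (\<Sum>r\<in>g ` J. W r)" by (simp add: sum.reindex[OF inj])
  also have "\<dots> \<le> (\<Sum>r\<in>cells m. W r)" using g by (intro sum_mono2) (auto simp: W_def intro: sum_nonneg)
  finally have *: "(\<Sum>j\<in>J. \<bar>u (blk m q (g j)) - u (blk m q' (g' j))\<bar> powr p) \<le> local_energy n u q"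
    by (simp add: W_def local_energy_def)
  have "(\<Sum>j\<in>J. \<alpha> j * u (blk m q (g j))) - (\<Sum>j\<in>J. \<alpha> j * u (blk m q' (g' j)))
      = (\<Sum>j\<in>J. \<alpha> j * (u (blk m q (g j)) - u (blk m q' (g' j))))"
    by (simp add: sum_subtractf right_diff_distrib)
  also have "\<bar>\<dots>\<bar> powr p \<le> \<kappa> * R * (\<Sum>j\<in>J. \<bar>u (blk m q (g j)) - u (blk m q' (g' j))\<bar> powr p)"
    by (rule weights_dual_bound)
  also have "\<dots> \<le> \<kappa> * R * local_energy n u q" using * R \<kappa>_ge by (intro mult_left_mono) auto
  finally show ?thesis .
qed

lemma diff_abs_le:
  fixes a b c x y :: real
  shows "\<bar>a - c\<bar> \<le> x \<Longrightarrow> \<bar>b - c\<bar> \<le> y \<Longrightarrow> \<bar>a - b\<bar> \<le> x + y"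
  by linarith

lemma abs_le_root:
  fixes x c :: real
  assumes "\<bar>x\<bar> powr p \<le> c"
  shows "\<bar>x\<bar> \<le> c powr (1 / p)"
proof -
  have "(\<bar>x\<bar> powr p) powr (1 / p) \<le> c powr (1 / p)" using assms p by (intro powr_mono2) auto
  then show ?thesis using p by (simp add: powr_powr)
qed

context
  fixes n :: nat and u :: "int \<times> int \<Rightarrow> real" and q :: "int \<times> int" and \<Lambda> :: real
  assumes q: "q \<in> cells n" and \<Lambda>: "local_energy n u q \<le> \<Lambda>"
begin

lemma \<kappa>_mono: "x \<le> \<kappa> * R * local_energy n u q \<Longrightarrow> x \<le> \<kappa> * R * \<Lambda>"
  using order_trans mult_left_mono[OF \<Lambda>, of "\<kappa> * R"] R \<kappa>_ge by fastforce

lemma block_step: "x \<le> \<kappa> * R * energy p m (\<lambda>r. u (blk m q r)) \<Longrightarrow> x \<le> \<kappa> * R * \<Lambda>"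
proof (rule \<kappa>_mono)
  assume "x \<le> \<kappa> * R * energy p m (\<lambda>r. u (blk m q r))"
  also have "\<dots> \<le> \<kappa> * R * local_energy n u q"
    using block_energy_le[OF q] R \<kappa>_ge by (intro mult_left_mono) auto
  finally show "x \<le> \<kappa> * R * local_energy n u q" .
qed

lemma trace_right: "\<bar>right (\<lambda>r. u (blk m q r)) - trace u q\<bar> \<le> (\<kappa> * R * \<Lambda>) powr (1 / p)"
proof (rule abs_le_root, rule block_step, unfold trace_def)
  have "R * energy p m (\<lambda>r. u (blk m q r)) \<le> \<kappa> * (R * energy p m (\<lambda>r. u (blk m q r)))"
    using \<kappa>_ge R energy_nonneg[of p m "\<lambda>r. u (blk m q r)"] mult_right_mono[of 1 \<kappa> "R * energy p m (\<lambda>r. u (blk m q r))"] by simp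
  then show "\<bar>right (\<lambda>r. u (blk m q r)) - left (\<lambda>r. u (blk m q r))\<bar> powr p \<le> \<kappa> * R * energy p m (\<lambda>r. u (blk m q r))"
    using left_right[of "\<lambda>r. u (blk m q r)"] by (simp add: mult.assoc)
qed

lemma trace_top: "\<bar>top_side (\<lambda>r. u (blk m q r)) - trace u q\<bar> \<le> (\<kappa> * R * \<Lambda>) powr (1 / p)"
  by (rule abs_le_root, rule block_step, unfold trace_def) (rule left_top)

lemma right_bottom: "\<bar>right (\<lambda>r. u (blk m q r)) - bottom (\<lambda>r. u (blk m q r))\<bar> \<le> (\<kappa> * R * \<Lambda>) powr (1 / p)"
  by (rule abs_le_root, rule block_step) (rule bottom_right)

lemma right_left_next:
  assumes "(fst q + 1, snd q) \<in> cells n"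
  shows "\<bar>right (\<lambda>r. u (blk m q r)) - trace u (fst q + 1, snd q)\<bar> \<le> (\<kappa> * R * \<Lambda>) powr (1 / p)"
  unfolding right_def trace_def left_def
  by (rule abs_le_root, rule \<kappa>_mono, rule matching_le[OF q assms])
    (auto intro!: inj_onI cells_left cells_right simp: near_def algebra_simps)

lemma top_bottom_next:
  assumes "(fst q, snd q + 1) \<in> cells n"
  shows "\<bar>top_side (\<lambda>r. u (blk m q r)) - bottom (\<lambda>r. u (blk m (fst q, snd q + 1) r))\<bar> \<le> (\<kappa> * R * \<Lambda>) powr (1 / p)"
  unfolding top_side_def bottom_def
  by (rule abs_le_root, rule \<kappa>_mono, rule matching_le[OF q assms])
    (auto intro!: inj_onI cells_top cells_bottom simp: near_def algebra_simps)

end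

text \<open>Horizontally two steps: from the left to the right side of \<open>q\<close>, then
  across. Vertically four: from left to top in \<open>q\<close>, across to the bottom of
  \<open>q'\<close>, then to the right and to the left side of \<open>q'\<close>.\<close>

lemma trace_side:
  assumes q: "q \<in> cells n" "q' \<in> cells n" and \<Lambda>: "local_energy n u q \<le> \<Lambda>" "local_energy n u q' \<le> \<Lambda>"
    and side: "q' = (fst q + 1, snd q) \<or> q' = (fst q, snd q + 1)"
  shows "\<bar>trace u q - trace u q'\<bar> \<le> 4 * (\<kappa> * R * \<Lambda>) powr (1 / p)"
  using side
proof
  assume e: "q' = (fst q + 1, snd q)"
  then show ?thesis using trace_right[OF q(1) \<Lambda>(1)] right_left_next[OF q(1) \<Lambda>(1)] q by auto
next
  assume e: "q' = (fst q, snd q + 1)"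
  then show ?thesis
    using trace_top[OF q(1) \<Lambda>(1)] top_bottom_next[OF q(1) \<Lambda>(1)] right_bottom[OF q(2) \<Lambda>(2)] trace_right[OF q(2) \<Lambda>(2)] q
    by auto
qed

text \<open>By \<open>cells_corner\<close> diagonal neighbours have a common side neighbour, so two
  side steps suffice and the 4 becomes an 8.\<close>

lemma trace_near:
  assumes q: "q \<in> cells n" "q' \<in> cells n" "near q q'" and \<Lambda>: "\<And>b. b \<in> nbrs n q \<Longrightarrow> local_energy n u b \<le> \<Lambda>"
  shows "\<bar>trace u q - trace u q'\<bar> \<le> 8 * (\<kappa> * R * \<Lambda>) powr (1 / p)"
proof -
  define \<eta> where "\<eta> = (\<kappa> * R * \<Lambda>) powr (1 / p)"
  have \<eta>: "0 \<le> \<eta>" by (simp add: \<eta>_def)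
  have side: "\<bar>trace u a - trace u b\<bar> \<le> 4 * \<eta>"
    if "a \<in> nbrs n q" "b \<in> nbrs n q" "\<bar>fst a - fst b\<bar> + \<bar>snd a - snd b\<bar> = 1" for a b
  proof -
    have ab: "a \<in> cells n" "b \<in> cells n" using that by (auto simp: nbrs_def)
    have "b = (fst a + 1, snd a) \<or> b = (fst a, snd a + 1) \<or> a = (fst b + 1, snd b) \<or> a = (fst b, snd b + 1)"
      using that(3) by (cases a; cases b) auto
    then show ?thesis
      using trace_side[OF ab \<Lambda>[OF that(1)] \<Lambda>[OF that(2)]] trace_side[OF ab(2,1) \<Lambda>[OF that(2)] \<Lambda>[OF that(1)]]
      unfolding \<eta>_def by (metis abs_minus_commute)
  qed
  have qn: "q \<in> nbrs n q" "q' \<in> nbrs n q" using q by (auto simp: nbrs_def)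
  have "\<bar>trace u q - trace u q'\<bar> \<le> 8 * \<eta>"
  proof (cases "\<bar>fst q - fst q'\<bar> = 1 \<and> \<bar>snd q - snd q'\<bar> = 1")
    case True
    then obtain z where z: "z \<in> cells n" "z = (fst q, snd q') \<or> z = (fst q', snd q)"
      using cells_corner[of "fst q" "snd q" n "fst q'" "snd q'"] q by auto
    have "z \<in> nbrs n q" using z True by (auto simp: nbrs_def near_def)
    moreover have "\<bar>fst q - fst z\<bar> + \<bar>snd q - snd z\<bar> = 1" "\<bar>fst z - fst q'\<bar> + \<bar>snd z - snd q'\<bar> = 1" using z True by auto
    ultimately show ?thesis using side[OF qn(1), of z] side[of z q'] qn by linarith
  next
    case False
    show ?thesis
    proof (cases "q = q'")
      case True
      then show ?thesis using \<eta> by simp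
    next
      case neq: False
      have "\<bar>fst q - fst q'\<bar> + \<bar>snd q - snd q'\<bar> = 1"
        using q(3) False neq by (cases q; cases q') (auto simp: near_def)
      from side[OF qn this] show ?thesis using \<eta> by simp
    qed
  qed
  then show ?thesis by (simp add: \<eta>_def)
qed

text \<open>\<open>8 powr p\<close> comes from \<open>trace_near\<close>. The 81 counts neighbours
  twice: in the coarse energy, and in the overlap of the local energies.\<close>

definition A :: real where "A = 81 * 8 powr p * \<kappa>"

text \<open>Passing to side averages over \<open>m\<close> levels divides the energy by the
  conductance, up to a factor \<open>A\<close> that is independent of \<open>m\<close>. This
  independence is what the dual weights achieve.\<close>

lemma energy_trace: "energy p n (trace u) \<le> A * R * energy p (n + m) u"
proof -
  define \<Lambda> where "\<Lambda> q = (\<Sum>b\<in>nbrs n q. local_energy n u b)" for q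
  have \<Lambda>0: "0 \<le> \<Lambda> q" for q by (auto simp: \<Lambda>_def intro!: sum_nonneg local_energy_nonneg)
  have "\<bar>trace u q - trace u q'\<bar> powr p \<le> 8 powr p * (\<kappa> * R * \<Lambda> q)" if "q \<in> cells n" "q' \<in> nbrs n q" for q q'
  proof -
    have le: "local_energy n u b \<le> \<Lambda> q" if "b \<in> nbrs n q" for b
      unfolding \<Lambda>_def using that local_energy_nonneg by (intro member_le_sum) auto
    have "\<bar>trace u q - trace u q'\<bar> \<le> 8 * (\<kappa> * R * \<Lambda> q) powr (1 / p)"
      using that le by (intro trace_near) (auto simp: nbrs_def)
    then have "\<bar>trace u q - trace u q'\<bar> powr p \<le> (8 * (\<kappa> * R * \<Lambda> q) powr (1 / p)) powr p"
      using p by (intro powr_mono_abs) auto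
    also have "\<dots> = 8 powr p * (\<kappa> * R * \<Lambda> q)"
      using p R \<kappa>_ge \<Lambda>0[of q] by (simp add: powr_mult powr_powr)
    finally show ?thesis .
  qed
  then have "energy p n (trace u) \<le> (\<Sum>q\<in>cells n. \<Sum>q'\<in>nbrs n q. 8 powr p * (\<kappa> * R * \<Lambda> q))"
    unfolding energy_eq_nbrs by (intro sum_mono)
  also have "\<dots> \<le> 9 * (\<Sum>q\<in>cells n. 8 powr p * (\<kappa> * R * \<Lambda> q))"
    using R \<kappa>_ge \<Lambda>0 by (intro sum_nbrs_le) auto
  also have "\<dots> = 9 * (8 powr p * (\<kappa> * R)) * (\<Sum>q\<in>cells n. \<Lambda> q)"
    by (simp add: mult.assoc flip: sum_distrib_left)
  finally have "energy p n (trace u) \<le> 9 * (8 powr p * (\<kappa> * R)) * (\<Sum>q\<in>cells n. \<Lambda> q)" .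
  moreover have "(\<Sum>q\<in>cells n. \<Lambda> q) \<le> 9 * (\<Sum>q\<in>cells n. local_energy n u q)"
    unfolding \<Lambda>_def by (intro sum_nbrs_le local_energy_nonneg)
  then have "9 * (8 powr p * (\<kappa> * R)) * (\<Sum>q\<in>cells n. \<Lambda> q) \<le> 9 * (8 powr p * (\<kappa> * R)) * (9 * energy p (n + m) u)"
    using R \<kappa>_ge unfolding sum_local_energy by (intro mult_left_mono) auto
  ultimately show ?thesis by (simp add: A_def mult_ac)
qed

end

section \<open>Rigidity of functions of small energy\<close>

definition adj_conn :: "nat \<Rightarrow> int \<times> int \<Rightarrow> int \<times> int \<Rightarrow> bool" where
  "adj_conn n = (\<lambda>a b. (a, b) \<in> (adj n)\<^sup>*)"

lemma adj_conn_refl: "adj_conn n a a" by (simp add: adj_conn_def)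

lemma adj_conn_trans: "adj_conn n a b \<Longrightarrow> adj_conn n b c \<Longrightarrow> adj_conn n a c"
  unfolding adj_conn_def by (rule rtrancl_trans)

lemma adj_conn_sym: "adj_conn n a b \<Longrightarrow> adj_conn n b a"
proof -
  have "sym (adj n)" by (auto simp: sym_def adj_def dest: near_sym)
  then show "adj_conn n a b \<Longrightarrow> adj_conn n b a" unfolding adj_conn_def by (metis sym_rtrancl symD)
qed

lemma near_adj_conn: "a \<in> cells n \<Longrightarrow> b \<in> cells n \<Longrightarrow> near a b \<Longrightarrow> adj_conn n a b"
  unfolding adj_conn_def by (cases "a = b") (auto simp: adj_def)

text \<open>Follows the two arcs of the ring of eight subcells that start at the corner
  \<open>(0, 0)\<close>.\<close>

lemma digits_conn:
  assumes a: "a \<in> cells n" and d: "d \<in> digits"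
  shows "adj_conn (Suc n) (blk 1 a (0, 0)) (blk 1 a d)"
proof -
  have in_cells: "blk 1 a e \<in> cells (Suc n)" if "e \<in> digits" for e
    using blk_in_cells[OF a, of e 1] that unfolding One_nat_def cells_1 by simp
  have step: "adj_conn (Suc n) (blk 1 a e) (blk 1 a e')" if "e \<in> digits" "e' \<in> digits" "near e e'" for e e'
    using that in_cells by (intro near_adj_conn) (auto simp: near_def)
  have 1: "adj_conn (Suc n) (blk 1 a (0, 0)) (blk 1 a (1, 0))" "adj_conn (Suc n) (blk 1 a (1, 0)) (blk 1 a (2, 0))"
    "adj_conn (Suc n) (blk 1 a (2, 0)) (blk 1 a (2, 1))" "adj_conn (Suc n) (blk 1 a (2, 1)) (blk 1 a (2, 2))"
    "adj_conn (Suc n) (blk 1 a (0, 0)) (blk 1 a (0, 1))" "adj_conn (Suc n) (blk 1 a (0, 1)) (blk 1 a (0, 2))"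
    "adj_conn (Suc n) (blk 1 a (0, 2)) (blk 1 a (1, 2))"
    by (rule step; simp add: digits_def near_def)+
  have "d = (0, 0) \<or> d = (1, 0) \<or> d = (2, 0) \<or> d = (2, 1) \<or> d = (2, 2) \<or> d = (0, 1) \<or> d = (0, 2) \<or> d = (1, 2)"
    using d by (auto simp: digits_def)
  moreover note 2 = adj_conn_trans[OF 1(1,2)]
  moreover note 3 = adj_conn_trans[OF 2 1(3)]
  moreover note adj_conn_trans[OF 3 1(4)]
  moreover note 4 = adj_conn_trans[OF 1(5,6)]
  moreover note adj_conn_trans[OF 4 1(7)]
  ultimately show ?thesis using 1(1,5) adj_conn_refl by metis
qed

lemma near_blocks_conn:
  assumes a: "a \<in> cells n" "b \<in> cells n" and near: "near a b"
  shows "adj_conn (Suc n) (blk 1 a (0, 0)) (blk 1 b (0, 0))"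
proof -
  \<comment> \<open>The digit facing the neighbour: 2 towards a larger coordinate and 0 otherwise.
    The digit 1 never occurs, so the chosen subcells are not removed.\<close>
  define s where "s u v = (if u < v then 2 else 0 :: int)" for u v :: int
  define d where "d = (s (fst a) (fst b), s (snd a) (snd b))"
  define e where "e = (s (fst b) (fst a), s (snd b) (snd a))"
  have de: "d \<in> digits" "e \<in> digits" by (auto simp: d_def e_def s_def digits_def)
  have s: "\<bar>3 * u + s u v - (3 * v + s v u)\<bar> \<le> 1" if "\<bar>u - v\<bar> \<le> 1" for u v
    using that by (auto simp: s_def)
  have "near (blk 1 a d) (blk 1 b e)" using near by (simp add: near_def d_def e_def s)
  moreover have "blk 1 a d \<in> cells (Suc n)" "blk 1 b e \<in> cells (Suc n)"
    using blk_in_cells[OF a(1), of d 1] blk_in_cells[OF a(2), of e 1] de unfolding One_nat_def cells_1 by simp_all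
  ultimately have "adj_conn (Suc n) (blk 1 a d) (blk 1 b e)" by (intro near_adj_conn)
  then show ?thesis
    using digits_conn[OF a(1) de(1)] digits_conn[OF a(2) de(2)] adj_conn_trans adj_conn_sym by blast
qed

lemma cells_conn: "a \<in> cells n \<Longrightarrow> adj_conn n (0, 0) a"
proof (induction n arbitrary: a)
  case (Suc n)
  then have "a \<in> cells (n + 1)" by simp
  then obtain q d where q: "q \<in> cells n" and d: "d \<in> cells 1" and a: "a = blk 1 q d" by (rule cells_blkE)
  have dd: "d \<in> digits" using d unfolding One_nat_def cells_1 .
  have "((0, 0), q) \<in> (adj n)\<^sup>*" using Suc.IH[OF q] by (simp add: adj_conn_def)
  then have "adj_conn (Suc n) (blk 1 (0, 0) (0, 0)) (blk 1 q (0, 0))"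
  proof (induction rule: rtrancl_induct)
    case base
    show ?case by (rule adj_conn_refl)
  next
    case (step y z)
    then show ?case using near_blocks_conn[of y n z] adj_conn_trans by (auto simp: adj_def)
  qed
  then have "adj_conn (Suc n) (0, 0) (blk 1 q (0, 0))" by (simp add: blk_def)
  then show ?case using digits_conn[OF q dd] adj_conn_trans a by blast
qed (simp add: adj_conn_refl)

text \<open>A path in the connected graph of level \<open>m\<close> costs one edge difference per
  step. The dependence of the constant on \<open>m\<close> is uncontrolled, which is harmless where
  \<open>m\<close> is fixed and only the number of iterations grows.\<close>

lemma cell_variation_bound:
  assumes p: "1 \<le> p"
  obtains c where "0 \<le> c" "\<And>v a. a \<in> cells m \<Longrightarrow> \<bar>v a - v (0, 0)\<bar> \<le> c * energy p m v powr (1 / p)"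
proof -
  have "\<exists>c\<ge>0. \<forall>v. \<bar>v a - v (0, 0)\<bar> \<le> c * energy p m v powr (1 / p)" if "a \<in> cells m" for a
  proof -
    have "((0, 0), a) \<in> (adj m)\<^sup>*" using cells_conn[OF that] by (simp add: adj_conn_def)
    then show ?thesis
    proof (induction rule: rtrancl_induct)
      case (step y z)
      then obtain c where c: "0 \<le> c" "\<And>v. \<bar>v y - v (0, 0)\<bar> \<le> c * energy p m v powr (1 / p)" by blast
      have "\<bar>v z - v (0, 0)\<bar> \<le> (c + 1) * energy p m v powr (1 / p)" for v
      proof -
        have "\<bar>v y - v z\<bar> powr p \<le> energy p m v" using step(2) by (intro energy_edge) (auto simp: adj_def)
        then have "(\<bar>v y - v z\<bar> powr p) powr (1 / p) \<le> energy p m v powr (1 / p)"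
          using p by (intro powr_mono2) auto
        then have "\<bar>v y - v z\<bar> \<le> energy p m v powr (1 / p)" using p by (simp add: powr_powr)
        then show ?thesis using c(2)[of v] by (simp add: distrib_right)
      qed
      then show ?case using c by (intro exI[of _ "c + 1"]) auto
    qed (auto intro!: exI[of _ 0])
  qed
  then obtain c where c: "\<And>a. a \<in> cells m \<Longrightarrow> 0 \<le> c a"
    "\<And>a v. a \<in> cells m \<Longrightarrow> \<bar>v a - v (0, 0)\<bar> \<le> c a * energy p m v powr (1 / p)" by metis
  show thesis
  proof (rule that[of "sum c (cells m)"])
    show "0 \<le> sum c (cells m)" using c by (intro sum_nonneg)
    show "\<bar>v a - v (0, 0)\<bar> \<le> sum c (cells m) * energy p m v powr (1 / p)" if "a \<in> cells m" for v a
    proof -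
      have "c a \<le> sum c (cells m)" using that c by (intro member_le_sum) auto
      then show ?thesis using c(2)[OF that, of v] by (meson mult_right_mono order_trans powr_ge_zero)
    qed
  qed
qed

section \<open>Comparison of means with side averages over many levels\<close>

context side_average
begin

text \<open>Both averages have total weight 1, so each differs from the value at the first subcell
  of the block by a multiple of the variation over the block.\<close>

lemma mean_trace:
  obtains c where "0 \<le> c" "\<And>u q. \<bar>mean u q - trace u q\<bar> powr p \<le> c * energy p m (\<lambda>r. u (blk m q r))"
proof -
  obtain c where c: "0 \<le> c" "\<And>v a. a \<in> cells m \<Longrightarrow> \<bar>v a - v (0, 0)\<bar> \<le> c * energy p m v powr (1 / p)"
    by (rule cell_variation_bound[OF p, of m]) blast
  define b where "b = (1 + (\<Sum>j\<in>J. \<bar>\<alpha> j\<bar>)) * c"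
  have b: "0 \<le> b" using c by (auto simp: b_def intro!: mult_nonneg_nonneg add_nonneg_nonneg sum_nonneg)
  have "\<bar>mean u q - trace u q\<bar> powr p \<le> b powr p * energy p m (\<lambda>r. u (blk m q r))" for u q
  proof -
    define v where "v r = u (blk m q r)" for r
    define e where "e = energy p m v powr (1 / p)"
    have cv: "\<bar>v a - v (0, 0)\<bar> \<le> c * e" if "a \<in> cells m" for a using c(2)[OF that] by (simp add: e_def)
    have "mean u q - v (0, 0) = (\<Sum>r\<in>cells m. v r - v (0, 0)) / 8 ^ m"
      by (simp add: mean_def v_def sum_subtractf card_cells field_simps)
    also have "\<bar>\<dots>\<bar> \<le> (\<Sum>r\<in>cells m. c * e) / 8 ^ m"
      unfolding abs_divide by (intro divide_mono order_trans[OF sum_abs] sum_mono cv sum_nonneg) auto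
    finally have 1: "\<bar>mean u q - v (0, 0)\<bar> \<le> c * e" by (simp add: card_cells)
    have "trace u q - v (0, 0) = (\<Sum>j\<in>J. \<alpha> j * v (0, j)) - (\<Sum>j\<in>J. \<alpha> j) * v (0, 0)"
      by (simp add: trace_def left_def v_def sum_weights)
    also have "\<dots> = (\<Sum>j\<in>J. \<alpha> j * (v (0, j) - v (0, 0)))"
      by (simp add: sum_distrib_right sum_subtractf right_diff_distrib)
    also have "\<bar>\<dots>\<bar> \<le> (\<Sum>j\<in>J. \<bar>\<alpha> j\<bar> * (c * e))"
    proof (rule order_trans[OF sum_abs], rule sum_mono)
      fix j assume "j \<in> J"
      then show "\<bar>\<alpha> j * (v (0, j) - v (0, 0))\<bar> \<le> \<bar>\<alpha> j\<bar> * (c * e)"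
        unfolding abs_mult by (intro mult_left_mono cv cells_left) auto
    qed
    finally have 2: "\<bar>trace u q - v (0, 0)\<bar> \<le> (\<Sum>j\<in>J. \<bar>\<alpha> j\<bar>) * (c * e)" by (simp add: sum_distrib_right)
    have "\<bar>mean u q - trace u q\<bar> \<le> c * e + (\<Sum>j\<in>J. \<bar>\<alpha> j\<bar>) * (c * e)"
      using 1 2 by (rule diff_abs_le)
    also have "\<dots> = b * e" by (simp add: b_def algebra_simps)
    finally have "\<bar>mean u q - trace u q\<bar> powr p \<le> (b * e) powr p" using p by (intro powr_mono_abs) auto
    also have "\<dots> = b powr p * energy p m v" using p energy_nonneg by (simp add: powr_mult e_def powr_powr)
    finally show ?thesis unfolding v_def .
  qed
  then show thesis by (intro that[of "b powr p"]) auto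
qed

text \<open>Jensen's inequality in each of the \<open>K\<close> steps, every one averaging over
  \<open>8 ^ m\<close> subcells; the sum over the descendants of \<open>q\<close> is relaxed to the
  sum over all cells.\<close>

lemma mean_iter_bound:
  "q \<in> cells n \<Longrightarrow> \<bar>(mean ^^ K) g q\<bar> powr p \<le> (1 / 8 ^ m) ^ K * (\<Sum>a\<in>cells (n + K * m). \<bar>g a\<bar> powr p)"
proof (induction K arbitrary: g)
  case 0
  then show ?case using member_le_sum[of q "cells n" "\<lambda>a. \<bar>g a\<bar> powr p"] by simp
next
  case (Suc K)
  have "(mean ^^ Suc K) g q = (mean ^^ K) (mean g) q" by (simp add: funpow_swap1)
  then have "\<bar>(mean ^^ Suc K) g q\<bar> powr p \<le> (1 / 8 ^ m) ^ K * (\<Sum>a\<in>cells (n + K * m). \<bar>mean g a\<bar> powr p)"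
    using Suc by simp
  also have "(\<Sum>a\<in>cells (n + K * m). \<bar>mean g a\<bar> powr p) \<le> (\<Sum>a\<in>cells (n + K * m). (\<Sum>r\<in>cells m. \<bar>g (blk m a r)\<bar> powr p) / 8 ^ m)"
  proof (rule sum_mono)
    fix a
    have "(0, 0) \<in> cells m" using cells_left[of 0 m] by simp
    then show "\<bar>mean g a\<bar> powr p \<le> (\<Sum>r\<in>cells m. \<bar>g (blk m a r)\<bar> powr p) / 8 ^ m"
      using powr_mean_le[OF finite_cells[of m] _ p, of "\<lambda>r. g (blk m a r)"] by (auto simp: mean_def card_cells)
  qed
  also have "\<dots> = (1 / 8 ^ m) * (\<Sum>a\<in>cells (n + K * m + m). \<bar>g a\<bar> powr p)"
    by (simp add: sum_cells_add sum_divide_distrib)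
  finally show ?case by (simp add: mult_left_mono algebra_simps)
qed

lemma mean_iter_diff: "(mean ^^ K) (\<lambda>a. f a - g a) q = (mean ^^ K) f q - (mean ^^ K) g q"
proof (induction K arbitrary: q)
  case (Suc K)
  have "(mean ^^ K) (\<lambda>a. f a - g a) = (\<lambda>a. (mean ^^ K) f a - (mean ^^ K) g a)" using Suc by auto
  then show ?case by (simp add: mean_def[of _ q] sum_subtractf diff_divide_distrib)
qed simp

lemma mean_iter_cong:
  "(\<And>a. a \<in> cells (n + K * m) \<Longrightarrow> f a = g a) \<Longrightarrow> q \<in> cells n \<Longrightarrow> (mean ^^ K) f q = (mean ^^ K) g q"
proof (induction K arbitrary: q f g)
  case (Suc K)
  have "(mean ^^ K) (mean f) q = (mean ^^ K) (mean g) q"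
  proof (rule Suc.IH[OF _ Suc.prems(2)])
    fix a assume a: "a \<in> cells (n + K * m)"
    have "f (blk m a r) = g (blk m a r)" if "r \<in> cells m" for r
      using Suc.prems(1) blk_in_cells[OF a that] by (simp add: algebra_simps)
    then show "mean f a = mean g a" by (simp add: mean_def)
  qed
  then show ?case by (simp add: funpow_swap1)
qed simp

text \<open>Replacing \<open>mean\<close> by \<open>trace\<close> step by step leaves
  \<open>K\<close> error terms. In each of them the outer means contract by
  \<open>1 / 8 ^ m\<close>, the inner traces multiply the energy by at most \<open>A * R\<close>,
  and \<open>b\<close> dominates both. The truncated exponent \<open>K - 1\<close> at
  \<open>K = 0\<close> is neutralised by the factor \<open>K\<close>.\<close>

lemma mean_trace_iter:
  assumes c: "0 \<le> c" "\<And>u q. \<bar>mean u q - trace u q\<bar> powr p \<le> c * energy p m (\<lambda>r. u (blk m q r))"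
    and b: "A * R \<le> b" "1 / 8 ^ m \<le> b" and q: "q \<in> cells n"
  shows "\<bar>(mean ^^ K) v q - (trace ^^ K) v q\<bar> \<le> real K * (c * b ^ (K - 1) * energy p (n + K * m) v) powr (1 / p)"
proof (induction K arbitrary: v)
  case (Suc K)
  have b0: "0 \<le> b" using b(2) by (meson order_trans zero_le_divide_1_iff zero_le_numeral zero_le_power)
  define e where "e = energy p (n + Suc K * m) v"
  have e0: "0 \<le> e" by (simp add: e_def energy_nonneg)
  have lev: "n + Suc K * m = n + K * m + m" by simp
  define g where "g a = mean v a - trace v a" for a
  have "(\<Sum>a\<in>cells (n + K * m). \<bar>g a\<bar> powr p) \<le> (\<Sum>a\<in>cells (n + K * m). c * local_energy (n + K * m) v a)"
  proof (rule sum_mono)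
    fix a assume a: "a \<in> cells (n + K * m)"
    have "\<bar>g a\<bar> powr p \<le> c * energy p m (\<lambda>r. v (blk m a r))" unfolding g_def by (rule c(2))
    also have "\<dots> \<le> c * local_energy (n + K * m) v a" by (intro mult_left_mono block_energy_le a c)
    finally show "\<bar>g a\<bar> powr p \<le> c * local_energy (n + K * m) v a" .
  qed
  also have "\<dots> = c * e" unfolding e_def lev by (simp add: sum_local_energy flip: sum_distrib_left)
  finally have G: "(\<Sum>a\<in>cells (n + K * m). \<bar>g a\<bar> powr p) \<le> c * e" .
  have "\<bar>(mean ^^ K) g q\<bar> powr p \<le> (1 / 8 ^ m) ^ K * (\<Sum>a\<in>cells (n + K * m). \<bar>g a\<bar> powr p)"
    by (rule mean_iter_bound[OF q])
  also have "\<dots> \<le> b ^ K * (c * e)"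
    using G b b0 c e0 by (intro mult_mono power_mono sum_nonneg) auto
  finally have 1: "\<bar>(mean ^^ K) g q\<bar> \<le> (c * b ^ K * e) powr (1 / p)"
    by (intro abs_le_root) (simp add: mult_ac)
  have "c * b ^ (K - 1) * energy p (n + K * m) (trace v) \<le> c * b ^ K * e" if "K \<noteq> 0"
  proof -
    have "energy p (n + K * m) (trace v) \<le> A * R * e"
      unfolding e_def lev by (rule energy_trace)
    also have "\<dots> \<le> b * e" using b e0 by (intro mult_right_mono)
    finally have "c * b ^ (K - 1) * energy p (n + K * m) (trace v) \<le> c * b ^ (K - 1) * (b * e)"
      using c b0 by (intro mult_left_mono) auto
    also have "\<dots> = c * b ^ K * e" using that by (cases K) auto
    finally show ?thesis .
  qed
  then have "real K * (c * b ^ (K - 1) * energy p (n + K * m) (trace v)) powr (1 / p) \<le> real K * (c * b ^ K * e) powr (1 / p)"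
    using c b0 p energy_nonneg by (cases "K = 0") (auto intro!: mult_left_mono powr_mono2)
  then have 2: "\<bar>(mean ^^ K) (trace v) q - (trace ^^ K) (trace v) q\<bar> \<le> real K * (c * b ^ K * e) powr (1 / p)"
    using Suc.IH[of "trace v"] by linarith
  have "(mean ^^ Suc K) v q - (trace ^^ Suc K) v q = (mean ^^ K) g q + ((mean ^^ K) (trace v) q - (trace ^^ K) (trace v) q)"
    using mean_iter_diff[of K "mean v" "trace v" q] by (simp add: g_def[abs_def] funpow_swap1)
  then have "\<bar>(mean ^^ Suc K) v q - (trace ^^ Suc K) v q\<bar> \<le> (c * b ^ K * e) powr (1 / p) + real K * (c * b ^ K * e) powr (1 / p)"
    using abs_triangle_ineq[of "(mean ^^ K) g q" "(mean ^^ K) (trace v) q - (trace ^^ K) (trace v) q"] 1 2 by linarith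
  then show ?case by (simp add: e_def distrib_right)
qed simp

lemma energy_trace_iter:
  assumes "A * R \<le> b"
  shows "energy p n ((trace ^^ K) v) \<le> b ^ K * energy p (n + K * m) v"
proof (induction K arbitrary: v)
  case (Suc K)
  have "0 \<le> A * R" using R \<kappa>_ge by (simp add: A_def)
  then have b0: "0 \<le> b" using assms by simp
  have 1: "energy p n ((trace ^^ Suc K) v) \<le> b ^ K * energy p (n + K * m) (trace v)"
    using Suc[of "trace v"] by (simp add: funpow_swap1)
  have "energy p (n + K * m) (trace v) \<le> A * R * energy p (n + K * m + m) v"
    by (rule energy_trace)
  also have "\<dots> \<le> b * energy p (n + K * m + m) v"
    by (rule mult_right_mono[OF assms energy_nonneg])
  finally have "energy p (n + K * m) (trace v) \<le> b * energy p (n + K * m + m) v" .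
  then have "b ^ K * energy p (n + K * m) (trace v) \<le> b ^ K * (b * energy p (n + K * m + m) v)"
    using b0 by (intro mult_left_mono) auto
  with 1 show ?case by (simp add: add.assoc add.commute[of m] mult_ac)
qed simp

text \<open>Both values are \<open>K\<close>-fold means of the values \<open>K * m\<close> levels
  below. Those means are close to \<open>K\<close>-fold side averages, whose energy is at most
  \<open>b ^ K\<close> times the energy \<open>K * m\<close> levels below. The assumptions
  \<open>small\<close> say that \<open>b * \<tau> ^ m < 1\<close>, so everything decays
  geometrically in \<open>K\<close>, up to a linear factor.\<close>

lemma averages_near_eq:
  assumes cons: "\<And>n q. q \<in> cells n \<Longrightarrow> mean (u (n + m)) q = u n q"
    and C: "\<And>n. energy p n (u n) \<le> C * \<tau> ^ n" and C0: "0 \<le> C" and \<tau>: "0 \<le> \<tau>"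
    and small: "A * R * \<tau> ^ m < 1" "\<tau> ^ m < 8 ^ m"
    and q: "q \<in> cells n" "q' \<in> cells n" "near q q'"
  shows "u n q = u n q'"
proof -
  obtain c where c: "0 \<le> c" "\<And>u q. \<bar>mean u q - trace u q\<bar> powr p \<le> c * energy p m (\<lambda>r. u (blk m q r))"
    by (rule mean_trace) blast
  define b where "b = max (A * R) (1 / 8 ^ m)"
  have b: "A * R \<le> b" "1 / 8 ^ m \<le> b" by (auto simp: b_def)
  have b0: "0 < b" by (simp add: b_def less_max_iff_disj)
  define s where "s = b * \<tau> ^ m"
  have s: "0 \<le> s" "s < 1" using small b0 \<tau> by (auto simp: s_def b_def max_def field_simps)
  have mean_iter: "(mean ^^ K) (u (n + K * m)) q = u n q" if "q \<in> cells n" for K q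
  proof (induction K)
    case (Suc K)
    have "(mean ^^ K) (mean (u (n + Suc K * m))) q = (mean ^^ K) (u (n + K * m)) q"
      using cons[of _ "n + K * m"] by (intro mean_iter_cong[OF _ that]) (simp add: algebra_simps)
    then show ?case using Suc by (simp add: funpow_swap1)
  qed simp
  \<comment> \<open>The quotient \<open>c / b\<close> compensates for the exponent
    \<open>K - 1\<close> in \<open>mean_trace_iter\<close>; the maximum with 1 lets the same
    constant serve for the energy of the traces.\<close>
  define D where "D = max (c / b) 1 * C * \<tau> ^ n"
  have D0: "0 \<le> D" using C0 \<tau> by (simp add: D_def max_def)
  have E: "energy p (n + K * m) (u (n + K * m)) \<le> C * \<tau> ^ n * (\<tau> ^ m) ^ K" for K
    using C[of "n + K * m"] by (simp add: power_add power_mult mult.commute[of K])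
  have near_trace: "\<bar>u n a - (trace ^^ K) (u (n + K * m)) a\<bar> \<le> real K * (D * s ^ K) powr (1 / p)"
    if a: "a \<in> cells n" for a K
  proof (cases "K = 0")
    case False
    have "c * b ^ (K - 1) * energy p (n + K * m) (u (n + K * m)) \<le> c * b ^ (K - 1) * (C * \<tau> ^ n * (\<tau> ^ m) ^ K)"
      using c b0 by (intro mult_left_mono E) auto
    also have "\<dots> = c / b * C * \<tau> ^ n * s ^ K"
      using False b0 by (cases K) (auto simp: s_def power_mult_distrib)
    also have "\<dots> \<le> D * s ^ K"
      unfolding D_def using C0 \<tau> s by (intro mult_right_mono) auto
    finally have "(c * b ^ (K - 1) * energy p (n + K * m) (u (n + K * m))) powr (1 / p) \<le> (D * s ^ K) powr (1 / p)"
      using c b0 energy_nonneg p by (intro powr_mono2) auto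
    then have "real K * (c * b ^ (K - 1) * energy p (n + K * m) (u (n + K * m))) powr (1 / p) \<le> real K * (D * s ^ K) powr (1 / p)"
      by (intro mult_left_mono) auto
    then show ?thesis
      using mean_trace_iter[OF c b a, of K "u (n + K * m)"] unfolding mean_iter[OF a] by (rule order_trans[rotated])
  qed simp
  have trace_diff: "\<bar>(trace ^^ K) (u (n + K * m)) q - (trace ^^ K) (u (n + K * m)) q'\<bar> \<le> (D * s ^ K) powr (1 / p)" for K
  proof (rule abs_le_root)
    have "\<bar>(trace ^^ K) (u (n + K * m)) q - (trace ^^ K) (u (n + K * m)) q'\<bar> powr p \<le> energy p n ((trace ^^ K) (u (n + K * m)))"
      by (rule energy_edge[OF q])
    also have "\<dots> \<le> b ^ K * energy p (n + K * m) (u (n + K * m))" by (rule energy_trace_iter[OF b(1)])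
    also have "\<dots> \<le> b ^ K * (C * \<tau> ^ n * (\<tau> ^ m) ^ K)" using b0 by (intro mult_left_mono E) auto
    also have "\<dots> = 1 * C * \<tau> ^ n * s ^ K" by (simp add: s_def power_mult_distrib)
    also have "\<dots> \<le> D * s ^ K" unfolding D_def using C0 \<tau> s by (intro mult_right_mono) auto
    finally show "\<bar>(trace ^^ K) (u (n + K * m)) q - (trace ^^ K) (u (n + K * m)) q'\<bar> powr p \<le> D * s ^ K" .
  qed
  have bound: "\<bar>u n q - u n q'\<bar> \<le> (2 * real K + 1) * (D * s ^ K) powr (1 / p)" for K
    using near_trace[OF q(1), of K] near_trace[OF q(2), of K] trace_diff[of K] by (simp add: algebra_simps)
  define \<sigma> where "\<sigma> = s powr (1 / p)"
  have \<sigma>: "0 \<le> \<sigma>" "\<sigma> < 1" using s p powr_less_mono2[of "1 / p" s 1] by (auto simp: \<sigma>_def)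
  have "(D * s ^ K) powr (1 / p) = D powr (1 / p) * \<sigma> ^ K" for K
  proof -
    have "(s ^ K) powr (1 / p) = \<sigma> ^ K"
      using s by (induction K) (auto simp: \<sigma>_def powr_mult)
    then show ?thesis using s D0 by (simp add: powr_mult)
  qed
  moreover have "(\<lambda>K. (2 * real K + 1) * (D powr (1 / p) * \<sigma> ^ K)) \<longlonglongrightarrow> 0"
  proof -
    have "(\<lambda>K. 2 * D powr (1 / p) * (real K * \<sigma> ^ K) + D powr (1 / p) * \<sigma> ^ K) \<longlonglongrightarrow> 2 * D powr (1 / p) * 0 + D powr (1 / p) * 0"
      using \<sigma> by (intro tendsto_add tendsto_mult tendsto_const LIMSEQ_power_zero powser_times_n_limit_0) auto
    then show ?thesis by (simp add: algebra_simps)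
  qed
  ultimately have "(\<lambda>K. (2 * real K + 1) * (D * s ^ K) powr (1 / p)) \<longlonglongrightarrow> 0" by simp
  then have "\<bar>u n q - u n q'\<bar> \<le> 0"
    by (rule LIMSEQ_le_const) (use bound in auto)
  then show ?thesis by simp
qed

end

text \<open>\<open>m\<close> is taken so large that the conductance exceeds
  \<open>A0 * \<tau> ^ m\<close>, which is possible since \<open>ln \<tau> < l\<close> and
  \<open>ln A0 / m\<close> tends to 0. The other smallness condition amounts to
  \<open>\<tau> < 8\<close> and follows from \<open>l \<le> ln 8\<close>. Near cells then have equal
  values, and the graph is connected.\<close>

theorem small_energy_constant:
  fixes u :: "nat \<Rightarrow> int \<times> int \<Rightarrow> real"
  assumes p: "1 < p" and l: "(\<lambda>m. ln (conductance p m) / real m) \<longlonglongrightarrow> l"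
    and \<tau>: "0 < \<tau>" "ln \<tau> < l"
    and cons: "\<And>n m q. q \<in> cells n \<Longrightarrow> (\<Sum>r\<in>cells m. u (n + m) (blk m q r)) / 8 ^ m = u n q"
    and C: "0 \<le> C" "\<And>n. energy p n (u n) \<le> C * \<tau> ^ n"
    and q: "q \<in> cells n"
  shows "u n q = u 0 (0, 0)"
proof -
  have p1: "1 \<le> p" "0 < p" using p by auto
  define A0 where "A0 = 81 * 8 powr p * (2 powr p * 18)"
  have A0: "0 < A0" by (simp add: A0_def)
  have "l \<le> ln 8 - p * ln 3" using conductance_growth_le[OF l p1(2)] .
  moreover have "0 \<le> p * ln 3" using p1 by simp
  ultimately have l8: "l \<le> ln 8" by linarith
  have "(\<lambda>m. ln (conductance p m) / real m - ln A0 / real m) \<longlonglongrightarrow> l - 0"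
    by (intro tendsto_diff l lim_const_over_n)
  then have "\<forall>\<^sub>F m in sequentially. ln \<tau> < ln (conductance p m) / real m - ln A0 / real m"
    using \<tau> by (intro order_tendstoD) auto
  then obtain m where m: "0 < m" "ln \<tau> < ln (conductance p m) / real m - ln A0 / real m"
    using eventually_happens[OF eventually_conj[OF eventually_gt_at_top[of 0]]] by auto
  define c where "c = conductance p m"
  have c: "0 < c" using conductance_pos[OF m(1) p1(2)] by (simp add: c_def)
  have "real m * ln \<tau> + ln A0 < ln c" using m by (simp add: c_def field_simps)
  then have "ln (\<tau> ^ m * A0) < ln c" using \<tau> A0 by (simp add: ln_mult ln_realpow)
  then have small: "\<tau> ^ m * A0 < c" using \<tau> A0 c by (subst (asm) ln_less_cancel_iff) auto
  have "ln \<tau> < ln 8" using \<tau>(2) l8 by linarith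
  then have "\<tau> < 8" using \<tau>(1) ln_less_cancel_iff[of \<tau> 8] by linarith
  then have small': "\<tau> ^ m < 8 ^ m" using \<tau> m by (intro power_strict_mono) auto
  obtain \<alpha> where \<alpha>: "(\<Sum>j\<in>{0..<3 ^ m}. \<alpha> j) = (1::real)"
    "\<And>f. \<bar>\<Sum>j\<in>{0..<3 ^ m}. \<alpha> j * (f (3 ^ m - 1, j) - f (0, j))\<bar> powr p \<le> energy p m f / c"
    using side_weights[OF m(1) p1(1)] unfolding c_def by blast
  interpret side_average m p "1 / c" \<alpha>
    using m(1) p1 c \<alpha> by unfold_locales auto
  have near_eq: "u n a = u n b" if "a \<in> cells n" "b \<in> cells n" "near a b" for n a b
  proof (rule averages_near_eq[OF _ C(2) C(1) _ _ small' that])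
    show "mean (u (n + m)) q = u n q" if "q \<in> cells n" for n q
      using cons[OF that] by (simp add: mean_def)
    show "A * (1 / c) * \<tau> ^ m < 1" using small c by (simp add: A_def \<kappa>_def A0_def field_simps)
  qed (use \<tau> in auto)
  have const: "u n a = u n (0, 0)" if "a \<in> cells n" for a
  proof -
    have "((0, 0), a) \<in> (adj n)\<^sup>*" using cells_conn[OF that] by (simp add: adj_conn_def)
    then show ?thesis
    proof (induction rule: rtrancl_induct)
      case (step y z)
      then have "y \<in> cells n" "z \<in> cells n" "near y z" by (auto simp: adj_def)
      from near_eq[OF this] step show ?case by simp
    qed simp
  qed
  have "u 0 (0, 0) = (\<Sum>r\<in>cells n. u n r) / 8 ^ n" using cons[of "(0, 0)" 0 n] by (simp add: blk_def)
  also have "(\<Sum>r\<in>cells n. u n r) = (\<Sum>r\<in>cells n. u n (0, 0))" by (intro sum.cong refl const)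
  finally show ?thesis using const[OF q] by (simp add: card_cells)
qed

section \<open>Similarities and Hausdorff measure\<close>

lemma diameter_le_metric:
  fixes S :: "'a::metric_space set"
  assumes "S \<noteq> {} \<or> 0 \<le> d" "\<And>x y. x \<in> S \<Longrightarrow> y \<in> S \<Longrightarrow> dist x y \<le> d"
  shows "diameter S \<le> d"
  unfolding diameter_def using assms by (auto intro: cSUP_least)

lemma diameter_similarity_le:
  fixes T :: "'a::metric_space \<Rightarrow> 'a"
  assumes T: "\<And>x y. dist (T x) (T y) = r * dist x y" and r: "0 < r" and E: "bounded E"
  shows "diameter (T ` E) \<le> r * diameter E" "bounded (T ` E)"
proof -
  have d: "dist x y \<le> diameter E" if "x \<in> E" "y \<in> E" for x y
    using diameter_bounded_bound[OF E that] .
  show "diameter (T ` E) \<le> r * diameter E"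
  proof (rule diameter_le_metric)
    show "T ` E \<noteq> {} \<or> 0 \<le> r * diameter E" using r diameter_ge_0[OF E] by auto
    show "dist x y \<le> r * diameter E" if "x \<in> T ` E" "y \<in> T ` E" for x y
      using that d r by (auto simp: T)
  qed
  obtain a B where "\<And>y. y \<in> E \<Longrightarrow> dist a y \<le> B" using E by (auto simp: bounded_def)
  then show "bounded (T ` E)"
    unfolding bounded_def using r by (intro exI[of _ "T a"] exI[of _ "r * B"]) (auto simp: T)
qed

lemma hausdorff_outer_similarity_le:
  fixes T :: "'a::metric_space \<Rightarrow> 'a"
  assumes T: "\<And>x y. dist (T x) (T y) = r * dist x y" and r: "0 < r" and s: "0 \<le> s"
  shows "hausdorff_outer s (T ` A) \<le> ennreal (r powr s) * hausdorff_outer s A"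
  unfolding hausdorff_outer_def[of s "T ` A"]
proof (rule SUP_least)
  fix \<delta> :: real assume d: "\<delta> \<in> {0<..}"
  have "hausdorff_content s \<delta> (T ` A) \<le> ennreal (r powr s) * hausdorff_content s (\<delta> / r) A"
  proof (rule ennreal_le_epsilon)
    have rs: "0 < ennreal (r powr s)" "ennreal (r powr s) < top" using r by auto
    fix e :: real assume e: "0 < e" and fin: "ennreal (r powr s) * hausdorff_content s (\<delta> / r) A < top"
    have "hausdorff_content s (\<delta> / r) A < hausdorff_content s (\<delta> / r) A + ennreal (e / r powr s)"
    proof -
      have "hausdorff_content s (\<delta> / r) A \<noteq> top" using fin rs by (auto simp: ennreal_mult_less_top)
      then show ?thesis using e r by (metis add.right_neutral divide_pos_pos ennreal_add_left_cancel_less ennreal_less_zero_iff infinity_ennreal_def powr_gt_zero not_less_iff_gr_or_eq)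
    qed
    then obtain E :: "nat \<Rightarrow> 'a set" where E: "A \<subseteq> (\<Union>i. E i)" "\<And>i. bounded (E i)"
      "\<And>i. diameter (E i) \<le> \<delta> / r"
      "(\<Sum>i. ennreal (diameter (E i) powr s)) < hausdorff_content s (\<delta> / r) A + ennreal (e / r powr s)"
      by (rule hausdorff_content_less) blast
    have "hausdorff_content s \<delta> (T ` A) \<le> (\<Sum>i. ennreal (diameter (T ` E i) powr s))"
    proof (rule hausdorff_content_le)
      show "T ` A \<subseteq> (\<Union>i. T ` E i)" using E(1) by blast
      show "bounded (T ` E i)" for i by (rule diameter_similarity_le[OF T r E(2)])
      show "diameter (T ` E i) \<le> \<delta>" for i
        using diameter_similarity_le(1)[OF T r E(2), of i] E(3)[of i] r by (simp add: field_simps)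
    qed
    also have "\<dots> \<le> (\<Sum>i. ennreal (r powr s) * ennreal (diameter (E i) powr s))"
    proof (intro suminf_le allI)
      fix i
      have "diameter (T ` E i) powr s \<le> (r * diameter (E i)) powr s"
        using diameter_similarity_le[OF T r E(2)] s by (intro powr_mono2 diameter_ge_0) auto
      also have "\<dots> = r powr s * diameter (E i) powr s" by (rule powr_mult)
      finally show "ennreal (diameter (T ` E i) powr s) \<le> ennreal (r powr s) * ennreal (diameter (E i) powr s)"
        by (simp add: ennreal_mult[symmetric] ennreal_leI)
    qed auto
    also have "\<dots> = ennreal (r powr s) * (\<Sum>i. ennreal (diameter (E i) powr s))" by simp
    also have "\<dots> \<le> ennreal (r powr s) * (hausdorff_content s (\<delta> / r) A + ennreal (e / r powr s))"
      using E(4) by (intro mult_left_mono) auto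
    also have "\<dots> = ennreal (r powr s) * hausdorff_content s (\<delta> / r) A + ennreal e"
      using e r by (simp add: distrib_left ennreal_mult[symmetric])
    finally show "hausdorff_content s \<delta> (T ` A) \<le> ennreal (r powr s) * hausdorff_content s (\<delta> / r) A + ennreal e" .
  qed
  also have "\<dots> \<le> ennreal (r powr s) * hausdorff_outer s A"
    using d r by (intro mult_left_mono hausdorff_outer_upper) auto
  finally show "hausdorff_content s \<delta> (T ` A) \<le> ennreal (r powr s) * hausdorff_outer s A" .
qed

text \<open>The inverse map is a similarity of ratio \<open>1 / r\<close>, which gives the reverse
  inequality.\<close>

lemma hausdorff_outer_similarity:
  fixes T :: "'a::metric_space \<Rightarrow> 'a"
  assumes T: "\<And>x y. dist (T x) (T y) = r * dist x y" and surj: "surj T" and r: "0 < r" and s: "0 \<le> s"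
  shows "hausdorff_outer s (T ` A) = ennreal (r powr s) * hausdorff_outer s A"
proof (rule antisym)
  show "hausdorff_outer s (T ` A) \<le> ennreal (r powr s) * hausdorff_outer s A"
    by (rule hausdorff_outer_similarity_le[OF T r s])
  have "inj T" using r T by (metis dist_eq_0_iff injI mult_eq_0_iff less_irrefl)
  define S where "S = inv T"
  have S: "T (S x) = x" "S (T x) = x" for x
    using surj \<open>inj T\<close> by (simp_all add: S_def surj_f_inv_f)
  have "dist (S x) (S y) = (1 / r) * dist x y" for x y
    using T[of "S x" "S y"] r by (simp add: S)
  from hausdorff_outer_similarity_le[OF this _ s, of "T ` A"]
  have "hausdorff_outer s A \<le> ennreal ((1 / r) powr s) * hausdorff_outer s (T ` A)"
    using r by (simp add: image_image S)
  then have "ennreal (r powr s) * hausdorff_outer s A \<le> ennreal (r powr s) * (ennreal ((1 / r) powr s) * hausdorff_outer s (T ` A))"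
    by (rule mult_left_mono) simp
  also have "\<dots> = ennreal (r powr s * (1 / r) powr s) * hausdorff_outer s (T ` A)"
    by (simp add: ennreal_mult mult.assoc)
  also have "r powr s * (1 / r) powr s = 1" using r by (simp flip: powr_mult)
  finally show "ennreal (r powr s) * hausdorff_outer s A \<le> hausdorff_outer s (T ` A)" by simp
qed

section \<open>Cells of the carpet\<close>

definition cell_map :: "nat \<Rightarrow> int \<times> int \<Rightarrow> real \<times> real \<Rightarrow> real \<times> real" where
  "cell_map n q x = (x + (real_of_int (fst q), real_of_int (snd q))) /\<^sub>R 3 ^ n"

definition cell_set :: "nat \<Rightarrow> int \<times> int \<Rightarrow> (real \<times> real) set" where
  "cell_set n q = cell_map n q ` carpet"

lemma fst_cell_map [simp]: "fst (cell_map n q x) = (fst x + fst q) / 3 ^ n"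
  and snd_cell_map [simp]: "snd (cell_map n q x) = (snd x + snd q) / 3 ^ n"
  by (simp_all add: cell_map_def divide_inverse mult.commute)

lemma cell_map_comp: "cell_map n q (cell_map m r x) = cell_map (n + m) (blk m q r) x"
  by (rule prod_eqI) (simp_all add: power_add field_simps)

lemma dist_cell_map: "dist (cell_map n q x) (cell_map n q y) = (1 / 3 ^ n) * dist x y"
  by (simp add: cell_map_def dist_norm divide_inverse flip: scaleR_diff_right)

lemma surj_cell_map: "surj (cell_map n q)"
proof (rule surjI)
  show "cell_map n q (3 ^ n *\<^sub>R x - (real_of_int (fst q), real_of_int (snd q))) = x" for x
    by (simp add: cell_map_def)
qed

lemma cell_map_0 [simp]: "cell_map 0 (0, 0) x = x" by (simp add: cell_map_def zero_prod_def[symmetric])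

lemma cell_set_0 [simp]: "cell_set 0 (0, 0) = carpet" by (simp add: cell_set_def)

lemma carpet_facts: "carpet \<noteq> {}" "compact carpet" "carpet = (\<Union>i\<in>carpet_index. carpet_map i ` carpet)"
  using is_carpet_carpet unfolding is_carpet_def by auto

lemma carpet_eq_digits: "carpet = (\<Union>d\<in>digits. cell_set 1 d)"
proof -
  have idx: "carpet_index = (\<lambda>d. (real_of_int (fst d), real_of_int (snd d))) ` digits"
  proof -
    have 1: "digits = {(0, 0), (0, 1), (0, 2), (1, 0), (1, 2), (2, 0), (2, 1), (2, 2)}"
      unfolding digits_def by auto
    have 2: "carpet_index = {(0, 0), (0, 1), (0, 2), (1, 0), (1, 2), (2, 0), (2, 1), (2, 2)}"
      unfolding carpet_index_def by auto
    show ?thesis unfolding 1 2 by simp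
  qed
  show ?thesis
    by (subst carpet_facts(3), unfold idx) (simp add: cell_set_def cell_map_def carpet_map_def)
qed

lemma image_cell_set: "cell_map n q ` cell_set m r = cell_set (n + m) (blk m q r)"
  by (simp add: cell_set_def image_image cell_map_comp)

lemma carpet_eq_cells: "carpet = (\<Union>q\<in>cells n. cell_set n q)"
proof (induction n)
  case (Suc n)
  have "carpet = (\<Union>d\<in>digits. cell_map 1 d ` carpet)"
    by (subst carpet_eq_digits) (simp add: cell_set_def)
  also have "\<dots> = (\<Union>d\<in>digits. cell_map 1 d ` (\<Union>q\<in>cells n. cell_set n q))" using Suc by simp
  also have "\<dots> = (\<Union>d\<in>digits. \<Union>q\<in>cells n. cell_set (Suc n) (blk n d q))"
    by (simp add: image_UN image_cell_set)
  also have "\<dots> = (\<Union>q\<in>cells (Suc n). cell_set (Suc n) q)" by (auto simp: cells.simps(2))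
  finally show ?case .
qed simp

lemma cell_set_eq: "cell_set n q = (\<Union>r\<in>cells m. cell_set (n + m) (blk m q r))"
  by (subst cell_set_def, subst carpet_eq_cells[of m]) (simp add: image_UN image_cell_set)

lemma cell_set_subset: "q \<in> cells n \<Longrightarrow> cell_set n q \<subseteq> carpet"
  using carpet_eq_cells[of n] by blast

lemma compact_cell_set: "compact (cell_set n q)"
  unfolding cell_set_def cell_map_def by (intro compact_continuous_image continuous_intros carpet_facts)

lemma cell_set_borel [measurable]: "cell_set n q \<in> sets borel"
  using compact_cell_set by (simp add: compact_imp_closed borel_closed)

lemma carpet_borel [measurable]: "carpet \<in> sets borel"
  using carpet_facts by (simp add: compact_imp_closed borel_closed)

lemma cell_set_bounds:
  assumes "x \<in> cell_set n q"
  shows "fst q \<le> 3 ^ n * fst x" "3 ^ n * fst x \<le> fst q + 1" "snd q \<le> 3 ^ n * snd x" "3 ^ n * snd x \<le> snd q + 1"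
  using assms carpet_subset by (auto simp: cell_set_def subset_iff)

lemma carpet_bounds:
  assumes "x \<in> carpet"
  shows "0 \<le> fst x" "fst x \<le> 1" "0 \<le> snd x" "snd x \<le> 1"
  using cell_set_bounds[of x 0 "(0, 0)"] assms by simp_all

lemma cell_set_dist:
  assumes "x \<in> cell_set n q" "y \<in> cell_set n q"
  shows "dist x y \<le> 2 / 3 ^ n"
proof -
  have c: "dist a b \<le> 2" if "a \<in> carpet" "b \<in> carpet" for a b
  proof -
    have "dist a b \<le> dist (fst a) (fst b) + dist (snd a) (snd b)"
      unfolding dist_prod_def by (rule sqrt_sum_squares_le_sum_abs[THEN order_trans]) simp
    also have "\<dots> \<le> 1 + 1" using carpet_bounds[OF that(1)] carpet_bounds[OF that(2)] by (intro add_mono) (auto simp: dist_real_def abs_le_iff)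
    finally show ?thesis by simp
  qed
  show ?thesis using assms c by (auto simp: cell_set_def dist_cell_map field_simps)
qed

text \<open>Each corner \<open>c\<close> is the fixed point of the map with index
  \<open>2 *\<^sub>R c\<close>, so the iterates of any point of the carpet under that map converge
  to it.\<close>

lemma carpet_corners: "(0, 0) \<in> carpet" "(1, 0) \<in> carpet" "(0, 1) \<in> carpet" "(1, 1) \<in> carpet"
proof -
  have fix_in: "c \<in> carpet" if c: "c = (0, 0) \<or> c = (1, 0) \<or> c = (0, 1) \<or> c = (1::real, 1)" for c
  proof -
    obtain x where x: "x \<in> carpet" using carpet_facts(1) by blast
    define d where "d = 2 *\<^sub>R c"
    have d: "d \<in> carpet_index" using c by (auto simp: d_def carpet_index_def)
    have dc: "carpet_map d y - c = (1/3) *\<^sub>R (y - c)" for y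
      by (simp add: carpet_map_def d_def algebra_simps flip: scaleR_add_left)
    have "((carpet_map d ^^ k) x) \<in> carpet \<and> (carpet_map d ^^ k) x = c + (1/3) ^ k *\<^sub>R (x - c)" for k
    proof (induction k)
      case (Suc k)
      have "carpet_map d ((carpet_map d ^^ k) x) \<in> carpet" using Suc d carpet_facts(3) by blast
      moreover have "carpet_map d ((carpet_map d ^^ k) x) = c + (1/3) *\<^sub>R ((carpet_map d ^^ k) x - c)"
        using dc[of "(carpet_map d ^^ k) x"] by (simp add: algebra_simps)
      ultimately show ?case using Suc by simp
    qed (use x in simp)
    moreover have "(\<lambda>k. c + (1/3) ^ k *\<^sub>R (x - c)) \<longlonglongrightarrow> c + 0 *\<^sub>R (x - c)"
      by (intro tendsto_intros LIMSEQ_power_zero) simp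
    ultimately have "(\<lambda>k. (carpet_map d ^^ k) x) \<longlonglongrightarrow> c" by simp
    then show ?thesis
      using closed_sequentially[OF compact_imp_closed[OF carpet_facts(2)], of "\<lambda>k. (carpet_map d ^^ k) x" c]
        \<open>\<And>k. ((carpet_map d ^^ k) x) \<in> carpet \<and> _\<close> by blast
  qed
  show "(0, 0) \<in> carpet" "(1, 0) \<in> carpet" "(0, 1) \<in> carpet" "(1, 1) \<in> carpet" by (rule fix_in; simp)+
qed

text \<open>In each coordinate the index of such a cell differs by at most 1 from the rounded-down
  rescaled position of a fixed point of \<open>S\<close>.\<close>

lemma card_cells_meeting:
  assumes S: "\<And>x y. x \<in> S \<Longrightarrow> y \<in> S \<Longrightarrow> dist x y < 1 / 3 ^ n"
  shows "card {q \<in> cells n. cell_set n q \<inter> S \<noteq> {}} \<le> 9"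
proof (cases "S = {}")
  case False
  then obtain y where y: "y \<in> S" by blast
  define i where "i = \<lfloor>3 ^ n * fst y\<rfloor>"
  define j where "j = \<lfloor>3 ^ n * snd y\<rfloor>"
  have "{q \<in> cells n. cell_set n q \<inter> S \<noteq> {}} \<subseteq> {i - 1..i + 1} \<times> {j - 1..j + 1}"
  proof
    fix q assume "q \<in> {q \<in> cells n. cell_set n q \<inter> S \<noteq> {}}"
    then obtain x where x: "x \<in> cell_set n q" "x \<in> S" by blast
    have d: "\<bar>fst x - fst y\<bar> < 1 / 3 ^ n" "\<bar>snd x - snd y\<bar> < 1 / 3 ^ n"
      using S[OF x(2) y] dist_fst_le[of x y] dist_snd_le[of x y] by (auto simp: dist_real_def)
    have "\<bar>3 ^ n * fst x - 3 ^ n * fst y\<bar> < 1" "\<bar>3 ^ n * snd x - 3 ^ n * snd y\<bar> < 1"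
      unfolding right_diff_distrib[symmetric] using d by (simp_all add: abs_mult pos_less_divide_eq mult.commute)
    then have "i - 1 \<le> fst q" "fst q \<le> i + 1" "j - 1 \<le> snd q" "snd q \<le> j + 1"
      using cell_set_bounds[OF x(1)] unfolding i_def j_def by linarith+
    then show "q \<in> {i - 1..i + 1} \<times> {j - 1..j + 1}" by (cases q) auto
  qed
  from card_mono[OF _ this] show ?thesis by (simp add: card_cartesian_product)
qed simp

section \<open>The measure of the carpet\<close>

lemma carpet_dim_pos: "1 < carpet_dim"
  by (simp add: carpet_dim_def less_divide_eq)

lemma carpet_dim_le_2: "carpet_dim \<le> 2"
proof -
  have "ln 8 \<le> ln (3 ^ 2 :: real)" by (subst ln_le_cancel_iff) auto
  then have "ln 8 \<le> 2 * ln (3::real)" by (simp only: ln_realpow of_nat_numeral)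
  then show ?thesis by (simp add: carpet_dim_def divide_le_eq)
qed

lemma three_powr_dim: "(3 ^ n) powr carpet_dim = 8 ^ n"
proof -
  have "(3 ^ n) powr carpet_dim = exp (carpet_dim * (real n * ln 3))" by (simp add: powr_def ln_realpow)
  also have "carpet_dim * (real n * ln 3) = real n * ln 8" by (simp add: carpet_dim_def)
  also have "exp (real n * ln 8) = 8 ^ n" by (simp add: exp_of_nat_mult)
  finally show ?thesis .
qed

lemma inverse_three_powr_dim: "(1 / 3 ^ n) powr carpet_dim = 1 / 8 ^ n"
  by (simp add: powr_divide three_powr_dim)

text \<open>The \<open>8 ^ n\<close> cells of level \<open>n\<close> have diameter at most
  \<open>2 / 3 ^ n\<close>, so their powers sum to at most \<open>2 powr carpet_dim\<close> at every
  level.\<close>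

lemma hausdorff_carpet_finite: "hausdorff_outer carpet_dim carpet < \<infinity>"
proof -
  let ?s = carpet_dim
  have "hausdorff_outer ?s carpet \<le> ennreal (2 powr ?s)"
    unfolding hausdorff_outer_def
  proof (rule SUP_least)
    fix \<delta> :: real assume d: "\<delta> \<in> {0<..}"
    obtain n where n: "(1 / 3) ^ n < \<delta> / 2" using real_arch_pow_inv[of "\<delta> / 2" "1 / 3"] d by auto
    have n': "2 / 3 ^ n \<le> \<delta>" using n by (simp add: power_one_over field_simps)
    obtain f where f: "bij_betw f {..<(8::nat) ^ n} (cells n)"
      using ex_bij_betw_nat_finite[OF finite_cells[of n]] by (auto simp: card_cells atLeast0LessThan)
    define E where "E i = (if i < 8 ^ n then cell_set n (f i) else {})" for i
    have diam: "diameter (E i) \<le> 2 / 3 ^ n" for i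
      by (rule diameter_le_metric) (auto simp: E_def cell_set_dist split: if_splits)
    have "hausdorff_content ?s \<delta> carpet \<le> (\<Sum>i. ennreal (diameter (E i) powr ?s))"
    proof (rule hausdorff_content_le)
      show "carpet \<subseteq> (\<Union>i. E i)"
      proof
        fix x assume "x \<in> carpet"
        then obtain q where q: "q \<in> cells n" "x \<in> cell_set n q" using carpet_eq_cells[of n] by blast
        then have "q \<in> f ` {..<8 ^ n}" using f by (simp add: bij_betw_def)
        then obtain i where "i < 8 ^ n" "f i = q" by auto
        then show "x \<in> (\<Union>i. E i)" using q by (auto simp: E_def)
      qed
      show "bounded (E i)" for i by (simp add: E_def compact_imp_bounded compact_cell_set)
      show "diameter (E i) \<le> \<delta>" for i using diam[of i] n' by simp
    qed
    also have "\<dots> = (\<Sum>i<8 ^ n. ennreal (diameter (E i) powr ?s))"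
      by (rule suminf_finite) (auto simp: E_def)
    also have "\<dots> \<le> (\<Sum>i<(8::nat) ^ n. ennreal ((2 / 3 ^ n) powr ?s))"
    proof (intro sum_mono ennreal_leI powr_mono2 diam)
      show "0 \<le> diameter (E i)" for i by (intro diameter_ge_0) (simp add: E_def compact_imp_bounded compact_cell_set)
    qed (use carpet_dim_pos in auto)
    also have "\<dots> = ennreal (8 ^ n * (2 / 3 ^ n) powr ?s)" by (simp add: ennreal_mult ennreal_power[symmetric] flip: ennreal_numeral)
    also have "8 ^ n * (2 / 3 ^ n) powr ?s = 2 powr ?s" by (simp add: powr_divide three_powr_dim)
    finally show "hausdorff_content ?s \<delta> carpet \<le> ennreal (2 powr ?s)" .
  qed
  then show ?thesis by (metis ennreal_less_top infinity_ennreal_def le_less_trans)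
qed

text \<open>A counting argument: a set of diameter below \<open>1 / 3 ^ k\<close> meets at most 9
  cells of level \<open>k\<close>, hence accounts for at most \<open>9 * 8 ^ (N - k)\<close> cells
  of level \<open>N\<close>, while a finite cover has to account for all
  \<open>8 ^ N\<close>.\<close>

lemma hausdorff_carpet_pos: "0 < hausdorff_outer carpet_dim carpet"
proof -
  let ?s = carpet_dim
  have "ennreal (1 / 1000) \<le> hausdorff_content ?s (1 / 2) carpet"
  proof (rule ccontr)
    assume "\<not> ?thesis"
    then have "hausdorff_content ?s (1 / 2) carpet < ennreal (1 / 1000)" by simp
    then obtain E :: "nat \<Rightarrow> (real \<times> real) set" where E: "carpet \<subseteq> (\<Union>i. E i)" "\<And>i. bounded (E i)"
      "\<And>i. diameter (E i) \<le> 1 / 2" "(\<Sum>i. ennreal (diameter (E i) powr ?s)) < ennreal (1 / 1000)"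
      by (rule hausdorff_content_less) blast
    have d0: "0 \<le> diameter (E i)" for i using E(2) by (rule diameter_ge_0)
    \<comment> \<open>The level satisfies \<open>1 / 3 ^ Suc k \<le> diameter (E i)\<close>, which
      costs the factor 8. Sets of diameter 0 get any deep level, paid for by a summable slack. The
      threshold then leads to the contradiction
      \<open>1 \<le> 9 * (8 / 1000 + 1 / 1000)\<close>.\<close>
    have "\<exists>k. diameter (E i) < 1 / 3 ^ k \<and> 1 / 8 ^ k \<le> 8 * diameter (E i) powr ?s + (1 / 1000) * (1 / 2) ^ Suc i" for i
    proof (cases "diameter (E i) = 0")
      case True
      obtain k where k: "(1 / 8) ^ k < (1 / 1000) * (1 / 2 :: real) ^ Suc i" using real_arch_pow_inv[of "(1 / 1000) * (1 / 2 :: real) ^ Suc i" "1 / 8"] by auto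
      then show ?thesis using True by (intro exI[of _ k]) (simp add: power_one_over)
    next
      case False
      then have pos: "0 < diameter (E i)" using d0[of i] by simp
      obtain k0 where k0: "(1 / 3) ^ k0 < diameter (E i)" using real_arch_pow_inv[OF pos, of "1 / 3"] by auto
      define k where "k = (LEAST k. 1 / 3 ^ k \<le> diameter (E i))"
      have k: "1 / 3 ^ k \<le> diameter (E i)" unfolding k_def by (rule LeastI[of _ k0]) (use k0 in \<open>simp add: power_one_over\<close>)
      have "k \<noteq> 0" using k E(3)[of i] by (intro notI) simp
      then obtain j where j: "k = Suc j" by (cases k) auto
      have "\<not> 1 / 3 ^ j \<le> diameter (E i)" using not_less_Least[of j "\<lambda>k. 1 / 3 ^ k \<le> diameter (E i)"] j k_def by simp
      moreover have "1 / 8 ^ j \<le> 8 * diameter (E i) powr ?s + (1 / 1000) * (1 / 2) ^ Suc i"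
      proof -
        have "1 / 8 ^ k \<le> diameter (E i) powr ?s"
          unfolding inverse_three_powr_dim[symmetric] using k carpet_dim_pos by (intro powr_mono2) auto
        then have "1 / 8 ^ j \<le> 8 * diameter (E i) powr ?s" by (simp add: j field_simps)
        then show ?thesis by (simp add: add_increasing2)
      qed
      ultimately show ?thesis by (intro exI[of _ j]) auto
    qed
    then obtain k where k: "\<And>i. diameter (E i) < 1 / 3 ^ k i"
      "\<And>i. 1 / 8 ^ k i \<le> 8 * diameter (E i) powr ?s + (1 / 1000) * (1 / 2) ^ Suc i" by metis
    \<comment> \<open>Open neighbourhoods thin enough to keep all distances below
      \<open>1 / 3 ^ k i\<close>; compactness then leaves a finite cover.\<close>
    define U where "U i = (\<Union>x\<in>E i. ball x ((1 / 3 ^ k i - diameter (E i)) / 2))" for i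
    have openU: "open (U i)" for i by (auto simp: U_def)
    have EU: "E i \<subseteq> U i" for i using k(1)[of i] by (auto simp: U_def intro!: bexI)
    have U: "dist x y < 1 / 3 ^ k i" if xy: "x \<in> U i" "y \<in> U i" for x y i
    proof -
      have "\<exists>a\<in>E i. dist a z < (1 / 3 ^ k i - diameter (E i)) / 2" if "z \<in> U i" for z
        using that unfolding U_def by auto
      then obtain a b where a: "a \<in> E i" "dist a x < (1 / 3 ^ k i - diameter (E i)) / 2"
        and b: "b \<in> E i" "dist b y < (1 / 3 ^ k i - diameter (E i)) / 2" using xy by meson
      have "dist a b \<le> diameter (E i)" using diameter_bounded_bound[OF E(2) a(1) b(1)] .
      moreover have "dist x y \<le> dist a x + dist a b + dist b y"
        using dist_triangle[of x y a] dist_triangle[of a y b] by (simp add: dist_commute)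
      ultimately show ?thesis using a(2) b(2) by argo
    qed
    have "carpet \<subseteq> \<Union> (range U)" using E(1) EU by blast
    then obtain C where C: "C \<subseteq> range U" "finite C" "carpet \<subseteq> \<Union> C"
      using compactE[OF carpet_facts(2), of "range U"] openU by (metis imageE)
    obtain I where I: "finite I" "C = U ` I" using finite_subset_image[OF C(2,1)] by auto
    define N where "N = Max (insert 0 (k ` I))"
    have kN: "k i \<le> N" if "i \<in> I" for i using that I by (auto simp: N_def intro!: Max_ge)
    define P where "P i = {q \<in> cells (k i). cell_set (k i) q \<inter> U i \<noteq> {}}" for i
    have cardP: "card (P i) \<le> 9" for i unfolding P_def by (rule card_cells_meeting) (rule U)
    have finP: "finite (P i)" for i by (simp add: P_def)
    have sub: "cells N \<subseteq> (\<Union>i\<in>I. case_prod (blk (N - k i)) ` (P i \<times> cells (N - k i)))"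
    proof
      fix a assume a: "a \<in> cells N"
      define x where "x = cell_map N a (0, 0)"
      have x: "x \<in> cell_set N a" using carpet_corners by (auto simp: x_def cell_set_def)
      then have "x \<in> carpet" using cell_set_subset[OF a] by blast
      then obtain i where i: "i \<in> I" "x \<in> U i" using C(3) I(2) by auto
      have "a \<in> cells (k i + (N - k i))" using a kN[OF i(1)] by simp
      then obtain q r where q: "q \<in> cells (k i)" and r: "r \<in> cells (N - k i)" and qr: "a = blk (N - k i) q r" by (rule cells_blkE)
      have "x \<in> cell_set (k i) q"
        unfolding cell_set_eq[of "k i" q "N - k i"] using x r qr kN[OF i(1)] by auto
      then have "q \<in> P i" using q i by (auto simp: P_def)
      then show "a \<in> (\<Union>i\<in>I. case_prod (blk (N - k i)) ` (P i \<times> cells (N - k i)))" using i r qr by auto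
    qed
    define X where "X = (\<Sum>i\<in>I. diameter (E i) powr ?s)"
    define Y where "Y = (\<Sum>i\<in>I. (1 / 2 :: real) ^ Suc i)"
    have "8 ^ N \<le> card (\<Union>i\<in>I. case_prod (blk (N - k i)) ` (P i \<times> cells (N - k i)))"
      unfolding card_cells[symmetric] using I finP by (intro card_mono sub) auto
    also have "\<dots> \<le> (\<Sum>i\<in>I. card (case_prod (blk (N - k i)) ` (P i \<times> cells (N - k i))))"
      using I by (intro card_UN_le)
    also have "\<dots> \<le> (\<Sum>i\<in>I. 9 * 8 ^ (N - k i))"
    proof (rule sum_mono)
      fix i
      have "card (case_prod (blk (N - k i)) ` (P i \<times> cells (N - k i))) \<le> card (P i \<times> cells (N - k i))"
        using finP by (intro card_image_le) auto
      also have "\<dots> \<le> 9 * 8 ^ (N - k i)" using cardP[of i] by (simp add: card_cartesian_product card_cells)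
      finally show "card (case_prod (blk (N - k i)) ` (P i \<times> cells (N - k i))) \<le> 9 * 8 ^ (N - k i)" .
    qed
    finally have "real (8 ^ N) \<le> real (\<Sum>i\<in>I. 9 * 8 ^ (N - k i))" by (rule of_nat_mono)
    also have "\<dots> = (\<Sum>i\<in>I. 9 * 8 ^ N * (1 / 8 ^ k i))"
      unfolding of_nat_sum
    proof (rule sum.cong)
      fix i assume "i \<in> I"
      then have "(8::real) ^ (N - k i) = 8 ^ N / 8 ^ k i" using kN by (intro power_diff) auto
      then show "real (9 * 8 ^ (N - k i)) = 9 * 8 ^ N * (1 / 8 ^ k i)" by simp
    qed simp
    also have "\<dots> = 8 ^ N * (9 * (\<Sum>i\<in>I. 1 / 8 ^ k i))" by (simp add: sum_distrib_left mult.commute)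
    finally have "(1::real) \<le> 9 * (\<Sum>i\<in>I. 1 / 8 ^ k i)" by simp
    moreover have "(\<Sum>i\<in>I. 1 / 8 ^ k i) \<le> 8 * X + (1 / 1000) * Y"
    proof -
      have "(\<Sum>i\<in>I. 1 / 8 ^ k i) \<le> (\<Sum>i\<in>I. 8 * diameter (E i) powr ?s + (1 / 1000) * (1 / 2) ^ Suc i)"
        by (intro sum_mono k)
      also have "\<dots> = 8 * X + (1 / 1000) * Y"
        unfolding X_def Y_def by (simp add: sum.distrib sum_distrib_left)
      finally show ?thesis .
    qed
    moreover have "X \<le> 1 / 1000"
    proof -
      have "ennreal X = (\<Sum>i\<in>I. ennreal (diameter (E i) powr ?s))" by (simp add: sum_ennreal X_def)
      also have "\<dots> \<le> (\<Sum>i. ennreal (diameter (E i) powr ?s))" by (rule sum_le_suminf) (use I in auto)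
      also have "\<dots> \<le> ennreal (1 / 1000)" using E(4) by simp
      finally show ?thesis by (subst (asm) ennreal_le_iff) auto
    qed
    moreover have "Y \<le> 1"
    proof -
      have "Y \<le> (\<Sum>i. (1 / 2 :: real) ^ Suc i)"
        unfolding Y_def by (rule sum_le_suminf) (use I power_half_series in \<open>auto simp: sums_iff\<close>)
      then show ?thesis using power_half_series by (simp add: sums_iff)
    qed
    ultimately show False by simp
  qed
  also have "\<dots> \<le> hausdorff_outer ?s carpet" by (rule hausdorff_outer_upper) simp
  finally show ?thesis by (metis ennreal_less_zero_iff less_le_trans zero_less_divide_1_iff zero_less_numeral)
qed

text \<open>A density rather than a restriction, so that the measure lives on all Borel sets of the
  plane.\<close>

definition carpet_measure :: "(real \<times> real) measure" where
  "carpet_measure = density (hausdorff_measure carpet_dim) (indicator carpet)"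

lemma sets_carpet_measure [simp, measurable_cong]: "sets carpet_measure = sets borel"
  by (simp add: carpet_measure_def)

lemma space_carpet_measure [simp]: "space carpet_measure = UNIV"
  by (simp add: carpet_measure_def)

lemma emeasure_carpet_measure:
  "A \<in> sets borel \<Longrightarrow> emeasure carpet_measure A = hausdorff_outer carpet_dim (carpet \<inter> A)"
  unfolding carpet_measure_def
  by (subst emeasure_density) (auto simp: emeasure_hausdorff_measure simp flip: indicator_inter_arith)

interpretation carpet_measure: finite_measure carpet_measure
  by (rule finite_measureI) (use hausdorff_carpet_finite in \<open>simp add: emeasure_carpet_measure\<close>)

abbreviation carpet_mass :: real where "carpet_mass \<equiv> measure carpet_measure UNIV"

lemma carpet_mass_pos: "0 < carpet_mass"
proof -
  have "0 < emeasure carpet_measure UNIV" using hausdorff_carpet_pos by (simp add: emeasure_carpet_measure)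
  then show ?thesis by (simp add: carpet_measure.emeasure_eq_measure)
qed

lemma measure_cell_set: "q \<in> cells n \<Longrightarrow> measure carpet_measure (cell_set n q) = carpet_mass / 8 ^ n"
proof -
  assume q: "q \<in> cells n"
  have "emeasure carpet_measure (cell_set n q) = hausdorff_outer carpet_dim (cell_map n q ` carpet)"
    using cell_set_subset[OF q] by (simp add: emeasure_carpet_measure Int_absorb1) (simp add: cell_set_def)
  also have "\<dots> = ennreal ((1 / 3 ^ n) powr carpet_dim) * hausdorff_outer carpet_dim carpet"
    using carpet_dim_pos by (intro hausdorff_outer_similarity dist_cell_map surj_cell_map) auto
  also have "\<dots> = ennreal (1 / 8 ^ n) * emeasure carpet_measure UNIV"
    by (simp add: inverse_three_powr_dim emeasure_carpet_measure)
  also have "\<dots> = ennreal (carpet_mass / 8 ^ n)"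
    by (simp add: carpet_measure.emeasure_eq_measure ennreal_mult[symmetric])
  finally show ?thesis by (simp add: carpet_measure.emeasure_eq_measure)
qed

lemma emeasure_cell_set: "q \<in> cells n \<Longrightarrow> emeasure carpet_measure (cell_set n q) = ennreal (carpet_mass / 8 ^ n)"
  by (simp add: carpet_measure.emeasure_eq_measure measure_cell_set)

lemma AE_carpet: "AE x in carpet_measure. x \<in> carpet"
  unfolding carpet_measure_def by (subst AE_density) (auto simp: indicator_def)

text \<open>Additivity forces the overlaps of the cells to be null sets.\<close>

lemma AE_cells_partition: "AE x in carpet_measure. (\<Sum>q\<in>cells n. indicator (cell_set n q) x) = (1::real)"
proof -
  define f where "f x = (\<Sum>q\<in>cells n. indicator (cell_set n q) x) - (1::real)" for x
  have int: "integrable carpet_measure f"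
    unfolding f_def by (intro Bochner_Integration.integrable_diff Bochner_Integration.integrable_sum) (auto simp: carpet_measure.emeasure_eq_measure)
  have "integral\<^sup>L carpet_measure f = (\<Sum>q\<in>cells n. carpet_mass / 8 ^ n) - carpet_mass"
    unfolding f_def
    by (subst Bochner_Integration.integral_diff) (auto simp: measure_cell_set carpet_measure.emeasure_eq_measure)
  also have "\<dots> = 0" by (simp add: card_cells)
  finally have 0: "integral\<^sup>L carpet_measure f = 0" .
  have nn: "AE x in carpet_measure. 0 \<le> f x"
    using AE_carpet
  proof (rule AE_mp, intro AE_I2 impI)
    fix x assume "x \<in> carpet"
    then obtain q where "q \<in> cells n" "x \<in> cell_set n q" using carpet_eq_cells[of n] by blast
    then have "(1::real) \<le> (\<Sum>q\<in>cells n. indicator (cell_set n q) x)"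
      using member_le_sum[of q "cells n" "\<lambda>q. indicator (cell_set n q) x :: real"] by simp
    then show "0 \<le> f x" by (simp add: f_def)
  qed
  have "AE x in carpet_measure. f x = 0"
    using integral_nonneg_eq_0_iff_AE[OF int nn] 0 by simp
  then show ?thesis by (simp add: f_def)
qed

text \<open>At the last level with \<open>2 * r \<le> 1 / 3 ^ j\<close> the ball meets at most 9
  cells. The next level costs a factor 8, and \<open>2 powr carpet_dim\<close> is at most 4, which
  gives 288. For \<open>r \<ge> 1 / 2\<close> the total mass is a sufficient bound.\<close>

lemma carpet_ball_upper: "0 < r \<Longrightarrow> measure carpet_measure (ball x r) \<le> 300 * carpet_mass * r powr carpet_dim"
proof (cases "1 / 2 \<le> r")
  case True
  have dim: "0 < carpet_dim" "carpet_dim \<le> 2" using carpet_dim_pos carpet_dim_le_2 by auto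
  have "(1 / 2) powr 2 \<le> (1 / 2 :: real) powr carpet_dim" using dim by (intro powr_mono') auto
  also have "\<dots> \<le> r powr carpet_dim" using True dim by (intro powr_mono2) auto
  finally have "1 \<le> 300 * r powr carpet_dim" by (simp add: power2_eq_square)
  then have "carpet_mass * 1 \<le> carpet_mass * (300 * r powr carpet_dim)" using carpet_mass_pos by (intro mult_left_mono) auto
  moreover have "measure carpet_measure (ball x r) \<le> carpet_mass" using carpet_measure.bounded_measure[of "ball x r"] by simp
  ultimately show ?thesis by (simp add: mult_ac)
next
  case False
  assume r: "0 < r"
  obtain k0 where k0: "(1 / 3) ^ k0 < 2 * r" using real_arch_pow_inv[of "2 * r" "1 / 3"] r by auto
  define k where "k = (LEAST k. 1 / 3 ^ k < 2 * r)"
  have k: "1 / 3 ^ k < 2 * r" unfolding k_def by (rule LeastI[of _ k0]) (use k0 in \<open>simp add: power_one_over\<close>)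
  have "k \<noteq> 0" using k False by (intro notI) simp
  then obtain j where j: "k = Suc j" by (cases k) auto
  have j2: "2 * r \<le> 1 / 3 ^ j" using not_less_Least[of j "\<lambda>k. 1 / 3 ^ k < 2 * r"] j k_def by simp
  define P where "P = {q \<in> cells j. cell_set j q \<inter> ball x r \<noteq> {}}"
  have card: "card P \<le> 9" unfolding P_def
  proof (rule card_cells_meeting)
    fix y z assume "y \<in> ball x r" "z \<in> ball x r"
    then have "dist y z < 2 * r" using dist_triangle[of y z x] by (simp add: dist_commute)
    then show "dist y z < 1 / 3 ^ j" using j2 by simp
  qed
  have "measure carpet_measure (ball x r) = measure carpet_measure (ball x r \<inter> carpet)"
    by (rule carpet_measure.finite_measure_eq_AE) (use AE_carpet in auto)
  also have "\<dots> \<le> measure carpet_measure (\<Union>q\<in>P. cell_set j q)"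
  proof (rule carpet_measure.finite_measure_mono)
    show "ball x r \<inter> carpet \<subseteq> (\<Union>q\<in>P. cell_set j q)"
    proof
      fix y assume y: "y \<in> ball x r \<inter> carpet"
      then obtain q where "q \<in> cells j" "y \<in> cell_set j q" using carpet_eq_cells[of j] by blast
      then have "q \<in> P" "y \<in> cell_set j q" using y by (auto simp: P_def)
      then show "y \<in> (\<Union>q\<in>P. cell_set j q)" by blast
    qed
  qed (auto simp: P_def)
  also have "\<dots> \<le> (\<Sum>q\<in>P. measure carpet_measure (cell_set j q))"
    by (intro carpet_measure.finite_measure_subadditive_finite) (auto simp: P_def)
  also have "\<dots> = real (card P) * (carpet_mass / 8 ^ j)" by (simp add: P_def measure_cell_set)
  also have "\<dots> \<le> 9 * (carpet_mass / 8 ^ j)" using card carpet_mass_pos by (intro mult_right_mono) auto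
  also have "\<dots> = 72 * carpet_mass * (1 / 8 ^ k)" by (simp add: j)
  also have "1 / 8 ^ k \<le> (2 * r) powr carpet_dim"
    unfolding inverse_three_powr_dim[symmetric] using k carpet_dim_pos by (intro powr_mono2) auto
  also have "(2 * r) powr carpet_dim = 2 powr carpet_dim * r powr carpet_dim" by (rule powr_mult)
  also have "72 * carpet_mass * (2 powr carpet_dim * r powr carpet_dim) \<le> 72 * carpet_mass * (4 * r powr carpet_dim)"
  proof (intro mult_left_mono mult_right_mono)
    have "2 powr carpet_dim \<le> (2::real) powr 2" using carpet_dim_le_2 by (intro powr_mono) auto
    then show "2 powr carpet_dim \<le> (4::real)" by simp
  qed (use carpet_mass_pos in auto)
  finally have "measure carpet_measure (ball x r) \<le> 288 * carpet_mass * r powr carpet_dim"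
    using carpet_mass_pos by (simp add: mult_left_mono)
  also have "\<dots> \<le> 300 * carpet_mass * r powr carpet_dim"
    using carpet_mass_pos by (intro mult_right_mono) auto
  finally show ?thesis .
qed

text \<open>A cell of the first level with \<open>2 / 3 ^ k < r\<close> fits into the ball; the
  constant 100 exceeds the product of 8, for one level, and 4, for
  \<open>2 powr carpet_dim\<close>.\<close>

lemma carpet_ball_lower:
  assumes x: "x \<in> carpet" and r: "0 < r" "r \<le> 2"
  shows "carpet_mass / 100 * r powr carpet_dim \<le> measure carpet_measure (ball x r)"
proof -
  obtain k0 where k0: "(1 / 3) ^ k0 < r / 2" using real_arch_pow_inv[of "r / 2" "1 / 3"] r by auto
  define k where "k = (LEAST k. 1 / 3 ^ k < r / 2)"
  have k: "1 / 3 ^ k < r / 2" unfolding k_def by (rule LeastI[of _ k0]) (use k0 in \<open>simp add: power_one_over\<close>)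
  have "k \<noteq> 0" using k r by (intro notI) simp
  then obtain j where j: "k = Suc j" by (cases k) auto
  have "\<not> 1 / 3 ^ j < r / 2" using not_less_Least[of j "\<lambda>k. 1 / 3 ^ k < r / 2"] j k_def by simp
  then have "r / 2 \<le> 1 / 3 ^ j" by simp
  then have "(r / 2) powr carpet_dim \<le> 1 / 8 ^ j"
    unfolding inverse_three_powr_dim[symmetric] using r carpet_dim_pos by (intro powr_mono2) auto
  also have "(1 :: real) / 8 ^ j = 8 * (1 / 8 ^ k)" by (simp add: j)
  finally have "r powr carpet_dim \<le> 2 powr carpet_dim * (8 * (1 / 8 ^ k))" by (simp add: powr_divide field_simps)
  also have "\<dots> \<le> 4 * (8 * (1 / 8 ^ k))"
  proof (intro mult_right_mono)
    have "2 powr carpet_dim \<le> (2::real) powr 2" using carpet_dim_le_2 by (intro powr_mono) auto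
    then show "2 powr carpet_dim \<le> (4::real)" by simp
  qed auto
  also have "\<dots> \<le> 100 * (1 / 8 ^ k)" by (simp add: divide_right_mono)
  finally have "carpet_mass / 100 * r powr carpet_dim \<le> carpet_mass / 100 * (100 * (1 / 8 ^ k))"
    using carpet_mass_pos by (intro mult_left_mono) auto
  also have "\<dots> = carpet_mass / 8 ^ k" by simp
  also obtain q where q: "q \<in> cells k" "x \<in> cell_set k q" using x carpet_eq_cells[of k] by blast
  have "carpet_mass / 8 ^ k = measure carpet_measure (cell_set k q)" by (simp add: measure_cell_set q)
  also have "\<dots> \<le> measure carpet_measure (ball x r)"
  proof (rule carpet_measure.finite_measure_mono)
    show "cell_set k q \<subseteq> ball x r"
    proof
      fix y assume "y \<in> cell_set k q"
      then have "dist x y \<le> 2 / 3 ^ k" using q by (intro cell_set_dist)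
      then show "y \<in> ball x r" using k by simp
    qed
  qed simp
  finally show ?thesis .
qed

lemma dist_carpet_le: "x \<in> carpet \<Longrightarrow> y \<in> carpet \<Longrightarrow> dist x y \<le> 2"
  using cell_set_dist[of x 0 "(0, 0)" y] by simp

text \<open>The indicator of a cell is at most the sum over its subcells. By
  \<open>AE_cells_partition\<close> at both levels these differences add up to 0 almost everywhere,
  so each of them vanishes.\<close>

lemma integral_cell_partition:
  fixes u :: "real \<times> real \<Rightarrow> real"
  assumes u: "integrable carpet_measure u" and q: "q \<in> cells n"
  shows "(LINT x|carpet_measure. indicator (cell_set n q) x * u x)
    = (\<Sum>r\<in>cells m. (LINT x|carpet_measure. indicator (cell_set (n + m) (blk m q r)) x * u x))"
proof -
  have "AE x in carpet_measure. indicator (cell_set n q) x = (\<Sum>r\<in>cells m. indicator (cell_set (n + m) (blk m q r)) x :: real)"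
    using AE_cells_partition[of "n + m"] AE_cells_partition[of n]
  proof eventually_elim
    fix x
    assume 1: "(\<Sum>a\<in>cells (n + m). indicator (cell_set (n + m) a) x) = (1::real)"
      and 2: "(\<Sum>q\<in>cells n. indicator (cell_set n q) x) = (1::real)"
    define g :: "int \<times> int \<Rightarrow> real" where "g q = (\<Sum>r\<in>cells m. indicator (cell_set (n + m) (blk m q r)) x)" for q
    have le: "indicator (cell_set n q) x \<le> g q" for q
    proof (cases "x \<in> cell_set n q")
      case True
      then obtain r where "r \<in> cells m" "x \<in> cell_set (n + m) (blk m q r)" using cell_set_eq[of n q m] by blast
      then have "1 \<le> g q" unfolding g_def
        using member_le_sum[of r "cells m" "\<lambda>r. indicator (cell_set (n + m) (blk m q r)) x :: real"] by simp
      then show ?thesis using True by simp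
    qed (simp add: g_def sum_nonneg)
    have "(\<Sum>q\<in>cells n. g q - indicator (cell_set n q) x) = 0"
      using 1 2 by (simp add: sum_subtractf g_def sum_cells_add)
    then have "g q - indicator (cell_set n q) x = 0"
      using sum_nonneg_eq_0_iff[of "cells n" "\<lambda>q. g q - indicator (cell_set n q) x"] le q by auto
    then show "indicator (cell_set n q) x = (\<Sum>r\<in>cells m. indicator (cell_set (n + m) (blk m q r)) x :: real)"
      by (simp add: g_def)
  qed
  then have "(LINT x|carpet_measure. indicator (cell_set n q) x * u x)
     = (LINT x|carpet_measure. (\<Sum>r\<in>cells m. indicator (cell_set (n + m) (blk m q r)) x * u x))"
  proof (intro integral_cong_AE)
    assume "AE x in carpet_measure. indicator (cell_set n q) x = (\<Sum>r\<in>cells m. indicator (cell_set (n + m) (blk m q r)) x :: real)"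
    then show "AE x in carpet_measure. indicator (cell_set n q) x * u x = (\<Sum>r\<in>cells m. indicator (cell_set (n + m) (blk m q r)) x * u x)"
      by eventually_elim (simp only: sum_distrib_right)
  qed (use u in measurable)
  also have "\<dots> = (\<Sum>r\<in>cells m. (LINT x|carpet_measure. indicator (cell_set (n + m) (blk m q r)) x * u x))"
  proof (rule Bochner_Integration.integral_sum)
    show "integrable carpet_measure (\<lambda>x. indicator (cell_set (n + m) (blk m q r)) x * u x)" for r
      using integrable_mult_indicator[OF _ u, of "cell_set (n + m) (blk m q r)"] by simp
  qed
  finally show ?thesis .
qed

section \<open>Functions of finite energy above the critical exponent\<close>

abbreviation Lp_powr :: "real \<Rightarrow> 'a measure \<Rightarrow> ('a \<Rightarrow> real) \<Rightarrow> ennreal" where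
  "Lp_powr p M u \<equiv> \<integral>\<^sup>+x. ennreal (\<bar>u x\<bar> powr p) \<partial>M"

abbreviation nn_integral2 :: "'a measure \<Rightarrow> ('a \<Rightarrow> 'a \<Rightarrow> ennreal) \<Rightarrow> ennreal" where
  "nn_integral2 M f \<equiv> \<integral>\<^sup>+x. \<integral>\<^sup>+y. f x y \<partial>M \<partial>M"

text \<open>The Besov integrand with the mass of the ball replaced by a power of the distance. As
  \<open>0 powr (- t) = 0\<close>, the diagonal contributes nothing.\<close>

definition riesz_energy :: "real \<Rightarrow> real \<Rightarrow> 'a::metric_space measure \<Rightarrow> ('a \<Rightarrow> real) \<Rightarrow> ennreal" where
  "riesz_energy p t M u = nn_integral2 M (\<lambda>x y. ennreal (\<bar>u y - u x\<bar> powr p * dist x y powr (- t)))"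

lemma (in finite_measure) integrable_Lp:
  fixes u :: "'a \<Rightarrow> real"
  assumes "u \<in> borel_measurable M" "integrable M (\<lambda>x. \<bar>u x\<bar> powr p)" "1 \<le> p"
  shows "integrable M u"
proof (rule Bochner_Integration.integrable_bound)
  show "integrable M (\<lambda>x. 1 + \<bar>u x\<bar> powr p)" using assms by auto
  show "AE x in M. norm (u x) \<le> norm (1 + \<bar>u x\<bar> powr p)"
  proof (rule AE_I2)
    fix x
    show "norm (u x) \<le> norm (1 + \<bar>u x\<bar> powr p)"
    proof (cases "\<bar>u x\<bar> \<le> 1")
      case False
      then have "\<bar>u x\<bar> powr 1 \<le> \<bar>u x\<bar> powr p" using assms by (intro powr_mono) auto
      then show ?thesis by simp
    qed (simp add: add_increasing2)
  qed
qed (use assms in auto)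

text \<open>Jensen's inequality on \<open>K\<close>: by Young's inequality the tangent of
  \<open>z powr p\<close> at the absolute value \<open>c\<close> of the average lies below the
  function, and it is integrated over \<open>K\<close>.\<close>

lemma (in finite_measure) powr_average_le:
  fixes f :: "'a \<Rightarrow> real"
  assumes K: "K \<in> sets M" "0 < measure M K" and f: "integrable M f" and p: "1 < p"
  shows "ennreal (\<bar>(LINT x|M. indicator K x * f x) / measure M K\<bar> powr p) * emeasure M K
    \<le> (\<integral>\<^sup>+x. indicator K x * ennreal (\<bar>f x\<bar> powr p) \<partial>M)"
proof (cases "(\<integral>\<^sup>+x. indicator K x * ennreal (\<bar>f x\<bar> powr p) \<partial>M) = \<infinity>")
  case False
  have [measurable]: "f \<in> borel_measurable M" using f by auto
  note [measurable] = K(1)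
  have eq: "indicator K x * ennreal (\<bar>f x\<bar> powr p) = ennreal (indicator K x * \<bar>f x\<bar> powr p)" for x
    by (auto simp: indicator_def)
  have int: "integrable M (\<lambda>x. indicator K x * \<bar>f x\<bar> powr p)"
    using False by (intro integrableI_nonneg) (auto simp: eq less_top)
  have int1: "integrable M (\<lambda>x. indicator K x * \<bar>f x\<bar>)"
    using integrable_mult_indicator[OF K(1) integrable_abs[OF f]] by simp
  have intK: "integrable M (\<lambda>x. indicator K x * c)" for c :: real
    by (intro integrable_mult_left) (auto simp: emeasure_eq_measure)
  define c where "c = \<bar>(LINT x|M. indicator K x * f x) / measure M K\<bar>"
  have c: "0 \<le> c" by (simp add: c_def)
  have "c * measure M K = \<bar>LINT x|M. indicator K x * f x\<bar>" using K by (simp add: c_def)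
  also have "\<dots> \<le> (LINT x|M. \<bar>indicator K x * f x\<bar>)" by (rule integral_abs_bound)
  also have "\<dots> = (LINT x|M. indicator K x * \<bar>f x\<bar>)" by (simp add: abs_mult)
  finally have cK: "c * measure M K \<le> (LINT x|M. indicator K x * \<bar>f x\<bar>)" .
  have young: "p * c powr (p - 1) * z - (p - 1) * c powr p \<le> z powr p" if z: "0 \<le> z" for z :: real
  proof -
    define q where "q = p / (p - 1)"
    have q: "1 < q" "1 / p + 1 / q = 1" using p by (auto simp: q_def field_simps)
    have "z * c powr (p - 1) \<le> z powr p / p + (c powr (p - 1)) powr q / q"
      by (rule Youngs_inequality) (use p q z in auto)
    also have "(c powr (p - 1)) powr q = c powr p" using p by (simp add: powr_powr q_def)
    finally have "p * (z * c powr (p - 1)) \<le> p * (z powr p / p + c powr p / q)" using p by (intro mult_left_mono) auto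
    also have "\<dots> = z powr p + (p - 1) * c powr p" using p by (simp add: q_def field_simps)
    finally show ?thesis by (simp add: mult_ac)
  qed
  have "c powr p * measure M K = p * c powr (p - 1) * (c * measure M K) - (p - 1) * c powr p * measure M K"
  proof (cases "c = 0")
    case False
    then have "c powr p = c powr (p - 1) * c" using c powr_add[of c "p - 1" 1] by simp
    then show ?thesis by (simp add: algebra_simps)
  qed (use p in simp)
  also have "\<dots> \<le> p * c powr (p - 1) * (LINT x|M. indicator K x * \<bar>f x\<bar>) - (p - 1) * c powr p * measure M K"
    using p by (intro diff_right_mono mult_left_mono cK) auto
  also have "\<dots> = (LINT x|M. p * c powr (p - 1) * (indicator K x * \<bar>f x\<bar>) - indicator K x * ((p - 1) * c powr p))"
    using K by (subst Bochner_Integration.integral_diff[OF integrable_mult_right[OF int1] intK]) (simp add: mult.commute)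
  also have "\<dots> \<le> (LINT x|M. indicator K x * \<bar>f x\<bar> powr p)"
  proof (intro integral_mono int Bochner_Integration.integrable_diff integrable_mult_right int1 intK)
    show "p * c powr (p - 1) * (indicator K x * \<bar>f x\<bar>) - indicator K x * ((p - 1) * c powr p) \<le> indicator K x * \<bar>f x\<bar> powr p" for x
      using young[of "\<bar>f x\<bar>"] by (auto simp: indicator_def)
  qed
  finally have "ennreal (c powr p * measure M K) \<le> ennreal (LINT x|M. indicator K x * \<bar>f x\<bar> powr p)"
    by (rule ennreal_leI)
  also have "\<dots> = (\<integral>\<^sup>+x. indicator K x * ennreal (\<bar>f x\<bar> powr p) \<partial>M)"
    unfolding eq by (rule nn_integral_eq_integral[symmetric]) (auto simp: int)
  finally show ?thesis by (simp add: c_def emeasure_eq_measure ennreal_mult)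
qed simp

lemma four_over_powr: "(4 / 3 ^ n) powr t = 4 powr t * (3 powr (- t)) ^ n" for t :: real
proof -
  have "(4 / 3 ^ n) powr t = 4 powr t / (3 ^ n :: real) powr t" by (rule powr_divide)
  also have "((3::real) ^ n) powr t = (3 powr t) ^ n" by (induction n) (auto simp: powr_mult)
  finally show ?thesis by (simp add: powr_minus divide_inverse power_inverse)
qed

lemma cell_set_dist_near:
  assumes "x \<in> cell_set n q" "y \<in> cell_set n q'" "near q q'"
  shows "dist x y \<le> 4 / 3 ^ n"
proof -
  have "\<bar>3 ^ n * fst x - 3 ^ n * fst y\<bar> \<le> 2" "\<bar>3 ^ n * snd x - 3 ^ n * snd y\<bar> \<le> 2"
    using cell_set_bounds[OF assms(1)] cell_set_bounds[OF assms(2)] assms(3) unfolding near_def by linarith+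
  then have "\<bar>fst x - fst y\<bar> \<le> 2 / 3 ^ n" "\<bar>snd x - snd y\<bar> \<le> 2 / 3 ^ n"
    unfolding right_diff_distrib[symmetric] by (simp_all add: abs_mult pos_le_divide_eq mult.commute)
  moreover have "dist x y \<le> dist (fst x) (fst y) + dist (snd x) (snd y)"
    unfolding dist_prod_def by (rule sqrt_sum_squares_le_sum_abs[THEN order_trans]) simp
  ultimately show ?thesis by (simp add: dist_real_def)
qed

lemma sum_Times_prod:
  fixes g h :: "_ \<Rightarrow> 'a::comm_semiring_1"
  shows "(\<Sum>(a, b)\<in>A \<times> B. g a * (h b * e)) = sum g A * (sum h B * e)"
  unfolding sum.cartesian_product[symmetric] by (simp add: sum_distrib_left[symmetric] sum_distrib_right[symmetric])

context
  fixes p t :: real and u :: "real \<times> real \<Rightarrow> real"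
  assumes p: "1 < p" and t: "0 < t" and u [measurable]: "u \<in> borel_measurable borel"
    and Lp: "integrable carpet_measure (\<lambda>x. \<bar>u x\<bar> powr p)"
begin

definition cell_average :: "nat \<Rightarrow> int \<times> int \<Rightarrow> real" where
  "cell_average n q = (LINT x|carpet_measure. indicator (cell_set n q) x * u x) / (carpet_mass / 8 ^ n)"

definition cell_pair_energy :: "nat \<Rightarrow> int \<times> int \<Rightarrow> int \<times> int \<Rightarrow> ennreal" where
  "cell_pair_energy n q q' = (\<integral>\<^sup>+x. indicator (cell_set n q) x *
     (\<integral>\<^sup>+y. indicator (cell_set n q') y * ennreal (\<bar>u y - u x\<bar> powr p) \<partial>carpet_measure) \<partial>carpet_measure)"

lemma integrable_u: "integrable carpet_measure u"
  using carpet_measure.integrable_Lp[OF _ Lp] p by simp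

lemma cell_average_le:
  assumes q: "q \<in> cells n"
  shows "ennreal (\<bar>c - cell_average n q\<bar> powr p) * ennreal (carpet_mass / 8 ^ n)
    \<le> (\<integral>\<^sup>+y. indicator (cell_set n q) y * ennreal (\<bar>u y - c\<bar> powr p) \<partial>carpet_measure)"
proof -
  have int: "integrable carpet_measure (\<lambda>x. u x - c)" using integrable_u by simp
  have i1: "integrable carpet_measure (\<lambda>x. indicator (cell_set n q) x * u x)"
    using integrable_mult_indicator[OF _ integrable_u, of "cell_set n q"] by simp
  have "(LINT x|carpet_measure. indicator (cell_set n q) x * (u x - c))
      = (LINT x|carpet_measure. indicator (cell_set n q) x * u x - indicator (cell_set n q) x * c)"
    by (simp add: right_diff_distrib)
  also have "\<dots> = (LINT x|carpet_measure. indicator (cell_set n q) x * u x) - (carpet_mass / 8 ^ n) * c"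
    by (subst Bochner_Integration.integral_diff[OF i1])
      (auto simp: measure_cell_set[OF q] carpet_measure.emeasure_eq_measure)
  finally have "(LINT x|carpet_measure. indicator (cell_set n q) x * (u x - c)) / (carpet_mass / 8 ^ n) = cell_average n q - c"
    using carpet_mass_pos by (simp add: cell_average_def field_simps)
  then show ?thesis
    using carpet_measure.powr_average_le[of "cell_set n q", OF _ _ int p] carpet_mass_pos
    by (simp add: measure_cell_set[OF q] emeasure_cell_set[OF q] abs_minus_commute)
qed

lemma cell_average_consistent:
  assumes q: "q \<in> cells n"
  shows "(\<Sum>r\<in>cells m. cell_average (n + m) (blk m q r)) / 8 ^ m = cell_average n q"
  unfolding cell_average_def integral_cell_partition[OF integrable_u q, of m]
  using carpet_mass_pos by (simp add: power_add field_simps sum_distrib_left)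

text \<open>Jensen's inequality twice, once in each variable; each use brings the mass of one
  cell.\<close>

lemma cell_average_diff_le:
  assumes q: "q \<in> cells n" "q' \<in> cells n"
  shows "ennreal (\<bar>cell_average n q - cell_average n q'\<bar> powr p) * ennreal ((carpet_mass / 8 ^ n)\<^sup>2)
    \<le> cell_pair_energy n q q'"
proof -
  let ?w = "ennreal (carpet_mass / 8 ^ n)"
  have "ennreal (\<bar>cell_average n q - cell_average n q'\<bar> powr p) * ennreal ((carpet_mass / 8 ^ n)\<^sup>2)
     = ?w * (ennreal (\<bar>cell_average n q' - cell_average n q\<bar> powr p) * ?w)"
    using carpet_mass_pos by (simp add: power2_eq_square ennreal_mult[symmetric] abs_minus_commute mult_ac)
  also have "\<dots> \<le> ?w * (\<integral>\<^sup>+x. indicator (cell_set n q) x * ennreal (\<bar>u x - cell_average n q'\<bar> powr p) \<partial>carpet_measure)"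
    by (intro mult_left_mono cell_average_le q) simp
  also have "\<dots> = (\<integral>\<^sup>+x. indicator (cell_set n q) x * (ennreal (\<bar>u x - cell_average n q'\<bar> powr p) * ?w) \<partial>carpet_measure)"
    by (subst nn_integral_cmult[symmetric]) (auto simp: mult_ac)
  also have "\<dots> \<le> cell_pair_energy n q q'"
    unfolding cell_pair_energy_def by (intro nn_integral_mono mult_left_mono cell_average_le q) simp
  finally show ?thesis .
qed

text \<open>Points of near cells are at distance at most \<open>4 / 3 ^ n\<close>, so off the
  diagonal the kernel is at least \<open>(4 / 3 ^ n) powr (- t)\<close> there. Products of cells
  overlap in null sets only, so the sum over \<open>S\<close> is bounded by the full double
  integral.\<close>

lemma sum_cell_pair_energy_le:
  assumes S: "S \<subseteq> cells n \<times> cells n" "\<And>q q'. (q, q') \<in> S \<Longrightarrow> near q q'"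
  shows "(\<Sum>(q, q')\<in>S. cell_pair_energy n q q') \<le> ennreal ((4 / 3 ^ n) powr t) * riesz_energy p t carpet_measure u"
proof -
  define F where "F x y = ennreal (\<bar>u y - u x\<bar> powr p * dist x y powr (- t))" for x y
  have [measurable]: "(\<lambda>(x, y). F x y) \<in> borel_measurable (carpet_measure \<Otimes>\<^sub>M carpet_measure)"
    unfolding F_def by measurable
  let ?c = "ennreal ((4 / 3 ^ n) powr t)"
  have pt: "indicator (cell_set n q) x * (indicator (cell_set n q') y * ennreal (\<bar>u y - u x\<bar> powr p))
      \<le> indicator (cell_set n q) x * (indicator (cell_set n q') y * (?c * F x y))" if "(q, q') \<in> S" for q q' x y
  proof (cases "x \<in> cell_set n q \<and> y \<in> cell_set n q'")
    case True
    have "\<bar>u y - u x\<bar> powr p \<le> (4 / 3 ^ n) powr t * (\<bar>u y - u x\<bar> powr p * dist x y powr (- t))"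
    proof (cases "x = y")
      case False
      have "dist x y powr t \<le> (4 / 3 ^ n) powr t"
        using True t cell_set_dist_near[OF _ _ S(2)[OF that]] by (intro powr_mono2) auto
      then have "1 \<le> (4 / 3 ^ n) powr t * dist x y powr (- t)"
        using False by (simp add: powr_minus field_simps)
      then have "\<bar>u y - u x\<bar> powr p * 1 \<le> \<bar>u y - u x\<bar> powr p * ((4 / 3 ^ n) powr t * dist x y powr (- t))"
        by (intro mult_left_mono) auto
      then show ?thesis by (simp add: mult_ac)
    qed (use p in simp)
    then show ?thesis using True by (simp add: F_def ennreal_mult[symmetric] ennreal_leI)
  qed auto
  have "(\<Sum>(q, q')\<in>S. cell_pair_energy n q q')
      \<le> (\<Sum>(q, q')\<in>S. \<integral>\<^sup>+x. \<integral>\<^sup>+y. indicator (cell_set n q) x * (indicator (cell_set n q') y * (?c * F x y)) \<partial>carpet_measure \<partial>carpet_measure)"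
  proof (intro sum_mono, clarsimp simp del: ennreal_plus)
    fix a b c d assume "((a, b), c, d) \<in> S"
    then show "cell_pair_energy n (a, b) (c, d) \<le> nn_integral2 carpet_measure (\<lambda>x y. indicator (cell_set n (a, b)) x * (indicator (cell_set n (c, d)) y * (?c * F x y)))"
      unfolding cell_pair_energy_def
      by (intro nn_integral_mono, subst nn_integral_cmult[symmetric]) (auto intro!: nn_integral_mono pt)
  qed
  also have "\<dots> = nn_integral2 carpet_measure (\<lambda>x y. (\<Sum>(q, q')\<in>S. indicator (cell_set n q) x * (indicator (cell_set n q') y * (?c * F x y))))"
  proof -
    have "nn_integral2 carpet_measure (\<lambda>x y. (\<Sum>z\<in>S. G z x y))
        = (\<Sum>z\<in>S. \<integral>\<^sup>+x. \<integral>\<^sup>+y. G z x y \<partial>carpet_measure \<partial>carpet_measure)"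
      if [measurable]: "\<And>z. (\<lambda>(x, y). G z x y) \<in> borel_measurable (carpet_measure \<Otimes>\<^sub>M carpet_measure)"
      for G :: "_ \<Rightarrow> real \<times> real \<Rightarrow> real \<times> real \<Rightarrow> ennreal"
      by (simp add: nn_integral_sum)
    from this[of "\<lambda>(q, q') x y. indicator (cell_set n q) x * (indicator (cell_set n q') y * (?c * F x y))"]
    show ?thesis by (simp add: case_prod_unfold del: sum_indicator_mult)
  qed
  also have "\<dots> \<le> nn_integral2 carpet_measure (\<lambda>x y. ?c * F x y)"
  proof (rule nn_integral_mono_AE, use AE_cells_partition[of n] in eventually_elim)
    fix x assume x: "(\<Sum>q\<in>cells n. indicator (cell_set n q) x) = (1::real)"
    show "(\<integral>\<^sup>+y. (\<Sum>(q, q')\<in>S. indicator (cell_set n q) x * (indicator (cell_set n q') y * (?c * F x y))) \<partial>carpet_measure)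
      \<le> (\<integral>\<^sup>+y. ?c * F x y \<partial>carpet_measure)"
    proof (rule nn_integral_mono_AE, use AE_cells_partition[of n] in eventually_elim)
      fix y assume y: "(\<Sum>q\<in>cells n. indicator (cell_set n q) y) = (1::real)"
      have one: "(\<Sum>q\<in>cells n. indicator (cell_set n q) z) = (1::ennreal)" if "(\<Sum>q\<in>cells n. indicator (cell_set n q) z) = (1::real)" for z
        using arg_cong[OF that, of ennreal] by (simp add: sum_ennreal[symmetric] ennreal_indicator del: sum_ennreal)
      have "(\<Sum>(q, q')\<in>S. indicator (cell_set n q) x * (indicator (cell_set n q') y * (?c * F x y)))
        \<le> (\<Sum>(q, q')\<in>cells n \<times> cells n. indicator (cell_set n q) x * (indicator (cell_set n q') y * (?c * F x y)))"
        using S(1) by (intro sum_mono2) auto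
      also have "\<dots> = ?c * F x y"
        unfolding sum_Times_prod by (simp only: one[OF x] one[OF y] mult_1)
      finally show "(\<Sum>(q, q')\<in>S. indicator (cell_set n q) x * (indicator (cell_set n q') y * (?c * F x y))) \<le> ?c * F x y" .
    qed
  qed
  also have "\<dots> = ?c * riesz_energy p t carpet_measure u"
    unfolding riesz_energy_def F_def by (simp add: nn_integral_cmult)
  finally show ?thesis .
qed

text \<open>The rate combines the kernel at scale \<open>1 / 3 ^ n\<close>, which gives
  \<open>3 powr (- t)\<close>, with the normalisation by the squared mass of a cell, which gives
  64.\<close>

lemma energy_cell_average_le:
  assumes fin: "riesz_energy p t carpet_measure u < \<infinity>"
  obtains C where "0 \<le> C" "\<And>n. energy p n (cell_average n) \<le> C * (64 * 3 powr (- t)) ^ n"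
proof -
  obtain I where I: "riesz_energy p t carpet_measure u = ennreal I" "0 \<le> I"
    using fin by (cases "riesz_energy p t carpet_measure u") auto
  define C where "C = 4 powr t * I / carpet_mass\<^sup>2"
  have "energy p n (cell_average n) \<le> C * (64 * 3 powr (- t)) ^ n" for n
  proof -
    have "ennreal (energy p n (cell_average n) * (carpet_mass / 8 ^ n)\<^sup>2)
       = (\<Sum>(q, q')\<in>adj n. ennreal (\<bar>cell_average n q - cell_average n q'\<bar> powr p) * ennreal ((carpet_mass / 8 ^ n)\<^sup>2))"
      unfolding energy_def sum_distrib_right
      by (subst sum_ennreal[symmetric]) (auto simp: case_prod_unfold ennreal_mult[symmetric])
    also have "\<dots> \<le> (\<Sum>(q, q')\<in>adj n. cell_pair_energy n q q')"
      by (intro sum_mono) (auto simp: adj_def intro!: cell_average_diff_le)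
    also have "\<dots> \<le> ennreal ((4 / 3 ^ n) powr t) * ennreal I"
      unfolding I(1)[symmetric] by (rule sum_cell_pair_energy_le) (auto simp: adj_def)
    also have "\<dots> = ennreal ((4 / 3 ^ n) powr t * I)" using I by (simp add: ennreal_mult)
    finally have "energy p n (cell_average n) * (carpet_mass / 8 ^ n)\<^sup>2 \<le> (4 / 3 ^ n) powr t * I"
      using I by (subst (asm) ennreal_le_iff) auto
    also have "(4 / 3 ^ n) powr t = 4 powr t * (3 powr (- t)) ^ n"
      by (rule four_over_powr)
    finally have "energy p n (cell_average n) * carpet_mass\<^sup>2 \<le> 4 powr t * (3 powr (- t)) ^ n * I * (8 ^ n)\<^sup>2"
      by (simp add: power_divide divide_le_eq)
    also have "((8::real) ^ n)\<^sup>2 = 64 ^ n" by (simp add: power2_eq_square flip: power_mult_distrib)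
    finally show ?thesis using carpet_mass_pos by (simp add: C_def power_mult_distrib field_simps)
  qed
  moreover have "0 \<le> C" using I by (simp add: C_def)
  ultimately show thesis by (rule that[rotated])
qed

text \<open>The assumption on \<open>t\<close> makes \<open>small_energy_constant\<close>
  applicable, so all cell averages equal one constant \<open>c\<close>. Pairs within the same cell
  then bound the distance of \<open>u\<close> from \<open>c\<close> at the rate
  \<open>8 * 3 powr (- t)\<close>, which is below 1 because \<open>l < ln 8\<close>.\<close>

lemma finite_energy_imp_constant:
  assumes fin: "riesz_energy p t carpet_measure u < \<infinity>"
    and l: "(\<lambda>m. ln (conductance p m) / real m) \<longlonglongrightarrow> l" "ln 64 - t * ln 3 < l"
  shows "\<exists>c. AE x in carpet_measure. u x = c"
proof -
  obtain C where C: "0 \<le> C" "\<And>n. energy p n (cell_average n) \<le> C * (64 * 3 powr (- t)) ^ n"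
    by (rule energy_cell_average_le[OF fin]) blast
  define c where "c = cell_average 0 (0, 0)"
  have const: "cell_average n q = c" if "q \<in> cells n" for n q
    unfolding c_def
  proof (rule small_energy_constant[OF p l(1) _ _ cell_average_consistent C that])
    show "0 < 64 * 3 powr (- t)" by simp
    show "ln (64 * 3 powr (- t)) < l" using l(2) by (simp add: ln_mult ln_powr)
  qed
  obtain I where I: "riesz_energy p t carpet_measure u = ennreal I" "0 \<le> I"
    using fin by (cases "riesz_energy p t carpet_measure u") auto
  have bound: "Lp_powr p carpet_measure (\<lambda>x. u x - c) \<le> ennreal (4 powr t * I / carpet_mass * (8 * 3 powr (- t)) ^ n)" for n
  proof -
    let ?w = "ennreal (carpet_mass / 8 ^ n)"
    have "?w * Lp_powr p carpet_measure (\<lambda>x. u x - c)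
        = (\<integral>\<^sup>+x. ?w * ennreal (\<bar>u x - c\<bar> powr p) \<partial>carpet_measure)"
      by (simp add: nn_integral_cmult)
    also have "\<dots> \<le> (\<integral>\<^sup>+x. (\<Sum>q\<in>cells n. indicator (cell_set n q) x * (ennreal (\<bar>u x - c\<bar> powr p) * ?w)) \<partial>carpet_measure)"
    proof (rule nn_integral_mono_AE, use AE_carpet in eventually_elim)
      fix x assume "x \<in> carpet"
      then obtain q where q: "q \<in> cells n" "x \<in> cell_set n q" using carpet_eq_cells[of n] by blast
      have "?w * ennreal (\<bar>u x - c\<bar> powr p) = indicator (cell_set n q) x * (ennreal (\<bar>u x - c\<bar> powr p) * ?w)"
        using q by (simp add: mult.commute)
      also have "\<dots> \<le> (\<Sum>q\<in>cells n. indicator (cell_set n q) x * (ennreal (\<bar>u x - c\<bar> powr p) * ?w))"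
        by (rule member_le_sum) (use q in auto)
      finally show "?w * ennreal (\<bar>u x - c\<bar> powr p) \<le> \<dots>" .
    qed
    also have "\<dots> = (\<Sum>q\<in>cells n. \<integral>\<^sup>+x. indicator (cell_set n q) x * (ennreal (\<bar>u x - c\<bar> powr p) * ?w) \<partial>carpet_measure)"
      by (rule nn_integral_sum) auto
    also have "\<dots> \<le> (\<Sum>q\<in>cells n. cell_pair_energy n q q)"
      unfolding cell_pair_energy_def
    proof (intro sum_mono nn_integral_mono mult_left_mono)
      fix q x assume q: "q \<in> cells n"
      show "ennreal (\<bar>u x - c\<bar> powr p) * ?w \<le> (\<integral>\<^sup>+y. indicator (cell_set n q) y * ennreal (\<bar>u y - u x\<bar> powr p) \<partial>carpet_measure)"
        using cell_average_le[OF q, of "u x"] const[OF q] by simp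
    qed simp
    also have "\<dots> = (\<Sum>(q, q')\<in>(\<lambda>q. (q, q)) ` cells n. cell_pair_energy n q q')"
      by (subst sum.reindex) (auto simp: inj_on_def)
    also have "\<dots> \<le> ennreal ((4 / 3 ^ n) powr t) * ennreal I"
      unfolding I(1)[symmetric] by (rule sum_cell_pair_energy_le) auto
    also have "\<dots> = ennreal ((4 / 3 ^ n) powr t * I)" using I by (simp add: ennreal_mult)
    also have "(4 / 3 ^ n) powr t = 4 powr t * (3 powr (- t)) ^ n"
      by (rule four_over_powr)
    finally have le: "?w * Lp_powr p carpet_measure (\<lambda>x. u x - c) \<le> ennreal (4 powr t * (3 powr (- t)) ^ n * I)" .
    have "Lp_powr p carpet_measure (\<lambda>x. u x - c)
        = ennreal (8 ^ n / carpet_mass) * (?w * Lp_powr p carpet_measure (\<lambda>x. u x - c))"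
      using carpet_mass_pos by (simp add: mult.assoc[symmetric] ennreal_mult[symmetric])
    also have "\<dots> \<le> ennreal (8 ^ n / carpet_mass) * ennreal (4 powr t * (3 powr (- t)) ^ n * I)"
      by (intro mult_left_mono le) simp
    also have "\<dots> = ennreal (4 powr t * I / carpet_mass * (8 * 3 powr (- t)) ^ n)"
      using I carpet_mass_pos by (simp add: ennreal_mult[symmetric] power_mult_distrib mult_ac)
    finally show ?thesis .
  qed
  have "l \<le> ln 8 - p * ln 3" using conductance_growth_le[OF l(1)] p by simp
  moreover have "0 < p * ln 3" using p by simp
  moreover have "ln 64 = ln 8 + ln (8::real)" using ln_mult[of 8 "8::real"] by simp
  ultimately have "ln 8 - t * ln 3 < 0" using l(2) by linarith
  then have "ln (8 * 3 powr (- t)) < 0" by (simp add: ln_mult ln_powr)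
  then have r: "8 * 3 powr (- t) < 1" by (subst (asm) ln_less_zero_iff) auto
  have "(\<lambda>n. ennreal (4 powr t * I / carpet_mass * (8 * 3 powr (- t)) ^ n)) \<longlonglongrightarrow> ennreal (4 powr t * I / carpet_mass * 0)"
    using r by (intro tendsto_ennrealI tendsto_mult tendsto_const LIMSEQ_power_zero) auto
  then have "Lp_powr p carpet_measure (\<lambda>x. u x - c) \<le> ennreal (4 powr t * I / carpet_mass * 0)"
    by (rule LIMSEQ_le_const) (use bound in auto)
  then have "Lp_powr p carpet_measure (\<lambda>x. u x - c) = 0" by simp
  then have "AE x in carpet_measure. ennreal (\<bar>u x - c\<bar> powr p) = 0"
    by (subst (asm) nn_integral_0_iff_AE) auto
  then have "AE x in carpet_measure. u x = c"
    by eventually_elim (use p in \<open>simp add: ennreal_eq_0_iff\<close>)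
  then show ?thesis by blast
qed

end

section \<open>Functions of finite energy below the critical exponent\<close>

text \<open>\<open>n\<close> is the starting level with corner values \<open>a0\<close>. Each
  refinement adds \<open>m\<close> levels, multiplies the energy by at most \<open>b\<close> and the
  mass of a cell by \<open>1 / 8 ^ m\<close>. The condition on \<open>\<eta>\<close> says that the
  weights of \<open>powr_sum_geometric_le\<close> grow more slowly than the powers of
  \<open>b / 8 ^ m\<close> decay.\<close>

locale carpet_refinement = profile m h for m h +
  fixes p b B \<eta> :: real and n :: nat and a0 :: "int \<times> int \<Rightarrow> real"
  assumes m_pos: "0 < m" and p: "1 < p"
    and b: "2 powr (p + 1) * vertex_energy p m h \<le> b" "0 < b"
    and B: "\<And>z. \<bar>a0 z\<bar> \<le> B"
    and \<eta>: "0 < \<eta>" "\<eta> < 1" "\<eta> powr (1 - p) * (b / 8 ^ m) < 1"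
begin

definition level :: "nat \<Rightarrow> nat" where "level k = n + k * m"

lemma level_0 [simp]: "level 0 = n" and level_Suc: "level (Suc k) = level k + m"
  by (simp_all add: level_def)

primrec vals :: "nat \<Rightarrow> int \<times> int \<Rightarrow> real" where
  "vals 0 = a0"
| "vals (Suc k) = refine m h (vals k)"

lemma abs_vals_le: "\<bar>vals k z\<bar> \<le> B"
proof (induction k arbitrary: z)
  case (Suc k)
  have "\<bar>bilinear_interp (vals k) q s t - 0\<bar> \<le> B" if "0 \<le> s" "s \<le> 1" "0 \<le> t" "t \<le> 1" for q s t
    using that Suc by (intro bilinear_interp_diff_le) auto
  then show ?case using nonneg le1 by (simp add: refine_def)
qed (simp add: B)

definition D0 :: real where "D0 = vertex_energy p n a0"

lemma D0_nonneg: "0 \<le> D0" by (simp add: D0_def vertex_energy_nonneg)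

lemma vertex_energy_vals: "vertex_energy p (level k) (vals k) \<le> b ^ k * D0"
proof (induction k)
  case (Suc k)
  have "vertex_energy p (level (Suc k)) (vals (Suc k)) \<le> 2 powr (p + 1) * vertex_energy p m h * vertex_energy p (level k) (vals k)"
    unfolding level_Suc vals.simps using p by (intro refine_vertex_energy) auto
  also have "\<dots> \<le> b * (b ^ k * D0)"
    using b Suc by (intro mult_mono vertex_energy_nonneg) auto
  finally show ?case by (simp add: mult_ac)
qed (simp add: D0_def)

definition grid_point :: "nat \<Rightarrow> real \<times> real \<Rightarrow> int \<times> int" where
  "grid_point k x = (\<lfloor>3 ^ level k * fst x\<rfloor>, \<lfloor>3 ^ level k * snd x\<rfloor>)"

text \<open>Piecewise constant: it reads the lattice point on the lower left of \<open>x\<close>,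
  which is a corner of every cell containing \<open>x\<close>, also on the boundaries of cells
  (\<open>grid_point_corner\<close>).\<close>

definition approx :: "nat \<Rightarrow> real \<times> real \<Rightarrow> real" where
  "approx k x = vals k (grid_point k x)"

lemma floor_borel_measurable: "f \<in> borel_measurable M \<Longrightarrow> (\<lambda>x. \<lfloor>f x :: real\<rfloor>) \<in> measurable M (count_space UNIV)"
  by measurable

lemma grid_point_measurable: "grid_point k \<in> measurable borel (count_space UNIV)"
proof -
  have "grid_point k = (\<lambda>x. (\<lfloor>3 ^ level k * fst x\<rfloor>, \<lfloor>3 ^ level k * snd x\<rfloor>))" by (auto simp: grid_point_def)
  also have "\<dots> \<in> measurable borel (count_space UNIV \<Otimes>\<^sub>M count_space UNIV)"
    by (intro measurable_Pair floor_borel_measurable) (auto intro!: borel_measurable_continuous_onI continuous_intros)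
  finally show ?thesis by (simp add: pair_measure_countable)
qed

lemma approx_measurable [measurable]: "approx k \<in> borel_measurable borel"
  unfolding approx_def[abs_def] by (rule measurable_compose[OF grid_point_measurable]) simp

lemma grid_point_corner: "x \<in> cell_set (level k) q \<Longrightarrow> grid_point k x \<in> corners q"
  using cell_set_bounds[of x "level k" q] unfolding grid_point_def corners_iff
  by (auto simp: floor_eq_iff)

text \<open>The vertex energy spread out as a function on the plane. Its integral carries the
  additional factor of the mass of a cell and decays like \<open>(b / 8 ^ m) ^ k\<close>.\<close>

definition V :: "nat \<Rightarrow> real \<times> real \<Rightarrow> real" where
  "V k x = (\<Sum>q\<in>cells (level k). indicator (cell_set (level k) q) x * osc (vals k) q powr p)"

lemma V_nonneg: "0 \<le> V k x" by (auto simp: V_def intro!: sum_nonneg)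

lemma V_measurable [measurable]: "V k \<in> borel_measurable borel"
  unfolding V_def[abs_def] by measurable

lemma osc_le_V: "q \<in> cells (level k) \<Longrightarrow> x \<in> cell_set (level k) q \<Longrightarrow> osc (vals k) q powr p \<le> V k x"
  unfolding V_def
  using member_le_sum[of q "cells (level k)" "\<lambda>q. indicator (cell_set (level k) q) x * osc (vals k) q powr p"] by simp

lemma integral_V: "(\<integral>\<^sup>+x. ennreal (V k x) \<partial>carpet_measure) \<le> ennreal (carpet_mass / 8 ^ n * D0 * (b / 8 ^ m) ^ k)"
proof -
  have "(\<integral>\<^sup>+x. ennreal (V k x) \<partial>carpet_measure)
      = (\<integral>\<^sup>+x. (\<Sum>q\<in>cells (level k). ennreal (osc (vals k) q powr p) * indicator (cell_set (level k) q) x) \<partial>carpet_measure)"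
    unfolding V_def
    by (intro nn_integral_cong) (auto simp: ennreal_mult ennreal_indicator mult.commute sum_ennreal[symmetric] simp del: sum_ennreal)
  also have "\<dots> = (\<Sum>q\<in>cells (level k). ennreal (osc (vals k) q powr p) * ennreal (carpet_mass / 8 ^ level k))"
    by (subst nn_integral_sum) (auto simp: nn_integral_cmult_indicator emeasure_cell_set intro!: sum.cong)
  also have "\<dots> = ennreal (vertex_energy p (level k) (vals k) * (carpet_mass / 8 ^ level k))"
    unfolding vertex_energy_def sum_distrib_right by (simp add: ennreal_mult[symmetric] sum_ennreal)
  also have "\<dots> \<le> ennreal ((b ^ k * D0) * (carpet_mass / 8 ^ level k))"
    using carpet_mass_pos by (intro ennreal_leI mult_right_mono vertex_energy_vals) auto
  also have "(b ^ k * D0) * (carpet_mass / 8 ^ level k) = carpet_mass / 8 ^ n * D0 * (b / 8 ^ m) ^ k"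
    by (simp add: level_def power_add power_mult power_divide mult.commute[of k])
  finally show ?thesis .
qed

lemma approx_step:
  assumes q: "q \<in> cells (level k)" and r: "r \<in> cells m" and x: "x \<in> cell_set (level (Suc k)) (blk m q r)"
  shows "\<bar>approx (Suc k) x - approx k x\<bar> \<le> osc (vals k) q"
proof -
  have "x \<in> cell_set (level k) q" using x r unfolding cell_set_eq[of "level k" q m] level_Suc by auto
  then have "grid_point k x \<in> corners q" by (rule grid_point_corner)
  then show ?thesis
    unfolding approx_def vals.simps
    using grid_point_corner[OF x] by (intro refine_diff_le[OF r])
qed

lemma cell_obtain:
  assumes "x \<in> carpet"
  obtains q r where "q \<in> cells (level k)" "r \<in> cells m" "x \<in> cell_set (level k) q" "x \<in> cell_set (level (Suc k)) (blk m q r)"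
proof -
  obtain q where q: "q \<in> cells (level k)" "x \<in> cell_set (level k) q" using assms carpet_eq_cells[of "level k"] by blast
  then obtain r where "r \<in> cells m" "x \<in> cell_set (level k + m) (blk m q r)" using cell_set_eq[of "level k" q m] by blast
  with q show thesis using that by (simp add: level_Suc)
qed

lemma approx_step_powr:
  assumes x: "x \<in> carpet"
  shows "\<bar>approx (Suc k) x - approx k x\<bar> powr p \<le> V k x"
proof -
  obtain q r where q: "q \<in> cells (level k)" "r \<in> cells m" "x \<in> cell_set (level k) q" "x \<in> cell_set (level (Suc k)) (blk m q r)"
    by (rule cell_obtain[OF x])
  have "\<bar>approx (Suc k) x - approx k x\<bar> powr p \<le> osc (vals k) q powr p"
    using approx_step[OF q(1,2,4)] p by (intro powr_mono_abs) auto
  then show ?thesis using osc_le_V[OF q(1,3)] by simp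
qed

text \<open>Such points lie in near cells, and near cells share a corner through which the two
  values are compared.\<close>

lemma approx_near:
  assumes x: "x \<in> carpet" and y: "y \<in> carpet" and d: "dist x y < 1 / 3 ^ level k"
  shows "\<bar>approx k x - approx k y\<bar> powr p \<le> 2 powr p * (V k x + V k y)"
proof -
  obtain q where q: "q \<in> cells (level k)" "x \<in> cell_set (level k) q" using x carpet_eq_cells[of "level k"] by blast
  obtain q' where q': "q' \<in> cells (level k)" "y \<in> cell_set (level k) q'" using y carpet_eq_cells[of "level k"] by blast
  have "\<bar>fst x - fst y\<bar> < 1 / 3 ^ level k" "\<bar>snd x - snd y\<bar> < 1 / 3 ^ level k"
    using d dist_fst_le[of x y] dist_snd_le[of x y] by (auto simp: dist_real_def)
  then have "\<bar>3 ^ level k * fst x - 3 ^ level k * fst y\<bar> < 1" "\<bar>3 ^ level k * snd x - 3 ^ level k * snd y\<bar> < 1"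
    unfolding right_diff_distrib[symmetric] by (simp_all add: abs_mult pos_less_divide_eq mult.commute)
  then have "near q q'"
    using cell_set_bounds[OF q(2)] cell_set_bounds[OF q'(2)] unfolding near_def by linarith
  then obtain z where z: "z \<in> corners q" "z \<in> corners q'" using near_common_corner by blast
  have "\<bar>approx k x - vals k z\<bar> \<le> osc (vals k) q" "\<bar>approx k y - vals k z\<bar> \<le> osc (vals k) q'"
    unfolding approx_def using grid_point_corner[OF q(2)] grid_point_corner[OF q'(2)] z by (intro osc_ge; simp)+
  then have "\<bar>approx k x - approx k y\<bar> \<le> osc (vals k) q + osc (vals k) q'" by linarith
  then have "\<bar>approx k x - approx k y\<bar> powr p \<le> (osc (vals k) q + osc (vals k) q') powr p"
    using p by (intro powr_mono_abs) auto
  also have "\<dots> \<le> 2 powr p * (osc (vals k) q powr p + osc (vals k) q' powr p)"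
    using p by (intro powr_add_le osc_nonneg) auto
  also have "\<dots> \<le> 2 powr p * (V k x + V k y)"
    by (intro mult_left_mono add_mono osc_le_V q q') auto
  finally show ?thesis .
qed

definition c :: real where "c = \<eta> powr (1 - p)"
definition c1 :: real where "c1 = (1 - \<eta>) powr (1 - p)"
definition lam :: real where "lam = b / 8 ^ m"

lemma c_gt_1: "1 < c"
proof -
  have "\<eta> powr 0 < \<eta> powr (1 - p)" using \<eta> p by (intro powr_less_mono') auto
  then show ?thesis using \<eta> by (simp add: c_def)
qed

lemma c1_nonneg: "0 \<le> c1" by (simp add: c1_def)

lemma lam_pos: "0 < lam" using b by (simp add: lam_def)

lemma c_lam: "c * lam < 1" using \<eta> by (simp add: c_def lam_def)

text \<open>A weighted tail that dominates the jumps from level \<open>k\<close> to all later levels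
  at once (\<open>approx_tail\<close>). The growing weights are affordable because the integral of
  \<open>V (k + j)\<close> decays like \<open>lam ^ (k + j)\<close> and
  \<open>c * lam < 1\<close>.\<close>

definition Z :: "nat \<Rightarrow> real \<times> real \<Rightarrow> ennreal" where
  "Z k x = (\<Sum>j. ennreal (c ^ j * V (k + j) x))"

lemma Z_measurable [measurable]: "Z k \<in> borel_measurable borel"
  unfolding Z_def[abs_def] by measurable

lemma V_le_Z: "ennreal (V k x) \<le> Z k x"
  using sum_le_suminf[of "\<lambda>j. ennreal (c ^ j * V (k + j) x)" "{0}"] by (simp add: Z_def)

definition Zmass :: real where "Zmass = carpet_mass / 8 ^ n * D0 / (1 - c * lam)"

lemma Zmass_nonneg: "0 \<le> Zmass"
  using c_lam D0_nonneg carpet_mass_pos by (simp add: Zmass_def)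

lemma integral_Z: "(\<integral>\<^sup>+x. Z k x \<partial>carpet_measure) \<le> ennreal (Zmass * lam ^ k)"
proof -
  have "(\<integral>\<^sup>+x. Z k x \<partial>carpet_measure) = (\<Sum>j. \<integral>\<^sup>+x. ennreal (c ^ j * V (k + j) x) \<partial>carpet_measure)"
    unfolding Z_def by (rule nn_integral_suminf) measurable
  also have "\<dots> = (\<Sum>j. ennreal (c ^ j) * (\<integral>\<^sup>+x. ennreal (V (k + j) x) \<partial>carpet_measure))"
    using c_gt_1 V_nonneg by (simp add: ennreal_mult nn_integral_cmult)
  also have "\<dots> \<le> (\<Sum>j. ennreal (c ^ j) * ennreal (carpet_mass / 8 ^ n * D0 * lam ^ (k + j)))"
    unfolding lam_def by (intro suminf_le mult_left_mono integral_V) auto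
  also have "\<dots> = (\<Sum>j. ennreal (carpet_mass / 8 ^ n * D0 * lam ^ k * (c * lam) ^ j))"
    using c_gt_1 D0_nonneg lam_pos by (simp add: ennreal_mult[symmetric] power_add power_mult_distrib mult_ac)
  also have "\<dots> = ennreal (carpet_mass / 8 ^ n * D0 * lam ^ k * (1 / (1 - c * lam)))"
    using c_gt_1 c_lam D0_nonneg lam_pos by (intro suminf_ennreal_eq sums_mult geometric_sums) auto
  finally show ?thesis by (simp add: Zmass_def mult_ac)
qed

text \<open>Finiteness of \<open>Z 0 x\<close> thus forces \<open>Z k x\<close> to decay like
  \<open>(1 / c) ^ k\<close>, which makes the approximations at \<open>x\<close> a Cauchy
  sequence.\<close>

lemma Z_shift: "ennreal (c ^ k) * Z k x \<le> Z 0 x"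
proof -
  have "ennreal (c ^ k) * Z k x = (\<Sum>j. ennreal (c ^ (j + k) * V (j + k) x))"
    unfolding Z_def using c_gt_1 V_nonneg
    by (subst ennreal_suminf_cmult[symmetric]) (simp add: ennreal_mult[symmetric] power_add mult_ac add.commute)
  also have "\<dots> \<le> (\<Sum>j<k. ennreal (c ^ j * V j x)) + (\<Sum>j. ennreal (c ^ (j + k) * V (j + k) x))" by simp
  also have "\<dots> = Z 0 x"
    unfolding Z_def using suminf_offset[of "\<lambda>j. ennreal (c ^ j * V j x)" k] by (simp add: add.commute)
  finally show ?thesis .
qed

lemma approx_tail:
  assumes x: "x \<in> carpet"
  shows "ennreal (\<bar>approx (k + J) x - approx k x\<bar> powr p) \<le> ennreal c1 * Z k x"
proof -
  define v where "v j = \<bar>approx (Suc (k + j)) x - approx (k + j) x\<bar>" for j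
  have "approx (k + J) x - approx k x = (\<Sum>j<J. approx (k + Suc j) x - approx (k + j) x)"
    by (subst sum_lessThan_telescope) simp
  then have "\<bar>approx (k + J) x - approx k x\<bar> \<le> (\<Sum>j<J. v j)"
    by (simp add: v_def sum_abs)
  then have "\<bar>approx (k + J) x - approx k x\<bar> powr p \<le> (\<Sum>j<J. v j) powr p" using p by (intro powr_mono_abs) auto
  also have "\<dots> \<le> c1 * (\<Sum>j<J. c ^ j * v j powr p)"
    unfolding c_def c1_def using \<eta> p by (intro powr_sum_geometric_le) (auto simp: v_def)
  also have "\<dots> \<le> c1 * (\<Sum>j<J. c ^ j * V (k + j) x)"
    using c1_nonneg c_gt_1 approx_step_powr[OF x] by (intro mult_left_mono sum_mono) (auto simp: v_def)
  finally have "ennreal (\<bar>approx (k + J) x - approx k x\<bar> powr p) \<le> ennreal c1 * ennreal (\<Sum>j<J. c ^ j * V (k + j) x)"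
    using c1_nonneg by (simp add: ennreal_mult'[symmetric] ennreal_leI)
  also have "ennreal (\<Sum>j<J. c ^ j * V (k + j) x) = (\<Sum>j<J. ennreal (c ^ j * V (k + j) x))"
    using c_gt_1 V_nonneg by (simp add: sum_ennreal)
  also have "\<dots> \<le> Z k x" unfolding Z_def by (rule sum_le_suminf) auto
  finally show ?thesis by (simp add: mult_left_mono)
qed

lemma approx_Cauchy:
  assumes x: "x \<in> carpet" and fin: "Z 0 x < \<infinity>"
  shows "Cauchy (\<lambda>k. approx k x)"
proof -
  obtain z where z: "Z 0 x = ennreal z" "0 \<le> z" using fin by (cases "Z 0 x") auto
  have tail: "\<bar>approx (k + J) x - approx k x\<bar> \<le> (c1 * z * (1 / c) ^ k) powr (1 / p)" for k J
  proof -
    have "ennreal (c ^ k) * ennreal (\<bar>approx (k + J) x - approx k x\<bar> powr p) \<le> ennreal (c ^ k) * (ennreal c1 * Z k x)"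
      by (intro mult_left_mono approx_tail x) simp
    also have "\<dots> = ennreal c1 * (ennreal (c ^ k) * Z k x)" by (simp add: mult_ac)
    also have "\<dots> \<le> ennreal c1 * ennreal z" unfolding z(1)[symmetric] by (intro mult_left_mono Z_shift) simp
    finally have "ennreal (c ^ k * \<bar>approx (k + J) x - approx k x\<bar> powr p) \<le> ennreal (c1 * z)"
      using c_gt_1 c1_nonneg z by (simp add: ennreal_mult)
    then have "c ^ k * \<bar>approx (k + J) x - approx k x\<bar> powr p \<le> c1 * z"
      using c1_nonneg z by (subst (asm) ennreal_le_iff) auto
    then have "\<bar>approx (k + J) x - approx k x\<bar> powr p \<le> c1 * z * (1 / c) ^ k"
      using c_gt_1 by (simp add: power_one_over field_simps)
    then have "(\<bar>approx (k + J) x - approx k x\<bar> powr p) powr (1 / p) \<le> (c1 * z * (1 / c) ^ k) powr (1 / p)"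
      using p by (intro powr_mono2) auto
    then show ?thesis using p by (simp add: powr_powr)
  qed
  have "(\<lambda>k. c1 * z * (1 / c) ^ k) \<longlonglongrightarrow> c1 * z * 0"
    using c_gt_1 by (intro tendsto_mult tendsto_const LIMSEQ_power_zero) auto
  then have lim: "(\<lambda>k. c1 * z * (1 / c) ^ k) \<longlonglongrightarrow> 0" by simp
  have lim': "(\<lambda>k. (c1 * z * (1 / c) ^ k) powr (1 / p)) \<longlonglongrightarrow> 0"
    by (rule tendsto_zero_powrI[OF lim tendsto_const]) (use p c_gt_1 c1_nonneg z in \<open>auto intro!: always_eventually\<close>)
  then have "\<exists>M. \<forall>k\<ge>M. (c1 * z * (1 / c) ^ k) powr (1 / p) < e" if "0 < e" for e
    using order_tendstoD(2)[OF lim' that] by (simp add: eventually_sequentially)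
  show ?thesis
  proof (rule CauchyI')
    fix e :: real assume "0 < e"
    then obtain M where M: "\<forall>k\<ge>M. (c1 * z * (1 / c) ^ k) powr (1 / p) < e" using \<open>\<And>e. 0 < e \<Longrightarrow> _\<close> by blast
    show "\<exists>M. \<forall>i\<ge>M. \<forall>j>i. dist (approx i x) (approx j x) < e"
    proof (intro exI[of _ M] allI impI)
      fix i j assume ij: "M \<le> i" "i < j"
      then show "dist (approx i x) (approx j x) < e"
        using tail[of i "j - i"] M by (simp add: dist_real_def abs_minus_commute le_less_trans)
    qed
  qed
qed

text \<open>Clamped so that the bound \<open>B\<close> holds everywhere, also where the sequence
  diverges and \<open>lim\<close> is unspecified; where it converges the clamping changes
  nothing.\<close>

definition limit :: "real \<times> real \<Rightarrow> real" where
  "limit x = max (- B) (min B (lim (\<lambda>k. approx k x)))"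

lemma limit_measurable [measurable]: "limit \<in> borel_measurable borel"
proof -
  have "(\<lambda>x. lim (\<lambda>k. approx k x)) \<in> borel_measurable borel"
    by (rule borel_measurable_lim_metric) measurable
  then show ?thesis unfolding limit_def[abs_def] by measurable
qed

lemma B_nonneg: "0 \<le> B" using B[of "(0, 0)"] by linarith

lemma abs_limit_le: "\<bar>limit x\<bar> \<le> B"
  using B_nonneg by (auto simp: limit_def)

lemma approx_limit:
  assumes x: "x \<in> carpet" and fin: "Z 0 x < \<infinity>"
  shows "(\<lambda>k. approx k x) \<longlonglongrightarrow> limit x"
proof -
  have "convergent (\<lambda>k. approx k x)" using approx_Cauchy[OF assms] by (simp add: Cauchy_convergent_iff)
  then have L: "(\<lambda>k. approx k x) \<longlonglongrightarrow> lim (\<lambda>k. approx k x)" by (simp add: convergent_LIMSEQ_iff)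
  have b: "- B \<le> approx k x" "approx k x \<le> B" for k
    using abs_vals_le[of k "grid_point k x"] by (auto simp: approx_def)
  have "lim (\<lambda>k. approx k x) \<le> B" by (rule LIMSEQ_le_const2[OF L]) (use b in blast)
  moreover have "- B \<le> lim (\<lambda>k. approx k x)"
    by (rule LIMSEQ_le_const[OF L]) (use b in blast)
  ultimately have "limit x = lim (\<lambda>k. approx k x)" by (simp add: limit_def)
  then show ?thesis using L by simp
qed

lemma limit_tail:
  assumes x: "x \<in> carpet" and fin: "Z 0 x < \<infinity>"
  shows "ennreal (\<bar>limit x - approx k x\<bar> powr p) \<le> ennreal c1 * Z k x"
proof -
  have "(\<lambda>J. approx (k + J) x) \<longlonglongrightarrow> limit x"
    using LIMSEQ_ignore_initial_segment[OF approx_limit[OF assms], of k] by (simp add: add.commute)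
  then have "(\<lambda>J. \<bar>approx (k + J) x - approx k x\<bar> powr p) \<longlonglongrightarrow> \<bar>limit x - approx k x\<bar> powr p"
    using p by (intro tendsto_powr2 tendsto_rabs tendsto_diff tendsto_const) (auto intro: always_eventually)
  then have "(\<lambda>J. ennreal (\<bar>approx (k + J) x - approx k x\<bar> powr p)) \<longlonglongrightarrow> ennreal (\<bar>limit x - approx k x\<bar> powr p)"
    by (rule tendsto_ennrealI)
  then show ?thesis by (rule LIMSEQ_le_const2) (use approx_tail[OF x] in auto)
qed

lemma AE_finite: "AE x in carpet_measure. x \<in> carpet \<and> Z 0 x < \<infinity>"
proof -
  have "(\<integral>\<^sup>+x. Z 0 x \<partial>carpet_measure) \<noteq> \<infinity>"
    using integral_Z[of 0] by (metis ennreal_less_top infinity_ennreal_def le_less_trans less_irrefl)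
  then have "AE x in carpet_measure. Z 0 x \<noteq> \<infinity>" by (intro nn_integral_PInf_AE) auto
  with AE_carpet show ?thesis by eventually_elim (auto simp: less_top)
qed

definition C :: real where "C = 3 powr p * (c1 + 2 powr p)"

lemma C_nonneg: "0 \<le> C" using c1_nonneg by (simp add: C_def)

text \<open>Goes from \<open>limit y\<close> to \<open>approx k y\<close>, to
  \<open>approx k x\<close> and to \<open>limit x\<close>: the outer steps are tails, the middle one
  is \<open>approx_near\<close>.\<close>

lemma limit_near:
  assumes x: "x \<in> carpet" "Z 0 x < \<infinity>" and y: "y \<in> carpet" "Z 0 y < \<infinity>" and d: "dist x y < 1 / 3 ^ level k"
  shows "ennreal (\<bar>limit y - limit x\<bar> powr p) \<le> ennreal C * (Z k x + Z k y)"
proof -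
  have "\<bar>limit y - limit x\<bar> \<le> (\<Sum>i<3. [\<bar>limit y - approx k y\<bar>, \<bar>approx k x - approx k y\<bar>, \<bar>limit x - approx k x\<bar>] ! i)"
    by (simp add: eval_nat_numeral)
  then have "\<bar>limit y - limit x\<bar> powr p \<le> (\<Sum>i<3. [\<bar>limit y - approx k y\<bar>, \<bar>approx k x - approx k y\<bar>, \<bar>limit x - approx k x\<bar>] ! i) powr p"
    using p by (intro powr_mono_abs) auto
  also have "\<dots> \<le> real (card {..<3::nat}) powr p * (\<Sum>i<3. ([\<bar>limit y - approx k y\<bar>, \<bar>approx k x - approx k y\<bar>, \<bar>limit x - approx k x\<bar>] ! i) powr p)"
    using p by (intro powr_sum_le) (auto simp: less_Suc_eq eval_nat_numeral)
  also have "\<dots> = 3 powr p * (\<bar>limit y - approx k y\<bar> powr p + \<bar>approx k x - approx k y\<bar> powr p + \<bar>limit x - approx k x\<bar> powr p)"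
    by (simp add: eval_nat_numeral)
  finally have "ennreal (\<bar>limit y - limit x\<bar> powr p)
     \<le> ennreal (3 powr p) * (ennreal (\<bar>limit y - approx k y\<bar> powr p) + ennreal (\<bar>approx k x - approx k y\<bar> powr p) + ennreal (\<bar>limit x - approx k x\<bar> powr p))"
    by (simp add: ennreal_mult'[symmetric] ennreal_plus[symmetric] ennreal_leI del: ennreal_plus)
  also have "\<dots> \<le> ennreal (3 powr p) * (ennreal c1 * Z k y + ennreal (2 powr p) * (Z k x + Z k y) + ennreal c1 * Z k x)"
  proof (intro mult_left_mono add_mono limit_tail x y)
    have "ennreal (\<bar>approx k x - approx k y\<bar> powr p) \<le> ennreal (2 powr p * (V k x + V k y))"
      by (intro ennreal_leI approx_near x y d)
    also have "\<dots> = ennreal (2 powr p) * (ennreal (V k x) + ennreal (V k y))"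
      using V_nonneg by (simp add: ennreal_mult)
    also have "\<dots> \<le> ennreal (2 powr p) * (Z k x + Z k y)" by (intro mult_left_mono add_mono V_le_Z) simp
    finally show "ennreal (\<bar>approx k x - approx k y\<bar> powr p) \<le> ennreal (2 powr p) * (Z k x + Z k y)" .
  qed simp
  also have "\<dots> = ennreal C * (Z k x + Z k y)"
    using c1_nonneg by (simp add: C_def ennreal_mult distrib_left distrib_right mult_ac add_ac)
  finally show ?thesis .
qed

text \<open>By symmetry twice the integral with \<open>Z k x\<close> alone, where integrating over
  \<open>y\<close> first gives the mass of a ball.\<close>

lemma near_double_integral:
  assumes "0 < r"
  shows "nn_integral2 carpet_measure (\<lambda>x y. indicator {y. dist x y < r} y * (Z k x + Z k y))
    \<le> ennreal (600 * carpet_mass * r powr carpet_dim * (Zmass * lam ^ k))"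
proof -
  interpret pair: pair_sigma_finite carpet_measure carpet_measure ..
  define G where "G x y = indicator {y. dist x y < r} y * Z k x" for x y
  have [measurable]: "(\<lambda>(x, y). G x y) \<in> borel_measurable (carpet_measure \<Otimes>\<^sub>M carpet_measure)"
  proof -
    have "(\<lambda>(x, y). G x y) = (\<lambda>z. indicator {z. dist (fst z) (snd z) < r} z * Z k (fst z))"
      by (auto simp: G_def indicator_def)
    then show ?thesis by simp
  qed
  have split: "indicator {y. dist x y < r} y * (Z k x + Z k y) = G x y + G y x" for x y
    by (auto simp: G_def indicator_def dist_commute)
  have "nn_integral2 carpet_measure (\<lambda>x y. G x y + G y x)
     = nn_integral2 carpet_measure G + nn_integral2 carpet_measure (\<lambda>x y. G y x)"
    by (simp add: nn_integral_add)
  also have "nn_integral2 carpet_measure (\<lambda>x y. G y x) = nn_integral2 carpet_measure G"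
    by (rule pair.Fubini') simp
  also have one: "nn_integral2 carpet_measure G \<le> ennreal (300 * carpet_mass * r powr carpet_dim) * ennreal (Zmass * lam ^ k)"
  proof -
    have "(\<integral>\<^sup>+y. G x y \<partial>carpet_measure) \<le> ennreal (300 * carpet_mass * r powr carpet_dim) * Z k x" for x
    proof -
      have "(\<integral>\<^sup>+y. G x y \<partial>carpet_measure) = Z k x * emeasure carpet_measure (ball x r)"
        unfolding G_def by (simp add: ball_def nn_integral_cmult_indicator mult.commute[of "indicator _ _"])
      also have "\<dots> \<le> Z k x * ennreal (300 * carpet_mass * r powr carpet_dim)"
        using carpet_ball_upper[OF assms, of x]
        by (intro mult_left_mono) (auto simp: carpet_measure.emeasure_eq_measure ennreal_leI)
      finally show ?thesis by (simp add: mult.commute)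
    qed
    then have "nn_integral2 carpet_measure G \<le> (\<integral>\<^sup>+x. ennreal (300 * carpet_mass * r powr carpet_dim) * Z k x \<partial>carpet_measure)"
      by (intro nn_integral_mono)
    also have "\<dots> = ennreal (300 * carpet_mass * r powr carpet_dim) * (\<integral>\<^sup>+x. Z k x \<partial>carpet_measure)"
      by (simp add: nn_integral_cmult)
    also have "\<dots> \<le> ennreal (300 * carpet_mass * r powr carpet_dim) * ennreal (Zmass * lam ^ k)"
      by (intro mult_left_mono integral_Z) simp
    finally show ?thesis .
  qed
  also have "ennreal (300 * carpet_mass * r powr carpet_dim) * ennreal (Zmass * lam ^ k) = ennreal (300 * carpet_mass * r powr carpet_dim * (Zmass * lam ^ k))"
    using Zmass_nonneg lam_pos carpet_mass_pos by (simp add: ennreal_mult)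
  finally have "nn_integral2 carpet_measure (\<lambda>x y. G x y + G y x)
     \<le> ennreal (300 * carpet_mass * r powr carpet_dim * (Zmass * lam ^ k)) + ennreal (300 * carpet_mass * r powr carpet_dim * (Zmass * lam ^ k))"
    using one by (simp add: add_mono)
  also have "\<dots> = ennreal (600 * carpet_mass * r powr carpet_dim * (Zmass * lam ^ k))"
    using Zmass_nonneg lam_pos carpet_mass_pos by (simp add: ennreal_plus[symmetric] del: ennreal_plus)
  finally show ?thesis by (simp add: split)
qed

text \<open>Pairs are sorted by distance into shells between \<open>1 / 3 ^ level (Suc k)\<close>
  and \<open>1 / 3 ^ level k\<close>. From one shell to the next the kernel grows by
  \<open>(3 powr t) ^ m\<close>, the mass of a ball shrinks by \<open>8 ^ m\<close> and the integral
  of \<open>Z k\<close> by \<open>lam\<close>; \<open>ratio\<close> says that the product of these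
  is below 1.\<close>

lemma limit_energy_finite:
  assumes t: "0 < t" and ratio: "(3 powr t) ^ m / 8 ^ m * lam < 1"
  shows "riesz_energy p t carpet_measure limit < \<infinity>"
proof -
  \<comment> \<open>Bounds the integrand for pairs at distance at least \<open>1 / 3 ^ n\<close>,
    which lie in no shell.\<close>
  define K0 where "K0 = (2 * B) powr p * (3 powr t) ^ n"
  define W where "W k = ennreal ((3 powr t) ^ level (Suc k))" for k
  define H where "H k x y = W k * (ennreal C * (indicator {y. dist x y < 1 / 3 ^ level k} y * (Z k x + Z k y)))" for k x y
  have [measurable]: "(\<lambda>(x, y). H k x y) \<in> borel_measurable (carpet_measure \<Otimes>\<^sub>M carpet_measure)" for k
  proof -
    have "(\<lambda>(x, y). H k x y) = (\<lambda>z. W k * (ennreal C * (indicator {z. dist (fst z) (snd z) < 1 / 3 ^ level k} z * (Z k (fst z) + Z k (snd z)))))"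
      by (auto simp: H_def indicator_def)
    then show ?thesis by simp
  qed
  have inv_powr: "(1 / 3 ^ i) powr (- t) = (3 powr t) ^ i" for i
  proof -
    have "((3::real) ^ i) powr t = (3 powr t) ^ i" by (induction i) (auto simp: powr_mult)
    then show ?thesis by (simp add: powr_minus powr_divide)
  qed
  have pt: "ennreal (\<bar>limit y - limit x\<bar> powr p * dist x y powr (- t)) \<le> ennreal K0 + (\<Sum>k. H k x y)"
    if x: "x \<in> carpet \<and> Z 0 x < \<infinity>" and y: "y \<in> carpet \<and> Z 0 y < \<infinity>" for x y
  proof (cases "dist x y < 1 / 3 ^ n")
    case False
    have "\<bar>limit y - limit x\<bar> \<le> 2 * B" using abs_limit_le[of x] abs_limit_le[of y] by linarith
    then have "\<bar>limit y - limit x\<bar> powr p \<le> (2 * B) powr p" using p by (intro powr_mono_abs) auto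
    moreover have "dist x y powr (- t) \<le> (1 / 3 ^ n) powr (- t)" using False t by (intro powr_mono2') auto
    ultimately have "\<bar>limit y - limit x\<bar> powr p * dist x y powr (- t) \<le> K0"
      unfolding K0_def inv_powr by (intro mult_mono) auto
    then have "ennreal (\<bar>limit y - limit x\<bar> powr p * dist x y powr (- t)) \<le> ennreal K0" by (rule ennreal_leI)
    then show ?thesis by (rule add_increasing2[rotated]) simp
  next
    case True
    show ?thesis
    proof (cases "x = y")
      case False
      then have d: "0 < dist x y" by simp
      have "\<exists>k. 1 / 3 ^ level k \<le> dist x y"
      proof -
        obtain k where "(1 / 3) ^ k < dist x y" using real_arch_pow_inv[OF d, of "1 / 3"] by auto
        moreover have "k \<le> level k" using m_pos by (simp add: level_def trans_le_add2)
        then have "1 / 3 ^ level k \<le> (1 / 3 :: real) ^ k" unfolding power_one_over[symmetric] by (intro power_decreasing) auto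
        ultimately show ?thesis by (intro exI[of _ k]) simp
      qed
      then obtain k0 where k0: "1 / 3 ^ level k0 \<le> dist x y" by blast
      define k1 where "k1 = (LEAST k. 1 / 3 ^ level k \<le> dist x y)"
      have k1: "1 / 3 ^ level k1 \<le> dist x y" unfolding k1_def by (rule LeastI[of _ k0]) (rule k0)
      have "k1 \<noteq> 0" using k1 True by (intro notI) simp
      then obtain k where k: "k1 = Suc k" by (cases k1) auto
      have dk: "dist x y < 1 / 3 ^ level k" using not_less_Least[of k "\<lambda>k. 1 / 3 ^ level k \<le> dist x y"] k k1_def by simp
      have "dist x y powr (- t) \<le> (1 / 3 ^ level (Suc k)) powr (- t)" using k1 k t d by (intro powr_mono2') auto
      then have "ennreal (dist x y powr (- t)) \<le> W k" unfolding W_def inv_powr by (rule ennreal_leI)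
      then have "ennreal (dist x y powr (- t)) * ennreal (\<bar>limit y - limit x\<bar> powr p) \<le> W k * (ennreal C * (Z k x + Z k y))"
        using x y dk by (intro mult_mono limit_near) auto
      also have "\<dots> = H k x y" using dk by (simp add: H_def)
      also have "\<dots> \<le> (\<Sum>k. H k x y)" using sum_le_suminf[of "\<lambda>k. H k x y" "{k}"] by simp
      finally have "ennreal (\<bar>limit y - limit x\<bar> powr p * dist x y powr (- t)) \<le> (\<Sum>k. H k x y)"
        by (simp add: ennreal_mult mult.commute)
      then show ?thesis by (simp add: add_increasing)
    qed (use p in simp)
  qed
  have "riesz_energy p t carpet_measure limit \<le> nn_integral2 carpet_measure (\<lambda>x y. (ennreal K0 + (\<Sum>k. H k x y)))"
    unfolding riesz_energy_def
  proof (rule nn_integral_mono_AE, use AE_finite in eventually_elim)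
    fix x assume x: "x \<in> carpet \<and> Z 0 x < \<infinity>"
    show "(\<integral>\<^sup>+y. ennreal (\<bar>limit y - limit x\<bar> powr p * dist x y powr (- t)) \<partial>carpet_measure) \<le> (\<integral>\<^sup>+y. (ennreal K0 + (\<Sum>k. H k x y)) \<partial>carpet_measure)"
      by (rule nn_integral_mono_AE, use AE_finite in eventually_elim) (rule pt[OF x])
  qed
  also have "\<dots> = ennreal K0 * emeasure carpet_measure UNIV * emeasure carpet_measure UNIV
      + (\<Sum>k. \<integral>\<^sup>+x. \<integral>\<^sup>+y. H k x y \<partial>carpet_measure \<partial>carpet_measure)"
    by (simp add: nn_integral_add nn_integral_suminf)
  also have "(\<Sum>k. \<integral>\<^sup>+x. \<integral>\<^sup>+y. H k x y \<partial>carpet_measure \<partial>carpet_measure) < \<infinity>"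
  proof -
    define q where "q = (3 powr t) ^ m / 8 ^ m * lam"
    define Q where "Q = (3 powr t) ^ (n + m) * C * (600 * carpet_mass * (1 / 8 ^ n) * Zmass)"
    have Q: "0 \<le> Q" using C_nonneg Zmass_nonneg carpet_mass_pos by (simp add: Q_def)
    have q: "0 \<le> q" "q < 1" using ratio lam_pos by (auto simp: q_def)
    have "nn_integral2 carpet_measure (\<lambda>x y. H k x y) \<le> ennreal (Q * q ^ k)" for k
    proof -
      have [measurable]: "(\<lambda>(x, y). indicator {y. dist x y < 1 / 3 ^ level k} y * (Z k x + Z k y)) \<in> borel_measurable (carpet_measure \<Otimes>\<^sub>M carpet_measure)"
      proof -
        have "(\<lambda>(x, y). indicator {y. dist x y < 1 / 3 ^ level k} y * (Z k x + Z k y)) = (\<lambda>z. indicator {z. dist (fst z) (snd z) < 1 / 3 ^ level k} z * (Z k (fst z) + Z k (snd z)))"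
          by (auto simp: indicator_def)
        then show ?thesis by simp
      qed
      have "nn_integral2 carpet_measure (\<lambda>x y. H k x y)
         = W k * (ennreal C * nn_integral2 carpet_measure (\<lambda>x y. indicator {y. dist x y < 1 / 3 ^ level k} y * (Z k x + Z k y)))"
        unfolding H_def by (simp add: nn_integral_cmult)
      also have "\<dots> \<le> W k * (ennreal C * ennreal (600 * carpet_mass * (1 / 3 ^ level k) powr carpet_dim * (Zmass * lam ^ k)))"
        by (intro mult_left_mono near_double_integral) auto
      also have "\<dots> = ennreal ((3 powr t) ^ level (Suc k) * (C * (600 * carpet_mass * (1 / 8 ^ level k) * (Zmass * lam ^ k))))"
        unfolding W_def inverse_three_powr_dim using C_nonneg Zmass_nonneg lam_pos carpet_mass_pos
        by (simp add: ennreal_mult[symmetric])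
      also have "(3 powr t) ^ level (Suc k) * (C * (600 * carpet_mass * (1 / 8 ^ level k) * (Zmass * lam ^ k))) = Q * q ^ k"
        by (simp add: Q_def q_def level_def power_add power_mult power_mult_distrib power_divide mult.commute[of k])
      finally show ?thesis .
    qed
    then have "(\<Sum>k. \<integral>\<^sup>+x. \<integral>\<^sup>+y. H k x y \<partial>carpet_measure \<partial>carpet_measure) \<le> (\<Sum>k. ennreal (Q * q ^ k))"
      by (intro suminf_le) auto
    also have "\<dots> = ennreal (Q * (1 / (1 - q)))"
      using q Q by (intro suminf_ennreal_eq sums_mult geometric_sums) auto
    finally show ?thesis by (metis ennreal_less_top infinity_ennreal_def le_less_trans)
  qed
  finally show ?thesis
    by (auto simp: carpet_measure.emeasure_eq_measure ennreal_mult[symmetric] less_top[symmetric] ennreal_mult_eq_top_iff)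
qed

text \<open>Refinement does not increase the oscillation (\<open>refine_osc_le\<close>), so it stays
  0 on all nested cells that contain \<open>x\<close>.\<close>

lemma limit_zero:
  assumes x: "x \<in> carpet" and 0: "\<And>q z. q \<in> cells n \<Longrightarrow> x \<in> cell_set n q \<Longrightarrow> z \<in> corners q \<Longrightarrow> a0 z = 0"
  shows "limit x = 0"
proof -
  have osc0: "osc (vals k) q = 0" if "q \<in> cells (level k)" "x \<in> cell_set (level k) q" for k q
    using that
  proof (induction k arbitrary: q)
    case 0
    then have "osc a0 q \<le> 0" using assms(2)[of q] by (intro osc_le) auto
    then show ?case using osc_nonneg[of a0 q] by simp
  next
    case (Suc k)
    obtain q' r where qr: "q' \<in> cells (level k)" "r \<in> cells m" "q = blk m q' r"
      using Suc.prems(1) unfolding level_Suc by (rule cells_blkE)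
    have "x \<in> cell_set (level k) q'" using Suc.prems(2) qr unfolding cell_set_eq[of "level k" q' m] level_Suc by auto
    then have "osc (vals k) q' = 0" using Suc.IH qr by blast
    then have "osc (vals (Suc k)) q \<le> 0" using refine_osc_le[OF qr(2), of "vals k" q'] qr by simp
    then show ?case using osc_nonneg[of "vals (Suc k)" q] by simp
  qed
  have "approx k x = 0" for k
  proof (induction k)
    case 0
    obtain q where q: "q \<in> cells n" "x \<in> cell_set n q" using x carpet_eq_cells[of n] by blast
    then show ?case using grid_point_corner[of x 0 q] assms(2)[of q] by (simp add: approx_def)
  next
    case (Suc k)
    obtain q r where q: "q \<in> cells (level k)" "r \<in> cells m" "x \<in> cell_set (level k) q" "x \<in> cell_set (level (Suc k)) (blk m q r)"
      by (rule cell_obtain[OF x])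
    show ?case using approx_step[OF q(1,2,4)] osc0[OF q(1,3)] Suc by simp
  qed
  then show ?thesis using B_nonneg by (simp add: limit_def)
qed

lemma limit_distance:
  "Lp_powr p carpet_measure (\<lambda>x. limit x - approx 0 x) \<le> ennreal (c1 * Zmass)"
proof -
  have "Lp_powr p carpet_measure (\<lambda>x. limit x - approx 0 x) \<le> (\<integral>\<^sup>+x. ennreal c1 * Z 0 x \<partial>carpet_measure)"
    by (rule nn_integral_mono_AE, use AE_finite in eventually_elim) (auto intro: limit_tail)
  also have "\<dots> = ennreal c1 * (\<integral>\<^sup>+x. Z 0 x \<partial>carpet_measure)" by (simp add: nn_integral_cmult)
  also have "\<dots> \<le> ennreal c1 * ennreal (Zmass * lam ^ 0)" by (intro mult_left_mono integral_Z) simp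
  finally show ?thesis using c1_nonneg Zmass_nonneg by (simp add: ennreal_mult)
qed

end

text \<open>The gap between \<open>l\<close> and \<open>ln 64 - t * ln 3\<close> is spent on the
  parameters: \<open>m\<close> is so large that the constant \<open>K0\<close> does not spoil
  \<open>ratio\<close>, \<open>\<eta>\<close> so close to 1 that \<open>c * lam < 1\<close>, and
  finally \<open>n\<close> so large that the corner values of \<open>f\<close> determine it up to
  the required error.\<close>

lemma carpet_approximation:
  fixes f :: "real \<times> real \<Rightarrow> real"
  assumes p: "1 < p" and l: "(\<lambda>m. ln (conductance p m) / real m) \<longlonglongrightarrow> l"
    and t: "carpet_dim < t" "l < ln 64 - t * ln 3"
    and f: "\<And>x y. \<bar>f x - f y\<bar> \<le> L * dist x y" "\<And>x. \<bar>f x\<bar> \<le> B" "\<And>x. dist o' x < \<delta> \<Longrightarrow> f x = 0"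
    and \<delta>: "0 < \<delta>" and \<epsilon>: "0 < \<epsilon>"
  obtains u where "u \<in> borel_measurable borel" "\<And>x. \<bar>u x\<bar> \<le> B"
    "\<And>x. x \<in> carpet \<Longrightarrow> dist o' x < \<delta> / 2 \<Longrightarrow> u x = 0"
    "riesz_energy p t carpet_measure u < \<infinity>"
    "Lp_powr p carpet_measure (\<lambda>x. f x - u x) < ennreal \<epsilon>"
proof -
  have p0: "0 < p" using p by simp
  have t0: "0 < t" using t carpet_dim_pos by simp
  have L: "0 \<le> L"
  proof -
    have "0 \<le> \<bar>f (0, 0) - f (1, 0)\<bar>" by simp
    also have "\<dots> \<le> L * dist (0::real, 0::real) (1, 0)" by (rule f)
    finally show ?thesis by (simp add: dist_prod_def)
  qed
  \<comment> \<open>The constant of \<open>refine_vertex_energy\<close> times that of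
    \<open>profile_exists\<close>.\<close>
  define K0 where "K0 = 2 powr (p + 1) * (8 powr (p + 1) * 2)"
  have K0: "0 < K0" by (simp add: K0_def)
  have "(\<lambda>m. ln (conductance p m) / real m + ln K0 / real m) \<longlonglongrightarrow> l + 0"
    by (intro tendsto_add l lim_const_over_n)
  then have "\<forall>\<^sub>F m in sequentially. ln (conductance p m) / real m + ln K0 / real m < ln 64 - t * ln 3"
    using t by (intro order_tendstoD) auto
  then obtain m where m: "0 < m" "ln (conductance p m) / real m + ln K0 / real m < ln 64 - t * ln 3"
    using eventually_happens[OF eventually_conj[OF eventually_gt_at_top[of 0]]] by auto
  define b where "b = K0 * conductance p m"
  have b: "0 < b" using conductance_pos[OF m(1) p0] K0 by (simp add: b_def)
  define lam where "lam = b / 8 ^ m"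
  have lam: "0 < lam" using b by (simp add: lam_def)
  have ratio: "(3 powr t) ^ m / 8 ^ m * lam < 1"
  proof -
    have lnb: "ln b = ln K0 + ln (conductance p m)"
      using K0 conductance_pos[OF m(1) p0] by (simp add: b_def ln_mult)
    have ln64: "ln 64 = 2 * ln (8::real)" using ln_mult[of 8 "8::real"] by simp
    have "ln ((3 powr t) ^ m / 8 ^ m * lam) = real m * (t * ln 3) - real m * ln 8 + (ln b - real m * ln 8)"
      using b by (simp add: lam_def ln_mult ln_div ln_realpow ln_powr)
    also have "\<dots> < 0" using m unfolding lnb ln64 by (simp add: field_simps)
    finally show ?thesis using lam by (subst (asm) ln_less_zero_iff) auto
  qed
  \<comment> \<open>Since \<open>t > carpet_dim\<close> means \<open>3 powr t > 8\<close>, the bound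
    \<open>ratio\<close> is the stronger one.\<close>
  have lam1: "lam < 1"
  proof -
    have "8 \<le> 3 powr t"
    proof -
      have "(3 ^ 1) powr carpet_dim \<le> 3 powr t" using t by (simp add: powr_mono)
      then show ?thesis unfolding three_powr_dim by simp
    qed
    then have "8 ^ m \<le> (3 powr t) ^ m" by (intro power_mono) auto
    then have "1 \<le> (3 powr t) ^ m / 8 ^ m" by simp
    from mult_right_mono[OF this, of lam] have "lam \<le> (3 powr t) ^ m / 8 ^ m * lam" using lam by simp
    then show ?thesis using ratio by (rule le_less_trans)
  qed
  \<comment> \<open>The midpoint of 1 and \<open>1 / lam\<close>; \<open>\<eta>\<close> is then
    chosen to make \<open>\<eta> powr (1 - p)\<close> equal to it.\<close>
  define c where "c = (1 + 1 / lam) / 2"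
  have c: "1 < c" "c * lam < 1" using lam lam1 by (auto simp: c_def field_simps)
  define \<eta> where "\<eta> = c powr (1 / (1 - p))"
  have \<eta>p: "\<eta> powr (1 - p) = c" using c p by (simp add: \<eta>_def powr_powr)
  have \<eta>: "0 < \<eta>" "\<eta> < 1"
  proof -
    show "0 < \<eta>" using c by (simp add: \<eta>_def)
    have "c powr (1 / (1 - p)) < c powr 0" using c p by (intro powr_less_mono) auto
    then show "\<eta> < 1" using c by (simp add: \<eta>_def)
  qed
  obtain h where h: "profile m h" "vertex_energy p m h \<le> 8 powr (p + 1) * (2 * conductance p m)"
    by (rule profile_exists[OF m(1) p0])
  have hb: "2 powr (p + 1) * vertex_energy p m h \<le> b"
    using mult_left_mono[OF h(2), of "2 powr (p + 1)"] by (simp add: b_def K0_def mult_ac)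
  \<comment> \<open>Collects all constants in front of \<open>s powr p\<close>, where
    \<open>s\<close> will bound the variation of \<open>f\<close> on a cell of level
    \<open>n\<close>. It does not involve \<open>n\<close>, so \<open>n\<close> can be chosen
    afterwards.\<close>
  define G where "G = 2 powr p * (carpet_mass + (1 - \<eta>) powr (1 - p) * (carpet_mass / (1 - c * lam)))"
  have "(\<lambda>n. (2 * L * (1 / 3) ^ n) powr p * G) \<longlonglongrightarrow> 0"
  proof -
    have "(\<lambda>n. 2 * L * (1 / 3) ^ n) \<longlonglongrightarrow> 2 * L * 0"
      by (intro tendsto_mult tendsto_const LIMSEQ_power_zero) auto
    then have "(\<lambda>n. 2 * L * (1 / 3) ^ n) \<longlonglongrightarrow> 0" by simp
    then have "(\<lambda>n. (2 * L * (1 / 3) ^ n) powr p) \<longlonglongrightarrow> 0"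
      by (rule tendsto_zero_powrI[OF _ tendsto_const]) (use p L in \<open>auto intro!: always_eventually\<close>)
    then show ?thesis by (rule tendsto_mult_left_zero)
  qed
  then have 1: "\<forall>\<^sub>F n in sequentially. (2 * L * (1 / 3) ^ n) powr p * G < \<epsilon>"
    using \<epsilon> by (intro order_tendstoD)
  have "(\<lambda>n. (1 / 3 :: real) ^ n) \<longlonglongrightarrow> 0" by (intro LIMSEQ_power_zero) auto
  then have 2: "\<forall>\<^sub>F n in sequentially. (1 / 3 :: real) ^ n < \<delta> / 4"
    using \<delta> by (intro order_tendstoD) auto
  obtain n where n: "(2 * L * (1 / 3) ^ n) powr p * G < \<epsilon>" "(1 / 3) ^ n < \<delta> / 4"
    using eventually_happens[OF eventually_conj[OF 1 2]] by auto
  define pos where "pos z = (real_of_int (fst z) / 3 ^ n, real_of_int (snd z) / 3 ^ n)" for z :: "int \<times> int"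
  define a0 where "a0 z = f (pos z)" for z
  have pos_mem: "z \<in> corners q \<Longrightarrow> pos z \<in> cell_set n q" for z q
  proof -
    assume z: "z \<in> corners q"
    define w where "w = (real_of_int (fst z - fst q), real_of_int (snd z - snd q))"
    have "w \<in> carpet" using z carpet_corners by (auto simp: w_def corners_iff)
    moreover have "cell_map n q w = pos z" by (rule prod_eqI) (auto simp: w_def pos_def)
    ultimately show "pos z \<in> cell_set n q" unfolding cell_set_def by (metis imageI)
  qed
  note lam_eq = lam_def[symmetric]
  interpret carpet_refinement m h p b B \<eta> n a0
    unfolding carpet_refinement_def carpet_refinement_axioms_def
    using h(1) m(1) p hb b f(2) \<eta> c by (auto simp: \<eta>p a0_def lam_def)
  have eqs: "carpet_refinement.c p \<eta> = c" "carpet_refinement.lam m b = lam"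
    unfolding carpet_refinement.c_def[OF carpet_refinement_axioms] carpet_refinement.lam_def[OF carpet_refinement_axioms]
    by (rule \<eta>p, rule lam_eq)
  define s where "s = 2 * L * (1 / 3) ^ n"
  have s: "0 \<le> s" using L by (simp add: s_def)
  have cell_le: "\<bar>f x - f y\<bar> \<le> s" if "x \<in> cell_set n q" "y \<in> cell_set n q" for x y q
  proof -
    have "\<bar>f x - f y\<bar> \<le> L * dist x y" by (rule f)
    also have "\<dots> \<le> L * (2 / 3 ^ n)" using that L by (intro mult_left_mono cell_set_dist)
    finally show ?thesis by (simp add: s_def power_one_over mult_ac)
  qed
  have "osc a0 q \<le> s" for q
    unfolding a0_def by (rule osc_le) (auto intro!: cell_le pos_mem)
  then have "vertex_energy p n a0 \<le> (\<Sum>q\<in>cells n. s powr p)"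
    unfolding vertex_energy_def using p osc_nonneg by (intro sum_mono powr_mono2) auto
  then have D0: "D0 \<le> 8 ^ n * s powr p" by (simp add: D0_def card_cells)
  have Zm: "Zmass \<le> carpet_mass / (1 - c * lam) * s powr p"
  proof -
    have "Zmass = carpet_mass / 8 ^ n * D0 / (1 - c * lam)" unfolding Zmass_def eqs ..
    also have "\<dots> \<le> carpet_mass / 8 ^ n * (8 ^ n * s powr p) / (1 - c * lam)"
      using c carpet_mass_pos D0 by (intro divide_right_mono mult_left_mono) auto
    finally show ?thesis by simp
  qed
  have approx0: "\<bar>f x - approx 0 x\<bar> powr p \<le> s powr p" if x: "x \<in> carpet" for x
  proof -
    obtain q where q: "q \<in> cells n" "x \<in> cell_set n q" using x carpet_eq_cells[of n] by blast
    have "grid_point 0 x \<in> corners q" using grid_point_corner[of x 0 q] q by simp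
    then have "\<bar>f x - approx 0 x\<bar> \<le> s" unfolding approx_def vals.simps a0_def by (intro cell_le[OF q(2)] pos_mem)
    then show ?thesis using p by (intro powr_mono_abs) auto
  qed
  have fcont: "continuous_on UNIV f"
  proof (rule continuous_onI)
    fix x :: "real \<times> real" and e :: real assume e: "0 < e"
    have "dist (f y) (f x) \<le> e" if "dist y x < e / (L + 1)" for y
    proof -
      have "dist (f y) (f x) \<le> L * dist y x" using f(1)[of y x] by (simp add: dist_real_def)
      also have "\<dots> \<le> (L + 1) * (e / (L + 1))" using that L e by (intro mult_mono) auto
      finally show ?thesis using L by simp
    qed
    then show "\<exists>d>0. \<forall>x'\<in>UNIV. dist x' x < d \<longrightarrow> dist (f x') (f x) \<le> e"
      using e L by (intro exI[of _ "e / (L + 1)"]) auto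
  qed
  have [measurable]: "f \<in> borel_measurable borel" by (rule borel_measurable_continuous_onI[OF fcont])
  have "Lp_powr p carpet_measure (\<lambda>x. f x - limit x)
     \<le> (\<integral>\<^sup>+x. ennreal (2 powr p) * (ennreal (s powr p) + ennreal (\<bar>limit x - approx 0 x\<bar> powr p)) \<partial>carpet_measure)"
  proof (rule nn_integral_mono_AE, use AE_carpet in eventually_elim)
    fix x assume x: "x \<in> carpet"
    have "\<bar>f x - limit x\<bar> powr p = \<bar>(f x - approx 0 x) - (limit x - approx 0 x)\<bar> powr p" by simp
    also have "\<dots> \<le> 2 powr p * (\<bar>f x - approx 0 x\<bar> powr p + \<bar>limit x - approx 0 x\<bar> powr p)"
      using p by (intro abs_powr_diff_le) auto
    also have "\<dots> \<le> 2 powr p * (s powr p + \<bar>limit x - approx 0 x\<bar> powr p)"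
      by (intro mult_left_mono add_mono approx0 x) auto
    finally show "ennreal (\<bar>f x - limit x\<bar> powr p) \<le> ennreal (2 powr p) * (ennreal (s powr p) + ennreal (\<bar>limit x - approx 0 x\<bar> powr p))"
      by (simp add: ennreal_mult'[symmetric] ennreal_plus[symmetric] ennreal_leI del: ennreal_plus)
  qed
  also have "\<dots> = ennreal (2 powr p) * (ennreal (s powr p) * ennreal carpet_mass + Lp_powr p carpet_measure (\<lambda>x. limit x - approx 0 x))"
    by (simp add: nn_integral_cmult nn_integral_add carpet_measure.emeasure_eq_measure)
  also have "\<dots> \<le> ennreal (2 powr p) * (ennreal (s powr p) * ennreal carpet_mass + ennreal (c1 * Zmass))"
    by (intro mult_left_mono add_mono limit_distance) auto
  also have "\<dots> = ennreal (2 powr p * (s powr p * carpet_mass + c1 * Zmass))"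
    using c1_nonneg Zmass_nonneg carpet_mass_pos by (simp add: ennreal_mult[symmetric] ennreal_plus[symmetric] del: ennreal_plus)
  also have "\<dots> \<le> ennreal (s powr p * G)"
  proof (rule ennreal_leI)
    have "c1 * Zmass \<le> c1 * (carpet_mass / (1 - c * lam) * s powr p)" by (intro mult_left_mono Zm c1_nonneg)
    then have "2 powr p * (s powr p * carpet_mass + c1 * Zmass) \<le> 2 powr p * (s powr p * carpet_mass + c1 * (carpet_mass / (1 - c * lam) * s powr p))"
      by (rule mult_left_mono[OF add_left_mono]) simp
    also have "\<dots> = s powr p * G" by (simp add: G_def c1_def algebra_simps)
    finally show "2 powr p * (s powr p * carpet_mass + c1 * Zmass) \<le> s powr p * G" .
  qed
  also have "\<dots> < ennreal \<epsilon>" using n(1) \<epsilon> by (simp add: s_def ennreal_lessI)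
  finally have dist: "Lp_powr p carpet_measure (\<lambda>x. f x - limit x) < ennreal \<epsilon>" .
  show thesis
  proof (rule that[of limit])
    show "limit x = 0" if x: "x \<in> carpet" "dist o' x < \<delta> / 2" for x
    proof (rule limit_zero[OF x(1)])
      fix q z assume "q \<in> cells n" "x \<in> cell_set n q" "z \<in> corners q"
      then have "dist x (pos z) \<le> 2 / 3 ^ n" by (intro cell_set_dist pos_mem)
      then have "dist o' (pos z) < \<delta>"
        using dist_triangle[of o' "pos z" x] x(2) n(2) by (simp add: power_one_over)
      then show "a0 z = 0" unfolding a0_def by (rule f(3))
    qed
    show "riesz_energy p t carpet_measure limit < \<infinity>"
      using limit_energy_finite[OF t0] ratio unfolding eqs by blast
  qed (use dist abs_limit_le in auto)
qed

section \<open>Density of Lipschitz functions\<close>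

text \<open>The approximants vanish near \<open>z\<close>, which will be the gluing point: this is
  what keeps the cross energy between the copies finite.\<close>

definition Lipschitz_closure :: "real \<Rightarrow> 'a::metric_space \<Rightarrow> 'a measure \<Rightarrow> ('a \<Rightarrow> real) \<Rightarrow> bool" where
  "Lipschitz_closure p z \<nu> f \<longleftrightarrow> (\<forall>\<epsilon>>0. \<exists>g L B \<delta>. 0 < \<delta> \<and> (\<forall>x y. \<bar>g x - g y\<bar> \<le> L * dist x y) \<and> (\<forall>x. \<bar>g x\<bar> \<le> B) \<and>
     (\<forall>x. dist z x < \<delta> \<longrightarrow> g x = 0) \<and> Lp_powr p \<nu> (\<lambda>x. f x - g x) < ennreal \<epsilon>)"

lemma Lipschitz_borel_measurable:
  fixes g :: "'a::metric_space \<Rightarrow> real"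
  assumes "\<And>x y. \<bar>g x - g y\<bar> \<le> L * dist x y"
  shows "g \<in> borel_measurable borel"
proof (rule borel_measurable_continuous_onI, rule continuous_onI)
  fix x :: 'a and e :: real assume e: "0 < e"
  have "dist (g y) (g x) \<le> e" if "dist y x < e / (\<bar>L\<bar> + 1)" for y
  proof -
    have "dist (g y) (g x) \<le> L * dist y x" using assms[of y x] by (simp add: dist_real_def)
    also have "\<dots> \<le> (\<bar>L\<bar> + 1) * (e / (\<bar>L\<bar> + 1))" using that e by (intro mult_mono) auto
    finally show ?thesis by simp
  qed
  then show "\<exists>d>0. \<forall>x'\<in>UNIV. dist x' x < d \<longrightarrow> dist (g x') (g x) \<le> e"
    using e by (intro exI[of _ "e / (\<bar>L\<bar> + 1)"]) (auto intro!: divide_pos_pos)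
qed

lemma Lp_distance_triangle:
  assumes [measurable]: "f \<in> borel_measurable \<nu>" "h \<in> borel_measurable \<nu>" "g \<in> borel_measurable \<nu>" and p: "0 \<le> (p::real)"
    and 1: "Lp_powr p \<nu> (\<lambda>x. f x - h x) < ennreal \<epsilon>1" "0 < \<epsilon>1"
    and 2: "Lp_powr p \<nu> (\<lambda>x. h x - g x) < ennreal \<epsilon>2" "0 < \<epsilon>2"
  shows "Lp_powr p \<nu> (\<lambda>x. f x - g x :: real) < ennreal (2 powr p * (\<epsilon>1 + \<epsilon>2))"
proof -
  have "Lp_powr p \<nu> (\<lambda>x. f x - g x)
     \<le> (\<integral>\<^sup>+x. ennreal (2 powr p) * (ennreal (\<bar>f x - h x\<bar> powr p) + ennreal (\<bar>h x - g x\<bar> powr p)) \<partial>\<nu>)"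
  proof (rule nn_integral_mono)
    fix x
    have "\<bar>(f x - h x) + (h x - g x)\<bar> powr p \<le> 2 powr p * (\<bar>f x - h x\<bar> powr p + \<bar>h x - g x\<bar> powr p)"
      by (rule abs_powr_add_le[OF p])
    then have "\<bar>f x - g x\<bar> powr p \<le> 2 powr p * (\<bar>f x - h x\<bar> powr p + \<bar>h x - g x\<bar> powr p)" by simp
    then show "ennreal (\<bar>f x - g x\<bar> powr p) \<le> ennreal (2 powr p) * (ennreal (\<bar>f x - h x\<bar> powr p) + ennreal (\<bar>h x - g x\<bar> powr p))"
      by (simp add: ennreal_mult'[symmetric] ennreal_plus[symmetric] ennreal_leI del: ennreal_plus)
  qed
  also have "\<dots> = ennreal (2 powr p) * (Lp_powr p \<nu> (\<lambda>x. f x - h x) + Lp_powr p \<nu> (\<lambda>x. h x - g x))"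
    by (simp add: nn_integral_cmult nn_integral_add)
  also have "\<dots> < ennreal (2 powr p) * (ennreal \<epsilon>1 + ennreal \<epsilon>2)"
    by (intro ennreal_mult_strict_left_mono add_strict_mono 1 2) auto
  also have "\<dots> = ennreal (2 powr p * (\<epsilon>1 + \<epsilon>2))"
    using 1 2 by (simp add: ennreal_mult'[symmetric] ennreal_plus[symmetric] del: ennreal_plus)
  finally show ?thesis .
qed

context
  fixes p :: real and z :: "'a::{second_countable_topology, complete_space}" and \<nu> :: "'a measure"
  assumes p: "0 < p" and \<nu>: "finite_measure \<nu>" "sets \<nu> = sets borel" and z: "emeasure \<nu> {z} = 0"
begin

interpretation finite_measure \<nu> by (rule \<nu>)

lemma borel_\<nu>: "f \<in> borel_measurable borel \<Longrightarrow> f \<in> borel_measurable \<nu>"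
  using \<nu>(2) by (simp cong: measurable_cong_sets)

text \<open>Closedness of the class under approximation in p-th mean. It reduces general functions
  to simple ones, and Borel sets to compact ones.\<close>

lemma Lipschitz_closure_approx:
  assumes f: "f \<in> borel_measurable borel"
    and apx: "\<And>\<epsilon>. 0 < \<epsilon> \<Longrightarrow> \<exists>h. h \<in> borel_measurable borel \<and> Lipschitz_closure p z \<nu> h \<and> Lp_powr p \<nu> (\<lambda>x. f x - h x) < ennreal \<epsilon>"
  shows "Lipschitz_closure p z \<nu> f"
  unfolding Lipschitz_closure_def
proof (intro allI impI)
  fix \<epsilon> :: real assume \<epsilon>: "0 < \<epsilon>"
  define \<eta> where "\<eta> = \<epsilon> / (2 * 2 powr p)"
  have \<eta>: "0 < \<eta>" "2 powr p * (\<eta> + \<eta>) = \<epsilon>" using \<epsilon> by (auto simp: \<eta>_def)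
  obtain h where h: "h \<in> borel_measurable borel" "Lipschitz_closure p z \<nu> h" "Lp_powr p \<nu> (\<lambda>x. f x - h x) < ennreal \<eta>"
    using apx[OF \<eta>(1)] by blast
  obtain g L B \<delta> where g: "0 < \<delta>" "\<forall>x y. \<bar>g x - g y\<bar> \<le> L * dist x y" "\<forall>x. \<bar>g x\<bar> \<le> B"
     "\<forall>x. dist z x < \<delta> \<longrightarrow> g x = 0" "Lp_powr p \<nu> (\<lambda>x. h x - g x) < ennreal \<eta>"
    using h(2) \<eta>(1) unfolding Lipschitz_closure_def by meson
  have "g \<in> borel_measurable borel" using g(2) Lipschitz_borel_measurable by blast
  then have "Lp_powr p \<nu> (\<lambda>x. f x - g x) < ennreal (2 powr p * (\<eta> + \<eta>))"
    using p by (intro Lp_distance_triangle[of _ _ h] borel_\<nu> f h g \<eta>) auto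
  then show "\<exists>g L B \<delta>. 0 < \<delta> \<and> (\<forall>x y. \<bar>g x - g y\<bar> \<le> L * dist x y) \<and> (\<forall>x. \<bar>g x\<bar> \<le> B) \<and>
     (\<forall>x. dist z x < \<delta> \<longrightarrow> g x = 0) \<and> Lp_powr p \<nu> (\<lambda>x. f x - g x) < ennreal \<epsilon>"
    using g unfolding \<eta>(2) by blast
qed

lemma Lipschitz_closure_add:
  assumes f: "f \<in> borel_measurable borel" "Lipschitz_closure p z \<nu> f"
    and h: "h \<in> borel_measurable borel" "Lipschitz_closure p z \<nu> h"
  shows "Lipschitz_closure p z \<nu> (\<lambda>x. f x + h x)"
  unfolding Lipschitz_closure_def
proof (intro allI impI)
  fix \<epsilon> :: real assume \<epsilon>: "0 < \<epsilon>"
  define \<eta> where "\<eta> = \<epsilon> / (2 * 2 powr p)"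
  have \<eta>: "0 < \<eta>" "2 powr p * (\<eta> + \<eta>) = \<epsilon>" using \<epsilon> by (auto simp: \<eta>_def)
  obtain g L B \<delta> where g: "0 < \<delta>" "\<forall>x y. \<bar>g x - g y\<bar> \<le> L * dist x y" "\<forall>x. \<bar>g x\<bar> \<le> B"
     "\<forall>x. dist z x < \<delta> \<longrightarrow> g x = 0" "Lp_powr p \<nu> (\<lambda>x. f x - g x) < ennreal \<eta>"
    using f(2) \<eta>(1) unfolding Lipschitz_closure_def by meson
  obtain g' L' B' \<delta>' where g': "0 < \<delta>'" "\<forall>x y. \<bar>g' x - g' y\<bar> \<le> L' * dist x y" "\<forall>x. \<bar>g' x\<bar> \<le> B'"
     "\<forall>x. dist z x < \<delta>' \<longrightarrow> g' x = 0" "Lp_powr p \<nu> (\<lambda>x. h x - g' x) < ennreal \<eta>"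
    using h(2) \<eta>(1) unfolding Lipschitz_closure_def by meson
  have gm: "g \<in> borel_measurable borel" "g' \<in> borel_measurable borel"
    using g(2) g'(2) Lipschitz_borel_measurable by blast+
  have "Lp_powr p \<nu> (\<lambda>x. (f x + h x) - (g x + g' x)) < ennreal (2 powr p * (\<eta> + \<eta>))"
  proof (rule Lp_distance_triangle[of _ _ "\<lambda>x. g x + h x"])
    show "(\<lambda>x. f x + h x) \<in> borel_measurable \<nu>" "(\<lambda>x. g x + h x) \<in> borel_measurable \<nu>" "(\<lambda>x. g x + g' x) \<in> borel_measurable \<nu>"
      using f(1) h(1) gm by (intro borel_\<nu> borel_measurable_add; simp)+
  qed (use p g(5) g'(5) \<eta> in auto)
  moreover have "\<bar>(g x + g' x) - (g y + g' y)\<bar> \<le> (L + L') * dist x y" for x y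
  proof -
    have "\<bar>g x - g y\<bar> \<le> L * dist x y" "\<bar>g' x - g' y\<bar> \<le> L' * dist x y" using g g' by auto
    then show ?thesis unfolding distrib_right by linarith
  qed
  moreover have "\<bar>g x + g' x\<bar> \<le> B + B'" for x using g(3) g'(3) abs_triangle_ineq[of "g x" "g' x"] by (meson add_mono order_trans)
  ultimately show "\<exists>g L B \<delta>. 0 < \<delta> \<and> (\<forall>x y. \<bar>g x - g y\<bar> \<le> L * dist x y) \<and> (\<forall>x. \<bar>g x\<bar> \<le> B) \<and>
     (\<forall>x. dist z x < \<delta> \<longrightarrow> g x = 0) \<and> Lp_powr p \<nu> (\<lambda>x. f x + h x - g x) < ennreal \<epsilon>"
    using g g' unfolding \<eta>(2)
    by (intro exI[of _ "\<lambda>x. g x + g' x"] exI[of _ "L + L'"] exI[of _ "B + B'"] exI[of _ "min \<delta> \<delta>'"]) auto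
qed

lemma Lipschitz_closure_scale:
  assumes f: "f \<in> borel_measurable borel" "Lipschitz_closure p z \<nu> f"
  shows "Lipschitz_closure p z \<nu> (\<lambda>x. c * f x)"
  unfolding Lipschitz_closure_def
proof (intro allI impI)
  fix \<epsilon> :: real assume \<epsilon>: "0 < \<epsilon>"
  define \<eta> where "\<eta> = \<epsilon> / (\<bar>c\<bar> powr p + 1)"
  have pos: "0 < \<bar>c\<bar> powr p + 1" by (rule add_nonneg_pos) auto
  have \<eta>: "0 < \<eta>" using \<epsilon> pos by (simp add: \<eta>_def)
  obtain g L B \<delta> where g: "0 < \<delta>" "\<forall>x y. \<bar>g x - g y\<bar> \<le> L * dist x y" "\<forall>x. \<bar>g x\<bar> \<le> B"
     "\<forall>x. dist z x < \<delta> \<longrightarrow> g x = 0" "Lp_powr p \<nu> (\<lambda>x. f x - g x) < ennreal \<eta>"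
    using f(2) \<eta>(1) unfolding Lipschitz_closure_def by meson
  have [measurable]: "g \<in> borel_measurable \<nu>" "f \<in> borel_measurable \<nu>"
    using g(2) Lipschitz_borel_measurable f by (blast intro: borel_\<nu>)+
  have "Lp_powr p \<nu> (\<lambda>x. c * f x - c * g x) = ennreal (\<bar>c\<bar> powr p) * Lp_powr p \<nu> (\<lambda>x. f x - g x)"
    by (subst nn_integral_cmult[symmetric]) (auto simp: abs_mult powr_mult ennreal_mult simp flip: right_diff_distrib)
  also have "\<dots> \<le> ennreal (\<bar>c\<bar> powr p) * ennreal \<eta>" using g(5) by (intro mult_left_mono) auto
  also have "\<dots> = ennreal (\<bar>c\<bar> powr p * \<eta>)" using \<eta> by (simp add: ennreal_mult)
  also have "\<dots> < ennreal \<epsilon>"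
    using pos \<epsilon> by (intro ennreal_lessI) (auto simp: \<eta>_def field_simps)
  finally have "Lp_powr p \<nu> (\<lambda>x. c * f x - c * g x) < ennreal \<epsilon>" .
  moreover have "\<bar>c * g x - c * g y\<bar> \<le> (\<bar>c\<bar> * L) * dist x y" for x y
    using g(2) by (simp add: abs_mult mult_left_mono mult.assoc flip: right_diff_distrib)
  moreover have "\<bar>c * g x\<bar> \<le> \<bar>c\<bar> * B" for x using g(3) by (simp add: abs_mult mult_left_mono)
  ultimately show "\<exists>g L B \<delta>. 0 < \<delta> \<and> (\<forall>x y. \<bar>g x - g y\<bar> \<le> L * dist x y) \<and> (\<forall>x. \<bar>g x\<bar> \<le> B) \<and>
     (\<forall>x. dist z x < \<delta> \<longrightarrow> g x = 0) \<and> Lp_powr p \<nu> (\<lambda>x. c * f x - g x) < ennreal \<epsilon>"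
    using g by (intro exI[of _ "\<lambda>x. c * g x"] exI[of _ "\<bar>c\<bar> * L"] exI[of _ "\<bar>c\<bar> * B"] exI[of _ \<delta>]) auto
qed

lemma Lipschitz_closure_zero: "Lipschitz_closure p z \<nu> (\<lambda>x. 0)"
  unfolding Lipschitz_closure_def using p
  by (intro allI impI exI[of _ "\<lambda>x. 0"] exI[of _ 0] exI[of _ 1]) auto

text \<open>The functions \<open>max 0 (1 - k * infdist x C)\<close> decrease to the indicator of
  \<open>C\<close>, and they vanish at distance more than \<open>1 / k\<close> from
  \<open>C\<close>, hence near \<open>z\<close> once \<open>k\<close> is large.\<close>

lemma Lipschitz_closure_indicator_compact:
  assumes C: "compact C" and \<delta>: "0 < \<delta>" "\<And>y. y \<in> C \<Longrightarrow> \<delta> \<le> dist z y"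
  shows "Lipschitz_closure p z \<nu> (indicator C)"
proof (cases "C = {}")
  case False
  have closed: "closed C" using C by (rule compact_imp_closed)
  define g where "g k x = max 0 (1 - real k * infdist x C)" for k x
  have Lip: "\<bar>g k x - g k y\<bar> \<le> real k * dist x y" for k x y
  proof -
    have "\<bar>infdist x C - infdist y C\<bar> \<le> dist x y" by (rule infdist_triangle_abs)
    then have "real k * \<bar>infdist x C - infdist y C\<bar> \<le> real k * dist x y" by (rule mult_left_mono) simp
    moreover have "\<bar>g k x - g k y\<bar> \<le> \<bar>real k * infdist x C - real k * infdist y C\<bar>" by (auto simp: g_def)
    ultimately show ?thesis by (simp add: abs_mult flip: right_diff_distrib)
  qed
  have g01: "0 \<le> g k x" "g k x \<le> 1" for k x using infdist_nonneg[of x C] by (auto simp: g_def)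
  have [measurable]: "g k \<in> borel_measurable \<nu>" for k by (intro borel_\<nu> Lipschitz_borel_measurable[OF Lip])
  have [measurable]: "C \<in> sets \<nu>" using closed \<nu> by simp
  have lim: "(\<lambda>k. \<integral>\<^sup>+x. ennreal (\<bar>indicator C x - g k x\<bar> powr p) \<partial>\<nu>) \<longlonglongrightarrow> (\<integral>\<^sup>+x. 0 \<partial>\<nu>)"
  proof (rule nn_integral_dominated_convergence[where w = "\<lambda>x. 1"])
    show "AE x in \<nu>. ennreal (\<bar>indicator C x - g k x\<bar> powr p) \<le> 1" for k
    proof (rule AE_I2)
      fix x
      have "\<bar>indicator C x - g k x\<bar> \<le> 1" using g01[of k x] by (auto simp: indicator_def)
      then have "\<bar>indicator C x - g k x\<bar> powr p \<le> 1 powr p" using p by (intro powr_mono_abs) auto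
      then show "ennreal (\<bar>indicator C x - g k x\<bar> powr p) \<le> 1" by simp
    qed
    show "AE x in \<nu>. (\<lambda>k. ennreal (\<bar>indicator C x - g k x\<bar> powr p)) \<longlonglongrightarrow> 0"
    proof (rule AE_I2)
      fix x
      have "\<forall>\<^sub>F k in sequentially. ennreal (\<bar>indicator C x - g k x\<bar> powr p) = 0"
      proof (cases "x \<in> C")
        case True
        then show ?thesis using p by (auto simp: g_def)
      next
        case x: False
        have d: "0 < infdist x C" using in_closed_iff_infdist_zero[OF closed False, of x] x infdist_nonneg[of x C] by auto
        obtain k0 where k0: "1 / infdist x C < real k0" using reals_Archimedean2 by blast
        show ?thesis
        proof (rule eventually_sequentiallyI[of k0])
          fix k assume "k0 \<le> k"
          then have "1 / infdist x C < real k" using k0 by linarith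
          then have "1 < real k * infdist x C" using d by (simp add: field_simps)
          then show "ennreal (\<bar>indicator C x - g k x\<bar> powr p) = 0" using x p by (simp add: g_def)
        qed
      qed
      then show "(\<lambda>k. ennreal (\<bar>indicator C x - g k x\<bar> powr p)) \<longlonglongrightarrow> 0"
        by (rule tendsto_eventually)
    qed
    show "(\<integral>\<^sup>+x. 1 \<partial>\<nu>) < \<infinity>" by (simp add: emeasure_eq_measure)
  qed auto
  show ?thesis
    unfolding Lipschitz_closure_def
  proof (intro allI impI)
    fix \<epsilon> :: real assume "0 < \<epsilon>"
    then have "\<forall>\<^sub>F k in sequentially. Lp_powr p \<nu> (\<lambda>x. indicator C x - g k x) < ennreal \<epsilon>"
      using order_tendstoD(2)[OF lim] by simp
    moreover obtain k0 where "2 / \<delta> < real k0" using reals_Archimedean2 by blast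
    ultimately obtain k where k: "k0 \<le> k" "Lp_powr p \<nu> (\<lambda>x. indicator C x - g k x) < ennreal \<epsilon>"
      using eventually_happens[OF eventually_conj[OF eventually_ge_at_top[of k0]]] by auto
    have k2: "1 < real k * (\<delta> / 2)"
    proof -
      have "2 / \<delta> < real k" using \<open>2 / \<delta> < real k0\<close> k by linarith
      then show ?thesis using \<delta> by (simp add: field_simps)
    qed
    have "g k x = 0" if x: "dist z x < \<delta> / 2" for x
    proof -
      have "\<delta> / 2 \<le> infdist x C"
        unfolding infdist_notempty[OF False]
      proof (rule cINF_greatest[OF False])
        fix y assume "y \<in> C"
        then show "\<delta> / 2 \<le> dist x y" using \<delta>(2)[of y] x dist_triangle[of z y x] by simp
      qed
      then have "real k * (\<delta> / 2) \<le> real k * infdist x C" by (intro mult_left_mono) auto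
      then show ?thesis using k2 by (simp add: g_def)
    qed
    then show "\<exists>g L B \<delta>. 0 < \<delta> \<and> (\<forall>x y. \<bar>g x - g y\<bar> \<le> L * dist x y) \<and> (\<forall>x. \<bar>g x\<bar> \<le> B) \<and>
       (\<forall>x. dist z x < \<delta> \<longrightarrow> g x = 0) \<and> Lp_powr p \<nu> (\<lambda>x. indicator C x - g x) < ennreal \<epsilon>"
      using k(2) Lip[of k] g01[of k] \<delta>
      by (intro exI[of _ "g k"] exI[of _ "real k"] exI[of _ 1] exI[of _ "\<delta> / 2"]) auto
  qed
next
  case True
  have "indicator C = (\<lambda>x. 0 :: real)" using True by auto
  then show ?thesis using Lipschitz_closure_zero by simp
qed

text \<open>As \<open>{z}\<close> is a null set, a small ball around \<open>z\<close> can be removed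
  first; inner regularity then provides a compact set at positive distance from
  \<open>z\<close>.\<close>

lemma Lipschitz_closure_indicator:
  assumes E: "E \<in> sets borel"
  shows "Lipschitz_closure p z \<nu> (indicator E)"
proof (rule Lipschitz_closure_approx)
  show "indicator E \<in> borel_measurable borel" using E by simp
  fix \<epsilon> :: real assume \<epsilon>: "0 < \<epsilon>"
  define Bk where "Bk k = ball z (1 / real (Suc k))" for k
  have Bk_sets [measurable]: "Bk k \<in> sets \<nu>" for k by (simp add: Bk_def \<nu>)
  have "(\<lambda>k. measure \<nu> (Bk k)) \<longlonglongrightarrow> measure \<nu> (\<Inter>k. Bk k)"
  proof (rule finite_Lim_measure_decseq)
    show "decseq Bk"
      by (auto simp: decseq_def Bk_def divide_left_mono intro: order.strict_trans2 elim!: less_le_trans intro!: divide_left_mono)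
  qed auto
  also have "(\<Inter>k. Bk k) = {z}"
  proof
    show "(\<Inter>k. Bk k) \<subseteq> {z}"
    proof
      fix x assume x: "x \<in> (\<Inter>k. Bk k)"
      have "dist z x = 0"
      proof (rule ccontr)
        assume "dist z x \<noteq> 0"
        then have "0 < dist z x" by simp
        then obtain k where "1 / real (Suc k) < dist z x" using nat_approx_posE by metis
        then show False using x by (auto simp: Bk_def dest!: spec[of _ k])
      qed
      then show "x \<in> {z}" by simp
    qed
  qed (auto simp: Bk_def)
  also have "measure \<nu> {z} = 0" using z by (simp add: measure_def)
  finally have "\<forall>\<^sub>F k in sequentially. measure \<nu> (Bk k) < \<epsilon> / 2" using \<epsilon> by (intro order_tendstoD) auto
  then obtain k where k: "measure \<nu> (Bk k) < \<epsilon> / 2" by (auto dest!: eventually_happens)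
  define E' where "E' = E - Bk k"
  have E': "E' \<in> sets borel" using E by (auto simp: E'_def Bk_def)
  have "measure \<nu> E' - \<epsilon> / 2 < measure \<nu> E'" using \<epsilon> by simp
  have "\<exists>C. C \<subseteq> E' \<and> compact C \<and> emeasure \<nu> E' < emeasure \<nu> C + ennreal (\<epsilon> / 2)"
  proof (cases "emeasure \<nu> E' = 0")
    case True
    then show ?thesis using \<epsilon> by (intro exI[of _ "{}"]) simp
  next
    case False
    have "emeasure \<nu> E' = (SUP C\<in>{C. C \<subseteq> E' \<and> compact C}. emeasure \<nu> C)"
      using inner_regular[of \<nu> E'] \<nu> E' by (simp add: emeasure_eq_measure)
    moreover have "emeasure \<nu> E' - ennreal (\<epsilon> / 2) < emeasure \<nu> E'"
      using False \<epsilon> by (intro ennreal_between) (auto simp: emeasure_eq_measure zero_less_iff_neq_zero)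
    ultimately obtain C where "C \<subseteq> E'" "compact C" "emeasure \<nu> E' - ennreal (\<epsilon> / 2) < emeasure \<nu> C"
      by (auto simp: less_SUP_iff)
    moreover from this(3) have "emeasure \<nu> E' < emeasure \<nu> C + ennreal (\<epsilon> / 2)"
    proof -
      assume "emeasure \<nu> E' - ennreal (\<epsilon> / 2) < emeasure \<nu> C"
      then have "ennreal (measure \<nu> E' - \<epsilon> / 2) < ennreal (measure \<nu> C)"
        using \<epsilon> by (simp add: emeasure_eq_measure ennreal_minus)
      then have "measure \<nu> E' - \<epsilon> / 2 < measure \<nu> C" by (meson ennreal_leI not_less)
      then show ?thesis
        using \<epsilon> by (simp add: emeasure_eq_measure ennreal_less_iff ennreal_plus[symmetric] del: ennreal_plus)
    qed
    ultimately show ?thesis by blast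
  qed
  then obtain C where C: "C \<subseteq> E'" "compact C" "emeasure \<nu> E' < emeasure \<nu> C + ennreal (\<epsilon> / 2)" by blast
  have Cb: "C \<in> sets borel" using C by (simp add: compact_imp_closed)
  have mC: "measure \<nu> E' < measure \<nu> C + \<epsilon> / 2"
    using C(3) \<epsilon> by (simp add: emeasure_eq_measure ennreal_plus[symmetric] ennreal_less_iff del: ennreal_plus)
  have sets_E: "E \<in> sets \<nu>" "E' \<in> sets \<nu>" "C \<in> sets \<nu>" unfolding \<nu>(2) using E E' Cb by auto
  have "Lipschitz_closure p z \<nu> (indicator C)"
  proof (rule Lipschitz_closure_indicator_compact[OF C(2)])
    show "0 < 1 / real (Suc k)" by simp
    show "1 / real (Suc k) \<le> dist z y" if "y \<in> C" for y using that C(1) by (auto simp: E'_def Bk_def not_less)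
  qed
  moreover have "Lp_powr p \<nu> (\<lambda>x. indicator E x - indicator C x) < ennreal \<epsilon>"
  proof -
    have "Lp_powr p \<nu> (\<lambda>x. indicator E x - indicator C x) = (\<integral>\<^sup>+x. indicator (E - C) x \<partial>\<nu>)"
      using C(1) p by (intro nn_integral_cong) (auto simp: indicator_def E'_def)
    also have "\<dots> = ennreal (measure \<nu> (E - C))"
      using sets_E by (simp add: emeasure_eq_measure)
    also have "\<dots> < ennreal \<epsilon>"
    proof (rule ennreal_lessI)
      have "measure \<nu> (E - C) \<le> measure \<nu> (Bk k \<union> (E' - C))"
        using sets_E by (intro finite_measure_mono) (auto simp: E'_def)
      also have "\<dots> \<le> measure \<nu> (Bk k) + measure \<nu> (E' - C)"
        using sets_E by (intro measure_subadditive) (auto simp: emeasure_eq_measure)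
      also have "measure \<nu> (E' - C) = measure \<nu> E' - measure \<nu> C"
        using sets_E C by (intro finite_measure_Diff) auto
      finally show "measure \<nu> (E - C) < \<epsilon>" using k mC by linarith
    qed (rule \<epsilon>)
    finally show ?thesis .
  qed
  ultimately show "\<exists>h. h \<in> borel_measurable borel \<and> Lipschitz_closure p z \<nu> h \<and> Lp_powr p \<nu> (\<lambda>x. indicator E x - h x) < ennreal \<epsilon>"
    using Cb by (intro exI[of _ "indicator C"]) auto
qed

text \<open>Simple functions bounded by \<open>2 * \<bar>f x\<bar>\<close> approximate
  \<open>f\<close> by dominated convergence, and they are finite combinations of indicators.\<close>

lemma Lipschitz_closure_Lp:
  assumes f: "f \<in> borel_measurable borel" "Lp_powr p \<nu> f < \<infinity>"
  shows "Lipschitz_closure p z \<nu> f"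
proof (rule Lipschitz_closure_approx[OF f(1)])
  fix \<epsilon> :: real assume \<epsilon>: "0 < \<epsilon>"
  obtain s where s: "\<And>i. simple_function borel (s i)" "\<And>x. (\<lambda>i. s i x) \<longlonglongrightarrow> f x" "\<And>i x. dist (s i x) 0 \<le> 2 * dist (f x) 0"
    using borel_measurable_implies_sequence_metric[OF f(1), of 0] by auto
  have sm: "s i \<in> borel_measurable borel" for i using s(1) by (rule borel_measurable_simple_function)
  note [measurable] = borel_\<nu>[OF sm] borel_\<nu>[OF f(1)]
  have clos: "Lipschitz_closure p z \<nu> (s i)" for i
  proof -
    have fin: "finite (range (s i))" using simple_functionD(1)[OF s(1)[of i]] by simp
    have "s i = (\<lambda>x. \<Sum>y\<in>range (s i). y * indicator (s i -` {y}) x)"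
    proof
      fix x
      have "(\<Sum>y\<in>range (s i). y * indicator (s i -` {y}) x) = (\<Sum>y\<in>{s i x}. y * indicator (s i -` {y}) x)"
        using fin by (intro sum.mono_neutral_right) (auto simp: indicator_def)
      then show "s i x = (\<Sum>y\<in>range (s i). y * indicator (s i -` {y}) x)" by simp
    qed
    moreover have "Lipschitz_closure p z \<nu> (\<lambda>x. \<Sum>y\<in>Y. y * indicator (s i -` {y}) x)" if "finite Y" for Y
      using that
    proof (induction Y)
      case empty
      then show ?case by (simp add: Lipschitz_closure_zero)
    next
      case (insert y Y)
      have b: "s i -` {w} \<in> sets borel" for w using measurable_sets[OF sm, of "{w}" i] by simp
      have 1: "Lipschitz_closure p z \<nu> (\<lambda>x. y * indicator (s i -` {y}) x)"
        by (intro Lipschitz_closure_scale Lipschitz_closure_indicator borel_measurable_indicator b)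
      have 2: "(\<lambda>x. \<Sum>w\<in>Y. w * indicator (s i -` {w}) x) \<in> borel_measurable borel"
        by (intro borel_measurable_sum borel_measurable_times borel_measurable_indicator b) simp
      have "Lipschitz_closure p z \<nu> (\<lambda>x. y * indicator (s i -` {y}) x + (\<Sum>w\<in>Y. w * indicator (s i -` {w}) x))"
        by (intro Lipschitz_closure_add[OF _ 1 2 insert.IH] borel_measurable_times borel_measurable_indicator b) simp
      then show ?case by (subst sum.insert[OF insert(1,2)])
    qed
    ultimately show ?thesis using fin by metis
  qed
  have "(\<lambda>i. \<integral>\<^sup>+x. ennreal (\<bar>f x - s i x\<bar> powr p) \<partial>\<nu>) \<longlonglongrightarrow> (\<integral>\<^sup>+x. 0 \<partial>\<nu>)"
  proof (rule nn_integral_dominated_convergence[where w = "\<lambda>x. ennreal (3 powr p) * ennreal (\<bar>f x\<bar> powr p)"])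
    show "AE x in \<nu>. ennreal (\<bar>f x - s i x\<bar> powr p) \<le> ennreal (3 powr p) * ennreal (\<bar>f x\<bar> powr p)" for i
    proof (rule AE_I2)
      fix x
      have "\<bar>f x - s i x\<bar> \<le> 3 * \<bar>f x\<bar>" using s(3)[of i x] by (simp add: dist_real_def)
      then have "\<bar>f x - s i x\<bar> powr p \<le> (3 * \<bar>f x\<bar>) powr p" using p by (intro powr_mono_abs) auto
      then show "ennreal (\<bar>f x - s i x\<bar> powr p) \<le> ennreal (3 powr p) * ennreal (\<bar>f x\<bar> powr p)"
        by (simp add: powr_mult ennreal_mult'[symmetric] ennreal_leI)
    qed
    show "AE x in \<nu>. (\<lambda>i. ennreal (\<bar>f x - s i x\<bar> powr p)) \<longlonglongrightarrow> 0"
    proof (rule AE_I2)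
      fix x
      have "(\<lambda>i. \<bar>f x - s i x\<bar>) \<longlonglongrightarrow> \<bar>f x - f x\<bar>" by (intro tendsto_intros s)
      then have "(\<lambda>i. \<bar>f x - s i x\<bar>) \<longlonglongrightarrow> 0" by simp
      then have "(\<lambda>i. \<bar>f x - s i x\<bar> powr p) \<longlonglongrightarrow> 0"
        by (rule tendsto_zero_powrI[OF _ tendsto_const]) (use p in \<open>auto intro: always_eventually\<close>)
      then show "(\<lambda>i. ennreal (\<bar>f x - s i x\<bar> powr p)) \<longlonglongrightarrow> 0" using tendsto_ennrealI by fastforce
    qed
    show "(\<integral>\<^sup>+x. ennreal (3 powr p) * ennreal (\<bar>f x\<bar> powr p) \<partial>\<nu>) < \<infinity>"
      using f(2) by (simp add: nn_integral_cmult ennreal_mult_less_top)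
  qed auto
  then have "\<forall>\<^sub>F i in sequentially. Lp_powr p \<nu> (\<lambda>x. f x - s i x) < ennreal \<epsilon>"
    using \<epsilon> by (intro order_tendstoD) auto
  then obtain i where "Lp_powr p \<nu> (\<lambda>x. f x - s i x) < ennreal \<epsilon>" by (auto dest!: eventually_happens)
  then show "\<exists>h. h \<in> borel_measurable borel \<and> Lipschitz_closure p z \<nu> h \<and> Lp_powr p \<nu> (\<lambda>x. f x - h x) < ennreal \<epsilon>"
    using sm clos by blast
qed

end

section \<open>Two copies of a regular space glued at a point\<close>

text \<open>The common form of both examples. \<open>\<mu>\<close> is the measure of one model copy
  \<open>K\<close>; the isometries \<open>\<phi>\<close> and \<open>\<psi>\<close> place it as the
  two halves and send \<open>base\<close> to the gluing point 0. \<open>nn_M\<close> says that the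
  overlap of the halves is negligible, and \<open>sep\<close> is the geometric content: points of
  different halves are at least as far apart as each of them is from 0. \<open>s\<close> is the
  dimension, and \<open>R\<close> bounds the diameter of \<open>K\<close> as well as the radii in
  \<open>lower\<close>.\<close>

locale glued_space =
  fixes \<mu> M :: "'a::euclidean_space measure" and K :: "'a set" and base :: 'a and \<phi> \<psi> :: "'a \<Rightarrow> 'a"
    and s k1 k2 R :: real
  assumes sets_\<mu>: "sets \<mu> = sets borel" and fin_\<mu>: "finite_measure \<mu>"
    and K: "K \<in> sets borel" and AE_K: "AE x in \<mu>. x \<in> K" and base: "base \<in> K"
    and \<phi>: "\<And>x y. dist (\<phi> x) (\<phi> y) = dist x y" "surj \<phi>" "\<phi> base = 0"
    and \<psi>: "\<And>x y. dist (\<psi> x) (\<psi> y) = dist x y" "surj \<psi>" "\<psi> base = 0"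
    and sep: "\<And>x y. x \<in> K \<Longrightarrow> y \<in> K \<Longrightarrow> dist x base \<le> dist (\<phi> x) (\<psi> y) \<and> dist y base \<le> dist (\<phi> x) (\<psi> y)"
    and space_M: "space M = \<phi> ` K \<union> \<psi> ` K"
    and sets_M: "sets M = sets (restrict_space borel (\<phi> ` K \<union> \<psi> ` K))"
    and nn_M: "\<And>f. f \<in> borel_measurable borel \<Longrightarrow>
      (\<integral>\<^sup>+x. f x \<partial>M) = (\<integral>\<^sup>+x. f (\<phi> x) \<partial>\<mu>) + (\<integral>\<^sup>+x. f (\<psi> x) \<partial>\<mu>)"
    and pos: "0 < s" "0 < k1" "0 < R"
    and upper: "\<And>x r. 0 < r \<Longrightarrow> measure \<mu> (ball x r) \<le> k2 * r powr s"
    and lower: "\<And>x r. x \<in> K \<Longrightarrow> 0 < r \<Longrightarrow> r \<le> R \<Longrightarrow> k1 * r powr s \<le> measure \<mu> (ball x r)"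
    and diam: "\<And>x y. x \<in> K \<Longrightarrow> y \<in> K \<Longrightarrow> dist x y \<le> R"
begin

interpretation \<mu>: finite_measure \<mu> by (rule fin_\<mu>)

interpretation pair: pair_sigma_finite \<mu> \<mu> ..

declare sets_\<mu> [measurable_cong]

lemma space_\<mu>: "space \<mu> = UNIV"
  using sets_eq_imp_space_eq[OF sets_\<mu>] by simp

lemma isometry_borel:
  fixes f :: "'a \<Rightarrow> 'a"
  assumes "\<And>x y. dist (f x) (f y) = dist x y"
  shows "f \<in> borel_measurable borel"
  by (rule borel_measurable_continuous_onI, rule continuous_onI) (use assms in \<open>auto intro: less_imp_le\<close>)

lemma \<phi>_borel [measurable]: "\<phi> \<in> borel_measurable borel" and \<psi>_borel [measurable]: "\<psi> \<in> borel_measurable borel"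
  using isometry_borel \<phi>(1) \<psi>(1) by blast+

lemma isometry_inj:
  fixes f :: "'a \<Rightarrow> 'a"
  assumes "\<And>x y. dist (f x) (f y) = dist x y"
  shows "inj f"
  using assms by (metis dist_eq_0_iff injI)

lemma inv_isometry:
  fixes f :: "'a \<Rightarrow> 'a"
  assumes "\<And>x y. dist (f x) (f y) = dist x y" "surj f"
  shows "dist (inv f x) (inv f y) = dist x y" "f (inv f x) = x" "inv f (f x) = x"
proof -
  show inv: "f (inv f x) = x" for x by (rule surj_f_inv_f[OF assms(2)])
  show "dist (inv f x) (inv f y) = dist x y" using assms(1)[of "inv f x" "inv f y"] by (simp add: inv)
  show "inv f (f x) = x" by (rule inv_f_f[OF isometry_inj[OF assms(1)]])
qed

lemma isometry_image_borel:
  fixes f :: "'a \<Rightarrow> 'a"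
  assumes "\<And>x y. dist (f x) (f y) = dist x y" "surj f" "E \<in> sets borel"
  shows "f ` E \<in> sets borel"
proof -
  have "f ` E = inv f -` E"
  proof (intro set_eqI iffI)
    show "x \<in> inv f -` E" if "x \<in> f ` E" for x using that inv_isometry(3)[OF assms(1,2)] by auto
    show "x \<in> f ` E" if "x \<in> inv f -` E" for x
      by (rule image_eqI[of _ _ "inv f x"]) (use that inv_isometry(2)[OF assms(1,2)] in auto)
  qed
  also have "\<dots> \<in> sets borel"
    using measurable_sets[OF isometry_borel[OF inv_isometry(1)[OF assms(1,2)]] assms(3)] by simp
  finally show ?thesis .
qed

lemma \<phi>K [measurable]: "\<phi> ` K \<in> sets borel" and \<psi>K [measurable]: "\<psi> ` K \<in> sets borel"
  using isometry_image_borel \<phi> \<psi> K by blast+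

text \<open>Lets one-sided facts be proved for \<open>\<phi>\<close> only.\<close>

lemma swapped: "glued_space \<mu> M K base \<psi> \<phi> s k1 k2 R"
proof unfold_locales
  show "dist x base \<le> dist (\<psi> x) (\<phi> y) \<and> dist y base \<le> dist (\<psi> x) (\<phi> y)" if "x \<in> K" "y \<in> K" for x y
    using sep[OF that(2,1)] by (simp add: dist_commute)
qed (use sets_\<mu> fin_\<mu> K AE_K base \<phi> \<psi> space_M sets_M nn_M pos upper lower diam in \<open>auto simp: Un_commute add.commute\<close>)

lemma base_null: "emeasure \<mu> {base} = 0"
proof -
  have "measure \<mu> {base} \<le> k2 * r powr s" if "0 < r" for r
  proof -
    have "measure \<mu> {base} \<le> measure \<mu> (ball base r)"
      using that by (intro \<mu>.finite_measure_mono) (auto simp: sets_\<mu>)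
    then show ?thesis using upper[OF that, of base] by simp
  qed
  then have le: "measure \<mu> {base} \<le> k2 * (1 / real (Suc n)) powr s" for n by simp
  have "(\<lambda>n. 1 / real (Suc n)) \<longlonglongrightarrow> 0" using LIMSEQ_inverse_real_of_nat by (simp add: inverse_eq_divide)
  then have "(\<lambda>n. (1 / real (Suc n)) powr s) \<longlonglongrightarrow> 0"
    by (rule tendsto_zero_powrI[OF _ tendsto_const]) (use pos in \<open>auto intro: always_eventually\<close>)
  then have "(\<lambda>n. k2 * (1 / real (Suc n)) powr s) \<longlonglongrightarrow> 0" by (rule tendsto_mult_right_zero)
  then have "measure \<mu> {base} \<le> 0" by (rule LIMSEQ_le_const) (use le in auto)
  then show ?thesis by (simp add: \<mu>.emeasure_eq_measure measure_le_0_iff)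
qed

lemma AE_not_base: "AE x in \<mu>. x \<noteq> base"
  using base_null by (intro AE_I[of _ _ "{base}"]) (auto simp: sets_\<mu>)

abbreviation mass :: real where "mass \<equiv> measure \<mu> UNIV"

lemma mass_pos: "0 < mass"
proof -
  have "0 < k1 * R powr s" using pos by simp
  also have "\<dots> \<le> measure \<mu> (ball base R)" using lower[OF base, of R] pos by simp
  also have "\<dots> \<le> mass" using \<mu>.bounded_measure[of "ball base R"] by (simp add: space_\<mu>)
  finally show ?thesis .
qed

lemma k2_nonneg: "0 \<le> k2"
  using order_trans[OF measure_nonneg upper[of 1 base]] by simp

section \<open>The Besov energy as a Riesz energy\<close>

lemma finite_M: "finite_measure M"
proof (rule finite_measureI)
  have "emeasure M (space M) = (\<integral>\<^sup>+x. 1 \<partial>M)" by simp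
  also have "\<dots> = emeasure \<mu> UNIV + emeasure \<mu> UNIV" using nn_M[of "\<lambda>x. 1"] by (simp add: space_\<mu>)
  finally show "emeasure M (space M) \<noteq> \<infinity>" by (simp add: \<mu>.emeasure_eq_measure)
qed

interpretation M: finite_measure M by (rule finite_M)

lemma mball_sets: "mball_of M x r \<in> sets M"
proof -
  have "mball_of M x r = ball x r \<inter> (\<phi> ` K \<union> \<psi> ` K)" by (auto simp: mball_of_def space_M)
  then show ?thesis unfolding sets_M by (auto simp: sets_restrict_space Int_commute)
qed

lemma emeasure_mball: "emeasure M (mball_of M x r) = emeasure \<mu> {z. dist x (\<phi> z) < r} + emeasure \<mu> {z. dist x (\<psi> z) < r}"
proof -
  have "emeasure M (mball_of M x r) = (\<integral>\<^sup>+y. indicator (mball_of M x r) y \<partial>M)"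
    using mball_sets by simp
  also have "\<dots> = (\<integral>\<^sup>+y. indicator (ball x r) y \<partial>M)"
    by (intro nn_integral_cong) (auto simp: mball_of_def indicator_def)
  also have "\<dots> = (\<integral>\<^sup>+z. indicator (ball x r) (\<phi> z) \<partial>\<mu>) + (\<integral>\<^sup>+z. indicator (ball x r) (\<psi> z) \<partial>\<mu>)"
    by (rule nn_M[OF borel_measurable_indicator]) simp
  also have "(\<lambda>z. indicator (ball x r) (\<phi> z)) = (indicator {z. dist x (\<phi> z) < r} :: _ \<Rightarrow> ennreal)"
    by (auto simp: indicator_def)
  also have "(\<lambda>z. indicator (ball x r) (\<psi> z)) = (indicator {z. dist x (\<psi> z) < r} :: _ \<Rightarrow> ennreal)"
    by (auto simp: indicator_def)
  finally show ?thesis by simp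
qed

text \<open>By \<open>sep\<close> a ball around a point of one half meets the other half only within
  the same distance of the gluing point. Radii up to \<open>2 * R\<close> are needed, as that bounds
  the diameter of the glued space, but \<open>lower\<close> reaches only to \<open>R\<close>; hence
  the halved radius.\<close>

lemma mball_bounds_\<phi>:
  assumes x: "x \<in> \<phi> ` K" and r: "0 < r"
  shows "measure M (mball_of M x r) \<le> 2 * k2 * r powr s"
    "r \<le> 2 * R \<Longrightarrow> k1 / 2 powr s * r powr s \<le> measure M (mball_of M x r)"
proof -
  obtain a where a: "a \<in> K" "x = \<phi> a" using x by blast
  have 1: "{z. dist x (\<phi> z) < r} = ball a r" by (auto simp: a \<phi>(1))
  have 2: "emeasure \<mu> {z. dist x (\<psi> z) < r} \<le> emeasure \<mu> (ball base r)"
  proof (rule emeasure_mono_AE)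
    show "AE z in \<mu>. z \<in> {z. dist x (\<psi> z) < r} \<longrightarrow> z \<in> ball base r"
      using AE_K by eventually_elim (use sep[OF a(1)] in \<open>force simp: a dist_commute\<close>)
  qed (simp add: sets_\<mu>)
  have M: "ennreal (measure M (mball_of M x r)) = emeasure \<mu> (ball a r) + emeasure \<mu> {z. dist x (\<psi> z) < r}"
    using emeasure_mball[of x r] by (simp add: 1 M.emeasure_eq_measure)
  have "ennreal (measure M (mball_of M x r)) \<le> emeasure \<mu> (ball a r) + emeasure \<mu> (ball base r)"
    unfolding M using 2 by (rule add_left_mono)
  also have "\<dots> \<le> ennreal (k2 * r powr s + k2 * r powr s)"
    using upper[OF r, of a] upper[OF r, of base]
    by (simp add: \<mu>.emeasure_eq_measure ennreal_leI add_mono flip: ennreal_plus)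
  finally show "measure M (mball_of M x r) \<le> 2 * k2 * r powr s" using k2_nonneg by simp
  assume r2: "r \<le> 2 * R"
  have "ennreal (k1 * (r / 2) powr s) \<le> emeasure \<mu> (ball a (r / 2))"
    using lower[OF a(1), of "r / 2"] r r2 by (simp add: \<mu>.emeasure_eq_measure ennreal_leI)
  also have "\<dots> \<le> emeasure \<mu> (ball a r)" using r by (intro emeasure_mono subset_ball) (auto simp: sets_\<mu>)
  also have "\<dots> \<le> ennreal (measure M (mball_of M x r))" unfolding M by simp
  finally show "k1 / 2 powr s * r powr s \<le> measure M (mball_of M x r)"
    by (subst (asm) ennreal_le_iff) (auto simp: powr_divide)
qed

lemma mball_bounds:
  assumes x: "x \<in> space M" and r: "0 < r"
  shows "measure M (mball_of M x r) \<le> 2 * k2 * r powr s"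
    "r \<le> 2 * R \<Longrightarrow> k1 / 2 powr s * r powr s \<le> measure M (mball_of M x r)"
  using mball_bounds_\<phi>[of x r] glued_space.mball_bounds_\<phi>[OF swapped, of x r] x r by (auto simp: space_M)

lemma dist_space_M: "x \<in> space M \<Longrightarrow> y \<in> space M \<Longrightarrow> dist x y \<le> 2 * R"
proof -
  have "dist x 0 \<le> R" if "x \<in> space M" for x
    using that diam base \<phi>(1)[of _ base] \<psi>(1)[of _ base] \<phi>(3) \<psi>(3) by (auto simp: space_M)
  then show "x \<in> space M \<Longrightarrow> y \<in> space M \<Longrightarrow> dist x y \<le> 2 * R"
    using dist_triangle2[of x y 0] by (smt (verit))
qed

text \<open>Extension by 0 to the ambient space, so that composing with \<open>\<phi>\<close> and
  \<open>\<psi>\<close> gives Borel functions on the model.\<close>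

definition extend :: "('a \<Rightarrow> real) \<Rightarrow> 'a \<Rightarrow> real" where
  "extend u x = indicator (\<phi> ` K \<union> \<psi> ` K) x * u x"

lemma extend_borel: "u \<in> borel_measurable M \<Longrightarrow> extend u \<in> borel_measurable borel"
proof -
  assume "u \<in> borel_measurable M"
  then have "u \<in> borel_measurable (restrict_space borel (\<phi> ` K \<union> \<psi> ` K))"
    using measurable_cong_sets[OF sets_M refl] by blast
  then show ?thesis
    unfolding extend_def[abs_def] by (subst (asm) borel_measurable_restrict_space_iff) auto
qed

lemma borel_measurable_M: "u \<in> borel_measurable borel \<Longrightarrow> u \<in> borel_measurable M"
  using measurable_cong_sets[OF sets_M refl, of borel] measurable_restrict_space1[of u borel borel "\<phi> ` K \<union> \<psi> ` K"] by blast

lemma extend_eq: "x \<in> space M \<Longrightarrow> extend u x = u x"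
  by (auto simp: extend_def space_M)

definition cross_energy :: "real \<Rightarrow> real \<Rightarrow> ('a \<Rightarrow> real) \<Rightarrow> ('a \<Rightarrow> real) \<Rightarrow> ennreal" where
  "cross_energy p t u v = nn_integral2 \<mu> (\<lambda>x y. ennreal (\<bar>v y - u x\<bar> powr p * dist (\<phi> x) (\<psi> y) powr (- t)))"

lemma scaled_riesz:
  assumes u: "u \<in> borel_measurable borel" and c: "0 < c"
  shows "nn_integral2 M (\<lambda>x y. ennreal (c * (\<bar>u y - u x\<bar> powr p * dist x y powr (- t))))
    = ennreal c * ((riesz_energy p t \<mu> (\<lambda>x. u (\<phi> x)) + cross_energy p t (\<lambda>x. u (\<phi> x)) (\<lambda>x. u (\<psi> x)))
       + (cross_energy p t (\<lambda>x. u (\<phi> x)) (\<lambda>x. u (\<psi> x)) + riesz_energy p t \<mu> (\<lambda>x. u (\<psi> x))))"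
proof -
  note [measurable] = u
  define F where "F x y = ennreal (c * (\<bar>u y - u x\<bar> powr p * dist x y powr (- t)))" for x y
  define G where "G x y = ennreal (\<bar>u y - u x\<bar> powr p * dist x y powr (- t))" for x y
  have FG: "F x y = ennreal c * G x y" for x y using c by (simp add: F_def G_def ennreal_mult)
  have G_sym: "G x y = G y x" for x y by (simp add: G_def dist_commute abs_minus_commute)
  have Fm [measurable]: "(\<lambda>(x, y). F x y) \<in> borel_measurable (borel \<Otimes>\<^sub>M borel)" unfolding F_def by measurable
  have Gm [measurable]: "(\<lambda>(x, y). G x y) \<in> borel_measurable (borel \<Otimes>\<^sub>M borel)" unfolding G_def by measurable
  have inner: "(\<integral>\<^sup>+y. F x y \<partial>M) = (\<integral>\<^sup>+y. F x (\<phi> y) \<partial>\<mu>) + (\<integral>\<^sup>+y. F x (\<psi> y) \<partial>\<mu>)" for x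
    by (rule nn_M) measurable
  have "nn_integral2 M F = (\<integral>\<^sup>+x. (\<integral>\<^sup>+y. F (\<phi> x) (\<phi> y) \<partial>\<mu>) + (\<integral>\<^sup>+y. F (\<phi> x) (\<psi> y) \<partial>\<mu>) \<partial>\<mu>)
     + (\<integral>\<^sup>+x. (\<integral>\<^sup>+y. F (\<psi> x) (\<phi> y) \<partial>\<mu>) + (\<integral>\<^sup>+y. F (\<psi> x) (\<psi> y) \<partial>\<mu>) \<partial>\<mu>)"
    unfolding inner by (rule nn_M) measurable
  also have "\<dots> = ennreal c * ((nn_integral2 \<mu> (\<lambda>x y. G (\<phi> x) (\<phi> y)) + nn_integral2 \<mu> (\<lambda>x y. G (\<phi> x) (\<psi> y)))
     + (nn_integral2 \<mu> (\<lambda>x y. G (\<psi> x) (\<phi> y)) + nn_integral2 \<mu> (\<lambda>x y. G (\<psi> x) (\<psi> y))))"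
    by (simp add: FG nn_integral_cmult nn_integral_add distrib_left)
  also have "nn_integral2 \<mu> (\<lambda>x y. G (\<psi> x) (\<phi> y)) = nn_integral2 \<mu> (\<lambda>y x. G (\<psi> x) (\<phi> y))"
    by (rule pair.Fubini'[symmetric]) measurable
  also have "\<dots> = nn_integral2 \<mu> (\<lambda>x y. G (\<phi> x) (\<psi> y))" by (simp only: G_sym)
  finally show ?thesis unfolding F_def G_def riesz_energy_def cross_energy_def \<phi>(1) \<psi>(1) .
qed

text \<open>The mass of a ball of radius \<open>r\<close> is comparable to \<open>r powr s\<close>,
  so the Besov integrand lies between two multiples of the Riesz integrand with exponent
  \<open>\<theta> * p + s\<close>; \<open>scaled_riesz\<close> then splits the double integral into
  its four parts.\<close>

lemma besov_energy_finite_iff: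
  assumes u: "u \<in> borel_measurable M" and \<theta>: "0 < \<theta>" and p: "0 < p"
  shows "besov_energy p \<theta> M u < \<infinity> \<longleftrightarrow>
    riesz_energy p (\<theta> * p + s) \<mu> (\<lambda>x. extend u (\<phi> x)) < \<infinity> \<and> riesz_energy p (\<theta> * p + s) \<mu> (\<lambda>x. extend u (\<psi> x)) < \<infinity> \<and>
    cross_energy p (\<theta> * p + s) (\<lambda>x. extend u (\<phi> x)) (\<lambda>x. extend u (\<psi> x)) < \<infinity>"
proof -
  let ?t = "\<theta> * p + s"
  let ?u = "extend u"
  let ?F = "\<lambda>x y. if x = y then 0 else ennreal (\<bar>u y - u x\<bar> powr p)
               / (ennreal (dist x y powr (\<theta> * p)) * emeasure M (mball_of M x (dist x y)))"
  define T where "T = (riesz_energy p ?t \<mu> (\<lambda>x. ?u (\<phi> x)) + cross_energy p ?t (\<lambda>x. ?u (\<phi> x)) (\<lambda>x. ?u (\<psi> x)))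
       + (cross_energy p ?t (\<lambda>x. ?u (\<phi> x)) (\<lambda>x. ?u (\<psi> x)) + riesz_energy p ?t \<mu> (\<lambda>x. ?u (\<psi> x)))"
  define a where "a = 2 powr s / k1"
  \<comment> \<open>\<open>k2 + 1\<close> keeps the denominator positive, since
    \<open>k2_nonneg\<close> gives only \<open>0 \<le> k2\<close>.\<close>
  define b where "b = 1 / (2 * (k2 + 1))"
  have ab: "0 < a" "0 < b" using pos k2_nonneg by (auto simp: a_def b_def)
  have integrand: "?F x y \<le> ennreal (a * (\<bar>?u y - ?u x\<bar> powr p * dist x y powr (- ?t)))"
    "ennreal (b * (\<bar>?u y - ?u x\<bar> powr p * dist x y powr (- ?t)))
      \<le> ?F x y"
    if xy: "x \<in> space M" "y \<in> space M" for x y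
  proof -
    define r where "r = dist x y"
    define m where "m = measure M (mball_of M x r)"
    define v where "v = \<bar>u y - u x\<bar> powr p"
    have v: "0 \<le> v" by (simp add: v_def)
    have *: "v / (r powr (\<theta> * p) * m) \<le> a * (v * r powr (- ?t)) \<and> b * (v * r powr (- ?t)) \<le> v / (r powr (\<theta> * p) * m) \<and> 0 < m"
      if r: "0 < r"
    proof -
      have m: "m \<le> 2 * k2 * r powr s" "k1 / 2 powr s * r powr s \<le> m"
        using mball_bounds[OF xy(1) r] dist_space_M[OF xy] by (auto simp: m_def r_def)
      have "0 < k1 / 2 powr s * r powr s" using pos r by simp
      then have m0: "0 < m" using m(2) by linarith
      have rt: "r powr (- ?t) = 1 / (r powr (\<theta> * p) * r powr s)"
        using r powr_add[of r "\<theta> * p" s] by (simp only: powr_minus_divide)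
      have "v / (r powr (\<theta> * p) * m) \<le> v / (r powr (\<theta> * p) * (k1 / 2 powr s * r powr s))"
        using v r m m0 pos by (intro divide_left_mono mult_left_mono mult_pos_pos) auto
      also have "\<dots> = a * (v * r powr (- ?t))" unfolding rt a_def using pos r by (simp add: field_simps)
      finally have 1: "v / (r powr (\<theta> * p) * m) \<le> a * (v * r powr (- ?t))" .
      have "m \<le> 2 * (k2 + 1) * r powr s"
        using m(1) r by (simp add: algebra_simps) (smt (verit) powr_gt_zero)
      then have "v / (r powr (\<theta> * p) * (2 * (k2 + 1) * r powr s)) \<le> v / (r powr (\<theta> * p) * m)"
        using v r m0 k2_nonneg by (intro divide_left_mono mult_left_mono mult_pos_pos) auto
      also have "v / (r powr (\<theta> * p) * (2 * (k2 + 1) * r powr s)) = b * (v * r powr (- ?t))"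
        unfolding rt b_def using k2_nonneg r by (simp add: field_simps)
      finally show ?thesis using 1 m0 by simp
    qed
    have eq: "ennreal (\<bar>u y - u x\<bar> powr p) / (ennreal (dist x y powr (\<theta> * p)) * emeasure M (mball_of M x (dist x y)))
        = ennreal (v / (r powr (\<theta> * p) * m))" if "x \<noteq> y"
    proof -
      have r: "0 < r" using that by (simp add: r_def)
      show ?thesis using * r
        by (simp add: M.emeasure_eq_measure flip: r_def m_def v_def) (simp add: ennreal_mult[symmetric] divide_ennreal v)
    qed
    have ext: "?u y = u y" "?u x = u x" using xy by (auto simp: extend_eq)
    show "?F x y
      \<le> ennreal (a * (\<bar>?u y - ?u x\<bar> powr p * dist x y powr (- ?t)))"
      using eq * by (auto simp: ext r_def v_def ennreal_leI)
    show "ennreal (b * (\<bar>?u y - ?u x\<bar> powr p * dist x y powr (- ?t)))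
      \<le> ?F x y"
      using eq * p by (auto simp: ext r_def v_def ennreal_leI)
  qed
  have 1: "besov_energy p \<theta> M u \<le> ennreal a * T"
    unfolding besov_energy_def T_def scaled_riesz[OF extend_borel[OF u] ab(1), symmetric]
    by (intro nn_integral_mono integrand)
  have 2: "ennreal b * T \<le> besov_energy p \<theta> M u"
    unfolding besov_energy_def T_def scaled_riesz[OF extend_borel[OF u] ab(2), symmetric]
    by (intro nn_integral_mono integrand)
  have "besov_energy p \<theta> M u < \<infinity> \<longleftrightarrow> T < \<infinity>"
  proof
    assume "besov_energy p \<theta> M u < \<infinity>"
    then have "ennreal b * T < \<infinity>" using 2 by (rule le_less_trans[rotated])
    then show "T < \<infinity>" using ab by (auto simp: ennreal_mult_less_top)
  next
    assume "T < \<infinity>"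
    then have "ennreal a * T < \<infinity>" by (simp add: ennreal_mult_less_top)
    then show "besov_energy p \<theta> M u < \<infinity>" using 1 by (rule le_less_trans[rotated])
  qed
  then show ?thesis by (auto simp: T_def)
qed

section \<open>Integrability and almost everywhere statements on the glued space\<close>

lemma nn_integral_M:
  assumes u: "u \<in> borel_measurable M"
  shows "Lp_powr p M u = Lp_powr p \<mu> (\<lambda>x. extend u (\<phi> x)) + Lp_powr p \<mu> (\<lambda>x. extend u (\<psi> x))"
proof -
  note [measurable] = extend_borel[OF u]
  have "Lp_powr p M u = Lp_powr p M (\<lambda>x. extend u x)"
    by (intro nn_integral_cong) (simp add: extend_eq)
  also have "\<dots> = Lp_powr p \<mu> (\<lambda>x. extend u (\<phi> x)) + Lp_powr p \<mu> (\<lambda>x. extend u (\<psi> x))"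
    by (rule nn_M) measurable
  finally show ?thesis .
qed

lemma Lp_space_iff:
  "u \<in> Lp_space p M \<longleftrightarrow> u \<in> borel_measurable M \<and> Lp_powr p M u < \<infinity>"
proof -
  have "integrable M (\<lambda>x. \<bar>u x\<bar> powr p) \<longleftrightarrow> Lp_powr p M u < \<infinity>" if [measurable]: "u \<in> borel_measurable M"
    by (subst integrable_iff_bounded) simp
  then show ?thesis by (auto simp: Lp_space_def)
qed

lemma bounded_Lp: "u \<in> borel_measurable M \<Longrightarrow> 0 \<le> p \<Longrightarrow> (\<And>x. x \<in> space M \<Longrightarrow> \<bar>u x\<bar> \<le> B) \<Longrightarrow> u \<in> Lp_space p M"
proof -
  assume u: "u \<in> borel_measurable M" "0 \<le> p" "\<And>x. x \<in> space M \<Longrightarrow> \<bar>u x\<bar> \<le> B"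
  have "Lp_powr p M u \<le> (\<integral>\<^sup>+x. ennreal (B powr p) \<partial>M)"
    using u by (intro nn_integral_mono ennreal_leI powr_mono_abs) auto
  also have "\<dots> < \<infinity>" by (simp add: M.emeasure_eq_measure ennreal_mult[symmetric])
  finally show ?thesis using u by (simp add: Lp_space_iff)
qed

lemma Lp_norm_less_iff:
  assumes u: "u \<in> Lp_space p M" and p: "0 < p" and \<epsilon>: "0 < \<epsilon>"
  shows "Lp_norm p M u < \<epsilon> \<longleftrightarrow> Lp_powr p M u < ennreal (\<epsilon> powr p)"
proof -
  define I where "I = (\<integral>x. \<bar>u x\<bar> powr p \<partial>M)"
  have I: "0 \<le> I" by (auto simp: I_def)
  have "Lp_powr p M u = ennreal I"
    unfolding I_def using u by (intro nn_integral_eq_integral) (auto simp: Lp_space_def)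
  moreover have "I powr (1 / p) < \<epsilon> \<longleftrightarrow> I < \<epsilon> powr p"
  proof
    assume "I powr (1 / p) < \<epsilon>"
    then have "(I powr (1 / p)) powr p < \<epsilon> powr p" using p by (intro powr_less_mono2) auto
    then show "I < \<epsilon> powr p" using p I by (simp add: powr_powr)
  next
    assume "I < \<epsilon> powr p"
    then have "I powr (1 / p) < (\<epsilon> powr p) powr (1 / p)" using p I by (intro powr_less_mono2) auto
    then show "I powr (1 / p) < \<epsilon>" using p \<epsilon> by (simp add: powr_powr)
  qed
  ultimately show ?thesis using I by (simp add: Lp_norm_def I_def[symmetric] ennreal_less_iff)
qed

lemma Lp_diff: "u \<in> Lp_space p M \<Longrightarrow> v \<in> Lp_space p M \<Longrightarrow> 0 < p \<Longrightarrow> (\<lambda>x. u x - v x) \<in> Lp_space p M"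
proof -
  assume u: "u \<in> Lp_space p M" and v: "v \<in> Lp_space p M" and p: "0 < p"
  have [measurable]: "u \<in> borel_measurable M" "v \<in> borel_measurable M" using u v by (auto simp: Lp_space_def)
  have "Lp_powr p M (\<lambda>x. u x - v x) \<le> (\<integral>\<^sup>+x. ennreal (2 powr p) * (ennreal (\<bar>u x\<bar> powr p) + ennreal (\<bar>v x\<bar> powr p)) \<partial>M)"
    using p by (intro nn_integral_mono) (simp add: ennreal_mult'[symmetric] ennreal_plus[symmetric] abs_powr_diff_le ennreal_leI del: ennreal_plus)
  also have "\<dots> < \<infinity>" using u v by (simp add: nn_integral_cmult nn_integral_add Lp_space_iff ennreal_mult_less_top)
  finally show ?thesis by (simp add: Lp_space_iff)
qed

lemma AE_M:
  assumes u: "u \<in> borel_measurable M"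
  shows "(AE x in M. u x = c) \<longleftrightarrow> (AE x in \<mu>. extend u (\<phi> x) = c) \<and> (AE x in \<mu>. extend u (\<psi> x) = c)"
proof -
  note [measurable] = extend_borel[OF u] u
  have "(AE x in M. u x = c) \<longleftrightarrow> (\<integral>\<^sup>+x. indicator {x. extend u x \<noteq> c} x \<partial>M) = 0"
  proof -
    have "(\<integral>\<^sup>+x. indicator {x. extend u x \<noteq> c} x \<partial>M) = (\<integral>\<^sup>+x. indicator {x\<in>space M. u x \<noteq> c} x \<partial>M)"
      by (intro nn_integral_cong) (auto simp: indicator_def extend_eq)
    also have "\<dots> = emeasure M {x\<in>space M. u x \<noteq> c}" by (intro nn_integral_indicator) measurable
    finally show ?thesis by (simp add: AE_iff_measurable[of "{x\<in>space M. u x \<noteq> c}"])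
  qed
  also have "(\<integral>\<^sup>+x. indicator {x. extend u x \<noteq> c} x \<partial>M) = (\<integral>\<^sup>+x. indicator {x. extend u x \<noteq> c} (\<phi> x) \<partial>\<mu>) + (\<integral>\<^sup>+x. indicator {x. extend u x \<noteq> c} (\<psi> x) \<partial>\<mu>)"
    by (rule nn_M) measurable
  also have "\<dots> = 0 \<longleftrightarrow> (AE x in \<mu>. extend u (\<phi> x) = c) \<and> (AE x in \<mu>. extend u (\<psi> x) = c)"
    by (simp add: nn_integral_0_iff_AE indicator_eq_0_iff)
  finally show ?thesis .
qed

section \<open>Convergence and divergence of the cross energy\<close>

text \<open>Dyadic balls: up to a constant the k-th one contributes
  \<open>(2 powr (\<tau> - s)) ^ k\<close>, a convergent geometric series for
  \<open>\<tau> < s\<close>.\<close>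

lemma dist_powr_integral:
  assumes x: "x \<in> K" and \<tau>: "0 < \<tau>" "\<tau> < s"
  shows "(\<integral>\<^sup>+y. ennreal (dist x y powr (- \<tau>)) \<partial>\<mu>) \<le> ennreal ((R / 2) powr (- \<tau>) * k2 * (2 * R) powr s / (1 - 2 powr (\<tau> - s)))"
proof -
  define W where "W k = (R / 2 / 2 ^ k) powr (- \<tau>)" for k :: nat
  have W: "0 \<le> W k" for k by (simp add: W_def)
  have pt: "ennreal (dist x y powr (- \<tau>)) \<le> (\<Sum>k. ennreal (W k) * indicator (ball x (2 * R / 2 ^ k)) y)" if y: "y \<in> K" for y
  proof (cases "x = y")
    case False
    define d where "d = dist x y"
    have d: "0 < d" "d \<le> R" using False diam[OF x y] by (auto simp: d_def)
    obtain k0 where "(1 / 2) ^ k0 < d / R" using real_arch_pow_inv[of "d / R" "1 / 2"] d pos by auto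
    then have k0: "R / 2 ^ k0 < d" using pos by (simp add: power_one_over field_simps)
    define k1 where "k1 = (LEAST k. R / 2 ^ k < d)"
    have k1: "R / 2 ^ k1 < d" unfolding k1_def by (rule LeastI[of _ k0]) (rule k0)
    have "k1 \<noteq> 0" using k1 d by (intro notI) simp
    then obtain k where k: "k1 = Suc k" by (cases k1) auto
    have dk: "d \<le> R / 2 ^ k" using not_less_Least[of k "\<lambda>k. R / 2 ^ k < d"] k k1_def by simp
    have "R / 2 ^ k < 2 * R / 2 ^ k" using pos by (intro divide_strict_right_mono) auto
    then have mem: "y \<in> ball x (2 * R / 2 ^ k)" using dk unfolding d_def mem_ball by linarith
    have "d powr (- \<tau>) \<le> W k" unfolding W_def using k1 k d \<tau> pos by (intro powr_mono2') (auto simp: field_simps)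
    then have "ennreal (d powr (- \<tau>)) \<le> ennreal (W k) * indicator (ball x (2 * R / 2 ^ k)) y"
      using mem by (simp add: ennreal_leI)
    also have "\<dots> \<le> (\<Sum>k. ennreal (W k) * indicator (ball x (2 * R / 2 ^ k)) y)"
      using sum_le_suminf[of "\<lambda>k. ennreal (W k) * indicator (ball x (2 * R / 2 ^ k)) y" "{k}", OF summableI]
      by (simp only: sum.insert sum.empty finite.emptyI empty_iff not_False_eq_True add_0_right finite_insert zero_le)
    finally show ?thesis by (simp add: d_def)
  qed simp
  have "(\<integral>\<^sup>+y. ennreal (dist x y powr (- \<tau>)) \<partial>\<mu>) \<le> (\<integral>\<^sup>+y. (\<Sum>k. ennreal (W k) * indicator (ball x (2 * R / 2 ^ k)) y) \<partial>\<mu>)"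
    by (rule nn_integral_mono_AE, use AE_K in eventually_elim) (rule pt)
  also have "\<dots> = (\<Sum>k. ennreal (W k) * emeasure \<mu> (ball x (2 * R / 2 ^ k)))"
  proof -
    have [measurable]: "ball x r \<in> sets \<mu>" for r by (simp add: sets_\<mu>)
    show ?thesis by (subst nn_integral_suminf) (auto simp: nn_integral_cmult_indicator)
  qed
  also have "\<dots> \<le> (\<Sum>k. ennreal ((R / 2) powr (- \<tau>) * k2 * (2 * R) powr s * (2 powr (\<tau> - s)) ^ k))"
  proof (intro suminf_le allI)
    fix k
    have pw: "(2 ^ k) powr a = (2 powr a) ^ k" for a :: real by (induction k) (auto simp: powr_mult)
    have "ennreal (W k) * emeasure \<mu> (ball x (2 * R / 2 ^ k)) \<le> ennreal (W k) * ennreal (k2 * (2 * R / 2 ^ k) powr s)"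
      using upper[of "2 * R / 2 ^ k" x] pos by (intro mult_left_mono) (auto simp: \<mu>.emeasure_eq_measure ennreal_leI)
    also have "\<dots> = ennreal (W k * (k2 * (2 * R / 2 ^ k) powr s))" using W by (simp add: ennreal_mult')
    also have "W k * (k2 * (2 * R / 2 ^ k) powr s) = (R / 2) powr (- \<tau>) * k2 * (2 * R) powr s * (2 powr (\<tau> - s)) ^ k"
      unfolding W_def powr_divide[of _ "2 ^ k"] pw by (simp add: powr_diff powr_minus power_divide field_simps)
    finally show "ennreal (W k) * emeasure \<mu> (ball x (2 * R / 2 ^ k)) \<le> ennreal ((R / 2) powr (- \<tau>) * k2 * (2 * R) powr s * (2 powr (\<tau> - s)) ^ k)" .
  qed auto
  also have "\<dots> = ennreal ((R / 2) powr (- \<tau>) * k2 * (2 * R) powr s * (1 / (1 - 2 powr (\<tau> - s))))"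
  proof (intro suminf_ennreal_eq sums_mult geometric_sums)
    have "2 powr (\<tau> - s) < (2::real) powr 0" using \<tau> by (intro powr_less_mono) auto
    then show "norm (2 powr (\<tau> - s)) < (1::real)" by simp
  qed (use k2_nonneg in auto)
  finally show ?thesis by simp
qed

text \<open>Half of the exponent is given to each variable: by \<open>sep\<close> the distance
  dominates both distances to the base, so the kernel is at most a product of two integrable
  functions. The half \<open>\<tau>\<close> is below \<open>s\<close> exactly when
  \<open>\<theta> * p < s\<close>.\<close>

lemma cross_indicator_finite:
  assumes \<theta>: "0 < \<theta>" "\<theta> * p < s" and p: "0 < p"
  shows "nn_integral2 \<mu> (\<lambda>x y. ennreal (dist (\<phi> x) (\<psi> y) powr (- (\<theta> * p + s)))) < \<infinity>"
proof -
  define \<tau> where "\<tau> = (\<theta> * p + s) / 2"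
  have \<tau>: "0 < \<tau>" "\<tau> < s" "\<theta> * p + s = \<tau> + \<tau>" using \<theta> mult_pos_pos[OF \<theta>(1) p] pos by (auto simp: \<tau>_def)
  define f where "f x = ennreal (dist base x powr (- \<tau>))" for x
  have [measurable]: "f \<in> borel_measurable \<mu>" unfolding f_def by measurable
  have "nn_integral2 \<mu> (\<lambda>x y. ennreal (dist (\<phi> x) (\<psi> y) powr (- (\<theta> * p + s)))) \<le> nn_integral2 \<mu> (\<lambda>x y. f x * f y)"
  proof (rule nn_integral_mono_AE, use AE_K AE_not_base in eventually_elim)
    fix x assume x: "x \<in> K" "x \<noteq> base"
    show "(\<integral>\<^sup>+y. ennreal (dist (\<phi> x) (\<psi> y) powr (- (\<theta> * p + s))) \<partial>\<mu>) \<le> (\<integral>\<^sup>+y. f x * f y \<partial>\<mu>)"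
    proof (rule nn_integral_mono_AE, use AE_K AE_not_base in eventually_elim)
      fix y assume y: "y \<in> K" "y \<noteq> base"
      have d: "dist base x \<le> dist (\<phi> x) (\<psi> y)" "dist base y \<le> dist (\<phi> x) (\<psi> y)"
        using sep[OF x(1) y(1)] by (auto simp: dist_commute)
      have "dist (\<phi> x) (\<psi> y) powr (- (\<theta> * p + s)) = dist (\<phi> x) (\<psi> y) powr (- \<tau>) * dist (\<phi> x) (\<psi> y) powr (- \<tau>)"
        unfolding \<tau>(3) by (simp add: powr_add[symmetric])
      also have "\<dots> \<le> dist base x powr (- \<tau>) * dist base y powr (- \<tau>)"
        using d x y \<tau> by (intro mult_mono powr_mono2') auto
      finally show "ennreal (dist (\<phi> x) (\<psi> y) powr (- (\<theta> * p + s))) \<le> f x * f y"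
        by (simp add: f_def ennreal_mult[symmetric] ennreal_leI)
    qed
  qed
  also have "\<dots> = (\<integral>\<^sup>+x. f x \<partial>\<mu>) * (\<integral>\<^sup>+x. f x \<partial>\<mu>)" by (simp add: nn_integral_cmult nn_integral_multc)
  also have "\<dots> < \<infinity>"
  proof -
    have "(\<integral>\<^sup>+x. f x \<partial>\<mu>) < \<infinity>"
      unfolding f_def using dist_powr_integral[OF base \<tau>(1,2)] by (rule le_less_trans) simp
    then show ?thesis by (simp add: ennreal_mult_less_top)
  qed
  finally show ?thesis .
qed

text \<open>Pairs within \<open>r\<close> of the base are at most \<open>2 * r\<close> apart, so
  they contribute at least a multiple of \<open>r powr (s - \<theta> * p)\<close>, which is
  unbounded as \<open>r\<close> tends to 0.\<close>

lemma cross_const_infinite: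
  assumes \<theta>: "0 < \<theta>" "s < \<theta> * p" and v: "0 < v"
  shows "nn_integral2 \<mu> (\<lambda>x y. ennreal (v * dist (\<phi> x) (\<psi> y) powr (- (\<theta> * p + s)))) = \<infinity>"
proof (rule ccontr)
  let ?t = "\<theta> * p + s"
  assume "\<not> ?thesis"
  then obtain I where I: "nn_integral2 \<mu> (\<lambda>x y. ennreal (v * dist (\<phi> x) (\<psi> y) powr (- ?t))) = ennreal I" "0 \<le> I"
    by (cases "nn_integral2 \<mu> (\<lambda>x y. ennreal (v * dist (\<phi> x) (\<psi> y) powr (- ?t)))") auto
  have bound: "v * (2 * r) powr (- ?t) * (k1 * r powr s)\<^sup>2 \<le> I" if r: "0 < r" "r \<le> R" for r
  proof -
    define B where "B = ball base r"
    have [measurable]: "B \<in> sets \<mu>" by (simp add: B_def sets_\<mu>)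
    have m: "k1 * r powr s \<le> measure \<mu> B" unfolding B_def by (rule lower[OF base r])
    have "ennreal (v * (2 * r) powr (- ?t) * (measure \<mu> B)\<^sup>2) = nn_integral2 \<mu> (\<lambda>x y. ennreal (v * (2 * r) powr (- ?t)) * indicator B y * indicator B x)"
      using v by (simp add: nn_integral_cmult_indicator nn_integral_multc \<mu>.emeasure_eq_measure ennreal_mult power2_eq_square mult.assoc nn_integral_cmult)
    also have "\<dots> \<le> ennreal I"
      unfolding I(1)[symmetric]
    proof (rule nn_integral_mono_AE, use AE_K AE_not_base in eventually_elim)
      fix x assume x: "x \<in> K" "x \<noteq> base"
      show "(\<integral>\<^sup>+y. ennreal (v * (2 * r) powr (- ?t)) * indicator B y * indicator B x \<partial>\<mu>) \<le> (\<integral>\<^sup>+y. ennreal (v * dist (\<phi> x) (\<psi> y) powr (- ?t)) \<partial>\<mu>)"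
      proof (rule nn_integral_mono_AE, use AE_K in eventually_elim)
        fix y assume y: "y \<in> K"
        show "ennreal (v * (2 * r) powr (- ?t)) * indicator B y * indicator B x \<le> ennreal (v * dist (\<phi> x) (\<psi> y) powr (- ?t))"
        proof (cases "x \<in> B \<and> y \<in> B")
          case True
          have "dist (\<phi> x) (\<psi> y) \<le> dist (\<phi> x) 0 + dist (\<psi> y) 0" by (rule dist_triangle2)
          also have "\<dots> = dist x base + dist y base" using \<phi>(1)[of x base] \<psi>(1)[of y base] \<phi>(3) \<psi>(3) by simp
          also have "\<dots> \<le> 2 * r" using True by (simp add: B_def dist_commute)
          finally have d: "dist (\<phi> x) (\<psi> y) \<le> 2 * r" .
          have "0 < dist x base" using x by simp
          then have "0 < dist (\<phi> x) (\<psi> y)" using sep[OF x(1) y] by linarith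
          then have "(2 * r) powr (- ?t) \<le> dist (\<phi> x) (\<psi> y) powr (- ?t)"
            using d \<theta> pos by (intro powr_mono2') auto
          then show ?thesis using True v by (simp add: ennreal_leI)
        qed auto
      qed
    qed
    finally have "v * (2 * r) powr (- ?t) * (measure \<mu> B)\<^sup>2 \<le> I" using I by (subst (asm) ennreal_le_iff) auto
    moreover have "v * (2 * r) powr (- ?t) * (k1 * r powr s)\<^sup>2 \<le> v * (2 * r) powr (- ?t) * (measure \<mu> B)\<^sup>2"
      using m v pos by (intro mult_left_mono power_mono) auto
    ultimately show ?thesis by simp
  qed
  define e where "e = \<theta> * p - s"
  have e: "0 < e" using \<theta> by (simp add: e_def)
  define c where "c = v * 2 powr (- ?t) * k1\<^sup>2"
  have c: "0 < c" using v pos by (simp add: c_def)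
  have eq: "v * (2 * r) powr (- ?t) * (k1 * r powr s)\<^sup>2 = c * r powr (- e)" if r: "0 < r" for r
  proof -
    have "r powr (- ?t) * (r powr s * r powr s) = r powr (- e)"
      by (simp add: powr_add[symmetric] e_def)
    then show ?thesis by (simp add: c_def powr_mult power2_eq_square mult_ac)
  qed
  \<comment> \<open>So small that this contribution is at least \<open>I + c\<close>.\<close>
  define r where "r = min R ((c / (I + c)) powr (1 / e))"
  have r: "0 < r" "r \<le> R" using pos c I by (auto simp: r_def)
  have "r powr e \<le> ((c / (I + c)) powr (1 / e)) powr e" using r e by (intro powr_mono2) (auto simp: r_def)
  also have "\<dots> = c / (I + c)" using e c I by (simp add: powr_powr)
  finally have "(I + c) * r powr e \<le> c" using c I by (simp add: field_simps)
  then have "I + c \<le> c * r powr (- e)" using r by (simp add: powr_minus field_simps)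
  then show False using bound[OF r] eq[OF r(1)] c by simp
qed

section \<open>The critical exponents of a glued space\<close>

context
  fixes p :: real
  assumes p: "1 < p"
begin

definition constant_above :: "real \<Rightarrow> bool" where
  "constant_above t \<longleftrightarrow> (\<forall>u. u \<in> borel_measurable borel \<longrightarrow> integrable \<mu> (\<lambda>x. \<bar>u x\<bar> powr p) \<longrightarrow>
     riesz_energy p t \<mu> u < \<infinity> \<longrightarrow> (\<exists>c. AE x in \<mu>. u x = c))"

text \<open>Together with \<open>constant_above\<close> this is all that the gluing argument asks of
  a single copy. The approximants keep the bound \<open>B\<close> and vanish near
  \<open>base\<close>, which is what controls the cross energy.\<close>

definition approximable_below :: "real \<Rightarrow> bool" where
  "approximable_below t \<longleftrightarrow> (\<forall>f L B \<delta> \<epsilon>. (\<forall>x y. \<bar>f x - f y\<bar> \<le> L * dist x y) \<longrightarrow> (\<forall>x. \<bar>f x\<bar> \<le> B) \<longrightarrow>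
     (\<forall>x. dist base x < \<delta> \<longrightarrow> f x = 0) \<longrightarrow> 0 < \<delta> \<longrightarrow> 0 < \<epsilon> \<longrightarrow>
     (\<exists>u \<delta>'. u \<in> borel_measurable borel \<and> (\<forall>x. \<bar>u x\<bar> \<le> B) \<and> 0 < \<delta>' \<and> (\<forall>x\<in>K. dist base x < \<delta>' \<longrightarrow> u x = 0) \<and>
       riesz_energy p t \<mu> u < \<infinity> \<and> Lp_powr p \<mu> (\<lambda>x. f x - u x) < ennreal \<epsilon>))"

lemma besov_constant:
  assumes H: "constant_above (\<theta> * p + s)" and \<theta>: "0 < \<theta>" and u: "u \<in> besov_space p \<theta> M"
  obtains a b where "AE x in \<mu>. extend u (\<phi> x) = a" "AE x in \<mu>. extend u (\<psi> x) = b"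
    "cross_energy p (\<theta> * p + s) (\<lambda>x. extend u (\<phi> x)) (\<lambda>x. extend u (\<psi> x)) < \<infinity>"
proof -
  have uM: "u \<in> borel_measurable M" and uL: "u \<in> Lp_space p M" and uB: "besov_energy p \<theta> M u < \<infinity>"
    using u by (auto simp: besov_space_def Lp_space_def)
  note [measurable] = extend_borel[OF uM]
  have 1: "riesz_energy p (\<theta> * p + s) \<mu> (\<lambda>x. extend u (\<phi> x)) < \<infinity>" "riesz_energy p (\<theta> * p + s) \<mu> (\<lambda>x. extend u (\<psi> x)) < \<infinity>"
    "cross_energy p (\<theta> * p + s) (\<lambda>x. extend u (\<phi> x)) (\<lambda>x. extend u (\<psi> x)) < \<infinity>"
    using besov_energy_finite_iff[OF uM \<theta>, of p] uB p by auto
  have "Lp_powr p M u < \<infinity>" using uL by (simp add: Lp_space_iff)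
  then have "Lp_powr p \<mu> (\<lambda>x. extend u (\<phi> x)) < \<infinity>" "Lp_powr p \<mu> (\<lambda>x. extend u (\<psi> x)) < \<infinity>"
    unfolding nn_integral_M[OF uM] by auto
  then have "integrable \<mu> (\<lambda>x. \<bar>extend u (\<phi> x)\<bar> powr p)" "integrable \<mu> (\<lambda>x. \<bar>extend u (\<psi> x)\<bar> powr p)"
    by (subst integrable_iff_bounded; simp)+
  then have "\<exists>c. AE x in \<mu>. extend u (\<phi> x) = c" "\<exists>c. AE x in \<mu>. extend u (\<psi> x) = c"
    using H 1 unfolding constant_above_def by auto
  then show thesis using that 1(3) by blast
qed

lemma not_contains_nonconstant:
  assumes H: "constant_above (\<theta> * p + s)" and \<theta>: "0 < \<theta>" "s < \<theta> * p"
  shows "\<not> contains_nonconstant M (besov_space p \<theta> M)"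
proof
  assume "contains_nonconstant M (besov_space p \<theta> M)"
  then obtain u where u: "u \<in> besov_space p \<theta> M" "\<not> (\<exists>c. AE x in M. u x = c)" by (auto simp: contains_nonconstant_def)
  have uM: "u \<in> borel_measurable M" using u by (auto simp: besov_space_def Lp_space_def)
  obtain a b where ab: "AE x in \<mu>. extend u (\<phi> x) = a" "AE x in \<mu>. extend u (\<psi> x) = b"
    "cross_energy p (\<theta> * p + s) (\<lambda>x. extend u (\<phi> x)) (\<lambda>x. extend u (\<psi> x)) < \<infinity>"
    by (rule besov_constant[OF H \<theta>(1) u(1)])
  have "a \<noteq> b" using u(2) AE_M[OF uM] ab by blast
  have "cross_energy p (\<theta> * p + s) (\<lambda>x. extend u (\<phi> x)) (\<lambda>x. extend u (\<psi> x))
     = nn_integral2 \<mu> (\<lambda>x y. ennreal (\<bar>b - a\<bar> powr p * dist (\<phi> x) (\<psi> y) powr (- (\<theta> * p + s))))"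
    unfolding cross_energy_def
  proof (rule nn_integral_cong_AE, use ab(1) in eventually_elim)
    fix x assume x: "extend u (\<phi> x) = a"
    show "(\<integral>\<^sup>+y. ennreal (\<bar>extend u (\<psi> y) - extend u (\<phi> x)\<bar> powr p * dist (\<phi> x) (\<psi> y) powr (- (\<theta> * p + s))) \<partial>\<mu>)
      = (\<integral>\<^sup>+y. ennreal (\<bar>b - a\<bar> powr p * dist (\<phi> x) (\<psi> y) powr (- (\<theta> * p + s))) \<partial>\<mu>)"
      by (rule nn_integral_cong_AE, use ab(2) in eventually_elim) (simp add: x)
  qed
  also have "\<dots> = \<infinity>" by (rule cross_const_infinite[OF \<theta>]) (use \<open>a \<noteq> b\<close> in simp)
  finally show False using ab(3) by simp
qed

text \<open>A constant differs by at least 1/2 either from the value 1 on \<open>E\<close> or from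
  the value 0 off \<open>E\<close>.\<close>

lemma indicator_distance:
  assumes E: "E \<in> sets borel" "AE x in \<mu>. u x = c"
  shows "ennreal ((1 / 2) powr p * min (measure \<mu> E) (mass - measure \<mu> E)) \<le> Lp_powr p \<mu> (\<lambda>x. indicator E x - u x)"
proof -
  have E': "E \<in> sets \<mu>" "- E \<in> sets \<mu>" using E by (auto simp: sets_\<mu>)
  have mE: "measure \<mu> (- E) = mass - measure \<mu> E"
    using \<mu>.finite_measure_compl[OF E'(1)] by (simp add: space_\<mu> Compl_eq_Diff_UNIV)
  define F where "F = (if c \<le> 1 / 2 then E else - E)"
  have F: "F \<in> sets \<mu>" using E' by (simp add: F_def)
  have "ennreal ((1 / 2) powr p * min (measure \<mu> E) (mass - measure \<mu> E)) \<le> ennreal ((1 / 2) powr p * measure \<mu> F)"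
    by (intro ennreal_leI mult_left_mono) (auto simp: F_def mE)
  also have "\<dots> = (\<integral>\<^sup>+x. ennreal ((1 / 2) powr p) * indicator F x \<partial>\<mu>)"
    using F by (simp add: nn_integral_cmult_indicator \<mu>.emeasure_eq_measure ennreal_mult)
  also have "\<dots> \<le> Lp_powr p \<mu> (\<lambda>x. indicator E x - u x)"
  proof (rule nn_integral_mono_AE, use E(2) in eventually_elim)
    fix x assume x: "u x = c"
    show "ennreal ((1 / 2) powr p) * indicator F x \<le> ennreal (\<bar>indicator E x - u x\<bar> powr p)"
    proof (cases "x \<in> F")
      case True
      then have "1 / 2 \<le> \<bar>indicator E x - c\<bar>" by (auto simp: F_def indicator_def split: if_splits)
      then have "(1 / 2) powr p \<le> \<bar>indicator E x - c\<bar> powr p" using p by (intro powr_mono2) auto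
      then show ?thesis using True x by (simp add: ennreal_leI)
    qed simp
  qed
  finally show ?thesis .
qed

text \<open>The indicator of a ball of positive mass, but at most half of the total, has positive
  distance from all constants. Constancy on the copy given by \<open>\<phi>\<close> alone already
  prevents density.\<close>

lemma not_dense:
  assumes B: "B \<subseteq> Lp_space p M" and const: "\<And>u. u \<in> B \<Longrightarrow> \<exists>c. AE x in \<mu>. extend u (\<phi> x) = c"
  shows "\<not> dense_in_Lp p M B"
proof
  assume dense: "dense_in_Lp p M B"
  \<comment> \<open>So small that \<open>upper\<close> leaves the ball at most half of the total
    mass.\<close>
  define r where "r = min R ((mass / (2 * (k2 + 1))) powr (1 / s))"
  have r: "0 < r" "r \<le> R" using pos mass_pos k2_nonneg by (auto simp: r_def)
  have "r powr s \<le> ((mass / (2 * (k2 + 1))) powr (1 / s)) powr s" using r pos by (intro powr_mono2) (auto simp: r_def)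
  also have "\<dots> = mass / (2 * (k2 + 1))" using pos mass_pos k2_nonneg by (simp add: powr_powr)
  finally have "k2 * r powr s \<le> k2 * (mass / (2 * (k2 + 1)))" using k2_nonneg by (rule mult_left_mono)
  also have "\<dots> \<le> mass / 2" using mass_pos k2_nonneg by (simp add: field_simps)
  finally have m2: "measure \<mu> (ball base r) \<le> mass / 2" using upper[OF r(1), of base] by simp
  have "0 < k1 * r powr s" using r pos by simp
  then have m1: "0 < measure \<mu> (ball base r)" using lower[OF base r] by simp
  define \<kappa> where "\<kappa> = (1 / 2) powr p * min (measure \<mu> (ball base r)) (mass - measure \<mu> (ball base r))"
  have \<kappa>: "0 < \<kappa>" using m1 m2 mass_pos by (simp add: \<kappa>_def)
  define f :: "'a \<Rightarrow> real" where "f = indicator (\<phi> ` ball base r)"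
  have "\<phi> ` ball base r \<in> sets borel" using isometry_image_borel[OF \<phi>(1,2)] by simp
  then have fM: "f \<in> borel_measurable M" unfolding f_def by (intro borel_measurable_M) simp
  have fL: "f \<in> Lp_space p M" using p by (intro bounded_Lp[OF fM, of _ 1]) (auto simp: f_def indicator_def)
  obtain u where u: "u \<in> B" "Lp_norm p M (\<lambda>x. f x - u x) < \<kappa> powr (1 / p)"
  proof -
    have "0 < \<kappa> powr (1 / p)" using \<kappa> by simp
    then show thesis using dense fL that unfolding dense_in_Lp_def by blast
  qed
  have uL: "u \<in> Lp_space p M" using B u by blast
  have diff: "(\<lambda>x. f x - u x) \<in> Lp_space p M" using Lp_diff[OF fL uL] p by simp
  have "Lp_powr p M (\<lambda>x. f x - u x) < ennreal \<kappa>"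
    using Lp_norm_less_iff[OF diff, of "\<kappa> powr (1 / p)"] u(2) p \<kappa> by (simp add: powr_powr)
  moreover have "ennreal \<kappa> \<le> Lp_powr p M (\<lambda>x. f x - u x)"
  proof -
    obtain c where c: "AE x in \<mu>. extend u (\<phi> x) = c" using const[OF u(1)] by blast
    have "ennreal \<kappa> \<le> Lp_powr p \<mu> (\<lambda>x. indicator (ball base r) x - extend u (\<phi> x))"
      unfolding \<kappa>_def by (rule indicator_distance[OF _ c]) simp
    also have "\<dots> = Lp_powr p \<mu> (\<lambda>x. extend (\<lambda>x. f x - u x) (\<phi> x))"
    proof (rule nn_integral_cong_AE, use AE_K in eventually_elim)
      fix x assume x: "x \<in> K"
      have "f (\<phi> x) = indicator (ball base r) x"
        unfolding f_def using isometry_inj[OF \<phi>(1)] by (auto simp: indicator_def inj_image_mem_iff)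
      then show "ennreal (\<bar>indicator (ball base r) x - extend u (\<phi> x)\<bar> powr p) = ennreal (\<bar>extend (\<lambda>x. f x - u x) (\<phi> x)\<bar> powr p)"
        using x by (simp add: extend_def)
    qed
    also have "\<dots> \<le> Lp_powr p M (\<lambda>x. f x - u x)"
      using nn_integral_M[of "\<lambda>x. f x - u x" p] diff by (simp add: Lp_space_def)
    finally show ?thesis .
  qed
  ultimately show False by simp
qed

lemma not_dense_above:
  assumes H: "constant_above (\<theta> * p + s)" and \<theta>: "0 < \<theta>"
  shows "\<not> dense_in_Lp p M (besov_space p \<theta> M)"
proof (rule not_dense)
  show "besov_space p \<theta> M \<subseteq> Lp_space p M" by (auto simp: besov_space_def)
  show "\<exists>c. AE x in \<mu>. extend u (\<phi> x) = c" if "u \<in> besov_space p \<theta> M" for u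
    by (rule besov_constant[OF H \<theta> that]) blast
qed

lemma dense_imp_contains_nonconstant:
  assumes "dense_in_Lp p M (besov_space p \<theta> M)"
  shows "contains_nonconstant M (besov_space p \<theta> M)"
proof (rule ccontr)
  assume nc: "\<not> contains_nonconstant M (besov_space p \<theta> M)"
  have "\<not> dense_in_Lp p M (besov_space p \<theta> M)"
  proof (rule not_dense)
    show "besov_space p \<theta> M \<subseteq> Lp_space p M" by (auto simp: besov_space_def)
    show "\<exists>c. AE x in \<mu>. extend u (\<phi> x) = c" if u: "u \<in> besov_space p \<theta> M" for u
    proof -
      have "u \<in> borel_measurable M" using u by (auto simp: besov_space_def Lp_space_def)
      then show ?thesis using nc u AE_M unfolding contains_nonconstant_def by blast
    qed
  qed
  then show False using assms by simp
qed

lemma contains_nonconstant_indicator: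
  assumes \<theta>: "0 < \<theta>" "\<theta> * p < s"
  shows "contains_nonconstant M (besov_space p \<theta> M)"
proof -
  define u :: "'a \<Rightarrow> real" where "u = indicator (\<phi> ` K)"
  have uM: "u \<in> borel_measurable M" unfolding u_def by (intro borel_measurable_M) simp
  have uL: "u \<in> Lp_space p M" using p by (intro bounded_Lp[OF uM, of _ 1]) (auto simp: u_def indicator_def)
  have e1: "AE x in \<mu>. extend u (\<phi> x) = 1"
    using AE_K by eventually_elim (simp add: extend_def u_def)
  have e2: "AE x in \<mu>. extend u (\<psi> x) = 0"
    using AE_K AE_not_base
  proof eventually_elim
    fix x assume x: "x \<in> K" "x \<noteq> base"
    have "\<psi> x \<notin> \<phi> ` K"
    proof
      assume "\<psi> x \<in> \<phi> ` K"
      then obtain y where y: "y \<in> K" "\<psi> x = \<phi> y" by blast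
      have "dist x base \<le> 0" using sep[OF y(1) x(1)] y by simp
      then show False using x by simp
    qed
    then show "extend u (\<psi> x) = 0" by (simp add: extend_def u_def)
  qed
  have zero: "riesz_energy p t \<mu> v = 0" if v: "AE x in \<mu>. v x = c" for v c t
  proof -
    have "riesz_energy p t \<mu> v = (\<integral>\<^sup>+x. 0 \<partial>\<mu>)"
      unfolding riesz_energy_def
    proof (rule nn_integral_cong_AE, use v in eventually_elim)
      fix x assume x: "v x = c"
      have "(\<integral>\<^sup>+y. ennreal (\<bar>v y - v x\<bar> powr p * dist x y powr (- t)) \<partial>\<mu>) = (\<integral>\<^sup>+y. 0 \<partial>\<mu>)"
        by (rule nn_integral_cong_AE, use v in eventually_elim) (use x p in simp)
      then show "(\<integral>\<^sup>+y. ennreal (\<bar>v y - v x\<bar> powr p * dist x y powr (- t)) \<partial>\<mu>) = 0" by simp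
    qed
    then show ?thesis by simp
  qed
  have "cross_energy p (\<theta> * p + s) (\<lambda>x. extend u (\<phi> x)) (\<lambda>x. extend u (\<psi> x))
     = nn_integral2 \<mu> (\<lambda>x y. ennreal (dist (\<phi> x) (\<psi> y) powr (- (\<theta> * p + s))))"
    unfolding cross_energy_def
  proof (rule nn_integral_cong_AE, use e1 in eventually_elim)
    fix x assume x: "extend u (\<phi> x) = 1"
    show "(\<integral>\<^sup>+y. ennreal (\<bar>extend u (\<psi> y) - extend u (\<phi> x)\<bar> powr p * dist (\<phi> x) (\<psi> y) powr (- (\<theta> * p + s))) \<partial>\<mu>)
      = (\<integral>\<^sup>+y. ennreal (dist (\<phi> x) (\<psi> y) powr (- (\<theta> * p + s))) \<partial>\<mu>)"
      by (rule nn_integral_cong_AE, use e2 in eventually_elim) (simp add: x)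
  qed
  also have "\<dots> < \<infinity>" using p by (intro cross_indicator_finite \<theta>) auto
  finally have "besov_energy p \<theta> M u < \<infinity>"
    using besov_energy_finite_iff[OF uM \<theta>(1), of p] zero[OF e1] zero[OF e2] p by simp
  then have "u \<in> besov_space p \<theta> M" using uL by (simp add: besov_space_def)
  moreover have "\<not> (\<exists>c. AE x in M. u x = c)"
  proof
    assume "\<exists>c. AE x in M. u x = c"
    then obtain c where "AE x in \<mu>. extend u (\<phi> x) = c" "AE x in \<mu>. extend u (\<psi> x) = c" using AE_M[OF uM] by blast
    then have "AE x in \<mu>. False" using e1 e2 by eventually_elim auto
    then have "mass = 0" using \<mu>.finite_measure_eq_AE[of UNIV "{}"] by (auto simp: sets_\<mu>)
    then show False using mass_pos by simp
  qed
  ultimately show ?thesis by (auto simp: contains_nonconstant_def)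
qed

lemma dense_below:
  assumes H: "approximable_below (\<theta> * p + s)" and \<theta>: "0 < \<theta>"
  shows "dense_in_Lp p M (besov_space p \<theta> M)"
  unfolding dense_in_Lp_def
proof (intro ballI allI impI)
  let ?t = "\<theta> * p + s"
  have t: "0 < ?t" using \<theta> p pos by (intro add_pos_pos mult_pos_pos) auto
  have p0: "0 < p" using p by simp
  fix f and \<epsilon> :: real assume f: "f \<in> Lp_space p M" and \<epsilon>: "0 < \<epsilon>"
  have fM: "f \<in> borel_measurable M" using f by (simp add: Lp_space_def)
  \<comment> \<open>The same measure on all Borel sets of the ambient space, the setting of
    \<open>Lipschitz_closure_Lp\<close>.\<close>
  define \<nu> where "\<nu> = distr M borel (\<lambda>x. x)"
  have idM [measurable]: "(\<lambda>x. x) \<in> M \<rightarrow>\<^sub>M borel" using borel_measurable_M[of "\<lambda>x. x"] by simp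
  have \<nu>: "finite_measure \<nu>" "sets \<nu> = sets borel" unfolding \<nu>_def by (auto intro: M.finite_measure_distr)
  have nn_\<nu>: "(\<integral>\<^sup>+x. g x \<partial>\<nu>) = (\<integral>\<^sup>+x. g x \<partial>M)" if "g \<in> borel_measurable borel" for g
    unfolding \<nu>_def using that by (subst nn_integral_distr[OF idM]) auto
  have "emeasure \<nu> {0} = (\<integral>\<^sup>+x. indicator {0} x \<partial>M)" using nn_\<nu>[of "indicator {0}"] \<nu> by simp
  also have "\<dots> = (\<integral>\<^sup>+x. indicator {0} (\<phi> x) \<partial>\<mu>) + (\<integral>\<^sup>+x. indicator {0} (\<psi> x) \<partial>\<mu>)" by (rule nn_M) simp
  also have "(\<integral>\<^sup>+x. indicator {0} (\<phi> x) \<partial>\<mu>) = (\<integral>\<^sup>+x. 0 \<partial>\<mu>)"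
  proof (rule nn_integral_cong_AE, use AE_not_base in eventually_elim)
    show "indicator {0} (\<phi> x) = (0::ennreal)" if "x \<noteq> base" for x
      using that injD[OF isometry_inj[OF \<phi>(1)], of x base] \<phi>(3) by (auto simp: indicator_def)
  qed
  also have "(\<integral>\<^sup>+x. indicator {0} (\<psi> x) \<partial>\<mu>) = (\<integral>\<^sup>+x. 0 \<partial>\<mu>)"
  proof (rule nn_integral_cong_AE, use AE_not_base in eventually_elim)
    show "indicator {0} (\<psi> x) = (0::ennreal)" if "x \<noteq> base" for x
      using that injD[OF isometry_inj[OF \<psi>(1)], of x base] \<psi>(3) by (auto simp: indicator_def)
  qed
  finally have null: "emeasure \<nu> {0} = 0" by simp
  note [measurable] = extend_borel[OF fM]
  have eqf: "Lp_powr p M (\<lambda>x. extend f x - g x) = Lp_powr p M (\<lambda>x. f x - g x)" for g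
    by (intro nn_integral_cong) (simp add: extend_eq)
  have "Lp_powr p \<nu> (\<lambda>x. extend f x) < \<infinity>"
    using f eqf[of "\<lambda>x. 0"] by (subst nn_\<nu>) (auto simp: Lp_space_iff)
  then have clos: "Lipschitz_closure p 0 \<nu> (extend f)"
    by (intro Lipschitz_closure_Lp p0 \<nu> null) simp_all
  define \<eta> where "\<eta> = \<epsilon> powr p / (4 * 2 powr p)"
  have \<eta>: "0 < \<eta>" "2 powr p * (2 * \<eta> + 2 * \<eta>) = \<epsilon> powr p" using \<epsilon> by (auto simp: \<eta>_def)
  obtain g L B \<delta> where g: "0 < \<delta>" "\<forall>x y. \<bar>g x - g y\<bar> \<le> L * dist x y" "\<forall>x. \<bar>g x\<bar> \<le> B"
     "\<forall>x. dist 0 x < \<delta> \<longrightarrow> g x = 0" "Lp_powr p \<nu> (\<lambda>x. extend f x - g x) < ennreal \<eta>"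
    using clos \<eta>(1) unfolding Lipschitz_closure_def by meson
  have gm [measurable]: "g \<in> borel_measurable borel" using g(2) Lipschitz_borel_measurable by blast
  have fg: "Lp_powr p M (\<lambda>x. f x - g x) < ennreal \<eta>"
    using g(5) by (subst (asm) nn_\<nu>) (auto simp: eqf)
  have approx: "\<exists>u \<delta>'. u \<in> borel_measurable borel \<and> (\<forall>x. \<bar>u x\<bar> \<le> B) \<and> 0 < \<delta>' \<and> (\<forall>x\<in>K. dist base x < \<delta>' \<longrightarrow> u x = 0) \<and>
       riesz_energy p ?t \<mu> u < \<infinity> \<and> Lp_powr p \<mu> (\<lambda>x. g (\<rho> x) - u x) < ennreal \<eta>"
    if \<rho>: "\<And>x y. dist (\<rho> x) (\<rho> y) = dist x y" "\<rho> base = 0" for \<rho> :: "'a \<Rightarrow> 'a"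
    using H[unfolded approximable_below_def, rule_format, of "\<lambda>x. g (\<rho> x)" L B \<delta> \<eta>] g(1-4) \<eta>(1) \<rho>(1)[of base] \<rho>
    by (metis (no_types, lifting))
  obtain u1 \<delta>1 where u1: "u1 \<in> borel_measurable borel" "\<And>x. \<bar>u1 x\<bar> \<le> B" "0 < \<delta>1" "\<And>x. x \<in> K \<Longrightarrow> dist base x < \<delta>1 \<Longrightarrow> u1 x = 0"
       "riesz_energy p ?t \<mu> u1 < \<infinity>" "Lp_powr p \<mu> (\<lambda>x. g (\<phi> x) - u1 x) < ennreal \<eta>"
    using approx[OF \<phi>(1,3)] by blast
  obtain u2 \<delta>2 where u2: "u2 \<in> borel_measurable borel" "\<And>x. \<bar>u2 x\<bar> \<le> B" "0 < \<delta>2" "\<And>x. x \<in> K \<Longrightarrow> dist base x < \<delta>2 \<Longrightarrow> u2 x = 0"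
       "riesz_energy p ?t \<mu> u2 < \<infinity>" "Lp_powr p \<mu> (\<lambda>x. g (\<psi> x) - u2 x) < ennreal \<eta>"
    using approx[OF \<psi>(1,3)] by blast
  have B: "0 \<le> B" using g(3) abs_ge_zero order_trans by blast
  define u where "u x = (if x \<in> \<phi> ` K then u1 (inv \<phi> x) else u2 (inv \<psi> x))" for x
  have [measurable]: "inv \<phi> \<in> borel_measurable borel" "inv \<psi> \<in> borel_measurable borel"
    using isometry_borel inv_isometry(1) \<phi> \<psi> by blast+
  have ub [measurable]: "u \<in> borel_measurable borel"
    unfolding u_def using u1(1) u2(1) by measurable
  have uM: "u \<in> borel_measurable M" by (rule borel_measurable_M[OF ub])
  have absu: "\<bar>u x\<bar> \<le> B" for x using u1(2) u2(2) by (simp add: u_def)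
  have uL: "u \<in> Lp_space p M" using p0 absu by (intro bounded_Lp[OF uM]) auto
  have e1: "extend u (\<phi> x) = u1 x" if "x \<in> K" for x
    using that by (simp add: extend_def u_def inv_isometry[OF \<phi>(1,2)])
  \<comment> \<open>The gluing point lies in both halves, and there the definition of
    \<open>u\<close> takes \<open>u1\<close>; this is consistent because both approximants vanish at
    \<open>base\<close>.\<close>
  have e2: "extend u (\<psi> x) = u2 x" if x: "x \<in> K" for x
  proof (cases "\<psi> x \<in> \<phi> ` K")
    case True
    then obtain y where y: "y \<in> K" "\<psi> x = \<phi> y" by blast
    have "dist x base \<le> 0" "dist y base \<le> 0" using sep[OF y(1) x] y by auto
    then have xy: "x = base" "y = base" by auto
    have "extend u (\<psi> x) = u1 y" using e1[OF y(1)] y by simp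
    then show ?thesis using u1(3,4) u2(3,4) base xy by simp
  next
    case False
    then show ?thesis using x by (simp add: extend_def u_def inv_isometry[OF \<psi>(1,2)])
  qed
  have riesz_cong: "riesz_energy p ?t \<mu> v = riesz_energy p ?t \<mu> w" if "\<And>x. x \<in> K \<Longrightarrow> v x = w x" for v w
    unfolding riesz_energy_def
  proof (rule nn_integral_cong_AE, use AE_K in eventually_elim)
    fix x assume x: "x \<in> K"
    show "(\<integral>\<^sup>+y. ennreal (\<bar>v y - v x\<bar> powr p * dist x y powr (- ?t)) \<partial>\<mu>) = (\<integral>\<^sup>+y. ennreal (\<bar>w y - w x\<bar> powr p * dist x y powr (- ?t)) \<partial>\<mu>)"
      by (rule nn_integral_cong_AE, use AE_K in eventually_elim) (use that x in simp)
  qed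
  \<comment> \<open>If both points are close to the gluing point the integrand is 0; otherwise by
    \<open>sep\<close> their distance is at least \<open>\<delta>'\<close>, and the integrand is
    bounded.\<close>
  have cross: "cross_energy p ?t (\<lambda>x. extend u (\<phi> x)) (\<lambda>x. extend u (\<psi> x)) < \<infinity>"
  proof -
    define \<delta>' where "\<delta>' = min \<delta>1 \<delta>2"
    have \<delta>': "0 < \<delta>'" using u1 u2 by (simp add: \<delta>'_def)
    have "cross_energy p ?t (\<lambda>x. extend u (\<phi> x)) (\<lambda>x. extend u (\<psi> x)) \<le> nn_integral2 \<mu> (\<lambda>x y. ennreal ((2 * B) powr p * \<delta>' powr (- ?t)))"
      unfolding cross_energy_def
    proof (rule nn_integral_mono_AE, use AE_K in eventually_elim)
      fix x assume x: "x \<in> K"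
      show "(\<integral>\<^sup>+y. ennreal (\<bar>extend u (\<psi> y) - extend u (\<phi> x)\<bar> powr p * dist (\<phi> x) (\<psi> y) powr (- ?t)) \<partial>\<mu>)
         \<le> (\<integral>\<^sup>+y. ennreal ((2 * B) powr p * \<delta>' powr (- ?t)) \<partial>\<mu>)"
      proof (rule nn_integral_mono_AE, use AE_K in eventually_elim)
        fix y assume y: "y \<in> K"
        show "ennreal (\<bar>extend u (\<psi> y) - extend u (\<phi> x)\<bar> powr p * dist (\<phi> x) (\<psi> y) powr (- ?t)) \<le> ennreal ((2 * B) powr p * \<delta>' powr (- ?t))"
        proof (cases "dist base x < \<delta>' \<and> dist base y < \<delta>'")
          case True
          then have "u1 x = 0" "u2 y = 0" using u1(4)[OF x] u2(4)[OF y] by (auto simp: \<delta>'_def)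
          then show ?thesis using p by (simp add: e1[OF x] e2[OF y])
        next
          case False
          then have "\<delta>' \<le> dist (\<phi> x) (\<psi> y)" using sep[OF x y] by (auto simp: dist_commute)
          then have "dist (\<phi> x) (\<psi> y) powr (- ?t) \<le> \<delta>' powr (- ?t)" using \<delta>' t by (intro powr_mono2') auto
          moreover have "\<bar>u2 y - u1 x\<bar> powr p \<le> (2 * B) powr p"
          proof (rule powr_mono_abs)
            show "\<bar>u2 y - u1 x\<bar> \<le> 2 * B" using u1(2)[of x] u2(2)[of y] by linarith
          qed (use p in simp)
          ultimately show ?thesis by (intro ennreal_leI) (auto simp: e1[OF x] e2[OF y] intro!: mult_mono)
        qed
      qed
    qed
    also have "\<dots> < \<infinity>" by (simp add: space_\<mu> \<mu>.emeasure_eq_measure ennreal_mult[symmetric])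
    finally show ?thesis .
  qed
  have "besov_energy p \<theta> M u < \<infinity>"
    using besov_energy_finite_iff[OF uM \<theta> p0] riesz_cong[of "\<lambda>x. extend u (\<phi> x)" u1] riesz_cong[of "\<lambda>x. extend u (\<psi> x)" u2]
      e1 e2 u1(5) u2(5) cross by simp
  then have uB: "u \<in> besov_space p \<theta> M" using uL by (simp add: besov_space_def)
  have gu: "Lp_powr p M (\<lambda>x. g x - u x) < ennreal (2 * \<eta>)"
  proof -
    have "Lp_powr p M (\<lambda>x. g x - u x) = Lp_powr p \<mu> (\<lambda>x. g (\<phi> x) - u (\<phi> x)) + Lp_powr p \<mu> (\<lambda>x. g (\<psi> x) - u (\<psi> x))"
      by (rule nn_M) measurable
    also have "Lp_powr p \<mu> (\<lambda>x. g (\<phi> x) - u (\<phi> x)) = Lp_powr p \<mu> (\<lambda>x. g (\<phi> x) - u1 x)"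
      by (rule nn_integral_cong_AE, use AE_K in eventually_elim) (use e1 in \<open>simp add: extend_def\<close>)
    also have "Lp_powr p \<mu> (\<lambda>x. g (\<psi> x) - u (\<psi> x)) = Lp_powr p \<mu> (\<lambda>x. g (\<psi> x) - u2 x)"
      by (rule nn_integral_cong_AE, use AE_K in eventually_elim) (use e2 in \<open>simp add: extend_def\<close>)
    also have "Lp_powr p \<mu> (\<lambda>x. g (\<phi> x) - u1 x) + Lp_powr p \<mu> (\<lambda>x. g (\<psi> x) - u2 x) < ennreal \<eta> + ennreal \<eta>"
      by (intro add_strict_mono u1 u2)
    also have "\<dots> = ennreal (2 * \<eta>)" using \<eta> by (simp flip: ennreal_plus)
    finally show ?thesis .
  qed
  have "Lp_powr p M (\<lambda>x. f x - u x) < ennreal (2 powr p * (2 * \<eta> + 2 * \<eta>))"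
  proof (rule Lp_distance_triangle[of _ _ g])
    have "ennreal \<eta> \<le> ennreal (2 * \<eta>)" using \<eta> by (intro ennreal_leI) auto
    with fg show "Lp_powr p M (\<lambda>x. f x - g x) < ennreal (2 * \<eta>)" by (rule less_le_trans)
  qed (use fM uM borel_measurable_M[OF gm] gu \<eta> p0 in auto)
  then have "Lp_powr p M (\<lambda>x. f x - u x) < ennreal (\<epsilon> powr p)" unfolding \<eta>(2) .
  then have "Lp_norm p M (\<lambda>x. f x - u x) < \<epsilon>"
    using Lp_norm_less_iff[OF Lp_diff[OF f uL p0] p0 \<epsilon>] by simp
  then show "\<exists>u\<in>besov_space p \<theta> M. Lp_norm p M (\<lambda>x. f x - u x) < \<epsilon>" using uB by blast
qed

text \<open>Nothing is asked at \<open>\<theta> * p = w\<close>: a single exponent does not change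
  the supremum.\<close>

lemma Sup_exponents:
  assumes w: "0 < w" and below: "\<And>\<theta>. 0 < \<theta> \<Longrightarrow> \<theta> * p < w \<Longrightarrow> P \<theta>" and above: "\<And>\<theta>. 0 < \<theta> \<Longrightarrow> w < \<theta> * p \<Longrightarrow> \<not> P \<theta>"
  shows "Sup (ereal ` {\<theta>. 0 < \<theta> \<and> P \<theta>}) = ereal (w / p)"
proof (rule antisym)
  show "Sup (ereal ` {\<theta>. 0 < \<theta> \<and> P \<theta>}) \<le> ereal (w / p)"
  proof (rule Sup_least, clarsimp)
    fix \<theta> assume "0 < \<theta>" "P \<theta>"
    then have "\<not> w < \<theta> * p" using above by blast
    then show "\<theta> \<le> w / p" using p by (simp add: field_simps)
  qed
  show "ereal (w / p) \<le> Sup (ereal ` {\<theta>. 0 < \<theta> \<and> P \<theta>})"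
  proof (rule dense_le)
    fix x assume "x < ereal (w / p)"
    moreover have "0 < ereal (w / p)" using w p by simp
    ultimately have "max x 0 < ereal (w / p)" by simp
    then obtain \<theta> where \<theta>: "max x 0 < ereal \<theta>" "ereal \<theta> < ereal (w / p)" using ereal_dense2 by blast
    then have "0 < \<theta>" "\<theta> * p < w" using p by (auto simp: field_simps)
    then have "P \<theta>" using below by blast
    with \<open>0 < \<theta>\<close> have "ereal \<theta> \<le> Sup (ereal ` {\<theta>. 0 < \<theta> \<and> P \<theta>})" by (intro Sup_upper) auto
    then show "x \<le> Sup (ereal ` {\<theta>. 0 < \<theta> \<and> P \<theta>})" using \<theta>(1) by (auto intro: order_trans[OF less_imp_le])
  qed
qed

theorem critical_exponents:
  assumes w: "0 < w" and below: "\<And>\<theta>. 0 < \<theta> \<Longrightarrow> \<theta> * p < w \<Longrightarrow> approximable_below (\<theta> * p + s)"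
    and above: "\<And>\<theta>. 0 < \<theta> \<Longrightarrow> w < \<theta> * p \<Longrightarrow> constant_above (\<theta> * p + s)"
  shows "critical_exponent p M = ereal (1 / p * max s w)" "dense_critical_exponent p M = ereal (w / p)"
proof -
  show "dense_critical_exponent p M = ereal (w / p)"
    unfolding dense_critical_exponent_def using w below above
    by (intro Sup_exponents dense_below not_dense_above)
  have "critical_exponent p M = ereal (max s w / p)"
    unfolding critical_exponent_def
  proof (rule Sup_exponents)
    show "0 < max s w" using w by simp
    show "contains_nonconstant M (besov_space p \<theta> M)" if "0 < \<theta>" "\<theta> * p < max s w" for \<theta>
    proof (cases "\<theta> * p < s")
      case True
      then show ?thesis using contains_nonconstant_indicator that by blast
    next
      case False
      then have "\<theta> * p < w" using that by (simp add: less_max_iff_disj)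
      then show ?thesis using that by (intro dense_imp_contains_nonconstant dense_below below)
    qed
    show "\<not> contains_nonconstant M (besov_space p \<theta> M)" if "0 < \<theta>" "max s w < \<theta> * p" for \<theta>
      using that by (intro not_contains_nonconstant above) auto
  qed
  then show "critical_exponent p M = ereal (1 / p * max s w)" by simp
qed

end

end

section \<open>Glued cubes\<close>

definition unit_cube :: "(real ^ 'n::finite) set" where
  "unit_cube = cbox 0 1"

definition cube_measure :: "(real ^ 'n::finite) measure" where
  "cube_measure = density lborel (indicator unit_cube)"

lemma mem_unit_cube: "x \<in> unit_cube \<longleftrightarrow> (\<forall>i. 0 \<le> x $ i \<and> x $ i \<le> 1)"
  by (simp add: unit_cube_def mem_box_cart)

lemma unit_cube_borel [measurable]: "unit_cube \<in> sets borel"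
  by (simp add: unit_cube_def)

lemma sets_cube_measure [simp, measurable_cong]: "sets cube_measure = sets borel"
  by (simp add: cube_measure_def)

lemma nn_integral_cube_measure:
  "f \<in> borel_measurable borel \<Longrightarrow> (\<integral>\<^sup>+x. f x \<partial>cube_measure) = (\<integral>\<^sup>+x. indicator unit_cube x * f x \<partial>lborel)"
  unfolding cube_measure_def by (subst nn_integral_density) auto

lemma emeasure_cube_measure: "A \<in> sets borel \<Longrightarrow> emeasure cube_measure A = emeasure lborel (unit_cube \<inter> A)"
  unfolding cube_measure_def by (subst emeasure_density) (auto simp flip: indicator_inter_arith)

lemma finite_cube_measure: "finite_measure (cube_measure :: (real ^ 'n::finite) measure)"
proof (rule finite_measureI)
  have "emeasure lborel (unit_cube :: (real ^ 'n) set) \<noteq> \<infinity>"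
    using emeasure_lborel_cbox_finite[of "0 :: real ^ 'n" 1] by (simp add: unit_cube_def)
  then show "emeasure cube_measure (space (cube_measure :: (real ^ 'n) measure)) \<noteq> \<infinity>"
    by (simp add: cube_measure_def emeasure_cube_measure[unfolded cube_measure_def])
qed

lemma measure_cbox_cart:
  fixes a b :: "real ^ 'n::finite"
  assumes "\<And>i. b $ i - a $ i = e" "0 \<le> e"
  shows "measure lborel (cbox a b) = e ^ CARD('n)"
proof -
  have "a \<in> cbox a b" using assms by (auto simp: mem_box_cart) (smt (verit) assms)
  then have "cbox a b \<noteq> {}" by blast
  then show ?thesis using assms by (simp add: content_cbox_cart)
qed

lemma cube_ball_upper:
  fixes x :: "real ^ 'n::finite"
  assumes r: "0 < r"
  shows "measure cube_measure (ball x r) \<le> 2 ^ CARD('n) * r powr real CARD('n)"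
proof -
  define a where "a = (\<chi> i. x $ i - r)"
  define b where "b = (\<chi> i. x $ i + r)"
  have sub: "ball x r \<subseteq> cbox a b"
  proof
    fix y assume "y \<in> ball x r"
    then have "\<bar>(x - y) $ i\<bar> \<le> r" for i using component_le_norm_cart[of "x - y" i] by (simp add: dist_norm)
    then show "y \<in> cbox a b" by (auto simp: mem_box_cart a_def b_def abs_le_iff) (smt (verit) vector_minus_component)+
  qed
  have "emeasure cube_measure (ball x r) \<le> emeasure lborel (cbox a b)"
    using sub by (subst emeasure_cube_measure) (auto intro!: emeasure_mono)
  then have "measure cube_measure (ball x r) \<le> measure lborel (cbox a b)"
    unfolding measure_def using emeasure_lborel_cbox_finite[of a b] by (intro enn2real_mono) auto
  also have "\<dots> = (2 * r) ^ CARD('n)" by (rule measure_cbox_cart) (use r in \<open>auto simp: a_def b_def\<close>)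
  finally show ?thesis using r by (simp add: power_mult_distrib powr_realpow)
qed

lemma cube_ball_lower:
  fixes x :: "real ^ 'n::finite"
  assumes x: "x \<in> unit_cube" and r: "0 < r" "r \<le> real CARD('n)"
  shows "(1 / (2 * real CARD('n))) ^ CARD('n) * r powr real CARD('n) \<le> measure cube_measure (ball x r)"
proof -
  \<comment> \<open>Half of \<open>r\<close> shared among the coordinates, so that the coordinate
    differences add up to less than \<open>r\<close>. As \<open>e \<le> 1 / 2\<close>, an interval
    of this length fits into the unit interval on one side of each coordinate of
    \<open>x\<close>.\<close>
  define e where "e = r / (2 * real CARD('n))"
  have e: "0 < e" "e \<le> 1 / 2" using r by (auto simp: e_def field_simps)
  define a where "a = (\<chi> i. if x $ i \<le> 1 / 2 then x $ i else x $ i - e)"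
  define b where "b = (\<chi> i. if x $ i \<le> 1 / 2 then x $ i + e else x $ i)"
  have xi: "0 \<le> x $ i" "x $ i \<le> 1" for i using x by (auto simp: mem_unit_cube)
  have sub: "cbox a b \<subseteq> unit_cube \<inter> ball x r"
  proof
    fix y assume y: "y \<in> cbox a b"
    have yi: "0 \<le> y $ i \<and> y $ i \<le> 1 \<and> \<bar>(x - y) $ i\<bar> \<le> e" for i
    proof -
      have "(if x $ i \<le> 1 / 2 then x $ i else x $ i - e) \<le> y $ i \<and> y $ i \<le> (if x $ i \<le> 1 / 2 then x $ i + e else x $ i)"
        using y by (auto simp: mem_box_cart a_def b_def)
      then show ?thesis using xi[of i] e by (auto split: if_splits simp: abs_le_iff)
    qed
    have "dist x y \<le> (\<Sum>i\<in>UNIV. \<bar>(x - y) $ i\<bar>)" unfolding dist_norm by (rule norm_le_l1_cart)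
    also have "\<dots> \<le> (\<Sum>i\<in>(UNIV::'n set). e)" using yi by (intro sum_mono) auto
    also have "\<dots> < r" using r by (simp add: e_def)
    finally show "y \<in> unit_cube \<inter> ball x r" using yi by (auto simp: mem_unit_cube)
  qed
  interpret finite_measure "cube_measure :: (real ^ 'n) measure" by (rule finite_cube_measure)
  have "e ^ CARD('n) = measure lborel (cbox a b)" by (rule measure_cbox_cart[symmetric]) (use e in \<open>auto simp: a_def b_def\<close>)
  then have "ennreal (e ^ CARD('n)) = emeasure lborel (cbox a b)"
    using emeasure_lborel_cbox_finite[of a b] by (simp add: emeasure_eq_ennreal_measure)
  also have "\<dots> \<le> emeasure cube_measure (ball x r)"
    using sub by (subst emeasure_cube_measure) (auto intro!: emeasure_mono)
  finally have "e ^ CARD('n) \<le> measure cube_measure (ball x r)"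
    by (simp add: emeasure_eq_measure)
  then show ?thesis using r by (simp add: e_def power_divide powr_realpow)
qed

lemma dist_unit_cube_le:
  fixes x y :: "real ^ 'n::finite"
  assumes "x \<in> unit_cube" "y \<in> unit_cube"
  shows "dist x y \<le> real CARD('n)"
proof -
  have "dist x y \<le> (\<Sum>i\<in>UNIV. \<bar>(x - y) $ i\<bar>)" unfolding dist_norm by (rule norm_le_l1_cart)
  also have "\<dots> \<le> (\<Sum>i\<in>(UNIV::'n set). 1)"
  proof (rule sum_mono)
    fix i
    have "0 \<le> x $ i" "x $ i \<le> 1" "0 \<le> y $ i" "y $ i \<le> 1" using assms by (auto simp: mem_unit_cube)
    then show "\<bar>(x - y) $ i\<bar> \<le> 1" by (simp add: abs_le_iff)
  qed
  finally show ?thesis by simp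
qed

lemma norm_le_norm_add_orthant:
  fixes x y :: "'a::real_inner"
  assumes "0 \<le> x \<bullet> y"
  shows "norm x \<le> norm (x + y)"
proof -
  have "(norm x)\<^sup>2 \<le> (norm (x + y))\<^sup>2"
    using assms by (simp add: power2_norm_eq_inner inner_add_left inner_add_right inner_commute)
  then show ?thesis by (rule power2_le_imp_le) simp
qed

lemma cube_dist_opposite:
  fixes x y :: "real ^ 'n::finite"
  assumes "x \<in> unit_cube" "y \<in> unit_cube"
  shows "dist x 0 \<le> dist x (- y) \<and> dist y 0 \<le> dist x (- y)"
proof -
  have "0 \<le> x \<bullet> y" using assms by (auto simp: inner_vec_def mem_unit_cube intro!: sum_nonneg)
  then show ?thesis
    using norm_le_norm_add_orthant[of x y] norm_le_norm_add_orthant[of y x] by (simp add: dist_norm inner_commute add.commute)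
qed

lemma glued_cubes_space:
  "glued_space cube_measure (glued_cubes :: (real ^ 'n::finite) measure) unit_cube 0 (\<lambda>x. x) uminus
    (real CARD('n)) ((1 / (2 * real CARD('n))) ^ CARD('n)) (2 ^ CARD('n)) (real CARD('n))"
proof (rule glued_space.intro)
  let ?Q = "unit_cube :: (real ^ 'n) set"
  have img: "uminus ` ?Q = {x. \<forall>i. -1 \<le> x $ i \<and> x $ i \<le> 0}"
  proof (intro set_eqI iffI)
    show "x \<in> uminus ` ?Q" if "x \<in> {x. \<forall>i. -1 \<le> x $ i \<and> x $ i \<le> 0}" for x
      by (rule image_eqI[of _ _ "- x"]) (use that in \<open>auto simp: mem_unit_cube minus_le_iff\<close>)
  qed (auto simp: mem_unit_cube)
  have glued: "glued_cubes = restrict_space lborel (?Q \<union> uminus ` ?Q)"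
    unfolding glued_cubes_def img by (simp add: mem_unit_cube[symmetric])
  have [measurable]: "uminus ` ?Q \<in> sets borel"
    unfolding img by (rule borel_closed) (auto intro!: closed_Collect_all closed_Collect_conj closed_Collect_le continuous_intros)
  show "space glued_cubes = (\<lambda>x. x) ` ?Q \<union> uminus ` ?Q" by (simp add: glued space_restrict_space)
  show "sets glued_cubes = sets (restrict_space borel ((\<lambda>x. x) ` ?Q \<union> uminus ` ?Q))"
    by (simp add: glued sets_restrict_space)
  show "(\<integral>\<^sup>+x. f x \<partial>glued_cubes) = (\<integral>\<^sup>+x. f x \<partial>cube_measure) + (\<integral>\<^sup>+x. f (- x) \<partial>cube_measure)"
    if f [measurable]: "f \<in> borel_measurable borel" for f :: "real ^ 'n \<Rightarrow> ennreal"
  proof -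
    have "(\<integral>\<^sup>+x. f x \<partial>glued_cubes) = (\<integral>\<^sup>+x. f x * indicator (?Q \<union> uminus ` ?Q) x \<partial>lborel)"
      unfolding glued by (subst nn_integral_restrict_space) auto
    \<comment> \<open>The two cubes meet only in the origin, which is a null set.\<close>
    also have "\<dots> = (\<integral>\<^sup>+x. indicator ?Q x * f x + indicator ?Q (- x) * f x \<partial>lborel)"
    proof (rule nn_integral_cong_AE, use AE_lborel_singleton[of 0] in eventually_elim)
      fix x :: "real ^ 'n" assume "x \<noteq> 0"
      then obtain i where "x $ i \<noteq> 0" by (auto simp: vec_eq_iff)
      then have "\<not> (x \<in> ?Q \<and> - x \<in> ?Q)"
        unfolding mem_unit_cube by (metis neg_0_le_iff_le order_antisym vector_uminus_component)
      moreover have "x \<in> uminus ` ?Q \<longleftrightarrow> - x \<in> ?Q" by (metis image_iff minus_minus)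
      ultimately show "f x * indicator (?Q \<union> uminus ` ?Q) x = indicator ?Q x * f x + indicator ?Q (- x) * f x"
        by (auto simp: indicator_def)
    qed
    also have "\<dots> = (\<integral>\<^sup>+x. indicator ?Q x * f x \<partial>lborel) + (\<integral>\<^sup>+x. indicator ?Q (- x) * f x \<partial>lborel)"
      by (rule nn_integral_add) auto
    also have "(\<integral>\<^sup>+x. indicator ?Q (- x) * f x \<partial>lborel) = (\<integral>\<^sup>+x. indicator ?Q (- x) * f x \<partial>distr lborel borel uminus)"
      using lborel_affine[of "-1" "0 :: real ^ 'n"] by (simp add: density_1)
    also have "\<dots> = (\<integral>\<^sup>+x. indicator ?Q x * f (- x) \<partial>lborel)"
      by (subst nn_integral_distr) auto
    finally show ?thesis by (simp add: nn_integral_cube_measure)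
  qed
  show "dist x 0 \<le> dist x (- y) \<and> dist y 0 \<le> dist x (- y)" if "x \<in> ?Q" "y \<in> ?Q" for x y
    by (rule cube_dist_opposite[OF that])
  show "AE x in cube_measure. x \<in> ?Q" unfolding cube_measure_def by (subst AE_density) (auto simp: indicator_def)
  show "surj (uminus :: real ^ 'n \<Rightarrow> _)" by (rule surjI[of _ uminus]) simp
qed (simp_all add: finite_cube_measure cube_ball_upper cube_ball_lower dist_unit_cube_le mem_unit_cube dist_minus)

section \<open>Rigidity on the cube by midpoints\<close>

lemma nn_integral_lborel_affine:
  fixes f :: "real ^ 'n::finite \<Rightarrow> ennreal" and x :: "real ^ 'n"
  assumes f [measurable]: "f \<in> borel_measurable borel"
  shows "(\<integral>\<^sup>+y. f ((1 / 2) *\<^sub>R x + (1 / 2) *\<^sub>R y) \<partial>lborel) = ennreal (2 ^ CARD('n)) * (\<integral>\<^sup>+z. f z \<partial>lborel)"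
proof -
  have "(\<integral>\<^sup>+z. f z \<partial>lborel) = (\<integral>\<^sup>+z. f z \<partial>density (distr lborel borel (\<lambda>y. (1 / 2) *\<^sub>R x + (1 / 2) *\<^sub>R y)) (\<lambda>_. ennreal (\<bar>1 / 2 :: real\<bar> ^ DIM(real ^ 'n))))"
    by (subst lborel_affine[of "1 / 2" "(1 / 2) *\<^sub>R x"]) auto
  also have "\<dots> = ennreal ((1 / 2) ^ CARD('n)) * (\<integral>\<^sup>+y. f ((1 / 2) *\<^sub>R x + (1 / 2) *\<^sub>R y) \<partial>lborel)"
    by (subst nn_integral_density) (auto simp: nn_integral_cmult nn_integral_distr)
  finally have "ennreal (2 ^ CARD('n)) * (\<integral>\<^sup>+z. f z \<partial>lborel)
     = ennreal (2 ^ CARD('n) * (1 / 2) ^ CARD('n)) * (\<integral>\<^sup>+y. f ((1 / 2) *\<^sub>R x + (1 / 2) *\<^sub>R y) \<partial>lborel)"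
    by (simp add: ennreal_mult mult.assoc)
  then show ?thesis by (simp flip: power_mult_distrib)
qed

lemma nn_integral_lborel_cmult_add:
  fixes f g :: "'a::euclidean_space \<Rightarrow> 'a \<Rightarrow> ennreal"
  assumes [measurable]: "(\<lambda>(x, y). f x y) \<in> borel_measurable (borel \<Otimes>\<^sub>M borel)" "(\<lambda>(x, y). g x y) \<in> borel_measurable (borel \<Otimes>\<^sub>M borel)"
  shows "nn_integral2 lborel (\<lambda>x y. c * (f x y + g x y))
    = c * (nn_integral2 lborel (\<lambda>x y. f x y) + nn_integral2 lborel (\<lambda>x y. g x y))"
  by (simp add: nn_integral_cmult nn_integral_add)

text \<open>For almost every \<open>x\<close> the value \<open>u x\<close> is itself the required
  constant. If no constant worked, the set of such \<open>x\<close> would be empty, hence the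
  measure null, and then the constant 0 works.\<close>

lemma nn_integral_powr_diff_eq_0:
  fixes u :: "'a \<Rightarrow> real"
  assumes "sigma_finite_measure M" and [measurable]: "u \<in> borel_measurable M"
    and z: "nn_integral2 M (\<lambda>x y. ennreal (\<bar>u x - u y\<bar> powr p)) = 0"
  shows "\<exists>c. AE x in M. u x = c"
proof -
  interpret sigma_finite_measure M by fact
  have "AE x in M. Lp_powr p M (\<lambda>y. u x - u y) = 0"
    using z by (subst (asm) nn_integral_0_iff_AE) auto
  then have ae: "AE x in M. AE y in M. u y = u x"
  proof eventually_elim
    fix x assume "Lp_powr p M (\<lambda>y. u x - u y) = 0"
    then have "AE y in M. ennreal (\<bar>u x - u y\<bar> powr p) = 0"
      by (subst (asm) nn_integral_0_iff_AE) auto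
    then show "AE y in M. u y = u x"
      by eventually_elim (simp add: ennreal_eq_0_iff)
  qed
  show ?thesis
  proof (rule ccontr)
    assume "\<nexists>c. AE x in M. u x = c"
    then have "AE x in M. False" using ae by (auto elim: AE_mp)
    then have "AE x in M. u x = 0" by eventually_elim simp
    with \<open>\<nexists>c. AE x in M. u x = c\<close> show False by blast
  qed
qed

text \<open>Inserting the midpoint of \<open>x\<close> and \<open>y\<close> bounds the energy at scale \<open>r\<close> by \<open>2\<^bsup>p+n\<^esup>\<close> times the
  energy at scale \<open>r / 2\<close>, which is incompatible with decay faster than \<open>r\<^bsup>p+n\<^esup>\<close>.\<close>

lemma cube_finite_energy_constant:
  fixes u :: "real ^ 'n::finite \<Rightarrow> real"
  assumes p: "1 < p" and t: "p + real CARD('n) < t" and u [measurable]: "u \<in> borel_measurable borel"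
    and fin: "riesz_energy p t cube_measure u < \<infinity>"
  shows "\<exists>c. AE x in cube_measure. u x = c"
proof -
  interpret G: glued_space cube_measure "glued_cubes :: (real ^ 'n) measure" unit_cube 0 "\<lambda>x. x" uminus
    "real CARD('n)" "(1 / (2 * real CARD('n))) ^ CARD('n)" "2 ^ CARD('n)" "real CARD('n)"
    by (rule glued_cubes_space)
  define Q where "Q = (unit_cube :: (real ^ 'n) set)"
  have Q [measurable]: "Q \<in> sets borel" by (simp add: Q_def)
  define F where "F r x y = indicator Q x * (indicator Q y * (if dist x y < r then ennreal (\<bar>u x - u y\<bar> powr p) else 0))" for r x y
  have Fm [measurable]: "(\<lambda>(x, y). F r x y) \<in> borel_measurable (borel \<Otimes>\<^sub>M borel)" for r
    unfolding F_def by measurable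
  define G where "G r = nn_integral2 lborel (\<lambda>x y. F r x y)" for r
  \<comment> \<open>The factor collects \<open>2 powr (p - 1)\<close> from convexity, 2 for the two
    half segments and \<open>2 ^ CARD('n)\<close> from substituting the midpoint for an
    endpoint.\<close>
  have half: "G r \<le> ennreal (2 powr (p + real CARD('n))) * G (r / 2)" for r
  proof -
    define mid where "mid x y = (1 / 2) *\<^sub>R x + (1 / 2) *\<^sub>R y" for x y :: "real ^ 'n"
    have mm [measurable]: "(\<lambda>(x, y). mid x y) \<in> borel_measurable (borel \<Otimes>\<^sub>M borel)" unfolding mid_def by measurable
    have pt: "F r x y \<le> ennreal (2 powr (p - 1)) * (F (r / 2) x (mid x y) + F (r / 2) y (mid x y))" for x y
    proof (cases "x \<in> Q \<and> y \<in> Q \<and> dist x y < r")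
      case True
      define z where "z = mid x y"
      have zQ: "z \<in> Q" unfolding Q_def mem_unit_cube
      proof
        fix i
        have "0 \<le> x $ i" "x $ i \<le> 1" "0 \<le> y $ i" "y $ i \<le> 1" using True by (auto simp: Q_def mem_unit_cube)
        then show "0 \<le> z $ i \<and> z $ i \<le> 1" by (simp add: z_def mid_def)
      qed
      have "x - z = (1 / 2) *\<^sub>R (x - y)" "y - z = (1 / 2) *\<^sub>R (y - x)"
        by (simp_all add: vec_eq_iff z_def mid_def field_simps)
      then have d: "dist x z < r / 2" "dist y z < r / 2" using True by (simp_all add: dist_norm norm_minus_commute)
      have "\<bar>u x - u y\<bar> powr p \<le> (\<bar>u x - u z\<bar> + \<bar>u y - u z\<bar>) powr p" using p by (intro powr_mono_abs) auto
      also have "\<dots> \<le> (1 - 1 / 2) powr (1 - p) * \<bar>u x - u z\<bar> powr p + (1 / 2) powr (1 - p) * \<bar>u y - u z\<bar> powr p"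
        using p by (intro powr_convex_add_le) auto
      also have "\<dots> = 2 powr (p - 1) * (\<bar>u x - u z\<bar> powr p + \<bar>u y - u z\<bar> powr p)"
        by (simp add: powr_divide powr_diff field_simps)
      finally have "ennreal (\<bar>u x - u y\<bar> powr p) \<le> ennreal (2 powr (p - 1)) * (ennreal (\<bar>u x - u z\<bar> powr p) + ennreal (\<bar>u y - u z\<bar> powr p))"
        by (simp add: ennreal_mult'[symmetric] ennreal_plus[symmetric] ennreal_leI del: ennreal_plus)
      then show ?thesis using True d zQ by (simp add: F_def z_def)
    qed (auto simp: F_def)
    have one: "nn_integral2 lborel (\<lambda>x y. F (r / 2) x (mid x y)) = ennreal (2 ^ CARD('n)) * G (r / 2)"
      unfolding mid_def G_def by (simp add: nn_integral_lborel_affine nn_integral_cmult)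
    have "(\<lambda>z. (fst z, mid (fst z) (snd z))) \<in> borel \<Otimes>\<^sub>M borel \<rightarrow>\<^sub>M borel \<Otimes>\<^sub>M borel"
      by (rule measurable_Pair[OF measurable_fst mm[unfolded case_prod_beta']])
    from measurable_compose[OF this Fm[of "r / 2"]]
    have m1: "(\<lambda>(x, y). F (r / 2) x (mid x y)) \<in> borel_measurable (borel \<Otimes>\<^sub>M borel)"
      unfolding case_prod_beta' fst_conv snd_conv .
    have "(\<lambda>z. (snd z, mid (fst z) (snd z))) \<in> borel \<Otimes>\<^sub>M borel \<rightarrow>\<^sub>M borel \<Otimes>\<^sub>M borel"
      by (rule measurable_Pair[OF measurable_snd mm[unfolded case_prod_beta']])
    from measurable_compose[OF this Fm[of "r / 2"]]
    have m2: "(\<lambda>(x, y). F (r / 2) y (mid x y)) \<in> borel_measurable (borel \<Otimes>\<^sub>M borel)"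
      unfolding case_prod_beta' fst_conv snd_conv .
    have two: "nn_integral2 lborel (\<lambda>x y. F (r / 2) y (mid x y)) = ennreal (2 ^ CARD('n)) * G (r / 2)"
    proof -
      have "nn_integral2 lborel (\<lambda>x y. F (r / 2) y (mid x y)) = nn_integral2 lborel (\<lambda>y x. F (r / 2) y (mid x y))"
        by (intro lborel_pair.Fubini'[symmetric], subst measurable_cong_sets[OF sets_pair_measure_cong[OF sets_lborel sets_lborel] refl])
          (rule m2)
      also have "\<dots> = nn_integral2 lborel (\<lambda>x y. F (r / 2) x (mid x y))" by (simp add: mid_def add.commute)
      finally show ?thesis using one by simp
    qed
    have "G r \<le> nn_integral2 lborel (\<lambda>x y. ennreal (2 powr (p - 1)) * (F (r / 2) x (mid x y) + F (r / 2) y (mid x y)))"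
      unfolding G_def by (intro nn_integral_mono pt)
    also have "\<dots> = ennreal (2 powr (p - 1)) * (nn_integral2 lborel (\<lambda>x y. F (r / 2) x (mid x y)) + nn_integral2 lborel (\<lambda>x y. F (r / 2) y (mid x y)))"
      by (rule nn_integral_lborel_cmult_add[OF m1 m2])
    also have "\<dots> = ennreal (2 powr (p - 1)) * (ennreal (2 * 2 ^ CARD('n)) * G (r / 2))"
    proof -
      have "ennreal (2 * 2 ^ CARD('n)) = ennreal (2 ^ CARD('n)) + ennreal (2 ^ CARD('n))"
        by (simp only: mult_2 ennreal_plus[OF zero_le_power zero_le_power] zero_le_numeral)
      then show ?thesis unfolding one two by (simp only: distrib_right)
    qed
    also have "\<dots> = ennreal (2 powr (p - 1) * (2 * 2 ^ CARD('n))) * G (r / 2)"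
      by (simp add: ennreal_mult mult.assoc)
    also have "2 powr (p - 1) * (2 * 2 ^ CARD('n)) = 2 powr (p + real CARD('n))"
      by (simp add: powr_diff powr_add powr_realpow)
    finally show ?thesis .
  qed
  obtain I where I: "riesz_energy p t cube_measure u = ennreal I" "0 \<le> I"
    using fin by (cases "riesz_energy p t cube_measure u") auto
  have decay: "G r \<le> ennreal (r powr t * I)" if r: "0 < r" for r
  proof -
    define E where "E x y = ennreal (\<bar>u y - u x\<bar> powr p * dist x y powr (- t))" for x y
    have [measurable]: "(\<lambda>(x, y). E x y) \<in> borel_measurable (borel \<Otimes>\<^sub>M borel)" unfolding E_def by measurable
    have pt: "F r x y \<le> indicator Q x * (indicator Q y * (ennreal (r powr t) * E x y))" for x y
    proof (cases "x \<in> Q \<and> y \<in> Q \<and> dist x y < r \<and> x \<noteq> y")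
      case True
      have "dist x y powr t \<le> r powr t" using True p t by (intro powr_mono2) auto
      then have "1 \<le> r powr t * dist x y powr (- t)" using True by (simp add: powr_minus field_simps)
      then have "\<bar>u y - u x\<bar> powr p * 1 \<le> \<bar>u y - u x\<bar> powr p * (r powr t * dist x y powr (- t))" by (intro mult_left_mono) auto
      then show ?thesis using True by (simp add: F_def E_def ennreal_mult'[symmetric] abs_minus_commute mult_ac ennreal_leI)
    qed (use p in \<open>auto simp: F_def\<close>)
    have "G r \<le> nn_integral2 lborel (\<lambda>x y. indicator Q x * (indicator Q y * (ennreal (r powr t) * E x y)))"
      unfolding G_def by (intro nn_integral_mono pt)
    also have "\<dots> = ennreal (r powr t) * (\<integral>\<^sup>+x. indicator Q x * (\<integral>\<^sup>+y. indicator Q y * E x y \<partial>lborel) \<partial>lborel)"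
      by (simp add: nn_integral_cmult[symmetric] mult_ac)
    also have "(\<integral>\<^sup>+x. indicator Q x * (\<integral>\<^sup>+y. indicator Q y * E x y \<partial>lborel) \<partial>lborel) = riesz_energy p t cube_measure u"
      unfolding riesz_energy_def Q_def E_def by (simp add: nn_integral_cube_measure)
    finally show ?thesis using I by (simp add: ennreal_mult')
  qed
  \<comment> \<open>Exceeds the diameter of the cube, so that \<open>G R\<close> runs over all
    pairs.\<close>
  define R where "R = real CARD('n) + 1"
  \<comment> \<open>Each halving of the scale costs \<open>2 powr (p + real CARD('n))\<close> and
    gains \<open>2 powr (- t)\<close>.\<close>
  define q where "q = 2 powr (p + real CARD('n) - t)"
  have q: "0 < q" "q < 1"
  proof -
    have "2 powr (p + real CARD('n) - t) < (2::real) powr 0" using t by (intro powr_less_mono) auto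
    then show "0 < q" "q < 1" by (simp_all add: q_def)
  qed
  have iter: "G R \<le> ennreal ((2 powr (p + real CARD('n))) ^ k) * G (R / 2 ^ k)" for k
  proof (induction k)
    case (Suc k)
    have "ennreal ((2 powr (p + real CARD('n))) ^ k) * G (R / 2 ^ k)
       \<le> ennreal ((2 powr (p + real CARD('n))) ^ k) * (ennreal (2 powr (p + real CARD('n))) * G (R / 2 ^ k / 2))"
      by (intro mult_left_mono half) simp
    also have "\<dots> = ennreal ((2 powr (p + real CARD('n))) ^ Suc k) * G (R / 2 ^ Suc k)"
      by (simp add: ennreal_mult mult_ac)
    finally show ?case using Suc by (rule order_trans[rotated])
  qed simp
  have "G R \<le> ennreal (R powr t * I * q ^ k)" for k
  proof -
    have pw: "((2::real) ^ k) powr a = (2 powr a) ^ k" for a by (induction k) (auto simp: powr_mult)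
    have "G R \<le> ennreal ((2 powr (p + real CARD('n))) ^ k) * ennreal ((R / 2 ^ k) powr t * I)"
      by (rule order_trans[OF iter[of k]], intro mult_left_mono decay) (auto simp: R_def)
    also have "\<dots> = ennreal ((2 powr (p + real CARD('n))) ^ k * ((R / 2 ^ k) powr t * I))" using I by (simp add: ennreal_mult)
    also have "(2 powr (p + real CARD('n))) ^ k * ((R / 2 ^ k) powr t * I) = R powr t * I * q ^ k"
      unfolding powr_divide[of _ "2 ^ k"] pw q_def powr_diff by (simp add: power_divide)
    finally show ?thesis .
  qed
  moreover have "(\<lambda>k. ennreal (R powr t * I * q ^ k)) \<longlonglongrightarrow> ennreal (R powr t * I * 0)"
    using q by (intro tendsto_ennrealI tendsto_mult tendsto_const LIMSEQ_power_zero) auto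
  ultimately have "G R \<le> ennreal (R powr t * I * 0)" by (intro LIMSEQ_le_const) auto
  then have G0: "G R = 0" by simp
  have "nn_integral2 cube_measure (\<lambda>x y. ennreal (\<bar>u x - u y\<bar> powr p)) = G R"
  proof -
    have "nn_integral2 cube_measure (\<lambda>x y. ennreal (\<bar>u x - u y\<bar> powr p))
       = nn_integral2 lborel (\<lambda>x y. indicator Q x * (indicator Q y * ennreal (\<bar>u x - u y\<bar> powr p)))"
      by (simp add: nn_integral_cube_measure nn_integral_cmult[symmetric] Q_def)
    also have "\<dots> = G R"
      unfolding G_def
    proof (intro nn_integral_cong)
      show "indicator Q x * (indicator Q y * ennreal (\<bar>u x - u y\<bar> powr p)) = F R x y" for x y
        using dist_unit_cube_le[of x y] by (auto simp: F_def R_def Q_def indicator_def)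
    qed
    finally show ?thesis .
  qed
  then show ?thesis
    using G0 by (intro nn_integral_powr_diff_eq_0[of _ _ p] finite_measure.axioms(1) finite_cube_measure) (simp_all add: measurable_cong_sets[OF sets_cube_measure refl] u)
qed

theorem glued_cubes_exponents:
  assumes p: "1 < p"
  shows "critical_exponent p (glued_cubes :: (real ^ 'n::finite) measure) = ereal (1 / p * max (real CARD('n)) p)"
    "dense_critical_exponent p (glued_cubes :: (real ^ 'n) measure) = ereal (p / p)"
proof -
  interpret G: glued_space cube_measure "glued_cubes :: (real ^ 'n) measure" unit_cube 0 "\<lambda>x. x" uminus
    "real CARD('n)" "(1 / (2 * real CARD('n))) ^ CARD('n)" "2 ^ CARD('n)" "real CARD('n)"
    by (rule glued_cubes_space)
  interpret cm: finite_measure "cube_measure :: (real ^ 'n) measure" by (rule finite_cube_measure)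
  define N where "N = real CARD('n)"
  have N: "0 < N" by (simp add: N_def)
  \<comment> \<open>On the cube a Lipschitz function has finite energy itself and serves as its own
    approximant.\<close>
  have below: "G.approximable_below p (\<theta> * p + real CARD('n))" if \<theta>: "0 < \<theta>" "\<theta> * p < p" for \<theta>
    unfolding G.approximable_below_def[OF p]
  proof (intro allI impI)
    fix f :: "real ^ 'n \<Rightarrow> real" and L B \<delta> \<epsilon> :: real
    assume f: "\<forall>x y. \<bar>f x - f y\<bar> \<le> L * dist x y" "\<forall>x. \<bar>f x\<bar> \<le> B" "\<forall>x. dist 0 x < \<delta> \<longrightarrow> f x = 0" "0 < \<delta>" "0 < \<epsilon>"
    have fm: "f \<in> borel_measurable borel" using f(1) Lipschitz_borel_measurable by blast
    define t where "t = \<theta> * p + N"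
    \<comment> \<open>The Lipschitz bound leaves the exponent \<open>t - p\<close>, which may be 0
      or negative, while \<open>dist_powr_integral\<close> asks for an exponent strictly between 0
      and \<open>N\<close>.\<close>
    define \<tau> where "\<tau> = max (t - p) (N / 2)"
    have \<tau>: "0 < \<tau>" "\<tau> < N" "t - p \<le> \<tau>" using \<theta> N by (auto simp: \<tau>_def t_def)
    define c where "c = \<bar>L\<bar> powr p * N powr (\<tau> + p - t)"
    obtain D where D: "\<And>x :: real ^ 'n. x \<in> unit_cube \<Longrightarrow> (\<integral>\<^sup>+y. ennreal (dist x y powr (- \<tau>)) \<partial>cube_measure) \<le> ennreal D"
    proof (rule that)
      show "(\<integral>\<^sup>+y. ennreal (dist x y powr (- \<tau>)) \<partial>cube_measure) \<le> ennreal ((N / 2) powr - \<tau> * 2 ^ CARD('n) * (2 * N) powr N / (1 - 2 powr (\<tau> - N)))"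
        if "x \<in> unit_cube" for x :: "real ^ 'n" using G.dist_powr_integral[OF that \<tau>(1)] \<tau>(2) by (simp add: N_def)
    qed
    have "riesz_energy p t cube_measure f \<le> (\<integral>\<^sup>+x. ennreal c * ennreal D \<partial>(cube_measure :: (real ^ 'n) measure))"
      unfolding riesz_energy_def
    proof (rule nn_integral_mono_AE, use G.AE_K in eventually_elim)
      fix x :: "real ^ 'n" assume x: "x \<in> unit_cube"
      have "(\<integral>\<^sup>+y. ennreal (\<bar>f y - f x\<bar> powr p * dist x y powr (- t)) \<partial>cube_measure) \<le> (\<integral>\<^sup>+y. ennreal c * ennreal (dist x y powr (- \<tau>)) \<partial>cube_measure)"
      proof (rule nn_integral_mono_AE, use G.AE_K in eventually_elim)
        fix y :: "real ^ 'n" assume y: "y \<in> unit_cube"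
        have "\<bar>f y - f x\<bar> powr p * dist x y powr (- t) \<le> c * dist x y powr (- \<tau>)"
        proof (cases "x = y")
          case False
          define d where "d = dist x y"
          have d: "0 < d" "d \<le> N" using False dist_unit_cube_le[OF x y] by (auto simp: d_def N_def)
          have "\<bar>f y - f x\<bar> \<le> \<bar>L\<bar> * d"
            using f(1)[rule_format, of y x] mult_right_mono[OF abs_ge_self[of L], of d] d
            unfolding d_def dist_commute[of y x] by linarith
          then have "\<bar>f y - f x\<bar> powr p * d powr (- t) \<le> (\<bar>L\<bar> * d) powr p * d powr (- t)"
            using p by (intro mult_right_mono powr_mono_abs) auto
          also have "\<dots> = \<bar>L\<bar> powr p * (d powr (\<tau> + p - t) * d powr (- \<tau>))"
            by (simp add: powr_mult flip: powr_add)
          also have "\<dots> \<le> \<bar>L\<bar> powr p * (N powr (\<tau> + p - t) * d powr (- \<tau>))"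
            using d \<tau>(3) by (intro mult_left_mono mult_right_mono powr_mono2) auto
          finally show ?thesis by (simp add: c_def d_def mult_ac)
        qed simp
        then show "ennreal (\<bar>f y - f x\<bar> powr p * dist x y powr (- t)) \<le> ennreal c * ennreal (dist x y powr (- \<tau>))"
          unfolding ennreal_mult''[OF powr_ge_zero, symmetric] by (rule ennreal_leI)
      qed
      also have "\<dots> = ennreal c * (\<integral>\<^sup>+y. ennreal (dist x y powr (- \<tau>)) \<partial>cube_measure)"
      proof (rule nn_integral_cmult)
        have "(\<lambda>y. ennreal (dist x y powr (- \<tau>))) \<in> borel_measurable borel" by measurable
        then show "(\<lambda>y. ennreal (dist x y powr (- \<tau>))) \<in> borel_measurable cube_measure"
          unfolding measurable_cong_sets[OF sets_cube_measure refl] .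
      qed
      also have "\<dots> \<le> ennreal c * ennreal D" by (intro mult_left_mono D x) simp
      finally show "(\<integral>\<^sup>+y. ennreal (\<bar>f y - f x\<bar> powr p * dist x y powr (- t)) \<partial>cube_measure) \<le> ennreal c * ennreal D" .
    qed
    also have "\<dots> < \<infinity>" by (simp add: cm.emeasure_eq_measure ennreal_mult_less_top)
    finally have fin: "riesz_energy p (\<theta> * p + real CARD('n)) cube_measure f < \<infinity>" by (simp add: t_def N_def)
    have "Lp_powr p cube_measure (\<lambda>x. f x - f x) < ennreal \<epsilon>" using f(5) by simp
    with fin fm f(2-4) show "\<exists>u \<delta>'. u \<in> borel_measurable borel \<and> (\<forall>x. \<bar>u x\<bar> \<le> B) \<and> 0 < \<delta>' \<and> (\<forall>x\<in>unit_cube. dist 0 x < \<delta>' \<longrightarrow> u x = 0) \<and>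
       riesz_energy p (\<theta> * p + real CARD('n)) cube_measure u < \<infinity> \<and> Lp_powr p cube_measure (\<lambda>x. f x - u x) < ennreal \<epsilon>"
      by blast
  qed
  have above: "G.constant_above p (\<theta> * p + real CARD('n))" if "p < \<theta> * p" for \<theta>
    unfolding G.constant_above_def[OF p]
  proof (intro allI impI)
    fix u :: "real ^ 'n \<Rightarrow> real" assume "u \<in> borel_measurable borel" "riesz_energy p (\<theta> * p + real CARD('n)) cube_measure u < \<infinity>"
    then show "\<exists>c. AE x in cube_measure. u x = c"
      using that by (intro cube_finite_energy_constant[OF p]) auto
  qed
  show "critical_exponent p (glued_cubes :: (real ^ 'n) measure) = ereal (1 / p * max (real CARD('n)) p)"
    "dense_critical_exponent p (glued_cubes :: (real ^ 'n) measure) = ereal (p / p)"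
    using p by (intro G.critical_exponents[OF p, of p] below above; simp)+
qed

section \<open>Words and cells\<close>

definition index_digit :: "real \<times> real \<Rightarrow> int \<times> int" where
  "index_digit i = (\<lfloor>fst i\<rfloor>, \<lfloor>snd i\<rfloor>)"

text \<open>The first letter becomes the leading ternary digit, since \<open>foldr\<close> applies
  the map of the first letter last.\<close>

primrec code :: "(real \<times> real) list \<Rightarrow> int \<times> int" where
  "code [] = (0, 0)"
| "code (i # w) = blk (length w) (index_digit i) (code w)"

lemma index_digit_bij: "bij_betw index_digit carpet_index digits"
proof -
  have e: "digits = {(0, 0), (0, 1), (0, 2), (1, 0), (1, 2), (2, 0), (2, 1), (2, 2)}"
    "carpet_index = {(0, 0), (0, 1), (0, 2), (1, 0), (1, 2), (2, 0), (2, 1), (2, 2)}"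
    unfolding digits_def carpet_index_def by auto
  show ?thesis unfolding e bij_betw_def by (auto simp: inj_on_def index_digit_def)
qed

lemma carpet_map_eq_cell_map: "i \<in> carpet_index \<Longrightarrow> carpet_map i = cell_map 1 (index_digit i)"
  by (rule ext) (auto simp: carpet_index_def carpet_map_def cell_map_def index_digit_def)

lemma cell_eq_cell_set: "w \<in> words m \<Longrightarrow> cell w = cell_set m (code w)"
proof -
  have "set w \<subseteq> carpet_index \<Longrightarrow> foldr carpet_map w x = cell_map (length w) (code w) x" for x
    by (induction w) (simp_all add: carpet_map_eq_cell_map cell_map_comp)
  then show "w \<in> words m \<Longrightarrow> cell w = cell_set m (code w)"
    by (auto simp: words_def cell_def cell_set_def)
qed

lemma words_Suc: "words (Suc m) = case_prod (#) ` (carpet_index \<times> words m)"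
  by (auto simp: words_def length_Suc_conv image_iff)

lemma bij_code: "bij_betw code (words m) (cells m)"
proof (induction m)
  case 0
  have "words 0 = {[]}" by (auto simp: words_def)
  then show ?case by (simp add: bij_betw_def)
next
  case (Suc m)
  have "bij_betw (map_prod index_digit code) (carpet_index \<times> words m) (digits \<times> cells m)"
    by (rule bij_betw_map_prod[OF index_digit_bij Suc])
  moreover have "bij_betw (case_prod (blk m)) (digits \<times> cells m) (cells (Suc m))"
    using bij_blk[of m 1] by (simp add: cells_1)
  ultimately have b: "bij_betw (case_prod (blk m) \<circ> map_prod index_digit code) (carpet_index \<times> words m) (cells (Suc m))"
    by (rule bij_betw_trans)
  have "bij_betw (code \<circ> case_prod (#)) (carpet_index \<times> words m) (cells (Suc m))"
    by (rule bij_betw_cong[THEN iffD1, OF _ b]) (auto simp: words_def)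
  moreover have "bij_betw (case_prod (#)) (carpet_index \<times> words m) (words (Suc m))"
    unfolding words_Suc bij_betw_def by (auto simp: inj_on_def)
  ultimately show ?case by (simp add: bij_betw_comp_iff)
qed

text \<open>Near cells have a common corner, which belongs to both because the carpet contains the
  corners of the unit square.\<close>

lemma cell_sets_meet: "cell_set m q \<inter> cell_set m r \<noteq> {} \<longleftrightarrow> near q r"
proof
  assume "cell_set m q \<inter> cell_set m r \<noteq> {}"
  then obtain x where "x \<in> cell_set m q" "x \<in> cell_set m r" by blast
  from cell_set_bounds[OF this(1)] cell_set_bounds[OF this(2)] show "near q r"
    unfolding near_def by linarith
next
  assume n: "near q r"
  define z where "z = (max (fst q) (fst r), max (snd q) (snd r))"
  have "((fst z) / 3 ^ m, (snd z) / 3 ^ m) \<in> cell_set m q'" if "q' = q \<or> q' = r" for q'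
  proof -
    have "fst z - fst q' \<in> {0, 1}" "snd z - snd q' \<in> {0, 1}" using n that unfolding near_def z_def by auto
    moreover have "\<forall>a\<in>{0, 1}. \<forall>b\<in>{0, 1}. (real_of_int a, real_of_int b) \<in> carpet" using carpet_corners by simp
    ultimately have "(real_of_int (fst z - fst q'), real_of_int (snd z - snd q')) \<in> carpet" by blast
    then show ?thesis unfolding cell_set_def by (rule image_eqI[rotated]) (rule prod_eqI; simp)
  qed
  then show "cell_set m q \<inter> cell_set m r \<noteq> {}" by blast
qed

lemma cell_set_meets_side:
  assumes q: "q \<in> cells m"
  shows "cell_set m q \<inter> ({0} \<times> {0..1}) \<noteq> {} \<longleftrightarrow> fst q = 0"
    "cell_set m q \<inter> ({1} \<times> {0..1}) \<noteq> {} \<longleftrightarrow> fst q = 3 ^ m - 1"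
proof -
  have sub: "cell_map m q c \<in> cell_set m q \<and> 0 \<le> snd (cell_map m q c) \<and> snd (cell_map m q c) \<le> 1" if "c \<in> carpet" for c
  proof -
    have "cell_map m q c \<in> cell_set m q" using that by (simp add: cell_set_def)
    then show ?thesis using cell_set_subset[OF q] carpet_bounds by blast
  qed
  show "cell_set m q \<inter> ({0} \<times> {0..1}) \<noteq> {} \<longleftrightarrow> fst q = 0"
  proof
    assume "cell_set m q \<inter> ({0} \<times> {0..1}) \<noteq> {}"
    then obtain x where "x \<in> cell_set m q \<inter> ({0} \<times> {0..1})" by blast
    then have x: "x \<in> cell_set m q" "fst x = 0" by auto
    then show "fst q = 0" using cell_set_bounds(1)[OF x(1)] cells_range[OF q] by simp
  next
    assume "fst q = 0"
    then have "cell_map m q (0, 0) \<in> {0} \<times> {0..1}" using sub[OF carpet_corners(1)] by (simp add: mem_Times_iff)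
    with sub[OF carpet_corners(1)] show "cell_set m q \<inter> ({0} \<times> {0..1}) \<noteq> {}" by (metis IntI emptyE)
  qed
  show "cell_set m q \<inter> ({1} \<times> {0..1}) \<noteq> {} \<longleftrightarrow> fst q = 3 ^ m - 1"
  proof
    assume "cell_set m q \<inter> ({1} \<times> {0..1}) \<noteq> {}"
    then obtain x where "x \<in> cell_set m q \<inter> ({1} \<times> {0..1})" by blast
    then have x: "x \<in> cell_set m q" "fst x = 1" by auto
    then have "real_of_int (3 ^ m) \<le> real_of_int (fst q + 1)" using cell_set_bounds(2)[OF x(1)] by simp
    then have "3 ^ m \<le> fst q + 1" by (simp only: of_int_le_iff)
    then show "fst q = 3 ^ m - 1" using cells_range[OF q] by simp
  next
    assume "fst q = 3 ^ m - 1"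
    then have "cell_map m q (1, 0) \<in> {1} \<times> {0..1}" using sub[OF carpet_corners(2)] by (simp add: mem_Times_iff)
    with sub[OF carpet_corners(2)] show "cell_set m q \<inter> ({1} \<times> {0..1}) \<noteq> {}" by (metis IntI emptyE)
  qed
qed

lemma graph_energy_code: "graph_energy p m (\<lambda>w. f (code w)) = energy p m f / 2"
proof -
  have inj: "inj_on code (words m)" and img: "code ` words m = cells m"
    using bij_code[of m] by (auto simp: bij_betw_def)
  have meet: "cell v \<inter> cell w \<noteq> {} \<longleftrightarrow> near (code v) (code w)" if "v \<in> words m" "w \<in> words m" for v w
    using cell_sets_meet by (simp add: cell_eq_cell_set[OF that(1)] cell_eq_cell_set[OF that(2)])
  have edges: "bij_betw (map_prod code code) (carpet_edges m) (adj m)"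
    unfolding bij_betw_def
  proof
    have "carpet_edges m \<subseteq> words m \<times> words m" by (auto simp: carpet_edges_def)
    then show "inj_on (map_prod code code) (carpet_edges m)"
      using inj by (auto intro: inj_on_subset[OF map_prod_inj_on])
    show "map_prod code code ` carpet_edges m = adj m"
    proof (intro subset_antisym subsetI)
      fix z assume "z \<in> map_prod code code ` carpet_edges m"
      then obtain v w where vw: "v \<in> words m" "w \<in> words m" "v \<noteq> w" "cell v \<inter> cell w \<noteq> {}" "z = (code v, code w)"
        by (auto simp: carpet_edges_def)
      then show "z \<in> adj m" using img inj meet[of v w] by (auto simp: adj_def inj_on_eq_iff)
    next
      fix z assume z: "z \<in> adj m"
      then obtain a b where ab: "z = (a, b)" "a \<in> code ` words m" "b \<in> code ` words m" unfolding img adj_def by blast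
      obtain v w where "v \<in> words m" "w \<in> words m" "z = (code v, code w)" using ab by blast
      with z meet show "z \<in> map_prod code code ` carpet_edges m"
        by (intro image_eqI[of _ _ "(v, w)"]) (auto simp: adj_def carpet_edges_def)
    qed
  qed
  show ?thesis
    unfolding graph_energy_def energy_def sum.reindex_bij_betw[OF edges, symmetric] by (simp add: case_prod_unfold)
qed

lemma crossing_function_code: "crossing_function m (\<lambda>w. f (code w)) \<longleftrightarrow> crossing m f"
proof -
  have img: "code ` words m = cells m" using bij_code[of m] by (simp add: bij_betw_def)
  have "crossing_function m (\<lambda>w. f (code w)) \<longleftrightarrow>
      (\<forall>w\<in>words m. (fst (code w) = 0 \<longrightarrow> f (code w) = 0) \<and> (fst (code w) = 3 ^ m - 1 \<longrightarrow> f (code w) = 1))"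
    unfolding crossing_function_def
  proof (rule ball_cong[OF refl])
    fix w assume w: "w \<in> words m"
    then have "code w \<in> cells m" using img by blast
    from cell_set_meets_side[OF this] show "((cell w \<inter> ({0} \<times> {0..1}) \<noteq> {} \<longrightarrow> f (code w) = 0) \<and> (cell w \<inter> ({1} \<times> {0..1}) \<noteq> {} \<longrightarrow> f (code w) = 1))
       = ((fst (code w) = 0 \<longrightarrow> f (code w) = 0) \<and> (fst (code w) = 3 ^ m - 1 \<longrightarrow> f (code w) = 1))"
      unfolding cell_eq_cell_set[OF w] by blast
  qed
  also have "\<dots> \<longleftrightarrow> (\<forall>q\<in>cells m. (fst q = 0 \<longrightarrow> f q = 0) \<and> (fst q = 3 ^ m - 1 \<longrightarrow> f q = 1))"
    unfolding img[symmetric] by blast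
  also have "\<dots> \<longleftrightarrow> crossing m f" unfolding crossing_def by auto
  finally show ?thesis .
qed

text \<open>\<open>0 < m\<close> guarantees that crossing functions exist; on the single cell of
  level 0 the two boundary conditions contradict each other. The factor 1/2 reflects that
  \<open>energy\<close> counts both orientations of an edge.\<close>

lemma carpet_conductance_eq:
  assumes m: "0 < m"
  shows "carpet_conductance p m = conductance p m / 2"
proof -
  let ?S = "{energy p m f | f. crossing m f}"
  have "{graph_energy p m f | f. crossing_function m f} = (\<lambda>x. x / 2) ` ?S"
  proof (intro subset_antisym subsetI)
    fix x assume "x \<in> {graph_energy p m f | f. crossing_function m f}"
    then obtain f where f: "crossing_function m f" "x = graph_energy p m f" by blast
    define g where "g q = f (inv_into (words m) code q)" for q
    have g: "g (code w) = f w" if "w \<in> words m" for w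
      using that bij_code[of m] by (simp add: g_def bij_betw_def)
    have "crossing_function m (\<lambda>w. g (code w))" using f(1) g by (simp add: crossing_function_def)
    then have c: "crossing m g" by (simp add: crossing_function_code)
    have "graph_energy p m f = graph_energy p m (\<lambda>w. g (code w))"
      unfolding graph_energy_def by (intro arg_cong[where f = "\<lambda>x. x / 2"] sum.cong) (auto simp: carpet_edges_def g)
    then show "x \<in> (\<lambda>x. x / 2) ` ?S" using c f(2) by (auto simp: graph_energy_code)
  next
    fix x assume "x \<in> (\<lambda>x. x / 2) ` ?S"
    then obtain f where "crossing m f" "x = energy p m f / 2" by blast
    then show "x \<in> {graph_energy p m f | f. crossing_function m f}"
      by (intro CollectI exI[of _ "\<lambda>w. f (code w)"]) (simp add: graph_energy_code crossing_function_code)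
  qed
  moreover have "Inf ?S / 2 = (INF x\<in>?S. x / 2)"
  proof (rule continuous_at_Inf_mono)
    show "mono (\<lambda>x :: real. x / 2)" by (rule monoI) simp
    show "continuous (at_right (Inf ?S)) (\<lambda>x :: real. x / 2)" by (intro continuous_intros) simp
    show "?S \<noteq> {}" using crossing_linear[OF m] by blast
    show "bdd_below ?S" by (auto intro!: bdd_belowI[of _ 0] energy_nonneg)
  qed
  ultimately show ?thesis by (simp add: carpet_conductance_def conductance_def)
qed

text \<open>The factor 1/2 between the two conductances disappears in the m-th root.\<close>

lemma carpet_walk_dim_eq:
  assumes p: "0 < p" and l: "(\<lambda>m. ln (conductance p m) / real m) \<longlonglongrightarrow> l"
  shows "carpet_walk_dim p = (ln 8 - l) / ln 3"
proof -
  have "(\<lambda>m. exp (- (ln (conductance p m) / real m) + ln 2 / real m)) \<longlonglongrightarrow> exp (- l + 0)"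
    by (intro tendsto_intros l lim_const_over_n)
  moreover have "\<forall>\<^sub>F m in sequentially. exp (- (ln (conductance p m) / real m) + ln 2 / real m) = carpet_conductance p m powr (- 1 / real m)"
    using eventually_gt_at_top[of 0]
  proof eventually_elim
    fix m :: nat assume m: "0 < m"
    then show "exp (- (ln (conductance p m) / real m) + ln 2 / real m) = carpet_conductance p m powr (- 1 / real m)"
      using conductance_pos[OF m p] by (simp add: carpet_conductance_eq powr_def ln_div diff_divide_distrib)
  qed
  ultimately have "(\<lambda>m. carpet_conductance p m powr (- 1 / real m)) \<longlonglongrightarrow> exp (- l)"
    by (simp add: tendsto_cong)
  then have "carpet_scaling p = exp (- l)" unfolding carpet_scaling_def by (rule limI)
  then show ?thesis by (simp add: carpet_walk_dim_def ln_mult)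
qed

section \<open>The glued carpets\<close>

lemma distr_hausdorff_isometry:
  fixes T :: "'a::metric_space \<Rightarrow> 'a"
  assumes T: "\<And>x y. dist (T x) (T y) = dist x y" "surj T" and s: "0 \<le> s"
  shows "distr (hausdorff_measure s) borel T = hausdorff_measure s"
proof (rule measure_eqI)
  have "continuous_on UNIV T" unfolding continuous_on_iff by (auto simp: T(1))
  then have [measurable]: "T \<in> borel_measurable borel" by (rule borel_measurable_continuous_onI)
  fix A assume "A \<in> sets (distr (hausdorff_measure s) borel T)"
  then have A [measurable]: "A \<in> sets borel" by simp
  have "T -` A \<in> sets borel" using measurable_sets[of T borel borel A] by simp
  then have "emeasure (distr (hausdorff_measure s) borel T) A = hausdorff_outer s (T -` A)"
    by (simp add: emeasure_distr emeasure_hausdorff_measure)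
  also have "\<dots> = hausdorff_outer s (T ` (T -` A))"
    using hausdorff_outer_similarity[of T 1 s "T -` A"] T s by simp
  also have "T ` (T -` A) = A" using T(2) by (simp add: surj_image_vimage_eq)
  finally show "emeasure (distr (hausdorff_measure s) borel T) A = emeasure (hausdorff_measure s) A"
    by (simp add: emeasure_hausdorff_measure)
qed simp

lemma AE_hausdorff_singleton:
  assumes s: "0 < s"
  shows "AE x in hausdorff_measure s. x \<noteq> a"
proof -
  have "hausdorff_content s \<delta> {a} \<le> 0" if "0 < \<delta>" for \<delta>
    using hausdorff_content_le[of "{a}" "\<lambda>_. {a}" \<delta> s] that by simp
  then have "hausdorff_outer s {a} \<le> 0"
    unfolding hausdorff_outer_def by (intro SUP_least) auto
  then have "{a} \<in> null_sets (hausdorff_measure s)" by (intro null_setsI) (simp_all add: emeasure_hausdorff_measure)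
  from AE_not_in[OF this] show ?thesis by simp
qed

lemma nn_integral_carpet_isometry:
  fixes T :: "real \<times> real \<Rightarrow> real \<times> real"
  assumes T: "\<And>x y. dist (T x) (T y) = dist x y" "surj T" and [measurable]: "f \<in> borel_measurable borel" "T ` carpet \<in> sets borel"
  shows "(\<integral>\<^sup>+x. f x * indicator (T ` carpet) x \<partial>hausdorff_measure carpet_dim) = (\<integral>\<^sup>+x. f (T x) \<partial>carpet_measure)"
proof -
  have "inj T" using T(1) by (metis dist_eq_0_iff injI)
  have "continuous_on UNIV T" unfolding continuous_on_iff by (auto simp: T(1))
  then have [measurable]: "T \<in> borel_measurable borel" by (rule borel_measurable_continuous_onI)
  have "(\<integral>\<^sup>+x. f x * indicator (T ` carpet) x \<partial>hausdorff_measure carpet_dim)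
     = (\<integral>\<^sup>+x. f x * indicator (T ` carpet) x \<partial>distr (hausdorff_measure carpet_dim) borel T)"
    using carpet_dim_pos by (subst distr_hausdorff_isometry[OF T]) simp_all
  also have "\<dots> = (\<integral>\<^sup>+x. f (T x) * indicator (T ` carpet) (T x) \<partial>hausdorff_measure carpet_dim)"
    by (rule nn_integral_distr) measurable
  also have "\<dots> = (\<integral>\<^sup>+x. indicator carpet x * f (T x) \<partial>hausdorff_measure carpet_dim)"
    using \<open>inj T\<close> by (intro nn_integral_cong) (simp add: indicator_def inj_image_mem_iff mult.commute)
  also have "\<dots> = (\<integral>\<^sup>+x. f (T x) \<partial>carpet_measure)"
    unfolding carpet_measure_def by (rule nn_integral_density[symmetric]) measurable
  finally show ?thesis .
qed

text \<open>The model is the standard carpet with base \<open>(1, 1)\<close>. The second map is the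
  translation followed by the reflection in the antidiagonal, so both maps carry the base to the
  gluing point.\<close>

lemma glued_carpets_space:
  "glued_space carpet_measure glued_carpets carpet (1, 1) (\<lambda>x. x - (1, 1)) (\<lambda>x. (1 - snd x, 1 - fst x))
     carpet_dim (carpet_mass / 100) (300 * carpet_mass) 2"
proof (rule glued_space.intro)
  let ?\<phi> = "\<lambda>x :: real \<times> real. x - (1, 1)" and ?\<psi> = "\<lambda>x :: real \<times> real. (1 - snd x, 1 - fst x)"
  show \<phi>: "dist (?\<phi> x) (?\<phi> y) = dist x y" for x y by (simp add: dist_norm)
  show \<psi>: "dist (?\<psi> x) (?\<psi> y) = dist x y" for x y
    by (simp add: dist_prod_def dist_real_def abs_minus_commute add.commute)
  show s\<phi>: "surj ?\<phi>" by (rule surjI[of _ "\<lambda>x. x + (1, 1)"]) simp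
  show s\<psi>: "surj ?\<psi>" by (rule surjI[of _ ?\<psi>]) simp
  show "?\<phi> (1, 1) = 0" "?\<psi> (1, 1) = 0" by (simp_all add: zero_prod_def)
  have minus: "carpet_minus = ?\<psi> ` carpet"
    unfolding carpet_minus_def carpet_plus_def image_image by (rule image_cong) (auto simp: case_prod_unfold)
  have comp: "compact (?\<phi> ` carpet)" "compact (?\<psi> ` carpet)"
    by (intro compact_continuous_image continuous_intros carpet_facts)+
  then have [measurable]: "?\<phi> ` carpet \<in> sets borel" "?\<psi> ` carpet \<in> sets borel"
    by (auto intro: borel_closed compact_imp_closed)
  have glued: "glued_carpets = restrict_space (hausdorff_measure carpet_dim) (?\<phi> ` carpet \<union> ?\<psi> ` carpet)"
    by (simp add: glued_carpets_def carpet_plus_def minus)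
  show "space glued_carpets = ?\<phi> ` carpet \<union> ?\<psi> ` carpet" by (simp add: glued space_restrict_space)
  show "sets glued_carpets = sets (restrict_space borel (?\<phi> ` carpet \<union> ?\<psi> ` carpet))"
    by (simp add: glued sets_restrict_space)
  have sign: "fst (?\<phi> x) \<le> 0 \<and> snd (?\<phi> x) \<le> 0 \<and> 0 \<le> fst (?\<psi> x) \<and> 0 \<le> snd (?\<psi> x)" if "x \<in> carpet" for x
    using carpet_bounds[OF that] by simp
  show "(\<integral>\<^sup>+x. f x \<partial>glued_carpets) = (\<integral>\<^sup>+x. f (?\<phi> x) \<partial>carpet_measure) + (\<integral>\<^sup>+x. f (?\<psi> x) \<partial>carpet_measure)"
    if [measurable]: "f \<in> borel_measurable borel" for f
  proof -
    have "(\<integral>\<^sup>+x. f x \<partial>glued_carpets) = (\<integral>\<^sup>+x. f x * indicator (?\<phi> ` carpet \<union> ?\<psi> ` carpet) x \<partial>hausdorff_measure carpet_dim)"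
      unfolding glued by (subst nn_integral_restrict_space) auto
    also have "\<dots> = (\<integral>\<^sup>+x. f x * indicator (?\<phi> ` carpet) x + f x * indicator (?\<psi> ` carpet) x \<partial>hausdorff_measure carpet_dim)"
    proof (rule nn_integral_cong_AE)
      have *: "c * indicator (A \<union> B) x = c * indicator A x + c * indicator B x" if "\<not> (x \<in> A \<and> x \<in> B)"
        for A B x and c :: ennreal using that by (auto simp: indicator_def)
      have "AE x in hausdorff_measure carpet_dim. x \<noteq> (0 :: real \<times> real)"
        using carpet_dim_pos by (intro AE_hausdorff_singleton) simp
      then show "AE x in hausdorff_measure carpet_dim. f x * indicator (?\<phi> ` carpet \<union> ?\<psi> ` carpet) x
         = f x * indicator (?\<phi> ` carpet) x + f x * indicator (?\<psi> ` carpet) x"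
      proof eventually_elim
        fix x :: "real \<times> real" assume "x \<noteq> 0"
        then have "\<not> (x \<in> ?\<phi> ` carpet \<and> x \<in> ?\<psi> ` carpet)"
          using sign by (metis (no_types, lifting) imageE order_antisym prod_eqI fst_zero snd_zero)
        then show "f x * indicator (?\<phi> ` carpet \<union> ?\<psi> ` carpet) x = f x * indicator (?\<phi> ` carpet) x + f x * indicator (?\<psi> ` carpet) x"
          by (rule *)
      qed
    qed
    also have "\<dots> = (\<integral>\<^sup>+x. f x * indicator (?\<phi> ` carpet) x \<partial>hausdorff_measure carpet_dim)
        + (\<integral>\<^sup>+x. f x * indicator (?\<psi> ` carpet) x \<partial>hausdorff_measure carpet_dim)"
      by (rule nn_integral_add) measurable
    also have "\<dots> = (\<integral>\<^sup>+x. f (?\<phi> x) \<partial>carpet_measure) + (\<integral>\<^sup>+x. f (?\<psi> x) \<partial>carpet_measure)"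
      using nn_integral_carpet_isometry[OF \<phi> s\<phi>, of f] nn_integral_carpet_isometry[OF \<psi> s\<psi>, of f] by simp
    finally show ?thesis .
  qed
  show "dist x (1, 1) \<le> dist (?\<phi> x) (?\<psi> y) \<and> dist y (1, 1) \<le> dist (?\<phi> x) (?\<psi> y)"
    if "x \<in> carpet" "y \<in> carpet" for x y
  proof -
    \<comment> \<open>The halves lie in opposite quadrants, so adding \<open>?\<psi> y\<close> to
      \<open>- ?\<phi> x\<close> cannot shorten either vector.\<close>
    have "0 \<le> (- ?\<phi> x) \<bullet> ?\<psi> y"
      using sign[OF that(1)] sign[OF that(2)] unfolding inner_prod_def inner_real_def
      by (intro add_nonneg_nonneg mult_nonneg_nonneg) simp_all
    moreover have "dist y (1, 1) = norm (?\<psi> y)" using \<psi>[of y "(1, 1)"] by (simp add: dist_norm zero_prod_def[symmetric])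
    moreover have "dist x (1, 1) = norm (- ?\<phi> x)" by (simp add: dist_norm norm_minus_commute)
    moreover have "dist (?\<phi> x) (?\<psi> y) = norm (- ?\<phi> x + ?\<psi> y)" by (simp only: dist_norm norm_minus_commute[of "?\<phi> x"] uminus_add_conv_diff)
    ultimately show ?thesis
      using norm_le_norm_add_orthant[of "- ?\<phi> x" "?\<psi> y"] norm_le_norm_add_orthant[of "?\<psi> y" "- ?\<phi> x"]
      by (simp only: inner_commute[of "?\<psi> y"] add.commute[of "?\<psi> y"])
  qed
  show "finite_measure carpet_measure" by (rule carpet_measure.finite_measure_axioms)
  show "carpet_mass / 100 * r powr carpet_dim \<le> measure carpet_measure (ball x r)"
    if "x \<in> carpet" "0 < r" "r \<le> 2" for x r by (rule carpet_ball_lower[OF that])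
qed (use carpet_mass_pos carpet_dim_pos in \<open>simp_all add: AE_carpet carpet_corners carpet_ball_upper dist_carpet_le\<close>)

theorem glued_carpets_exponents:
  assumes p: "1 < p"
  shows "critical_exponent p glued_carpets = ereal (1 / p * max carpet_dim (carpet_walk_dim p))"
    "dense_critical_exponent p glued_carpets = ereal (carpet_walk_dim p / p)"
proof -
  interpret G: glued_space carpet_measure glued_carpets carpet "(1, 1)" "\<lambda>x. x - (1, 1)" "\<lambda>x. (1 - snd x, 1 - fst x)"
    carpet_dim "carpet_mass / 100" "300 * carpet_mass" 2
    by (rule glued_carpets_space)
  have p0: "0 < p" using p by simp
  obtain l where l: "(\<lambda>m. ln (conductance p m) / real m) \<longlonglongrightarrow> l" by (rule conductance_growth[OF p0])
  have w: "carpet_walk_dim p = (ln 8 - l) / ln 3" by (rule carpet_walk_dim_eq[OF p0 l])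
  have "0 < p * ln 3" using p0 by (simp add: zero_less_mult_iff)
  then have w0: "0 < carpet_walk_dim p"
    using conductance_growth_le[OF l p0] unfolding w by (intro divide_pos_pos) auto
  have "ln 64 = ln (8 * 8 :: real)" by simp
  then have "ln 64 = 2 * ln (8 :: real)" by (subst (asm) ln_mult) auto
  \<comment> \<open>Converts the exponents: with \<open>t = \<theta> * p + carpet_dim\<close>, the
    sign of \<open>carpet_walk_dim p - \<theta> * p\<close> decides on which side of
    \<open>ln 64 - t * ln 3\<close> the rate \<open>l\<close> lies. This is the threshold both in
    \<open>carpet_approximation\<close> and in \<open>finite_energy_imp_constant\<close>.\<close>
  then have gap: "ln 64 - (\<theta> * p + carpet_dim) * ln 3 - l = (carpet_walk_dim p - \<theta> * p) * ln 3" for \<theta>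
    unfolding w carpet_dim_def by (simp add: field_simps)
  have below: "G.approximable_below p (\<theta> * p + carpet_dim)" if "0 < \<theta>" "\<theta> * p < carpet_walk_dim p" for \<theta>
    unfolding G.approximable_below_def[OF p]
  proof (intro allI impI)
    fix f :: "real \<times> real \<Rightarrow> real" and L B \<delta> \<epsilon> :: real
    assume f: "\<forall>x y. \<bar>f x - f y\<bar> \<le> L * dist x y" "\<forall>x. \<bar>f x\<bar> \<le> B" "\<forall>x. dist (1, 1) x < \<delta> \<longrightarrow> f x = 0" "0 < \<delta>" "0 < \<epsilon>"
    have "0 < (carpet_walk_dim p - \<theta> * p) * ln 3" using that by (intro mult_pos_pos) auto
    then have lt: "l < ln 64 - (\<theta> * p + carpet_dim) * ln 3" using gap[of \<theta>] by linarith
    have "0 < \<theta> * p" using that p0 by simp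
    then have t: "carpet_dim < \<theta> * p + carpet_dim" by simp
    obtain u where u: "u \<in> borel_measurable borel" "\<And>x. \<bar>u x\<bar> \<le> B"
      "\<And>x. x \<in> carpet \<Longrightarrow> dist (1, 1) x < \<delta> / 2 \<Longrightarrow> u x = 0"
      "riesz_energy p (\<theta> * p + carpet_dim) carpet_measure u < \<infinity>"
      "Lp_powr p carpet_measure (\<lambda>x. f x - u x) < ennreal \<epsilon>"
      by (rule carpet_approximation[OF p l t lt _ _ _ f(4,5), where f = f and o' = "(1, 1)"]) (use f in blast)+
    show "\<exists>u \<delta>'. u \<in> borel_measurable borel \<and> (\<forall>x. \<bar>u x\<bar> \<le> B) \<and> 0 < \<delta>' \<and> (\<forall>x\<in>carpet. dist (1, 1) x < \<delta>' \<longrightarrow> u x = 0) \<and>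
       riesz_energy p (\<theta> * p + carpet_dim) carpet_measure u < \<infinity> \<and> Lp_powr p carpet_measure (\<lambda>x. f x - u x) < ennreal \<epsilon>"
      using u f(4) by (intro exI[of _ u] exI[of _ "\<delta> / 2"]) simp
  qed
  have above: "G.constant_above p (\<theta> * p + carpet_dim)" if "0 < \<theta>" "carpet_walk_dim p < \<theta> * p" for \<theta>
    unfolding G.constant_above_def[OF p]
  proof (intro allI impI)
    fix u :: "real \<times> real \<Rightarrow> real"
    assume u: "u \<in> borel_measurable borel" "integrable carpet_measure (\<lambda>x. \<bar>u x\<bar> powr p)"
      "riesz_energy p (\<theta> * p + carpet_dim) carpet_measure u < \<infinity>"
    have "(carpet_walk_dim p - \<theta> * p) * ln 3 < 0" using that by (intro mult_neg_pos) auto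
    then have "ln 64 - (\<theta> * p + carpet_dim) * ln 3 < l" using gap[of \<theta>] by linarith
    moreover have "0 < \<theta> * p + carpet_dim" using that p0 carpet_dim_pos by (intro add_pos_pos) auto
    ultimately show "\<exists>c. AE x in carpet_measure. u x = c"
      using u by (intro finite_energy_imp_constant[OF p _ u(1,2,3) l])
  qed
  show "critical_exponent p glued_carpets = ereal (1 / p * max carpet_dim (carpet_walk_dim p))"
    "dense_critical_exponent p glued_carpets = ereal (carpet_walk_dim p / p)"
    by (rule G.critical_exponents[OF p w0 below above]; assumption)+
qed

theorem theorem1p9:
  fixes p :: real
  assumes "1 < p"
  shows "(2 \<le> CARD('n::finite) \<longrightarrow>
            (let X = (glued_cubes :: (real ^ 'n) measure); d\<^sub>f = real CARD('n); d\<^sub>w = p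
             in critical_exponent p X = ereal (1 / p * max d\<^sub>f d\<^sub>w) \<and>
                dense_critical_exponent p X = ereal (d\<^sub>w / p))) \<and>
         (let X = glued_carpets; d\<^sub>f = carpet_dim; d\<^sub>w = carpet_walk_dim p
          in critical_exponent p X = ereal (1 / p * max d\<^sub>f d\<^sub>w) \<and>
             dense_critical_exponent p X = ereal (d\<^sub>w / p))"
  unfolding Let_def
  using glued_cubes_exponents[OF assms, where 'n = 'n] glued_carpets_exponents[OF assms] by blast

end
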